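(* The only constant angle proper biharmonic surface in $S^2\times\mathbb{R}$ and $H^2\times\mathbb{R}$ is an open part of $S^1(1/\sqrt2)\times\mathbb{R}$. That is, a constant angle proper biharmonic surface in $S^2\times\mathbb{R}$ or $H^2\times\mathbb{R}$ exists only in $S^2\times\mathbb{R}$, where it is an open part of $S^1(1/\sqrt2)\times\mathbb{R}\subset S^2\times\mathbb{R}$.
   Context: $S^2$ and $H^2$ are the simply connected surfaces of constant curvature $1$ and $-1$; the products with $\mathbb{R}$ carry the product metric, and $\partial_t$ is the unit vector field tangent to $\mathbb{R}$. A surface means a two-sided isometrically immersed surface with global unit normal field $\xi$. It has constant angle if its angle function $\theta=\langle\xi,\partial_t\rangle$ is constant. It is biharmonic if its defining isometric immersion is a biharmonic map (critical point of the bienergy $\frac12\int|\tau(\varphi)|^2$, $\tau$ the tension field), and proper biharmonic if it is biharmonic but not minimal. $S^1(1/\sqrt2)\subset S^2$ is a circle of radius $1/\sqrt2$ in $S^2$. *)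

theory Defs
  imports "HOL-Analysis.Analysis"
begin

section \<open>Smooth maps between normed spaces\<close>

text \<open>Meant for open subsets \<open>S\<close> of Euclidean spaces, where it says that all iterated
  directional derivatives up to order \<open>k\<close> exist and are continuous.\<close>

primrec Ck_on :: "nat \<Rightarrow> ('a::real_normed_vector \<Rightarrow> 'b::real_normed_vector) \<Rightarrow> 'a set \<Rightarrow> bool" where
  "Ck_on 0 f S \<longleftrightarrow> continuous_on S f"
| "Ck_on (Suc k) f S \<longleftrightarrow>
     f differentiable_on S \<and> (\<forall>v. Ck_on k (\<lambda>x. frechet_derivative f (at x) v) S)"

definition smooth_on :: "('a::real_normed_vector \<Rightarrow> 'b::real_normed_vector) \<Rightarrow> 'a set \<Rightarrow> bool" where
  "smooth_on f S \<longleftrightarrow> (\<forall>k. Ck_on k f S)"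

definition partial_deriv :: "2 \<Rightarrow> (real^2 \<Rightarrow> 'b::real_normed_vector) \<Rightarrow> real^2 \<Rightarrow> 'b" where
  "partial_deriv i f u = frechet_derivative f (at u) (axis i 1)"


section \<open>The ambient spaces\<close>

text \<open>Both product spaces are realised inside \<open>\<real>\<^sup>3 \<times> \<real>\<close>; the parameter \<open>c\<close> is the curvature
  of the first factor and only the values \<open>1\<close> and \<open>-1\<close> are meant. For \<open>c = 1\<close> the first
  factor is the unit sphere of Euclidean \<open>\<real>\<^sup>3\<close>, for \<open>c = -1\<close> it is the upper sheet of the
  hyperboloid in Minkowski space. The metric is the restriction of \<open>ambient_form c\<close> to
  tangent vectors.\<close>

definition first_form :: "real \<Rightarrow> real^3 \<Rightarrow> real^3 \<Rightarrow> real" where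
  "first_form c a b = a $ 1 * b $ 1 + a $ 2 * b $ 2 + c * (a $ 3 * b $ 3)"

definition ambient_form :: "real \<Rightarrow> (real^3) \<times> real \<Rightarrow> (real^3) \<times> real \<Rightarrow> real" where
  "ambient_form c v w = first_form c (fst v) (fst w) + snd v * snd w"

definition space_form :: "real \<Rightarrow> (real^3) set" where
  "space_form c = {a. first_form c a a = c \<and> (c < 0 \<longrightarrow> a $ 3 > 0)}"

definition product_space :: "real \<Rightarrow> ((real^3) \<times> real) set" where
  "product_space c = space_form c \<times> UNIV"

definition tangent_space :: "real \<Rightarrow> (real^3) \<times> real \<Rightarrow> ((real^3) \<times> real) set" where
  "tangent_space c y = {v. first_form c (fst v) (fst y) = 0}"

text \<open>The normal line of the product space at \<open>y\<close> is spanned by \<open>(fst y, 0)\<close>, whose square is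
  \<open>c\<close>; since \<open>1 / c = c\<close>, this is the orthogonal projection onto the tangent space. The
  Levi-Civita connection of the product space is the flat derivative followed by it.\<close>

definition tangent_proj :: "real \<Rightarrow> (real^3) \<times> real \<Rightarrow> (real^3) \<times> real \<Rightarrow> (real^3) \<times> real" where
  "tangent_proj c y v = v - (c * first_form c (fst v) (fst y)) *\<^sub>R (fst y, 0)"

definition vertical_field :: "(real^3) \<times> real" where
  "vertical_field = (0, 1)"


section \<open>Immersed surfaces with unit normal\<close>

text \<open>A chart is a pair \<open>(U, x)\<close> of an open set \<open>U\<close> of \<open>\<real>\<^sup>2\<close> and a parametrisation \<open>x\<close> of an
  open subset of the surface (the inverse of a coordinate map).\<close>

type_synonym 'm chart = "(real^2) set \<times> (real^2 \<Rightarrow> 'm)"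

definition smooth_atlas :: "'m topology \<Rightarrow> 'm chart set \<Rightarrow> bool" where
  "smooth_atlas X A \<longleftrightarrow>
     (\<forall>(U, x) \<in> A. open U \<and> openin X (x ` U) \<and>
        homeomorphic_map (top_of_set U) (subtopology X (x ` U)) x) \<and>
     (\<Union>(U, x) \<in> A. x ` U) = topspace X \<and>
     (\<forall>(U, x) \<in> A. \<forall>(V, y) \<in> A. smooth_on (\<lambda>u. inv_into V y (x u)) {u \<in> U. x u \<in> y ` V})"

definition connected_smooth_surface :: "'m topology \<Rightarrow> 'm chart set \<Rightarrow> bool" where
  "connected_smooth_surface X A \<longleftrightarrow>
     Hausdorff_space X \<and> second_countable X \<and> connected_space X \<and> topspace X \<noteq> {} \<and>
     smooth_atlas X A"

definition smooth_immersion ::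
  "real \<Rightarrow> 'm topology \<Rightarrow> 'm chart set \<Rightarrow> ('m \<Rightarrow> (real^3) \<times> real) \<Rightarrow> bool" where
  "smooth_immersion c X A \<phi> \<longleftrightarrow>
     \<phi> ` topspace X \<subseteq> product_space c \<and>
     (\<forall>(U, x) \<in> A. smooth_on (\<phi> \<circ> x) U \<and>
        (\<forall>u \<in> U. inj (frechet_derivative (\<phi> \<circ> x) (at u))))"

definition unit_normal_field ::
  "real \<Rightarrow> 'm topology \<Rightarrow> 'm chart set \<Rightarrow> ('m \<Rightarrow> (real^3) \<times> real) \<Rightarrow> ('m \<Rightarrow> (real^3) \<times> real) \<Rightarrow> bool"
where
  "unit_normal_field c X A \<phi> \<xi> \<longleftrightarrow>
     (\<forall>p \<in> topspace X. \<xi> p \<in> tangent_space c (\<phi> p) \<and> ambient_form c (\<xi> p) (\<xi> p) = 1) \<and>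
     (\<forall>(U, x) \<in> A. smooth_on (\<xi> \<circ> x) U \<and>
        (\<forall>u \<in> U. \<forall>v. ambient_form c (\<xi> (x u)) (frechet_derivative (\<phi> \<circ> x) (at u) v) = 0))"

text \<open>The surface carries the metric induced by \<open>\<phi>\<close>, so that \<open>\<phi>\<close> is an isometric immersion.\<close>

definition immersed_surface ::
  "real \<Rightarrow> 'm topology \<Rightarrow> 'm chart set \<Rightarrow> ('m \<Rightarrow> (real^3) \<times> real) \<Rightarrow> ('m \<Rightarrow> (real^3) \<times> real) \<Rightarrow> bool"
where
  "immersed_surface c X A \<phi> \<xi> \<longleftrightarrow>
     connected_smooth_surface X A \<and> smooth_immersion c X A \<phi> \<and> unit_normal_field c X A \<phi> \<xi>"

definition constant_angle ::
  "real \<Rightarrow> 'm topology \<Rightarrow> ('m \<Rightarrow> (real^3) \<times> real) \<Rightarrow> bool" where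
  "constant_angle c X \<xi> \<longleftrightarrow>
     (\<exists>\<theta>. \<forall>p \<in> topspace X. ambient_form c (\<xi> p) vertical_field = \<theta>)"


section \<open>Induced metric and second fundamental form in coordinates\<close>

text \<open>In this section \<open>\<Phi>\<close> is the immersion \<open>\<phi> \<circ> x\<close> read in a chart.\<close>

definition metric :: "real \<Rightarrow> (real^2 \<Rightarrow> (real^3) \<times> real) \<Rightarrow> real^2 \<Rightarrow> real^2^2" where
  "metric c \<Phi> u = (\<chi> i j. ambient_form c (partial_deriv i \<Phi> u) (partial_deriv j \<Phi> u))"

definition inverse_metric :: "real \<Rightarrow> (real^2 \<Rightarrow> (real^3) \<times> real) \<Rightarrow> real^2 \<Rightarrow> real^2^2" where
  "inverse_metric c \<Phi> u = matrix_inv (metric c \<Phi> u)"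

definition christoffel ::
  "real \<Rightarrow> (real^2 \<Rightarrow> (real^3) \<times> real) \<Rightarrow> 2 \<Rightarrow> 2 \<Rightarrow> 2 \<Rightarrow> real^2 \<Rightarrow> real" where
  "christoffel c \<Phi> k i j u =
     (\<Sum>l\<in>UNIV. inverse_metric c \<Phi> u $ k $ l / 2 *
        (partial_deriv i (\<lambda>w. metric c \<Phi> w $ j $ l) u
         + partial_deriv j (\<lambda>w. metric c \<Phi> w $ i $ l) u
         - partial_deriv l (\<lambda>w. metric c \<Phi> w $ i $ j) u))"

text \<open>The covariant derivative along \<open>\<Psi>\<close> of the vector field \<open>\<partial>\<^sub>j \<Psi>\<close> in the direction \<open>\<partial>\<^sub>i\<close>.\<close>

definition cov_deriv_along ::
  "real \<Rightarrow> (real^2 \<Rightarrow> (real^3) \<times> real) \<Rightarrow> 2 \<Rightarrow> 2 \<Rightarrow> real^2 \<Rightarrow> (real^3) \<times> real" where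
  "cov_deriv_along c \<Psi> i j u =
     tangent_proj c (\<Psi> u) (partial_deriv i (partial_deriv j \<Psi>) u)"

definition chart_mean_curvature ::
  "real \<Rightarrow> (real^2 \<Rightarrow> (real^3) \<times> real) \<Rightarrow> (real^2 \<Rightarrow> (real^3) \<times> real) \<Rightarrow> real^2 \<Rightarrow> real" where
  "chart_mean_curvature c \<Phi> \<Xi> u =
     (\<Sum>i\<in>UNIV. \<Sum>j\<in>UNIV. inverse_metric c \<Phi> u $ i $ j *
        ambient_form c (cov_deriv_along c \<Phi> i j u) (\<Xi> u)) / 2"

definition minimal_surface ::
  "real \<Rightarrow> 'm chart set \<Rightarrow> ('m \<Rightarrow> (real^3) \<times> real) \<Rightarrow> ('m \<Rightarrow> (real^3) \<times> real) \<Rightarrow> bool" where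
  "minimal_surface c A \<phi> \<xi> \<longleftrightarrow>
     (\<forall>(U, x) \<in> A. \<forall>u \<in> U. chart_mean_curvature c (\<phi> \<circ> x) (\<xi> \<circ> x) u = 0)"


section \<open>Tension field, bienergy and biharmonicity\<close>

text \<open>Trace, with respect to the metric induced by \<open>\<Phi>\<close>, of the second fundamental form
  \<open>\<nabla>d\<Psi>\<close> of a map \<open>\<Psi>\<close> into the product space.\<close>

definition chart_tension ::
  "real \<Rightarrow> (real^2 \<Rightarrow> (real^3) \<times> real) \<Rightarrow> (real^2 \<Rightarrow> (real^3) \<times> real) \<Rightarrow> real^2 \<Rightarrow> (real^3) \<times> real"
where
  "chart_tension c \<Phi> \<Psi> u =
     (\<Sum>i\<in>UNIV. \<Sum>j\<in>UNIV. inverse_metric c \<Phi> u $ i $ j *\<^sub>R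
        (cov_deriv_along c \<Psi> i j u
         - (\<Sum>k\<in>UNIV. christoffel c \<Phi> k i j u *\<^sub>R partial_deriv k \<Psi> u)))"

text \<open>The tension field of \<open>\<psi>\<close> with respect to the metric induced by \<open>\<phi>\<close>. It does not depend on
  the chart that is used to compute it.\<close>

definition tension_field ::
  "real \<Rightarrow> 'm chart set \<Rightarrow> ('m \<Rightarrow> (real^3) \<times> real) \<Rightarrow> ('m \<Rightarrow> (real^3) \<times> real) \<Rightarrow> 'm \<Rightarrow> (real^3) \<times> real"
where
  "tension_field c A \<phi> \<psi> p =
     (let (U, x) = (SOME (U, x). (U, x) \<in> A \<and> p \<in> x ` U)
      in chart_tension c (\<phi> \<circ> x) (\<psi> \<circ> x) (inv_into U x p))"

text \<open>The Riemannian measure of the metric induced by \<open>\<phi>\<close> on the Borel sets of the surface; these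
  conditions determine it uniquely.\<close>

definition is_area_measure ::
  "real \<Rightarrow> 'm topology \<Rightarrow> 'm chart set \<Rightarrow> ('m \<Rightarrow> (real^3) \<times> real) \<Rightarrow> 'm measure \<Rightarrow> bool" where
  "is_area_measure c X A \<phi> dv \<longleftrightarrow>
     sets dv = sigma_sets (topspace X) {S. openin X S} \<and>
     (\<forall>(U, x) \<in> A. \<forall>E \<in> sets borel. E \<subseteq> U \<longrightarrow>
        emeasure dv (x ` E) =
          (\<integral>\<^sup>+u\<in>E. ennreal (sqrt (det (metric c (\<phi> \<circ> x) u))) \<partial>lborel))"

definition bienergy ::
  "real \<Rightarrow> 'm chart set \<Rightarrow> ('m \<Rightarrow> (real^3) \<times> real) \<Rightarrow> 'm measure \<Rightarrow> 'm set
    \<Rightarrow> ('m \<Rightarrow> (real^3) \<times> real) \<Rightarrow> real" where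
  "bienergy c A \<phi> dv K \<psi> =
     (LINT p:K|dv. ambient_form c (tension_field c A \<phi> \<psi> p) (tension_field c A \<phi> \<psi> p)) / 2"

definition smooth_variation ::
  "real \<Rightarrow> 'm topology \<Rightarrow> 'm chart set \<Rightarrow> ('m \<Rightarrow> (real^3) \<times> real) \<Rightarrow> 'm set \<Rightarrow> real
    \<Rightarrow> (real \<Rightarrow> 'm \<Rightarrow> (real^3) \<times> real) \<Rightarrow> bool" where
  "smooth_variation c X A \<phi> K \<epsilon> F \<longleftrightarrow>
     (\<forall>s \<in> {-\<epsilon><..<\<epsilon>}. \<forall>p \<in> topspace X. F s p \<in> product_space c) \<and>
     (\<forall>(U, x) \<in> A. smooth_on (\<lambda>(s, u). F s (x u)) ({-\<epsilon><..<\<epsilon>} \<times> U)) \<and>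
     (\<forall>p \<in> topspace X. F 0 p = \<phi> p) \<and>
     (\<forall>s \<in> {-\<epsilon><..<\<epsilon>}. \<forall>p \<in> topspace X - K. F s p = \<phi> p)"

text \<open>Critical points of the bienergy, with respect to all variations with compact support: the
  surface need not be compact, so the bienergy is taken over a compact set \<open>K\<close> outside of which
  the variation is constant.\<close>

definition biharmonic ::
  "real \<Rightarrow> 'm topology \<Rightarrow> 'm chart set \<Rightarrow> ('m \<Rightarrow> (real^3) \<times> real) \<Rightarrow> bool" where
  "biharmonic c X A \<phi> \<longleftrightarrow>
     (\<exists>dv. is_area_measure c X A \<phi> dv \<and>
        (\<forall>K \<epsilon> F. compactin X K \<and> \<epsilon> > 0 \<and> smooth_variation c X A \<phi> K \<epsilon> F \<longrightarrow>
           ((\<lambda>s. bienergy c A \<phi> dv K (F s)) has_real_derivative 0) (at 0)))"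

definition proper_biharmonic ::
  "real \<Rightarrow> 'm topology \<Rightarrow> 'm chart set \<Rightarrow> ('m \<Rightarrow> (real^3) \<times> real) \<Rightarrow> ('m \<Rightarrow> (real^3) \<times> real) \<Rightarrow> bool"
where
  "proper_biharmonic c X A \<phi> \<xi> \<longleftrightarrow> biharmonic c X A \<phi> \<and> \<not> minimal_surface c A \<phi> \<xi>"


section \<open>Circles\<close>

definition is_circle :: "real \<Rightarrow> (real^3) set \<Rightarrow> bool" where
  "is_circle r C \<longleftrightarrow>
     r > 0 \<and> (\<exists>q n. norm n = 1 \<and> C = {a. dist a q = r \<and> (a - q) \<bullet> n = 0})"

end

theory Submission
  imports Defs
begin

text \<open>
  Both space forms sit in \<open>\<real>\<^sup>3\<close> with the bilinear form \<open>\<langle>a, b\<rangle> = first_form c a b\<close>, so a map into the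
  product space is a vector valued function \<open>F = (F\<^sub>1, F\<^sub>2)\<close>, and the metric on the surface stays
  fixed along a variation. Write \<open>\<Delta>\<close> for the Laplacian of this metric, applied to vector valued
  functions. The tension field of \<open>F\<close> is the tangential part of \<open>\<Delta>F\<close>, hence
  \<open>|\<tau>(F)|\<^sup>2 = |\<Delta>F|\<^sup>2 - c \<langle>\<Delta>F\<^sub>1, F\<^sub>1\<rangle>\<^sup>2\<close> (\<open>tangent_proj_square\<close>). The derivative of the bienergy at
  \<open>\<phi> = (f, h)\<close> in the direction of \<open>V\<close> is therefore the integral of
  \<open>\<langle>\<Delta>\<phi>, \<Delta>V\<rangle> - c \<langle>\<Delta>f, f\<rangle> (\<langle>\<Delta>V\<^sub>1, f\<rangle> + \<langle>\<Delta>f, V\<^sub>1\<rangle>)\<close> (\<open>first_variation\<close>), and Green's identity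
  (\<open>green_form\<close>) moves the Laplacian off \<open>V\<close>.

  The geometric properties of \<open>\<Delta>\<close> come from one characterisation (\<open>laplacian_unique\<close>): among the second
  order operators without zeroth order term whose leading coefficients are the inverse metric, it is
  the only one that maps the immersion to a normal vector. Independence of the chart, the divergence
  form behind Green's identity, and the formula in a moving frame are three instances.

  Suppose the angle function has the constant value \<open>\<theta>\<close>. If \<open>\<theta>\<^sup>2 \<ge> 1\<close>, the unit normal is vertical
  and the surface is horizontal, hence minimal (\<open>horizontal_minimal\<close>). Otherwise let
  \<open>s = sqrt (1 - \<theta>\<^sup>2)\<close> and write the normal as \<open>(s \<nu>, \<theta>)\<close>. The tangential part of \<open>\<partial>\<^sub>t\<close> gives a unit
  field \<open>e\<^sub>1\<close>, the level curves of \<open>h\<close> a unit field \<open>e\<^sub>2\<close>, and the whole geometry is governed by one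
  function \<open>\<kappa>\<close>, the geodesic curvature of these level curves: the mean curvature is \<open>s \<kappa> / 2\<close>, the
  Codazzi equation reads \<open>e\<^sub>1 \<kappa> = - \<theta> (c + \<kappa>\<^sup>2)\<close> (\<open>codazzi\<close>), and \<open>\<langle>\<Delta>f, f\<rangle> = - (1 + \<theta>\<^sup>2)\<close> is
  constant. Variations along cut-off Killing fields, which span the tangent spaces of the product
  space, show that \<open>\<Delta>\<Delta>h = 0\<close> and that \<open>\<Delta>\<Delta>f + 2 c (1 + \<theta>\<^sup>2) \<Delta>f\<close> is a multiple of \<open>f\<close> (\<open>euler_lagrange\<close>). In the frame this says
  \<open>\<theta> \<Delta>\<kappa> = 0\<close>, \<open>\<kappa> e\<^sub>2 \<kappa> = 0\<close> and \<open>\<Delta>\<kappa> = \<kappa>\<^sup>3 - c \<kappa>\<close>. Where \<open>\<kappa> \<noteq> 0\<close>, a nonzero \<open>\<theta>\<close> would force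
  \<open>\<kappa>\<^sup>2 = c\<close> and so \<open>e\<^sub>1 \<kappa> = 0\<close>, against the Codazzi equation; with \<open>\<theta> = 0\<close> all derivatives of \<open>\<kappa>\<close>
  vanish, which leaves \<open>\<kappa>\<^sup>2 = c = 1\<close> (\<open>biharmonic_curvature\<close>). By connectedness \<open>\<kappa>\<close> is constant on
  the surface, \<open>f + \<kappa> \<nu> = 2 q\<close> is a constant vector, and \<open>f\<close> lies on the circle of radius
  \<open>1 / sqrt 2\<close> about \<open>q\<close>. The immersion into the cylinder over this circle is a local
  diffeomorphism, so its image is open (\<open>image_open_in_cylinder\<close>).

  Conversely, on this cylinder \<open>\<Delta>\<phi> = (- 2 (f - q), 0)\<close> (\<open>cylinder_geometry\<close>). The integrand of the
  first variation then coincides with the one of Green's identity for the pair \<open>(2 q - f, 0)\<close> and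
  \<open>V\<close>, so the first variation vanishes. That the area measure exists, as the definition of a
  biharmonic immersion requires, is \<open>area_measure_exists\<close>.
\<close>

section \<open>Calculus of smooth maps\<close>

abbreviation dir_deriv :: "'a::real_normed_vector \<Rightarrow> ('a \<Rightarrow> 'b::real_normed_vector) \<Rightarrow> 'a \<Rightarrow> 'b" where
  "dir_deriv v f \<equiv> (\<lambda>x. frechet_derivative f (at x) v)"

lemma dir_deriv_eqI: "(f has_derivative f') (at x) \<Longrightarrow> dir_deriv v f x = f' v"
  using frechet_derivative_at by metis

lemma frechet_derivative_cong_open:
  assumes "open S" "x \<in> S" "\<And>y. y \<in> S \<Longrightarrow> f y = g y"
  shows "frechet_derivative f (at x) = frechet_derivative g (at x)"
proof -
  have "(f has_derivative f') (at x) \<longleftrightarrow> (g has_derivative f') (at x)" for f'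
    using has_derivative_transform_within_open[of f f' x UNIV S g]
      has_derivative_transform_within_open[of g f' x UNIV S f] assms by auto
  then show ?thesis by (simp add: frechet_derivative_def)
qed

lemma differentiable_cong_open:
  assumes "open S" "x \<in> S" "\<And>y. y \<in> S \<Longrightarrow> f y = g y"
  shows "f differentiable (at x) \<longleftrightarrow> g differentiable (at x)"
  unfolding differentiable_def
  using has_derivative_transform_within_open[of f _ x UNIV S g]
      has_derivative_transform_within_open[of g _ x UNIV S f] assms by auto

lemma Ck_on_cong:
  assumes "open S" "\<And>x. x \<in> S \<Longrightarrow> f x = g x"
  shows "Ck_on k f S \<longleftrightarrow> Ck_on k g S"
  using assms(2)
proof (induction k arbitrary: f g)
  case 0
  then show ?case by (auto cong: continuous_on_cong)
next
  case (Suc k)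
  have "Ck_on k (dir_deriv v f) S \<longleftrightarrow> Ck_on k (dir_deriv v g) S" for v
    by (rule Suc.IH, rule arg_cong[where f="\<lambda>h. h v"],
        rule frechet_derivative_cong_open[OF assms(1) _ Suc.prems])
  moreover have "f differentiable_on S \<longleftrightarrow> g differentiable_on S"
    unfolding differentiable_on_eq_differentiable_at[OF assms(1)]
    by (rule ball_cong[OF refl], rule differentiable_cong_open[OF assms(1) _ Suc.prems])
  ultimately show ?case unfolding Ck_on.simps by blast
qed

lemma Ck_on_subset: "Ck_on k f S \<Longrightarrow> T \<subseteq> S \<Longrightarrow> Ck_on k f T"
proof (induction k arbitrary: f)
  case 0
  then show ?case using continuous_on_subset by auto
next
  case (Suc k)
  from Suc.prems have "f differentiable_on T" "\<And>v. Ck_on k (dir_deriv v f) T"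
    using differentiable_on_subset Suc.IH unfolding Ck_on.simps by blast+
  then show ?case unfolding Ck_on.simps by blast
qed

text \<open>Smooth functions on a surface are glued from pieces; this is what makes the gluing smooth.\<close>

lemma Ck_on_local:
  assumes "open S" "\<And>x. x \<in> S \<Longrightarrow> \<exists>T. open T \<and> x \<in> T \<and> Ck_on k f T"
  shows "Ck_on k f S"
  using assms(2)
proof (induction k arbitrary: f)
  case 0
  then show ?case
    using continuous_on_eq_continuous_at assms(1) unfolding Ck_on.simps by blast
next
  case (Suc k)
  have "f differentiable (at x)" if "x \<in> S" for x
    using Suc.prems[OF that] differentiable_on_eq_differentiable_at unfolding Ck_on.simps by blast
  moreover have "Ck_on k (dir_deriv v f) S" for v
  proof (rule Suc.IH)
    fix x assume "x \<in> S"
    then obtain T where "open T" "x \<in> T" "Ck_on (Suc k) f T" using Suc.prems by blast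
    then have "open T \<and> x \<in> T \<and> Ck_on k (dir_deriv v f) T" unfolding Ck_on.simps by blast
    then show "\<exists>T. open T \<and> x \<in> T \<and> Ck_on k (dir_deriv v f) T" by blast
  qed
  ultimately show ?case
    unfolding Ck_on.simps differentiable_on_eq_differentiable_at[OF assms(1)] by blast
qed

lemma Ck_on_SucD: "Ck_on (Suc k) f S \<Longrightarrow> Ck_on k f S"
proof (induction k arbitrary: f)
  case 0
  then show ?case using differentiable_imp_continuous_on unfolding Ck_on.simps by blast
next
  case (Suc k)
  have "f differentiable_on S" "\<And>v. Ck_on (Suc k) (dir_deriv v f) S"
    using Suc.prems unfolding Ck_on.simps(2)[of "Suc k"] by blast+
  with Suc.IH show ?case unfolding Ck_on.simps(2)[of k f] by blast
qed

lemma Ck_on_SucI: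
  assumes "open S" "\<And>x. x \<in> S \<Longrightarrow> (f has_derivative f' x) (at x)"
    and "\<And>v. Ck_on k (\<lambda>x. f' x v) S"
  shows "Ck_on (Suc k) f S"
proof -
  have "f differentiable_on S"
    using assms(2) by (auto simp: differentiable_on_eq_differentiable_at[OF assms(1)] differentiable_def)
  moreover have "Ck_on k (dir_deriv v f) S" for v
    using Ck_on_cong[OF assms(1), of "dir_deriv v f" "\<lambda>x. f' x v"] assms(3)
    by (simp add: dir_deriv_eqI[OF assms(2)])
  ultimately show ?thesis by simp
qed

lemma Ck_on_SucE:
  assumes "open S" "Ck_on (Suc k) f S" "x \<in> S"
  shows "(f has_derivative frechet_derivative f (at x)) (at x)"
  using assms by (simp add: differentiable_on_eq_differentiable_at frechet_derivative_works)

lemma Ck_on_const: "open S \<Longrightarrow> Ck_on k (\<lambda>x. a) S"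
  by (induction k arbitrary: a) (simp_all add: frechet_derivative_const)

lemma Ck_on_linear:
  assumes "bounded_linear h" "open S"
  shows "Ck_on k h S"
proof (cases k)
  case 0
  then show ?thesis using assms by (simp add: linear_continuous_on)
next
  case (Suc j)
  show ?thesis unfolding Suc
    by (rule Ck_on_SucI[OF assms(2) bounded_linear_imp_has_derivative[OF assms(1)]])
       (rule Ck_on_const[OF assms(2)])
qed

lemma Ck_on_compose_linear:
  assumes "bounded_linear h" "open S" "Ck_on k f S"
  shows "Ck_on k (\<lambda>x. h (f x)) S"
  using assms(3)
proof (induction k arbitrary: f)
  case 0
  then show ?case using assms(1) by (auto intro: bounded_linear.continuous_on)
next
  case (Suc k)
  show ?case
    by (rule Ck_on_SucI[OF assms(2)
          bounded_linear.has_derivative[OF assms(1) Ck_on_SucE[OF assms(2) Suc.prems]]])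
       (use Suc in auto)
qed

lemma Ck_on_add:
  assumes "open S" "Ck_on k f S" "Ck_on k g S"
  shows "Ck_on k (\<lambda>x. f x + g x) S"
  using assms(2,3)
proof (induction k arbitrary: f g)
  case 0
  then show ?case by (auto intro: continuous_intros)
next
  case (Suc k)
  show ?case
    by (rule Ck_on_SucI[OF assms(1) has_derivative_add[OF Ck_on_SucE[OF assms(1) Suc.prems(1)]
           Ck_on_SucE[OF assms(1) Suc.prems(2)]]])
       (use Suc in auto)
qed

lemma (in bounded_bilinear) Ck_on_prod:
  assumes "open S" "Ck_on k f S" "Ck_on k g S"
  shows "Ck_on k (\<lambda>x. prod (f x) (g x)) S"
  using assms(2,3)
proof (induction k arbitrary: f g)
  case 0
  then show ?case by (auto intro: continuous_on)
next
  case (Suc k)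
  show ?case
    by (rule Ck_on_SucI[OF assms(1) FDERIV[OF Ck_on_SucE[OF assms(1) Suc.prems(1)]
           Ck_on_SucE[OF assms(1) Suc.prems(2)]]])
       (use Suc Ck_on_SucD[OF Suc.prems(1)] Ck_on_SucD[OF Suc.prems(2)] in \<open>auto intro!: Ck_on_add[OF assms(1)]\<close>)
qed

lemma Ck_on_sum:
  assumes "open S" "\<And>i. i \<in> I \<Longrightarrow> Ck_on k (f i) S"
  shows "Ck_on k (\<lambda>x. \<Sum>i\<in>I. f i x) S"
  using assms(2)
  by (induction I rule: infinite_finite_induct) (auto intro: Ck_on_const Ck_on_add assms(1))

lemma dir_deriv_Basis:
  fixes f :: "'a::euclidean_space \<Rightarrow> 'b::real_normed_vector"
  assumes "f differentiable (at x)"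
  shows "dir_deriv v f x = (\<Sum>b\<in>Basis. (v \<bullet> b) *\<^sub>R dir_deriv b f x)"
proof -
  have "linear (frechet_derivative f (at x))"
    using assms frechet_derivative_works has_derivative_linear by blast
  then have "frechet_derivative f (at x) (\<Sum>b\<in>Basis. (v \<bullet> b) *\<^sub>R b)
      = (\<Sum>b\<in>Basis. (v \<bullet> b) *\<^sub>R dir_deriv b f x)"
    by (simp add: linear_sum linear_cmul)
  then show ?thesis by (simp add: euclidean_representation)
qed

text \<open>By the chain rule a directional derivative of the composition is a sum of products of
  directional derivatives of \<open>f\<close>, composed with \<open>g\<close>, and coordinates of derivatives of \<open>g\<close>. The
  expansion in a basis is needed because the direction in which \<open>f\<close> is differentiated varies
  with the point.\<close>

lemma Ck_on_compose:
  fixes f :: "'a::euclidean_space \<Rightarrow> 'b::real_normed_vector"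
  assumes "open S" "open T" "Ck_on k f T" "Ck_on k g S" "g ` S \<subseteq> T"
  shows "Ck_on k (\<lambda>x. f (g x)) S"
  using assms(3,4)
proof (induction k arbitrary: f)
  case 0
  then show ?case using assms(5) by (auto intro: continuous_on_compose2)
next
  case (Suc k)
  have eq: "dir_deriv (dir_deriv v g x) f (g x)
      = (\<Sum>b\<in>Basis. (dir_deriv v g x \<bullet> b) *\<^sub>R dir_deriv b f (g x))" if "x \<in> S" for v x
    by (rule dir_deriv_Basis)
       (use Suc.prems that assms in \<open>auto simp: differentiable_on_eq_differentiable_at\<close>)
  have gx: "g x \<in> T" if "x \<in> S" for x
    using that assms(5) by auto
  have C: "Ck_on k (\<lambda>x. \<Sum>b\<in>Basis. (dir_deriv v g x \<bullet> b) *\<^sub>R dir_deriv b f (g x)) S" for v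
    using Suc.prems Suc.IH Ck_on_SucD[OF Suc.prems(2)]
    by (intro Ck_on_sum assms(1) bounded_bilinear.Ck_on_prod[OF bounded_bilinear_scaleR]
         Ck_on_compose_linear[OF bounded_linear_inner_left]) auto
  show ?case
  proof (rule Ck_on_SucI[OF assms(1)])
    fix x assume x: "x \<in> S"
    show "((\<lambda>x. f (g x)) has_derivative
        (\<lambda>v. frechet_derivative f (at (g x)) (frechet_derivative g (at x) v))) (at x)"
      using has_derivative_compose[OF Ck_on_SucE[OF assms(1) Suc.prems(2) x]
          Ck_on_SucE[OF assms(2) Suc.prems(1) gx[OF x]]] .
  next
    fix v
    show "Ck_on k (\<lambda>x. frechet_derivative f (at (g x)) (frechet_derivative g (at x) v)) S"
      by (subst Ck_on_cong[OF assms(1) eq]) (use C in auto)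
  qed
qed

lemma Ck_on_real_SucI:
  fixes f :: "real \<Rightarrow> real"
  assumes "open S" "\<And>x. x \<in> S \<Longrightarrow> (f has_real_derivative f' x) (at x)" "Ck_on k f' S"
  shows "Ck_on (Suc k) f S"
proof (rule Ck_on_SucI[OF assms(1)])
  show "(f has_derivative (*) (f' x)) (at x)" if "x \<in> S" for x
    using assms(2)[OF that] by (simp add: has_field_derivative_def)
  show "Ck_on k (\<lambda>x. f' x * v) S" for v
    by (rule Ck_on_compose_linear[OF bounded_linear_mult_left assms(1,3)])
qed

lemma Ck_on_inverse: "Ck_on k (inverse :: real \<Rightarrow> real) (- {0})"
proof (induction k)
  case 0
  then show ?case by (auto intro!: continuous_intros)
next
  case (Suc k)
  have o: "open (- {0::real})" by auto
  show ?case
  proof (rule Ck_on_real_SucI[OF o])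
    show "(inverse has_real_derivative - (inverse x * inverse x)) (at x)" if "x \<in> - {0}" for x :: real
      using that by (auto intro!: derivative_eq_intros)
    show "Ck_on k (\<lambda>x. - (inverse x * inverse x) :: real) (- {0})"
      by (intro Ck_on_compose_linear[OF bounded_linear_minus[OF bounded_linear_ident]]
           bounded_bilinear.Ck_on_prod[OF bounded_bilinear_mult] o Suc)
  qed
qed

lemma Ck_on_exp: "Ck_on k (exp :: real \<Rightarrow> real) UNIV"
proof (induction k)
  case 0
  then show ?case by (auto intro!: continuous_intros)
next
  case (Suc k)
  show ?case by (rule Ck_on_real_SucI[OF open_UNIV DERIV_exp Suc])
qed

text \<open>The two functions are each other's derivative up to sign, so neither can be treated alone.\<close>

lemma Ck_on_sin_cos: "Ck_on k (sin :: real \<Rightarrow> real) UNIV \<and> Ck_on k (cos :: real \<Rightarrow> real) UNIV"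
proof (induction k)
  case 0
  then show ?case by (auto intro!: continuous_intros)
next
  case (Suc k)
  have "Ck_on k (\<lambda>x. - sin x :: real) UNIV"
    using Ck_on_compose_linear[OF bounded_linear_minus[OF bounded_linear_ident]] Suc by blast
  then show ?case using Suc by (metis Ck_on_real_SucI DERIV_sin DERIV_cos open_UNIV)
qed

lemma Ck_on_sqrt: "Ck_on k sqrt {0<..}"
proof (induction k)
  case 0
  then show ?case by (auto intro!: continuous_intros)
next
  case (Suc k)
  have o: "open {0::real<..}" by auto
  show ?case
  proof (rule Ck_on_real_SucI[OF o])
    show "(sqrt has_real_derivative inverse (sqrt x) * (1/2)) (at x)" if "x \<in> {0<..}" for x :: real
      using DERIV_real_sqrt[of x] that by simp
    have "Ck_on k (\<lambda>x. inverse (sqrt x)) {0<..}"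
      by (rule Ck_on_compose[OF o _ Ck_on_inverse Suc]) (auto simp: image_subset_iff)
    then show "Ck_on k (\<lambda>x. inverse (sqrt x) * (1/2)) {0<..}"
      by (rule Ck_on_compose_linear[OF bounded_linear_mult_left o])
  qed
qed

lemma flat_tail_limit:
  "((\<lambda>x. x ^ n * exp (- x) :: real) \<longlongrightarrow> 0) at_top"
  using tendsto_power_div_exp_0[of n] by (simp add: exp_minus divide_inverse)

text \<open>The functions \<open>x\<^sup>-\<^sup>n exp (- 1 / x)\<close> on the positive half-line, extended by zero, span a class
  that is closed under differentiation; this is why the standard cut-off function, the case
  \<open>n = 0\<close>, is smooth at the origin.\<close>

definition flat_fun :: "nat \<Rightarrow> real \<Rightarrow> real" where
  "flat_fun n x = (if x > 0 then inverse x ^ n * exp (- inverse x) else 0)"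

lemma flat_fun_limit: "(flat_fun n \<longlongrightarrow> 0) (at 0)"
proof -
  have r: "((\<lambda>x. inverse x ^ n * exp (- inverse x)) \<longlongrightarrow> 0) (at_right (0::real))"
    using filterlim_compose[OF flat_tail_limit filterlim_inverse_at_top_right] .
  have "(flat_fun n \<longlongrightarrow> 0) (at_right 0)"
    by (rule Lim_transform_eventually[OF r])
       (auto simp: flat_fun_def eventually_at_right_field intro: exI[of _ 1])
  moreover have "(flat_fun n \<longlongrightarrow> 0) (at_left 0)"
    by (rule Lim_transform_eventually[OF tendsto_const])
       (auto simp: flat_fun_def eventually_at_left_field intro: exI[of _ "-1"])
  ultimately show ?thesis
    using filterlim_split_at by blast
qed

lemma flat_fun_deriv:
  "(flat_fun n has_real_derivative flat_fun (n+2) x - real n * flat_fun (n+1) x) (at x)"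
proof -
  consider "x > 0" | "x < 0" | "x = 0" by linarith
  then show ?thesis
  proof cases
    case 1
    have d: "(inverse has_real_derivative - (inverse x * inverse x)) (at x)"
      using 1 by (auto intro!: derivative_eq_intros)
    have p: "((\<lambda>x. inverse x ^ n) has_real_derivative - real n * inverse x ^ (n+1)) (at x)"
      by (rule DERIV_cong[OF DERIV_power[OF d]]) (cases n; simp add: algebra_simps)
    have e: "((\<lambda>x. exp (- inverse x)) has_real_derivative
        exp (- inverse x) * (inverse x * inverse x)) (at x)"
      by (rule DERIV_cong[OF DERIV_fun_exp[OF DERIV_minus[OF d]]]) simp
    have "((\<lambda>x. inverse x ^ n * exp (- inverse x)) has_real_derivative
        flat_fun (n+2) x - real n * flat_fun (n+1) x) (at x)"
      by (rule DERIV_cong[OF DERIV_mult[OF p e]])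
         (use 1 in \<open>simp add: flat_fun_def algebra_simps\<close>)
    then show ?thesis
      by (rule has_field_derivative_transform_within_open[where S="{0<..}"])
         (use 1 in \<open>auto simp: flat_fun_def\<close>)
  next
    case 2
    have "((\<lambda>x. 0) has_real_derivative flat_fun (n+2) x - real n * flat_fun (n+1) x) (at x)"
      using 2 by (simp add: flat_fun_def)
    then show ?thesis
      by (rule has_field_derivative_transform_within_open[where S="{..<0}"])
         (use 2 in \<open>auto simp: flat_fun_def\<close>)
  next
    case 3
    have "flat_fun (n+1) h = (flat_fun n (0 + h) - flat_fun n 0) / h" if "h \<noteq> 0" for h
      using that by (auto simp: flat_fun_def field_simps)
    then have "((\<lambda>h. (flat_fun n (0 + h) - flat_fun n 0) / h) \<longlongrightarrow> 0) (at 0)"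
      using flat_fun_limit[of "n+1"]
      by (subst tendsto_cong[where g="flat_fun (n+1)"]) (auto simp: eventually_at_filter)
    moreover have "flat_fun (n+2) 0 - real n * flat_fun (n+1) 0 = 0"
      by (simp add: flat_fun_def)
    ultimately show ?thesis
      unfolding 3 by (metis DERIV_def)
  qed
qed

lemma Ck_on_flat_fun: "Ck_on k (flat_fun n) UNIV"
proof (induction k arbitrary: n)
  case 0
  then show ?case
    using flat_fun_deriv DERIV_isCont by (simp add: continuous_on_eq_continuous_at) blast
next
  case (Suc k)
  have "Ck_on k (\<lambda>x. flat_fun (n+2) x + (- real n) * flat_fun (n+1) x) UNIV"
    by (intro Ck_on_add Suc Ck_on_compose_linear[OF bounded_linear_mult_right]) auto
  then show ?case
    by (intro Ck_on_real_SucI[OF _ flat_fun_deriv]) auto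
qed

lemma smooth_on_cong: "open S \<Longrightarrow> (\<And>x. x \<in> S \<Longrightarrow> f x = g x) \<Longrightarrow> smooth_on f S \<longleftrightarrow> smooth_on g S"
  by (simp add: smooth_on_def Ck_on_cong[of S f g])

lemma smooth_on_subset: "smooth_on f S \<Longrightarrow> T \<subseteq> S \<Longrightarrow> smooth_on f T"
  unfolding smooth_on_def using Ck_on_subset by blast

lemma smooth_on_local:
  assumes "open S" "\<And>x. x \<in> S \<Longrightarrow> \<exists>T. open T \<and> x \<in> T \<and> smooth_on f T"
  shows "smooth_on f S"
  unfolding smooth_on_def
proof
  fix k
  show "Ck_on k f S"
    by (rule Ck_on_local[OF assms(1)]) (use assms(2) in \<open>auto simp: smooth_on_def\<close>)
qed

lemma smooth_on_const: "open S \<Longrightarrow> smooth_on (\<lambda>x. a) S"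
  by (simp add: smooth_on_def Ck_on_const)

lemma smooth_on_linear: "bounded_linear h \<Longrightarrow> open S \<Longrightarrow> smooth_on h S"
  by (simp add: smooth_on_def Ck_on_linear)

lemma smooth_on_id: "open S \<Longrightarrow> smooth_on (\<lambda>x. x) S"
  by (rule smooth_on_linear) (auto intro: bounded_linear_ident)

lemma smooth_on_compose_linear:
  "bounded_linear h \<Longrightarrow> open S \<Longrightarrow> smooth_on f S \<Longrightarrow> smooth_on (\<lambda>x. h (f x)) S"
  unfolding smooth_on_def by (intro allI Ck_on_compose_linear[of h S _ f]) auto

lemma smooth_on_add:
  "open S \<Longrightarrow> smooth_on f S \<Longrightarrow> smooth_on g S \<Longrightarrow> smooth_on (\<lambda>x. f x + g x) S"
  by (simp add: smooth_on_def Ck_on_add)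

lemma smooth_on_uminus: "open S \<Longrightarrow> smooth_on f S \<Longrightarrow> smooth_on (\<lambda>x. - f x) S"
  by (rule smooth_on_compose_linear[OF bounded_linear_minus[OF bounded_linear_ident]])

lemma smooth_on_diff:
  "open S \<Longrightarrow> smooth_on f S \<Longrightarrow> smooth_on g S \<Longrightarrow> smooth_on (\<lambda>x. f x - g x) S"
  using smooth_on_add[of S f "\<lambda>x. - g x"] smooth_on_uminus[of S g] by simp

lemma smooth_on_bilinear:
  "bounded_bilinear h \<Longrightarrow> open S \<Longrightarrow> smooth_on f S \<Longrightarrow> smooth_on g S \<Longrightarrow> smooth_on (\<lambda>x. h (f x) (g x)) S"
  unfolding smooth_on_def by (intro allI bounded_bilinear.Ck_on_prod[of h S _ f g]) auto

lemma smooth_on_scaleR: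
  "open S \<Longrightarrow> smooth_on f S \<Longrightarrow> smooth_on g S \<Longrightarrow> smooth_on (\<lambda>x. f x *\<^sub>R g x) S"
  by (rule smooth_on_bilinear[OF bounded_bilinear_scaleR])

lemma smooth_on_mult:
  fixes f g :: "'a::real_normed_vector \<Rightarrow> real"
  shows "open S \<Longrightarrow> smooth_on f S \<Longrightarrow> smooth_on g S \<Longrightarrow> smooth_on (\<lambda>x. f x * g x) S"
  by (rule smooth_on_bilinear[OF bounded_bilinear_mult])

lemma smooth_on_sum:
  "open S \<Longrightarrow> (\<And>i. i \<in> I \<Longrightarrow> smooth_on (f i) S) \<Longrightarrow> smooth_on (\<lambda>x. \<Sum>i\<in>I. f i x) S"
  by (simp add: smooth_on_def Ck_on_sum)

lemma smooth_on_compose: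
  fixes f :: "'a::euclidean_space \<Rightarrow> 'b::real_normed_vector"
  assumes "open S" "open T" "smooth_on f T" "smooth_on g S" "g ` S \<subseteq> T"
  shows "smooth_on (\<lambda>x. f (g x)) S"
  using assms(3,4) Ck_on_compose[OF assms(1,2) _ _ assms(5), of _ f] by (simp add: smooth_on_def)

lemma smooth_on_inverse:
  fixes f :: "'a::real_normed_vector \<Rightarrow> real"
  assumes "open S" "smooth_on f S" "\<And>x. x \<in> S \<Longrightarrow> f x \<noteq> 0"
  shows "smooth_on (\<lambda>x. inverse (f x)) S"
  by (rule smooth_on_compose[where T="- {0}" and f=inverse and g=f]) (use assms Ck_on_inverse in \<open>auto simp: smooth_on_def\<close>)

lemma smooth_on_divide:
  fixes f g :: "'a::real_normed_vector \<Rightarrow> real"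
  assumes "open S" "smooth_on f S" "smooth_on g S" "\<And>x. x \<in> S \<Longrightarrow> g x \<noteq> 0"
  shows "smooth_on (\<lambda>x. f x / g x) S"
  unfolding divide_inverse by (intro smooth_on_mult smooth_on_inverse assms)

lemma smooth_on_sqrt:
  assumes "open S" "smooth_on f S" "\<And>x. x \<in> S \<Longrightarrow> f x > 0"
  shows "smooth_on (\<lambda>x. sqrt (f x)) S"
  by (rule smooth_on_compose[where T="{0<..}" and f=sqrt and g=f]) (use assms Ck_on_sqrt in \<open>auto simp: smooth_on_def\<close>)

lemma smooth_on_Pair:
  assumes "open S" "smooth_on f S" "smooth_on g S"
  shows "smooth_on (\<lambda>x. (f x, g x)) S"
proof -
  have l: "bounded_linear (\<lambda>a. (a, 0))" "bounded_linear (\<lambda>b. (0, b))"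
    by (auto intro!: bounded_linear_Pair bounded_linear_ident bounded_linear_zero)
  have "smooth_on (\<lambda>x. (f x, 0) + (0, g x)) S"
    by (rule smooth_on_add[OF assms(1) smooth_on_compose_linear[OF l(1) assms(1,2)]
          smooth_on_compose_linear[OF l(2) assms(1,3)]])
  then show ?thesis by simp
qed

lemma smooth_on_fst: "open S \<Longrightarrow> smooth_on f S \<Longrightarrow> smooth_on (\<lambda>x. fst (f x)) S"
  by (rule smooth_on_compose_linear[OF bounded_linear_fst])

lemma smooth_on_snd: "open S \<Longrightarrow> smooth_on f S \<Longrightarrow> smooth_on (\<lambda>x. snd (f x)) S"
  by (rule smooth_on_compose_linear[OF bounded_linear_snd])

lemma smooth_on_nth: "open S \<Longrightarrow> smooth_on f S \<Longrightarrow> smooth_on (\<lambda>x. f x $ i) S"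
  by (rule smooth_on_compose_linear[OF bounded_linear_vec_nth])

lemma smooth_on_inner:
  "open S \<Longrightarrow> smooth_on f S \<Longrightarrow> smooth_on g S \<Longrightarrow> smooth_on (\<lambda>x. f x \<bullet> g x) S"
  by (rule smooth_on_bilinear[OF bounded_bilinear_inner])

lemma smooth_on_vec:
  fixes f :: "'a::real_normed_vector \<Rightarrow> real ^ 'n"
  assumes "open S" "\<And>i. smooth_on (\<lambda>x. f x $ i) S"
  shows "smooth_on f S"
proof -
  have "smooth_on (\<lambda>x. \<Sum>i\<in>UNIV. f x $ i *\<^sub>R (axis i 1 :: real^'n)) S"
    by (intro smooth_on_sum smooth_on_scaleR smooth_on_const assms)
  moreover have "(\<Sum>i\<in>UNIV. f x $ i *\<^sub>R axis i 1) = f x" for x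
    using basis_expansion[of "f x"] by (simp add: scalar_mult_eq_scaleR)
  then have "(\<lambda>x. \<Sum>i\<in>UNIV. f x $ i *\<^sub>R axis i 1) = f" by (rule ext)
  ultimately show ?thesis by (simp only:)
qed

lemma smooth_on_dir_deriv: "smooth_on f S \<Longrightarrow> smooth_on (dir_deriv v f) S"
  unfolding smooth_on_def using Ck_on.simps(2) by blast

lemma smooth_on_has_derivative:
  "open S \<Longrightarrow> smooth_on f S \<Longrightarrow> x \<in> S \<Longrightarrow> (f has_derivative frechet_derivative f (at x)) (at x)"
  unfolding smooth_on_def using Ck_on_SucE by blast

lemma smooth_on_differentiable:
  "open S \<Longrightarrow> smooth_on f S \<Longrightarrow> x \<in> S \<Longrightarrow> f differentiable (at x)"
  using smooth_on_has_derivative differentiableI by blast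

lemma smooth_on_continuous: "smooth_on f S \<Longrightarrow> continuous_on S f"
  unfolding smooth_on_def using Ck_on.simps(1) by blast

lemma smooth_on_partial_deriv: "smooth_on f S \<Longrightarrow> smooth_on (partial_deriv i f) S"
  unfolding partial_deriv_def by (rule smooth_on_dir_deriv)

lemma partial_deriv_cong:
  "open S \<Longrightarrow> u \<in> S \<Longrightarrow> (\<And>y. y \<in> S \<Longrightarrow> f y = g y) \<Longrightarrow> partial_deriv i f u = partial_deriv i g u"
  unfolding partial_deriv_def using frechet_derivative_cong_open by metis

subsection \<open>Symmetry of second derivatives\<close>

text \<open>The mean value theorem applied in the direction \<open>v\<close> and then in the direction \<open>w\<close>. Since the
  left hand side is symmetric in \<open>v\<close> and \<open>w\<close>, the symmetry of second derivatives follows in the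
  limit \<open>h \<rightarrow> 0\<close>.\<close>

lemma second_difference_mvt:
  fixes f :: "'a::real_normed_vector \<Rightarrow> real"
  assumes "open S" "Ck_on 2 f S" "h > 0"
    and sub: "\<And>s t. 0 \<le> s \<Longrightarrow> s \<le> h \<Longrightarrow> 0 \<le> t \<Longrightarrow> t \<le> h \<Longrightarrow> x + s *\<^sub>R v + t *\<^sub>R w \<in> S"
  shows "\<exists>s t. 0 < s \<and> s < h \<and> 0 < t \<and> t < h \<and>
     f (x + h *\<^sub>R v + h *\<^sub>R w) - f (x + h *\<^sub>R v) - f (x + h *\<^sub>R w) + f x
     = h * h * dir_deriv w (dir_deriv v f) (x + s *\<^sub>R v + t *\<^sub>R w)"
proof -
  have C: "Ck_on (Suc (Suc 0)) f S" using assms(2) by (simp add: numeral_2_eq_2)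
  have d: "((\<lambda>s. f (y + s *\<^sub>R v)) has_real_derivative dir_deriv v f (y + s *\<^sub>R v)) (at s)"
    if "y + s *\<^sub>R v \<in> S" for y s
  proof -
    have "((\<lambda>s. y + s *\<^sub>R v) has_derivative (\<lambda>r. r *\<^sub>R v)) (at s)"
      by (auto intro!: derivative_eq_intros)
    from has_derivative_compose[OF this Ck_on_SucE[OF assms(1) C that]]
    have "((\<lambda>s. f (y + s *\<^sub>R v)) has_derivative (\<lambda>r. dir_deriv (r *\<^sub>R v) f (y + s *\<^sub>R v))) (at s)" .
    moreover have "dir_deriv (r *\<^sub>R v) f (y + s *\<^sub>R v) = dir_deriv v f (y + s *\<^sub>R v) * r" for r
      using Ck_on_SucE[OF assms(1) C that]
      by (simp add: has_derivative_linear linear_cmul)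
    ultimately show ?thesis by (simp add: has_field_derivative_def)
  qed
  have C1: "Ck_on (Suc 0) (dir_deriv v f) S" using C by auto
  have e: "((\<lambda>t. dir_deriv v f (y + t *\<^sub>R w)) has_real_derivative
      dir_deriv w (dir_deriv v f) (y + t *\<^sub>R w)) (at t)" if "y + t *\<^sub>R w \<in> S" for y t
  proof -
    have "((\<lambda>t. y + t *\<^sub>R w) has_derivative (\<lambda>r. r *\<^sub>R w)) (at t)"
      by (auto intro!: derivative_eq_intros)
    from has_derivative_compose[OF this Ck_on_SucE[OF assms(1) C1 that]]
    have "((\<lambda>t. dir_deriv v f (y + t *\<^sub>R w)) has_derivative
       (\<lambda>r. dir_deriv (r *\<^sub>R w) (dir_deriv v f) (y + t *\<^sub>R w))) (at t)" .
    moreover have "dir_deriv (r *\<^sub>R w) (dir_deriv v f) (y + t *\<^sub>R w)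
        = dir_deriv w (dir_deriv v f) (y + t *\<^sub>R w) * r" for r
      using Ck_on_SucE[OF assms(1) C1 that]
      by (simp add: has_derivative_linear linear_cmul)
    ultimately show ?thesis by (simp add: has_field_derivative_def)
  qed
  define g where "g s = f (x + h *\<^sub>R w + s *\<^sub>R v) - f (x + s *\<^sub>R v)" for s
  have "\<exists>s>0. s < h \<and> g h - g 0 = (h - 0) *
      (dir_deriv v f (x + h *\<^sub>R w + s *\<^sub>R v) - dir_deriv v f (x + s *\<^sub>R v))"
    unfolding g_def
    by (rule MVT2[OF assms(3)], rule DERIV_diff; rule d)
       (use sub[of _ h] sub[of _ 0] assms(3) in \<open>auto simp: add.commute add.left_commute\<close>)
  then obtain s where s: "0 < s" "s < h" "g h - g 0 = h *
      (dir_deriv v f (x + h *\<^sub>R w + s *\<^sub>R v) - dir_deriv v f (x + s *\<^sub>R v))" by auto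
  have "\<exists>t>0. t < h \<and> dir_deriv v f (x + s *\<^sub>R v + h *\<^sub>R w) - dir_deriv v f (x + s *\<^sub>R v + 0 *\<^sub>R w)
      = (h - 0) * dir_deriv w (dir_deriv v f) (x + s *\<^sub>R v + t *\<^sub>R w)"
    by (rule MVT2[OF assms(3)], rule e) (use sub[of s] s in auto)
  then obtain t where t: "0 < t" "t < h"
    "dir_deriv v f (x + s *\<^sub>R v + h *\<^sub>R w) - dir_deriv v f (x + s *\<^sub>R v)
      = h * dir_deriv w (dir_deriv v f) (x + s *\<^sub>R v + t *\<^sub>R w)" by auto
  have "f (x + h *\<^sub>R v + h *\<^sub>R w) - f (x + h *\<^sub>R v) - f (x + h *\<^sub>R w) + f x = g h - g 0"
    by (simp add: g_def algebra_simps)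
  also have "\<dots> = h * h * dir_deriv w (dir_deriv v f) (x + s *\<^sub>R v + t *\<^sub>R w)"
    using s(3) t(3) by (simp add: add.commute add.left_commute)
  finally show ?thesis using s t by blast
qed

lemma dir_deriv_commute_real:
  fixes f :: "'a::real_normed_vector \<Rightarrow> real"
  assumes "open S" "Ck_on 2 f S" "x \<in> S"
  shows "dir_deriv v (dir_deriv w f) x = dir_deriv w (dir_deriv v f) x"
proof (rule ccontr)
  assume ne: "\<not> ?thesis"
  let ?P = "dir_deriv v (dir_deriv w f)" and ?Q = "dir_deriv w (dir_deriv v f)"
  define e where "e = \<bar>?P x - ?Q x\<bar> / 2"
  have e: "e > 0" using ne by (simp add: e_def)
  have C: "Ck_on (Suc (Suc 0)) f S" using assms(2) by (simp add: numeral_2_eq_2)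
  have "continuous_on S ?P" "continuous_on S ?Q"
    using C by (metis Ck_on.simps)+
  then have "continuous (at x) ?P" "continuous (at x) ?Q"
    using assms by (simp_all add: continuous_on_eq_continuous_at)
  then obtain d1 d2 where d: "d1 > 0" "\<And>y. dist y x < d1 \<Longrightarrow> dist (?P y) (?P x) < e"
     "d2 > 0" "\<And>y. dist y x < d2 \<Longrightarrow> dist (?Q y) (?Q x) < e"
    unfolding continuous_at_eps_delta using e by metis
  obtain d3 where d3: "d3 > 0" "ball x d3 \<subseteq> S"
    using assms(1,3) openE by blast
  define r where "r = min d1 (min d2 d3)"
  define h where "h = r / (2 * (norm v + norm w + 1))"
  have r: "r > 0" using d d3 by (simp add: r_def)
  have N: "2 * (norm v + norm w + 1) > 0" by (simp add: add_nonneg_pos)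
  have h: "h > 0" unfolding h_def using r N by simp
  have near: "dist (x + s *\<^sub>R v + t *\<^sub>R w) x < r" "dist (x + t *\<^sub>R w + s *\<^sub>R v) x < r"
    if "0 \<le> s" "s \<le> h" "0 \<le> t" "t \<le> h" for s t
  proof -
    have "norm (s *\<^sub>R v + t *\<^sub>R w) \<le> s * norm v + t * norm w"
      using norm_triangle_ineq[of "s *\<^sub>R v" "t *\<^sub>R w"] that by simp
    also have "\<dots> \<le> h * norm v + h * norm w"
      using that by (intro add_mono mult_right_mono) auto
    also have "\<dots> < h * (2 * (norm v + norm w + 1))"
      using h by (simp add: distrib_left add_nonneg_pos add_pos_nonneg)
    also have "\<dots> = r" using N by (simp add: h_def)
    finally show "dist (x + s *\<^sub>R v + t *\<^sub>R w) x < r" by (simp add: dist_norm add.assoc)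
    then show "dist (x + t *\<^sub>R w + s *\<^sub>R v) x < r" by (simp add: add_ac)
  qed
  have inS: "y \<in> S" if "dist y x < r" for y
    using that d3 by (auto simp: r_def dist_commute subset_iff)
  obtain s t where st: "0 < s" "s < h" "0 < t" "t < h"
    "f (x + h *\<^sub>R v + h *\<^sub>R w) - f (x + h *\<^sub>R v) - f (x + h *\<^sub>R w) + f x
     = h * h * ?Q (x + s *\<^sub>R v + t *\<^sub>R w)"
    using second_difference_mvt[OF assms(1,2) h, of x v w] near inS by metis
  obtain s' t' where st': "0 < s'" "s' < h" "0 < t'" "t' < h"
    "f (x + h *\<^sub>R w + h *\<^sub>R v) - f (x + h *\<^sub>R w) - f (x + h *\<^sub>R v) + f x
     = h * h * ?P (x + s' *\<^sub>R w + t' *\<^sub>R v)"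
    using second_difference_mvt[OF assms(1,2) h, of x w v] near inS by metis
  have "x + h *\<^sub>R w + h *\<^sub>R v = x + h *\<^sub>R v + h *\<^sub>R w" by (simp add: add_ac)
  then have "?Q (x + s *\<^sub>R v + t *\<^sub>R w) = ?P (x + s' *\<^sub>R w + t' *\<^sub>R v)"
    using st(5) st'(5) h by (simp add: algebra_simps)
  moreover have "dist (?Q (x + s *\<^sub>R v + t *\<^sub>R w)) (?Q x) < e"
    using near[of s t] st d(4) by (auto simp: r_def)
  moreover have "dist (?P (x + s' *\<^sub>R w + t' *\<^sub>R v)) (?P x) < e"
    using near(2)[of t' s'] st' d(2) by (auto simp: r_def)
  moreover have "False" if "a = b" "\<bar>a - q\<bar> < \<bar>p - q\<bar> / 2" "\<bar>b - p\<bar> < \<bar>p - q\<bar> / 2" for a b p q :: real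
  proof -
    have "\<bar>p - q\<bar> \<le> \<bar>a - q\<bar> + \<bar>a - p\<bar>" by linarith
    then show False using that by simp
  qed
  ultimately show False unfolding e_def dist_real_def by blast
qed

lemma dir_deriv_compose_linear:
  assumes "bounded_linear h" "f differentiable (at x)"
  shows "dir_deriv v (\<lambda>x. h (f x)) x = h (dir_deriv v f x)"
  by (rule dir_deriv_eqI[OF bounded_linear.has_derivative[OF assms(1)]])
     (use assms(2) frechet_derivative_works in blast)

text \<open>Reduced to real valued functions by taking inner products with basis vectors.\<close>

lemma dir_deriv_commute:
  fixes f :: "'a::real_normed_vector \<Rightarrow> 'b::euclidean_space"
  assumes "open S" "smooth_on f S" "x \<in> S"
  shows "dir_deriv v (dir_deriv w f) x = dir_deriv w (dir_deriv v f) x"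
proof (rule euclidean_eqI)
  fix b :: 'b assume "b \<in> Basis"
  have l: "bounded_linear (\<lambda>y. y \<bullet> b)" by (rule bounded_linear_inner_left)
  have s: "smooth_on (\<lambda>x. f x \<bullet> b) S"
    by (rule smooth_on_compose_linear[OF l assms(1,2)])
  have 1: "dir_deriv w (\<lambda>x. f x \<bullet> b) y = dir_deriv w f y \<bullet> b" if "y \<in> S" for y w
    by (rule dir_deriv_compose_linear[OF l smooth_on_differentiable[OF assms(1,2) that]])
  have 2: "dir_deriv v (dir_deriv w (\<lambda>x. f x \<bullet> b)) x = dir_deriv v (dir_deriv w f) x \<bullet> b" for v w
    using frechet_derivative_cong_open[OF assms(1,3), of "dir_deriv w (\<lambda>x. f x \<bullet> b)"
        "\<lambda>y. dir_deriv w f y \<bullet> b", OF 1]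
      dir_deriv_compose_linear[OF l smooth_on_differentiable[OF assms(1)
       smooth_on_dir_deriv[OF assms(2)] assms(3)], of w v] by simp
  show "dir_deriv v (dir_deriv w f) x \<bullet> b = dir_deriv w (dir_deriv v f) x \<bullet> b"
    using dir_deriv_commute_real[OF assms(1) _ assms(3), of "\<lambda>x. f x \<bullet> b" v w] s
    unfolding smooth_on_def 2 by metis
qed

subsection \<open>Partial derivatives\<close>

lemma partial_deriv_eqI: "(f has_derivative f') (at u) \<Longrightarrow> partial_deriv i f u = f' (axis i 1)"
  unfolding partial_deriv_def by (rule dir_deriv_eqI)

lemma partial_deriv_add:
  assumes "f differentiable (at u)" "g differentiable (at u)"
  shows "partial_deriv i (\<lambda>u. f u + g u) u = partial_deriv i f u + partial_deriv i g u"
  unfolding partial_deriv_def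
  by (rule dir_deriv_eqI[OF has_derivative_add]) (use assms frechet_derivative_works in blast)+

lemma partial_deriv_diff:
  assumes "f differentiable (at u)" "g differentiable (at u)"
  shows "partial_deriv i (\<lambda>u. f u - g u) u = partial_deriv i f u - partial_deriv i g u"
  unfolding partial_deriv_def
  by (rule dir_deriv_eqI[OF has_derivative_diff]) (use assms frechet_derivative_works in blast)+

lemma partial_deriv_bilinear:
  assumes "bounded_bilinear h" "f differentiable (at u)" "g differentiable (at u)"
  shows "partial_deriv i (\<lambda>u. h (f u) (g u)) u = h (f u) (partial_deriv i g u) + h (partial_deriv i f u) (g u)"
  unfolding partial_deriv_def
  by (rule dir_deriv_eqI[OF bounded_bilinear.FDERIV[OF assms(1)]])
     (use assms frechet_derivative_works in blast)+

lemma partial_deriv_linear: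
  assumes "bounded_linear h" "f differentiable (at u)"
  shows "partial_deriv i (\<lambda>u. h (f u)) u = h (partial_deriv i f u)"
  unfolding partial_deriv_def using dir_deriv_compose_linear[OF assms] .

lemma partial_deriv_const [simp]: "partial_deriv i (\<lambda>u. a) u = 0"
  unfolding partial_deriv_def by (simp add: frechet_derivative_const)

lemmas partial_deriv_mult = partial_deriv_bilinear[OF bounded_bilinear_mult]
lemmas partial_deriv_scaleR = partial_deriv_bilinear[OF bounded_bilinear_scaleR]

lemma partial_deriv_sum:
  assumes "\<And>j. j \<in> I \<Longrightarrow> f j differentiable (at u)"
  shows "partial_deriv i (\<lambda>u. \<Sum>j\<in>I. f j u) u = (\<Sum>j\<in>I. partial_deriv i (f j) u)"
  unfolding partial_deriv_def
  by (rule dir_deriv_eqI[OF has_derivative_sum]) (use assms frechet_derivative_works in blast)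

lemma partial_deriv_commute:
  fixes f :: "real^2 \<Rightarrow> 'b::euclidean_space"
  assumes "open S" "smooth_on f S" "u \<in> S"
  shows "partial_deriv i (partial_deriv j f) u = partial_deriv j (partial_deriv i f) u"
  unfolding partial_deriv_def using dir_deriv_commute[OF assms] .

lemma dir_deriv_partial:
  assumes "f differentiable (at u)"
  shows "dir_deriv v f u = (\<Sum>i\<in>UNIV. v $ i *\<^sub>R partial_deriv i f u)"
proof -
  have l: "linear (frechet_derivative f (at u))"
    using assms frechet_derivative_works has_derivative_linear by blast
  have "v = (\<Sum>i\<in>UNIV. v $ i *\<^sub>R (axis i 1 :: real^2))"
    using basis_expansion[of v] by (simp add: scalar_mult_eq_scaleR)
  then have "dir_deriv v f u = frechet_derivative f (at u) (\<Sum>i\<in>UNIV. v $ i *\<^sub>R axis i 1)"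
    by (rule arg_cong)
  also have "\<dots> = (\<Sum>i\<in>UNIV. v $ i *\<^sub>R partial_deriv i f u)"
    by (simp add: linear_sum[OF l] linear_cmul[OF l] partial_deriv_def)
  finally show ?thesis .
qed

lemma partial_deriv_compose:
  fixes f :: "real^2 \<Rightarrow> 'b::real_normed_vector"
  assumes "g differentiable (at u)" "f differentiable (at (g u))"
  shows "partial_deriv i (\<lambda>u. f (g u)) u = (\<Sum>k\<in>UNIV. partial_deriv i g u $ k *\<^sub>R partial_deriv k f (g u))"
proof -
  have "partial_deriv i (\<lambda>u. f (g u)) u = dir_deriv (partial_deriv i g u) f (g u)"
    unfolding partial_deriv_def
    by (rule dir_deriv_eqI[OF has_derivative_compose])
      (use assms frechet_derivative_works in blast)+
  then show ?thesis using dir_deriv_partial[OF assms(2)] by simp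
qed

section \<open>The ambient bilinear form\<close>

lemma bounded_bilinear_first_form: "bounded_bilinear (first_form c)"
proof -
  have n: "\<bar>a $ i * b $ j\<bar> \<le> norm a * norm b" for a b :: "real^3" and i j
    by (simp add: abs_mult component_le_norm_cart mult_mono)
  have "norm (first_form c a b) \<le> norm a * norm b * (2 + \<bar>c\<bar>)" for a b
  proof -
    have "\<bar>c * (a $ 3 * b $ 3)\<bar> \<le> \<bar>c\<bar> * (norm a * norm b)"
      unfolding abs_mult[of c] by (intro mult_left_mono n) auto
    then show ?thesis unfolding first_form_def real_norm_def
      using n[of a 1 b 1] n[of a 2 b 2] by (simp add: algebra_simps)
  qed
  then have "\<exists>K. \<forall>a b. norm (first_form c a b) \<le> norm a * norm b * K" by blast
  then show ?thesis
    unfolding bounded_bilinear_def by (auto simp: first_form_def algebra_simps)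
qed

lemma bounded_bilinear_ambient_form: "bounded_bilinear (ambient_form c)"
proof -
  have "bounded_bilinear (\<lambda>v w. first_form c (fst v) (fst w))"
    by (rule bounded_bilinear.comp[OF bounded_bilinear_first_form bounded_linear_fst bounded_linear_fst])
  moreover have "bounded_bilinear (\<lambda>(v::(real^3)\<times>real) (w::(real^3)\<times>real). snd v * snd w)"
    by (rule bounded_bilinear.comp[OF bounded_bilinear_mult bounded_linear_snd bounded_linear_snd])
  ultimately have b: "bounded_bilinear (\<lambda>v w. first_form c (fst v) (fst w))"
    "bounded_bilinear (\<lambda>(v::(real^3)\<times>real) (w::(real^3)\<times>real). snd v * snd w)" by auto
  obtain K1 where K1: "\<And>v w. norm (first_form c (fst v) (fst w)) \<le> norm (v::(real^3)\<times>real) * norm (w::(real^3)\<times>real) * K1"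
    using bounded_bilinear.bounded[OF b(1)] by blast
  obtain K2 where K2: "\<And>v w. norm (snd v * snd w) \<le> norm (v::(real^3)\<times>real) * norm (w::(real^3)\<times>real) * K2"
    using bounded_bilinear.bounded[OF b(2)] by metis
  have "norm (ambient_form c v w) \<le> norm v * norm w * (K1 + K2)" for v w
    using K1[of v w] K2[of v w] norm_triangle_ineq[of "first_form c (fst v) (fst w)" "snd v * snd w"]
    unfolding ambient_form_def by (simp only: distrib_left)
  then have "\<exists>K. \<forall>a b. norm (ambient_form c a b) \<le> norm a * norm b * K" by blast
  then show ?thesis
    unfolding bounded_bilinear_def by (auto simp: ambient_form_def first_form_def algebra_simps)
qed

lemma first_form_commute: "first_form c a b = first_form c b a"
  by (simp add: first_form_def mult.commute)

lemma ambient_form_commute: "ambient_form c a b = ambient_form c b a"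
  by (simp add: ambient_form_def first_form_commute mult.commute)

lemmas first_form_simps =
  bounded_bilinear.add_left[OF bounded_bilinear_first_form]
  bounded_bilinear.add_right[OF bounded_bilinear_first_form]
  bounded_bilinear.diff_left[OF bounded_bilinear_first_form]
  bounded_bilinear.diff_right[OF bounded_bilinear_first_form]
  bounded_bilinear.minus_left[OF bounded_bilinear_first_form]
  bounded_bilinear.minus_right[OF bounded_bilinear_first_form]
  bounded_bilinear.scaleR_left[OF bounded_bilinear_first_form]
  bounded_bilinear.scaleR_right[OF bounded_bilinear_first_form]
  bounded_bilinear.zero_left[OF bounded_bilinear_first_form]
  bounded_bilinear.zero_right[OF bounded_bilinear_first_form]

lemmas ambient_form_simps =
  bounded_bilinear.add_left[OF bounded_bilinear_ambient_form]
  bounded_bilinear.add_right[OF bounded_bilinear_ambient_form]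
  bounded_bilinear.diff_left[OF bounded_bilinear_ambient_form]
  bounded_bilinear.diff_right[OF bounded_bilinear_ambient_form]
  bounded_bilinear.scaleR_left[OF bounded_bilinear_ambient_form]
  bounded_bilinear.scaleR_right[OF bounded_bilinear_ambient_form]
  bounded_bilinear.zero_left[OF bounded_bilinear_ambient_form]
  bounded_bilinear.zero_right[OF bounded_bilinear_ambient_form]

lemmas ambient_form_sum =
  bounded_bilinear.sum_left[OF bounded_bilinear_ambient_form]
  bounded_bilinear.sum_right[OF bounded_bilinear_ambient_form]

text \<open>The metric of the space form is Riemannian. On the hyperboloid this is the reversed
  Cauchy-Schwarz inequality: a vector orthogonal to a timelike one is spacelike.\<close>

lemma first_form_pos:
  assumes "c = 1 \<or> c = -1" "y \<in> space_form c" "first_form c v y = 0" "v \<noteq> 0"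
  shows "first_form c v v > 0"
  using assms(1)
proof
  assume c: "c = 1"
  have "v \<bullet> v > 0" using assms(4) by simp
  then show ?thesis using c by (simp add: first_form_def inner_vec_def sum_3)
next
  assume c: "c = -1"
  define a where "a = (v$1)^2 + (v$2)^2"
  have y: "(y$3)^2 = 1 + (y$1)^2 + (y$2)^2"
    using assms(2) c by (simp add: space_form_def first_form_def power2_eq_square)
  have o: "v$3 * y$3 = v$1 * y$1 + v$2 * y$2"
    using assms(3) c by (simp add: first_form_def)
  \<comment> \<open>Lagrange's identity; dropping the second square gives the Cauchy-Schwarz inequality.\<close>
  have "(v$1 * y$1 + v$2 * y$2)^2 + (v$1 * y$2 - v$2 * y$1)^2 = a * ((y$1)^2 + (y$2)^2)"
    unfolding a_def by (simp add: power2_eq_square algebra_simps)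
  then have "(v$1 * y$1 + v$2 * y$2)^2 \<le> a * ((y$1)^2 + (y$2)^2)"
    using zero_le_power2[of "v$1 * y$2 - v$2 * y$1"] by linarith
  then have "(v$3 * y$3)^2 \<le> a * ((y$3)^2 - 1)" unfolding o y by simp
  then have "(v$3)^2 * (y$3)^2 \<le> a * ((y$3)^2 - 1)" by (simp add: power_mult_distrib)
  then have *: "(a - (v$3)^2) * (y$3)^2 \<ge> a" by (simp add: algebra_simps)
  have "a \<ge> 0" by (simp add: a_def)
  show ?thesis
  proof (rule ccontr)
    assume "\<not> ?thesis"
    then have "a - (v$3)^2 \<le> 0" by (simp add: c first_form_def a_def power2_eq_square)
    then have "(a - (v$3)^2) * (y$3)^2 \<le> 0" by (simp add: mult_nonpos_nonneg)
    then have "a = 0" using * \<open>a \<ge> 0\<close> by linarith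
    then have v12: "v$1 = 0" "v$2 = 0" by (auto simp: a_def sum_power2_eq_zero_iff)
    moreover have "y$3 \<noteq> 0" using y by (metis add_nonneg_eq_0_iff add_pos_nonneg less_irrefl zero_le_power2 zero_less_one power_zero_numeral)
    ultimately have "v$3 = 0" using o by simp
    then have "v = 0" using v12 by (simp add: vec_eq_iff forall_3)
    then show False using assms(4) by simp
  qed
qed

lemma ambient_form_pos:
  assumes "c = 1 \<or> c = -1" "y \<in> product_space c" "v \<in> tangent_space c y" "v \<noteq> 0"
  shows "ambient_form c v v > 0"
proof (cases "fst v = 0")
  case True
  then have "snd v \<noteq> 0" using assms(4) by (metis prod.collapse zero_prod_def)
  then have "snd v * snd v > 0" using not_real_square_gt_zero by blast
  then show ?thesis using True by (simp add: ambient_form_def first_form_simps)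
next
  case False
  have "first_form c (fst v) (fst v) > 0"
    by (rule first_form_pos[of c "fst y"])
       (use assms False in \<open>auto simp: product_space_def tangent_space_def\<close>)
  then show ?thesis by (simp add: ambient_form_def add_pos_nonneg)
qed

text \<open>Differentiate the equation \<open>\<langle>f, f\<rangle> = c\<close> of the space form.\<close>

lemma partial_tangent:
  assumes "open U" "smooth_on \<Psi> U" "\<And>u. u \<in> U \<Longrightarrow> \<Psi> u \<in> product_space c" "u \<in> U"
  shows "partial_deriv i \<Psi> u \<in> tangent_space c (\<Psi> u)"
proof -
  have d: "(\<lambda>u. fst (\<Psi> u)) differentiable (at u)"
    by (rule smooth_on_differentiable[OF assms(1) smooth_on_fst[OF assms(1,2)] assms(4)])
  have "first_form c (fst (\<Psi> w)) (fst (\<Psi> w)) = c" if "w \<in> U" for w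
    using assms(3)[OF that] by (simp add: product_space_def space_form_def mem_Times_iff)
  then have "partial_deriv i (\<lambda>u. first_form c (fst (\<Psi> u)) (fst (\<Psi> u))) u = 0"
    using partial_deriv_cong[OF assms(1,4), of _ "\<lambda>_. c"] by simp
  then show ?thesis
    using partial_deriv_bilinear[OF bounded_bilinear_first_form d d, of i c]
      partial_deriv_linear[OF bounded_linear_fst smooth_on_differentiable[OF assms(1,2,4)], of i]
    by (simp add: tangent_space_def first_form_commute)
qed

section \<open>The Laplacian of the induced metric\<close>

text \<open>The trace of the Hessian with respect to the metric induced by \<open>\<Phi>\<close>, for functions with values
  in a vector space: the flat counterpart of \<open>chart_tension\<close>.\<close>

definition laplacian :: "real \<Rightarrow> (real^2 \<Rightarrow> (real^3) \<times> real) \<Rightarrow> (real^2 \<Rightarrow> 'b::real_normed_vector) \<Rightarrow> real^2 \<Rightarrow> 'b" where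
  "laplacian c \<Phi> \<psi> u = (\<Sum>i\<in>UNIV. \<Sum>j\<in>UNIV. inverse_metric c \<Phi> u $ i $ j *\<^sub>R
     (partial_deriv i (partial_deriv j \<psi>) u - (\<Sum>k\<in>UNIV. christoffel c \<Phi> k i j u *\<^sub>R partial_deriv k \<psi> u)))"

text \<open>The first order coefficients of the Laplacian.\<close>

definition drift :: "real \<Rightarrow> (real^2 \<Rightarrow> (real^3) \<times> real) \<Rightarrow> 2 \<Rightarrow> real^2 \<Rightarrow> real" where
  "drift c \<Phi> k u = - (\<Sum>i\<in>UNIV. \<Sum>j\<in>UNIV. inverse_metric c \<Phi> u $ i $ j * christoffel c \<Phi> k i j u)"

text \<open>The Laplacian is compared with other expressions for it as a second order operator with given
  coefficients at the point \<open>u\<close>.\<close>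

definition second_order_op :: "(2 \<Rightarrow> 2 \<Rightarrow> real) \<Rightarrow> (2 \<Rightarrow> real) \<Rightarrow> (real^2 \<Rightarrow> 'b::real_normed_vector) \<Rightarrow> real^2 \<Rightarrow> 'b" where
  "second_order_op a b \<psi> u = (\<Sum>i\<in>UNIV. \<Sum>j\<in>UNIV. a i j *\<^sub>R partial_deriv i (partial_deriv j \<psi>) u)
     + (\<Sum>k\<in>UNIV. b k *\<^sub>R partial_deriv k \<psi> u)"

lemma laplacian_second_order_op:
  "laplacian c \<Phi> \<psi> u
    = second_order_op (\<lambda>i j. inverse_metric c \<Phi> u $ i $ j) (\<lambda>k. drift c \<Phi> k u) \<psi> u"
  unfolding laplacian_def second_order_op_def drift_def
  by (simp add: sum_2 scaleR_diff_right scaleR_add_right scaleR_add_left scaleR_minus_left algebra_simps)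

lemma matrix_inv_unique_right:
  fixes A B :: "real^'n^'n"
  assumes "B ** A = mat 1"
  shows "matrix_inv A = B"
proof -
  have AB: "A ** B = mat 1" using assms matrix_left_right_inverse by blast
  have "A ** matrix_inv A = mat 1 \<and> matrix_inv A ** A = mat 1"
    unfolding matrix_inv_def by (rule someI[of _ B]) (simp add: assms AB)
  then have "B ** (A ** matrix_inv A) = B" by simp
  then show ?thesis by (simp add: matrix_mul_assoc assms)
qed


locale immersed_chart =
  fixes c :: real and \<Phi> :: "real^2 \<Rightarrow> (real^3) \<times> real" and U :: "(real^2) set"
  assumes c: "c = 1 \<or> c = -1" and openU: "open U" and smooth: "smooth_on \<Phi> U"
    and inj: "\<And>u. u \<in> U \<Longrightarrow> inj (frechet_derivative \<Phi> (at u))"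
    and img: "\<And>u. u \<in> U \<Longrightarrow> \<Phi> u \<in> product_space c"
begin

abbreviation "g i j u \<equiv> metric c \<Phi> u $ i $ j"
abbreviation "G i j u \<equiv> inverse_metric c \<Phi> u $ i $ j"
abbreviation "vol2 u \<equiv> g 1 1 u * g 2 2 u - g 1 2 u * g 1 2 u"

lemma cc [simp]: "c * c = 1" using c by auto

lemma diff_at: "smooth_on \<psi> U \<Longrightarrow> u \<in> U \<Longrightarrow> \<psi> differentiable (at u)"
  by (rule smooth_on_differentiable[OF openU])

lemma diff_partial: "smooth_on \<psi> U \<Longrightarrow> u \<in> U \<Longrightarrow> partial_deriv i \<psi> differentiable (at u)"
  by (rule smooth_on_differentiable[OF openU smooth_on_partial_deriv])

lemma metric_nth: "g i j u = ambient_form c (partial_deriv i \<Phi> u) (partial_deriv j \<Phi> u)"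
  by (simp add: metric_def)

lemma metric_commute: "g i j u = g j i u"
  unfolding metric_nth by (rule ambient_form_commute)

lemma metric_smooth: "smooth_on (\<lambda>u. g i j u) U"
  unfolding metric_nth
  by (intro smooth_on_bilinear[OF bounded_bilinear_ambient_form] smooth_on_partial_deriv openU smooth)

lemma first_const: "u \<in> U \<Longrightarrow> first_form c (fst (\<Phi> u)) (fst (\<Phi> u)) = c"
  using img[of u] by (simp add: product_space_def space_form_def mem_Times_iff)

lemma partial_fst: "u \<in> U \<Longrightarrow> partial_deriv i (\<lambda>u. fst (\<Phi> u)) u = fst (partial_deriv i \<Phi> u)"
  by (rule partial_deriv_linear[OF bounded_linear_fst diff_at[OF smooth]])

lemma partial_snd: "u \<in> U \<Longrightarrow> partial_deriv i (\<lambda>u. snd (\<Phi> u)) u = snd (partial_deriv i \<Phi> u)"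
  by (rule partial_deriv_linear[OF bounded_linear_snd diff_at[OF smooth]])

lemma tangent: "u \<in> U \<Longrightarrow> partial_deriv i \<Phi> u \<in> tangent_space c (\<Phi> u)"
  by (rule partial_tangent[OF openU smooth img])

lemma tangent_sum:
  "u \<in> U \<Longrightarrow> (\<Sum>i\<in>UNIV. b i *\<^sub>R partial_deriv i \<Phi> u) \<in> tangent_space c (\<Phi> u)"
  using tangent[of u 1] tangent[of u 2]
  by (simp add: tangent_space_def sum_2 first_form_simps)

lemma partials_independent:
  assumes "u \<in> U" "(\<Sum>i\<in>UNIV. b i *\<^sub>R partial_deriv i \<Phi> u) = 0"
  shows "b i = 0"
proof -
  have l: "linear (frechet_derivative \<Phi> (at u))"
    using smooth_on_has_derivative[OF openU smooth assms(1)] by (rule has_derivative_linear)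
  have "dir_deriv (\<chi> i. b i) \<Phi> u = 0"
    using dir_deriv_partial[OF diff_at[OF smooth assms(1)], of "\<chi> i. b i"] assms(2) by simp
  then have "(\<chi> i. b i) = 0"
    using inj[OF assms(1)] linear_injective_0[OF l] by blast
  then show ?thesis by (simp add: vec_eq_iff)
qed

text \<open>A combination of the \<open>\<partial>\<^sub>l \<Phi>\<close> that is orthogonal to all of them is orthogonal to itself, and
  the form is positive on tangent vectors.\<close>

lemma partials_ortho_zero:
  assumes "u \<in> U" "\<And>l. ambient_form c (\<Sum>i\<in>UNIV. b i *\<^sub>R partial_deriv i \<Phi> u) (partial_deriv l \<Phi> u) = 0"
  shows "b i = 0"
proof -
  let ?w = "\<Sum>i\<in>UNIV. b i *\<^sub>R partial_deriv i \<Phi> u"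
  have "ambient_form c w ?w = (\<Sum>i\<in>UNIV. b i * ambient_form c w (partial_deriv i \<Phi> u))" for w
    by (simp add: ambient_form_simps ambient_form_sum)
  from this[of ?w] have "ambient_form c ?w ?w = 0" using assms(2) by simp
  then have "?w = 0"
    using ambient_form_pos[OF c img[OF assms(1)] tangent_sum[OF assms(1), of b]] by fastforce
  then show ?thesis by (rule partials_independent[OF assms(1)])
qed

lemma metric_det: assumes "u \<in> U" shows "vol2 u > 0"
proof -
  have nz: "partial_deriv i \<Phi> u \<noteq> 0" for i
  proof
    assume "partial_deriv i \<Phi> u = 0"
    then have "(\<Sum>k\<in>UNIV. (if k = i then 1 else 0) *\<^sub>R partial_deriv k \<Phi> u) = 0"
      using exhaust_2[of i] by (auto simp: sum_2)
    then show False using partials_independent[OF assms, of "\<lambda>k. if k = i then 1 else 0" i] by simp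
  qed
  have g1: "g 1 1 u > 0"
    unfolding metric_nth by (rule ambient_form_pos[OF c img[OF assms] tangent[OF assms] nz])
  \<comment> \<open>The Gram-Schmidt combination \<open>g\<^sub>1\<^sub>1 \<partial>\<^sub>2\<Phi> - g\<^sub>1\<^sub>2 \<partial>\<^sub>1\<Phi>\<close>, whose square is \<open>g\<^sub>1\<^sub>1\<close>
    times the determinant.\<close>
  define b :: "2 \<Rightarrow> real" where "b i = (if i = 1 then - g 1 2 u else g 1 1 u)" for i
  let ?w = "\<Sum>i\<in>UNIV. b i *\<^sub>R partial_deriv i \<Phi> u"
  have "?w \<noteq> 0" using partials_independent[OF assms, of b 2] g1 by (auto simp: b_def)
  then have "ambient_form c ?w ?w > 0"
    by (rule ambient_form_pos[OF c img[OF assms] tangent_sum[OF assms]])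
  moreover have "ambient_form c ?w ?w = g 1 1 u * vol2 u"
    using metric_commute[of u 2 1] by (simp add: b_def sum_2 ambient_form_simps metric_nth algebra_simps)
  ultimately show ?thesis using g1 by (simp add: zero_less_mult_iff)
qed

lemma det_metric: "det (metric c \<Phi> u) = vol2 u"
  using metric_commute[of u 2 1] by (simp add: det_2)

lemma inverse_metric_eq:
  assumes "u \<in> U"
  shows "G 1 1 u = g 2 2 u / vol2 u" "G 1 2 u = - g 1 2 u / vol2 u"
    "G 2 1 u = - g 1 2 u / vol2 u" "G 2 2 u = g 1 1 u / vol2 u"
    and "inverse_metric c \<Phi> u ** metric c \<Phi> u = mat 1"
proof -
  define B :: "real^2^2" where "B = (\<chi> i j. if i = j then (if i = 1 then g 2 2 u else g 1 1 u) / vol2 u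
     else - g 1 2 u / vol2 u)"
  have D: "vol2 u \<noteq> 0" using metric_det[OF assms] by simp
  have m: "g 2 1 u = g 1 2 u" by (rule metric_commute)
  have n: "x / vol2 u + y / vol2 u = (x + y) / vol2 u" for x y by (simp add: add_divide_distrib)
  have "B ** metric c \<Phi> u = mat 1"
    using D by (simp add: B_def matrix_matrix_mult_def vec_eq_iff forall_2 sum_2 mat_def m n mult.commute
         diff_divide_distrib[symmetric] del: add_divide_distrib)
  moreover from this have "inverse_metric c \<Phi> u = B"
    unfolding inverse_metric_def by (rule matrix_inv_unique_right)
  ultimately show "G 1 1 u = g 2 2 u / vol2 u" "G 1 2 u = - g 1 2 u / vol2 u"
    "G 2 1 u = - g 1 2 u / vol2 u" "G 2 2 u = g 1 1 u / vol2 u"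
    "inverse_metric c \<Phi> u ** metric c \<Phi> u = mat 1"
    by (simp_all add: B_def)
qed

lemma inverse_metric_commute: "u \<in> U \<Longrightarrow> G i j u = G j i u"
  using exhaust_2[of i] exhaust_2[of j] inverse_metric_eq by auto

lemma inverse_metric_mult: "u \<in> U \<Longrightarrow> (\<Sum>k\<in>UNIV. G i k u * g k j u) = (if i = j then 1 else 0)"
  using inverse_metric_eq(5)[of u] by (simp add: matrix_matrix_mult_def vec_eq_iff mat_def)

lemma inverse_metric_smooth: "smooth_on (\<lambda>u. G i j u) U"
proof -
  have D: "smooth_on vol2 U"
    by (intro smooth_on_diff smooth_on_mult metric_smooth openU)
  have nz: "vol2 u \<noteq> 0" if "u \<in> U" for u using metric_det[OF that] by simp
  have q: "smooth_on (\<lambda>u. g i j u / vol2 u) U" "smooth_on (\<lambda>u. - g i j u / vol2 u) U" for i j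
    by (intro smooth_on_divide smooth_on_uminus metric_smooth openU D nz; assumption)+
  show ?thesis
    using exhaust_2[of i] exhaust_2[of j] q
    by (elim disjE) (simp_all add: smooth_on_cong[OF openU inverse_metric_eq(1)]
       smooth_on_cong[OF openU inverse_metric_eq(2)] smooth_on_cong[OF openU inverse_metric_eq(3)]
       smooth_on_cong[OF openU inverse_metric_eq(4)])
qed

lemma christoffel_smooth: "smooth_on (christoffel c \<Phi> k i j) U"
proof -
  have "smooth_on (\<lambda>u. \<Sum>l\<in>UNIV. G k l u / 2 *
        (partial_deriv i (\<lambda>w. g j l w) u + partial_deriv j (\<lambda>w. g i l w) u
         - partial_deriv l (\<lambda>w. g i j w) u)) U"
    by (intro smooth_on_sum smooth_on_mult smooth_on_divide inverse_metric_smooth smooth_on_const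
      smooth_on_add smooth_on_diff smooth_on_partial_deriv metric_smooth openU) auto
  then show ?thesis by (simp add: christoffel_def[abs_def])
qed

lemma drift_smooth: "smooth_on (drift c \<Phi> k) U"
  unfolding drift_def[abs_def]
  by (intro smooth_on_uminus smooth_on_sum smooth_on_mult inverse_metric_smooth christoffel_smooth openU)

lemma laplacian_smooth: "smooth_on \<psi> U \<Longrightarrow> smooth_on (laplacian c \<Phi> \<psi>) U"
  unfolding laplacian_def[abs_def]
  by (intro smooth_on_sum smooth_on_scaleR smooth_on_diff inverse_metric_smooth christoffel_smooth
     smooth_on_partial_deriv openU)

lemma metric_partial:
  assumes "u \<in> U"
  shows "partial_deriv i (\<lambda>w. g j l w) u
    = ambient_form c (partial_deriv i (partial_deriv j \<Phi>) u) (partial_deriv l \<Phi> u)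
    + ambient_form c (partial_deriv i (partial_deriv l \<Phi>) u) (partial_deriv j \<Phi> u)"
  unfolding metric_nth
  by (subst partial_deriv_bilinear[OF bounded_bilinear_ambient_form diff_partial[OF smooth assms]
        diff_partial[OF smooth assms]])
     (simp add: ambient_form_commute add.commute)

text \<open>Koszul's formula, read in the ambient vector space.\<close>

lemma christoffel_eq:
  assumes "u \<in> U"
  shows "christoffel c \<Phi> k i j u
    = (\<Sum>l\<in>UNIV. G k l u * ambient_form c (partial_deriv i (partial_deriv j \<Phi>) u) (partial_deriv l \<Phi> u))"
  unfolding christoffel_def
proof (rule sum.cong[OF refl])
  fix l
  have "partial_deriv a (partial_deriv b \<Phi>) u = partial_deriv b (partial_deriv a \<Phi>) u" for a b
    by (rule partial_deriv_commute[OF openU smooth assms])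
  then have "partial_deriv i (\<lambda>w. g j l w) u + partial_deriv j (\<lambda>w. g i l w) u
      - partial_deriv l (\<lambda>w. g i j w) u
    = 2 * ambient_form c (partial_deriv i (partial_deriv j \<Phi>) u) (partial_deriv l \<Phi> u)"
    unfolding metric_partial[OF assms] by (simp add: algebra_simps)
  then show "G k l u / 2 * (partial_deriv i (\<lambda>w. g j l w) u + partial_deriv j (\<lambda>w. g i l w) u
      - partial_deriv l (\<lambda>w. g i j w) u)
    = G k l u * ambient_form c (partial_deriv i (partial_deriv j \<Phi>) u) (partial_deriv l \<Phi> u)"
    by simp
qed

text \<open>By \<open>christoffel_eq\<close> the Christoffel terms remove exactly the tangential part of the second
  derivatives: the Laplacian of an isometric immersion is normal.\<close>

lemma laplacian_normal:
  assumes "u \<in> U"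
  shows "ambient_form c (laplacian c \<Phi> \<Phi> u) (partial_deriv l \<Phi> u) = 0"
proof -
  have "ambient_form c (\<Sum>k\<in>UNIV. christoffel c \<Phi> k i j u *\<^sub>R partial_deriv k \<Phi> u) (partial_deriv l \<Phi> u)
    = ambient_form c (partial_deriv i (partial_deriv j \<Phi>) u) (partial_deriv l \<Phi> u)" for i j
  proof -
    let ?a = "\<lambda>l. ambient_form c (partial_deriv i (partial_deriv j \<Phi>) u) (partial_deriv l \<Phi> u)"
    have "ambient_form c (\<Sum>k\<in>UNIV. christoffel c \<Phi> k i j u *\<^sub>R partial_deriv k \<Phi> u) (partial_deriv l \<Phi> u)
      = (\<Sum>k\<in>UNIV. (\<Sum>m\<in>UNIV. G k m u * ?a m) * g k l u)"
      by (simp add: ambient_form_sum ambient_form_simps christoffel_eq[OF assms] metric_nth)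
    also have "\<dots> = (\<Sum>m\<in>UNIV. ?a m * (\<Sum>k\<in>UNIV. G m k u * g k l u))"
      using inverse_metric_commute[OF assms, of 2 1] by (simp add: sum_2 algebra_simps)
    also have "\<dots> = ?a l"
      unfolding inverse_metric_mult[OF assms] using exhaust_2[of l] by (auto simp: sum_2)
    finally show ?thesis .
  qed
  then show ?thesis
    unfolding laplacian_def by (simp add: ambient_form_sum(1) ambient_form_simps)
qed

text \<open>Two operators with the same leading coefficients differ by a vector field, and on \<open>\<Phi>\<close> this
  difference is the tangent vector itself; if both values are normal it vanishes. Below, this
  takes the place of computations with Christoffel symbols.\<close>

lemma laplacian_unique:
  assumes "u \<in> U" and a: "\<And>i j. a i j = G i j u"
    and "\<And>l. ambient_form c (second_order_op a b \<Phi> u) (partial_deriv l \<Phi> u) = 0"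
  shows "laplacian c \<Phi> \<psi> u = second_order_op a b \<psi> u"
proof -
  have "b k - drift c \<Phi> k u = 0" for k
  proof (rule partials_ortho_zero[OF assms(1)])
    fix l
    have "second_order_op a b \<Phi> u - laplacian c \<Phi> \<Phi> u
      = (\<Sum>k\<in>UNIV. (b k - drift c \<Phi> k u) *\<^sub>R partial_deriv k \<Phi> u)"
      unfolding laplacian_second_order_op second_order_op_def a
      by (simp add: scaleR_diff_left sum_subtractf)
    then show "ambient_form c (\<Sum>k\<in>UNIV. (b k - drift c \<Phi> k u) *\<^sub>R partial_deriv k \<Phi> u) (partial_deriv l \<Phi> u) = 0"
      using assms(3)[of l] laplacian_normal[OF assms(1), of l]
      by (metis ambient_form_simps(3) diff_self)
  qed
  then show ?thesis unfolding laplacian_second_order_op second_order_op_def a by simp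
qed

end

subsection \<open>Change of coordinates\<close>

lemma partial_deriv_compose_on:
  fixes \<tau> :: "real^2 \<Rightarrow> real^2" and \<psi> :: "real^2 \<Rightarrow> 'b::real_normed_vector"
  assumes "open U" "open V" "smooth_on \<tau> V" "\<tau> ` V \<subseteq> U" "smooth_on \<psi> U" "v \<in> V"
  shows "partial_deriv b (\<lambda>v. \<psi> (\<tau> v)) v = (\<Sum>i\<in>UNIV. partial_deriv b \<tau> v $ i *\<^sub>R partial_deriv i \<psi> (\<tau> v))"
  by (rule partial_deriv_compose)
     (use assms smooth_on_differentiable in blast)+

lemma second_partial_compose:
  fixes \<tau> :: "real^2 \<Rightarrow> real^2" and \<psi> :: "real^2 \<Rightarrow> 'b::real_normed_vector"
  assumes "open U" "open V" "smooth_on \<tau> V" "\<tau> ` V \<subseteq> U" "smooth_on \<psi> U" "v \<in> V"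
  shows "partial_deriv a (partial_deriv b (\<lambda>v. \<psi> (\<tau> v))) v
    = (\<Sum>i\<in>UNIV. partial_deriv a (partial_deriv b \<tau>) v $ i *\<^sub>R partial_deriv i \<psi> (\<tau> v))
    + (\<Sum>i\<in>UNIV. \<Sum>j\<in>UNIV. (partial_deriv b \<tau> v $ i * partial_deriv a \<tau> v $ j) *\<^sub>R partial_deriv j (partial_deriv i \<psi>) (\<tau> v))"
proof -
  have d1: "(\<lambda>v. partial_deriv b \<tau> v $ i) differentiable (at v)" for i
    by (rule smooth_on_differentiable[OF assms(2) smooth_on_nth[OF assms(2) smooth_on_partial_deriv[OF assms(3)]] assms(6)])
  have "smooth_on (\<lambda>v. partial_deriv i \<psi> (\<tau> v)) V" for i
    by (rule smooth_on_compose[OF assms(2,1) smooth_on_partial_deriv[OF assms(5)] assms(3,4)])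
  then have d2: "(\<lambda>v. partial_deriv i \<psi> (\<tau> v)) differentiable (at v)" for i
    using smooth_on_differentiable[OF assms(2) _ assms(6)] by blast
  have d12: "(\<lambda>v. partial_deriv b \<tau> v $ i *\<^sub>R partial_deriv i \<psi> (\<tau> v)) differentiable (at v)" for i
    using d1 d2 by (rule differentiable_scaleR)
  have "partial_deriv a (partial_deriv b (\<lambda>v. \<psi> (\<tau> v))) v
    = partial_deriv a (\<lambda>v. \<Sum>i\<in>UNIV. partial_deriv b \<tau> v $ i *\<^sub>R partial_deriv i \<psi> (\<tau> v)) v"
    by (rule partial_deriv_cong[OF assms(2,6) partial_deriv_compose_on[OF assms(1-5)]])
  also have "\<dots> = (\<Sum>i\<in>UNIV. partial_deriv a (\<lambda>v. partial_deriv b \<tau> v $ i *\<^sub>R partial_deriv i \<psi> (\<tau> v)) v)"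
    by (rule partial_deriv_sum[OF d12])
  also have "\<dots> = (\<Sum>i\<in>UNIV. partial_deriv b \<tau> v $ i *\<^sub>R
        (\<Sum>j\<in>UNIV. partial_deriv a \<tau> v $ j *\<^sub>R partial_deriv j (partial_deriv i \<psi>) (\<tau> v))
      + partial_deriv a (partial_deriv b \<tau>) v $ i *\<^sub>R partial_deriv i \<psi> (\<tau> v))"
    by (simp add: partial_deriv_scaleR[OF d1 d2]
        partial_deriv_compose_on[OF assms(1-4) smooth_on_partial_deriv[OF assms(5)] assms(6)]
        partial_deriv_linear[OF bounded_linear_vec_nth
          smooth_on_differentiable[OF assms(2) smooth_on_partial_deriv[OF assms(3)] assms(6)]])
  finally show ?thesis
    by (simp add: sum.distrib scaleR_sum_right add.commute)
qed

text \<open>The chain rule, arranged by order: the second derivatives of \<open>\<tau>\<close> contribute to the first order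
  part.\<close>

lemma second_order_op_compose:
  fixes \<tau> :: "real^2 \<Rightarrow> real^2" and \<psi> :: "real^2 \<Rightarrow> 'b::real_normed_vector"
  assumes "open U" "open V" "smooth_on \<tau> V" "\<tau> ` V \<subseteq> U" "smooth_on \<psi> U" "v \<in> V"
  shows "second_order_op A B (\<lambda>v. \<psi> (\<tau> v)) v
    = second_order_op
        (\<lambda>j i. \<Sum>a\<in>UNIV. \<Sum>b\<in>UNIV. A a b * partial_deriv a \<tau> v $ j * partial_deriv b \<tau> v $ i)
        (\<lambda>k. (\<Sum>a\<in>UNIV. \<Sum>b\<in>UNIV. A a b * partial_deriv a (partial_deriv b \<tau>) v $ k)
           + (\<Sum>a\<in>UNIV. B a * partial_deriv a \<tau> v $ k)) \<psi> (\<tau> v)"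
  unfolding second_order_op_def second_partial_compose[OF assms] partial_deriv_compose_on[OF assms]
  by (simp add: sum_2 scaleR_add_right scaleR_add_left) (simp add: algebra_simps)

lemma metric_compose:
  assumes "immersed_chart c \<Phi> U" "open V" "smooth_on \<tau> V" "\<tau> ` V \<subseteq> U" "v \<in> V"
  shows "metric c (\<lambda>v. \<Phi> (\<tau> v)) v
    = transpose (\<chi> i a. partial_deriv a \<tau> v $ i) ** metric c \<Phi> (\<tau> v) ** (\<chi> i a. partial_deriv a \<tau> v $ i)"
proof -
  interpret immersed_chart c \<Phi> U by fact
  show ?thesis
    unfolding metric_def partial_deriv_compose_on[OF openU assms(2,3,4) smooth assms(5)]
    by (simp add: vec_eq_iff matrix_matrix_mult_def transpose_def sum_2 ambient_form_simps algebra_simps)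
qed

text \<open>The operator on the left, transported to the coordinates of \<open>\<Phi>\<close>, has the inverse metric as
  leading coefficients and maps \<open>\<Phi>\<close> to a normal vector, so \<open>laplacian_unique\<close> identifies it.\<close>

lemma laplacian_compose:
  fixes \<psi> :: "real^2 \<Rightarrow> 'b::real_normed_vector"
  assumes "immersed_chart c \<Phi> U" "immersed_chart c (\<lambda>v. \<Phi> (\<tau> v)) V"
    "smooth_on \<tau> V" "\<tau> ` V \<subseteq> U" "v \<in> V" "smooth_on \<psi> U"
  shows "laplacian c (\<lambda>v. \<Phi> (\<tau> v)) (\<lambda>v. \<psi> (\<tau> v)) v = laplacian c \<Phi> \<psi> (\<tau> v)"
proof -
  interpret \<Phi>: immersed_chart c \<Phi> U by fact
  interpret \<Phi>': immersed_chart c "\<lambda>v. \<Phi> (\<tau> v)" V by fact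
  have u: "\<tau> v \<in> U" using assms(4,5) by auto
  define A where "A a b = inverse_metric c (\<lambda>v. \<Phi> (\<tau> v)) v $ a $ b" for a b
  define J :: "real^2^2" where "J = (\<chi> i a. partial_deriv a \<tau> v $ i)"
  let ?A' = "\<lambda>j i. \<Sum>a\<in>UNIV. \<Sum>b\<in>UNIV. A a b * partial_deriv a \<tau> v $ j * partial_deriv b \<tau> v $ i"
  note comp = second_order_op_compose[OF \<Phi>.openU \<Phi>'.openU assms(3,4) _ assms(5)]
  have gm: "metric c (\<lambda>v. \<Phi> (\<tau> v)) v = transpose J ** metric c \<Phi> (\<tau> v) ** J"
    unfolding J_def by (rule metric_compose[OF assms(1) \<Phi>'.openU assms(3,4,5)])
  have iv: "inverse_metric c (\<lambda>v. \<Phi> (\<tau> v)) v ** metric c (\<lambda>v. \<Phi> (\<tau> v)) v = mat 1"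
    by (rule \<Phi>'.inverse_metric_eq(5)[OF assms(5)])
  have "det (metric c (\<lambda>v. \<Phi> (\<tau> v)) v) \<noteq> 0"
    using \<Phi>'.metric_det[OF assms(5)] unfolding \<Phi>'.det_metric by linarith
  then have "det J \<noteq> 0" unfolding gm det_mul by simp
  then obtain K where K: "J ** K = mat 1" using invertible_right_inverse invertible_det_nz by blast
  define M where "M = J ** inverse_metric c (\<lambda>v. \<Phi> (\<tau> v)) v ** transpose J"
  have "M ** metric c \<Phi> (\<tau> v) ** J = J"
    using iv unfolding gm M_def by (metis matrix_mul_assoc matrix_mul_rid)
  then have "M ** metric c \<Phi> (\<tau> v) = mat 1"
    using K by (metis matrix_mul_assoc matrix_mul_rid)
  then have "inverse_metric c \<Phi> (\<tau> v) = M"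
    unfolding inverse_metric_def by (rule matrix_inv_unique_right)
  then have A': "?A' j i = inverse_metric c \<Phi> (\<tau> v) $ j $ i" for i j
    unfolding M_def J_def A_def by (simp add: matrix_matrix_mult_def transpose_def sum_2 algebra_simps)
  let ?B' = "\<lambda>k. (\<Sum>a\<in>UNIV. \<Sum>b\<in>UNIV. A a b * partial_deriv a (partial_deriv b \<tau>) v $ k)
           + (\<Sum>a\<in>UNIV. drift c (\<lambda>v. \<Phi> (\<tau> v)) a v * partial_deriv a \<tau> v $ k)"
  have L: "laplacian c (\<lambda>v. \<Phi> (\<tau> v)) (\<lambda>v. f (\<tau> v)) v = second_order_op ?A' ?B' f (\<tau> v)"
    if "smooth_on f U" for f :: "real^2 \<Rightarrow> 'c::real_normed_vector"
    unfolding laplacian_second_order_op A_def[symmetric] using comp[OF that] .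
  have "ambient_form c (second_order_op ?A' ?B' \<Phi> (\<tau> v)) (partial_deriv l \<Phi> (\<tau> v)) = 0" for l
  proof -
    let ?n = "second_order_op ?A' ?B' \<Phi> (\<tau> v)"
    have 0: "ambient_form c ?n (partial_deriv a (\<lambda>v. \<Phi> (\<tau> v)) v) = 0" for a
      using \<Phi>'.laplacian_normal[OF assms(5), of a] L[OF \<Phi>.smooth] by simp
    have "partial_deriv l \<Phi> (\<tau> v) = (\<Sum>a\<in>UNIV. K $ a $ l *\<^sub>R partial_deriv a (\<lambda>v. \<Phi> (\<tau> v)) v)"
    proof -
      have JK: "(\<Sum>a\<in>UNIV. partial_deriv a \<tau> v $ i * K $ a $ l) = (if i = l then 1 else 0)" for i
        using K unfolding J_def by (simp add: matrix_matrix_mult_def vec_eq_iff mat_def)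
      have "(\<Sum>a\<in>UNIV. K $ a $ l *\<^sub>R partial_deriv a (\<lambda>v. \<Phi> (\<tau> v)) v)
        = (\<Sum>i\<in>UNIV. (\<Sum>a\<in>UNIV. partial_deriv a \<tau> v $ i * K $ a $ l) *\<^sub>R partial_deriv i \<Phi> (\<tau> v))"
        unfolding partial_deriv_compose_on[OF \<Phi>.openU \<Phi>'.openU assms(3,4) \<Phi>.smooth assms(5)]
        by (simp add: sum_2 scaleR_add_right scaleR_add_left algebra_simps)
      also have "\<dots> = partial_deriv l \<Phi> (\<tau> v)"
        unfolding JK using exhaust_2[of l] by (auto simp: sum_2)
      finally show ?thesis ..
    qed
    then show ?thesis using 0 by (simp add: ambient_form_sum ambient_form_simps)
  qed
  then show ?thesis
    using \<Phi>.laplacian_unique[OF u A', of ?B' \<psi>] L[OF assms(6)] by simp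
qed

subsection \<open>Divergence form\<close>

lemma partial_deriv_real_chain:
  fixes f :: "real^2 \<Rightarrow> real"
  assumes "(h has_real_derivative h') (at (f u))" "f differentiable (at u)"
  shows "partial_deriv i (\<lambda>u. h (f u)) u = h' * partial_deriv i f u"
proof -
  have "((\<lambda>u. h (f u)) has_derivative (\<lambda>v. h' * frechet_derivative f (at u) v)) (at u)"
    using has_derivative_compose[of f _ u UNIV h "(*) h'"] assms frechet_derivative_works
    unfolding has_field_derivative_def by blast
  from partial_deriv_eqI[OF this] show ?thesis by (simp add: partial_deriv_def)
qed

text \<open>The pure algebra behind \<open>laplacian_divergence\<close>. Here \<open>gij\<close> are the entries of the metric and
  \<open>V\<close> its determinant, \<open>aijl\<close> stands for \<open>\<langle>\<partial>\<^sub>i\<partial>\<^sub>j\<Phi>, \<partial>\<^sub>l\<Phi>\<rangle>\<close>, \<open>V1\<close> and \<open>V2\<close> are the derivatives of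
  \<open>V\<close>, and \<open>b1\<close>, \<open>b2\<close> the first order coefficients of the divergence form. The conclusions say
  that its value on \<open>\<Phi>\<close> is orthogonal to \<open>\<partial>\<^sub>1\<Phi>\<close> and to \<open>\<partial>\<^sub>2\<Phi>\<close>.\<close>

lemma divergence_identity:
  fixes g11 :: real
  assumes V: "V = g11 * g22 - g12 * g12" "V \<noteq> 0"
    and "V1 = 2 * a111 * g22 + 2 * a122 * g11 - 2 * g12 * (a112 + a121)"
    and "V2 = 2 * a121 * g22 + 2 * a222 * g11 - 2 * g12 * (a122 + a221)"
    and "b1 = ((a122 - a221) - (g22 * V1 - g12 * V2) / (2 * V)) / V"
    and "b2 = ((a121 - a112) - (g11 * V2 - g12 * V1) / (2 * V)) / V"
  shows "(g22 * a111 - 2 * g12 * a121 + g11 * a221) / V + b1 * g11 + b2 * g12 = 0"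
    and "(g22 * a112 - 2 * g12 * a122 + g11 * a222) / V + b1 * g12 + b2 * g22 = 0"
proof -
  define P where "P = (g22 * V1 - g12 * V2) / (2 * V)"
  define Q where "Q = (g11 * V2 - g12 * V1) / (2 * V)"
  have B: "b1 = (a122 - a221 - P) / V" "b2 = (a121 - a112 - Q) / V"
    unfolding assms P_def Q_def by simp_all
  have "(g22 * V1 - g12 * V2) * g11 + (g11 * V2 - g12 * V1) * g12 = V1 * V"
    "(g22 * V1 - g12 * V2) * g12 + (g11 * V2 - g12 * V1) * g22 = V2 * V"
    unfolding V(1) by (simp_all add: algebra_simps)
  then have PQ: "P * g11 + Q * g12 = V1 / 2" "P * g12 + Q * g22 = V2 / 2"
    using V(2) unfolding P_def Q_def by (simp_all add: field_simps)
  have "g22 * a111 - 2 * g12 * a121 + g11 * a221 + (a122 - a221 - P) * g11 + (a121 - a112 - Q) * g12 = 0"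
    using PQ(1) unfolding assms(3) by (simp add: algebra_simps)
  then show "(g22 * a111 - 2 * g12 * a121 + g11 * a221) / V + b1 * g11 + b2 * g12 = 0"
    unfolding B times_divide_eq_left add_divide_distrib[symmetric] by simp
  have "g22 * a112 - 2 * g12 * a122 + g11 * a222 + (a122 - a221 - P) * g12 + (a121 - a112 - Q) * g22 = 0"
    using PQ(2) unfolding assms(4) by (simp add: algebra_simps)
  then show "(g22 * a112 - 2 * g12 * a122 + g11 * a222) / V + b1 * g12 + b2 * g22 = 0"
    unfolding B times_divide_eq_left add_divide_distrib[symmetric] by simp
qed

context immersed_chart
begin

abbreviation "vol u \<equiv> sqrt (vol2 u)"

lemma vol2_smooth: "smooth_on vol2 U"
  by (intro smooth_on_diff smooth_on_mult metric_smooth openU)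

lemma vol_smooth: "smooth_on vol U"
  by (rule smooth_on_sqrt[OF openU vol2_smooth metric_det])

lemma flux_partial:
  assumes "u \<in> U"
  shows "partial_deriv i (\<lambda>u. g k l u / vol u) u
    = (partial_deriv i (\<lambda>u. g k l u) u - g k l u * partial_deriv i vol2 u / (2 * vol2 u)) / vol u"
proof -
  have V: "vol2 u > 0" by (rule metric_det[OF assms])
  have d: "((\<lambda>x. inverse (sqrt x)) has_real_derivative - 1 / (2 * vol2 u * vol u)) (at (vol2 u))"
    by (rule DERIV_cong[OF DERIV_inverse_fun[OF DERIV_real_sqrt[OF V]]])
       (use V in \<open>auto simp: field_simps\<close>)
  have "smooth_on (\<lambda>u. inverse (vol u)) U"
    by (rule smooth_on_inverse[OF openU vol_smooth]) (use metric_det in fastforce)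
  then have dv: "(\<lambda>u. inverse (vol u)) differentiable (at u)" using assms diff_at by blast
  have "partial_deriv i (\<lambda>u. g k l u * inverse (vol u)) u
    = g k l u * (- 1 / (2 * vol2 u * vol u) * partial_deriv i vol2 u) + partial_deriv i (\<lambda>u. g k l u) u * inverse (vol u)"
    using partial_deriv_mult[OF diff_at[OF metric_smooth assms] dv, of i k l]
      partial_deriv_real_chain[OF d diff_at[OF vol2_smooth assms], of i] by simp
  moreover have "x * (- 1 / (2 * a * w) * d) + y * inverse w = (y - x * d / (2 * a)) / w"
    if "a > 0" "w > 0" for x y d a w :: real
    using that by (simp add: field_simps)
  moreover have "(\<lambda>u. g k l u / vol u) = (\<lambda>u. g k l u * inverse (vol u))"
    by (simp only: divide_inverse)
  ultimately show ?thesis using V by (simp only: real_sqrt_gt_0_iff)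
qed

lemma vol2_partial:
  assumes "u \<in> U"
  shows "partial_deriv i vol2 u = partial_deriv i (\<lambda>u. g 1 1 u) u * g 2 2 u + partial_deriv i (\<lambda>u. g 2 2 u) u * g 1 1 u
    - 2 * g 1 2 u * partial_deriv i (\<lambda>u. g 1 2 u) u"
proof -
  note d = diff_at[OF metric_smooth assms]
  have dm: "(\<lambda>u. g i j u * g k l u) differentiable (at u)" for i j k l
    by (rule diff_at[OF smooth_on_mult[OF openU metric_smooth metric_smooth] assms])
  show ?thesis
    unfolding partial_deriv_diff[OF dm dm] partial_deriv_mult[OF d d] by (simp add: algebra_simps)
qed

definition flux :: "2 \<Rightarrow> 2 \<Rightarrow> real^2 \<Rightarrow> real" where
  "flux i j u = vol u * G i j u"

lemma flux_eq:
  assumes "u \<in> U"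
  shows "flux 1 1 u = g 2 2 u / vol u" "flux 1 2 u = - (g 1 2 u / vol u)"
    "flux 2 1 u = - (g 1 2 u / vol u)" "flux 2 2 u = g 1 1 u / vol u"
proof -
  have V: "vol2 u > 0" by (rule metric_det[OF assms])
  have "w * (x / (w * w)) = x / w" if "w > 0" for x w :: real
    using that by (simp add: field_simps)
  from this[of "vol u"] have *: "vol u * (x / vol2 u) = x / vol u" for x
    using V by simp
  then show "flux 1 1 u = g 2 2 u / vol u" "flux 1 2 u = - (g 1 2 u / vol u)"
    "flux 2 1 u = - (g 1 2 u / vol u)" "flux 2 2 u = g 1 1 u / vol u"
    by (simp_all only: flux_def inverse_metric_eq[OF assms] * minus_divide_left)
qed

lemma flux_smooth: "smooth_on (flux i j) U"
  unfolding flux_def[abs_def] by (intro smooth_on_mult vol_smooth inverse_metric_smooth openU)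

lemma flux_commute: "u \<in> U \<Longrightarrow> flux i j u = flux j i u"
  unfolding flux_def using inverse_metric_commute by simp

text \<open>Another use of \<open>laplacian_unique\<close>: the divergence form, divided by the area density, has the
  right leading coefficients, and \<open>divergence_identity\<close> shows that it maps \<open>\<Phi>\<close> to a normal
  vector.\<close>

lemma laplacian_divergence:
  fixes \<psi> :: "real^2 \<Rightarrow> real"
  assumes "u \<in> U" "smooth_on \<psi> U"
  shows "(\<Sum>i\<in>UNIV. partial_deriv i (\<lambda>u. \<Sum>j\<in>UNIV. flux i j u * partial_deriv j \<psi> u) u)
    = vol u * laplacian c \<Phi> \<psi> u"
proof -
  have V: "vol2 u > 0" by (rule metric_det[OF assms(1)])
  have vv: "vol u * vol u = vol2 u" using V by simp
  have vnz: "vol u \<noteq> 0" using V by auto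
  define b where "b j = (\<Sum>i\<in>UNIV. partial_deriv i (flux i j) u) / vol u" for j
  have df: "flux i j differentiable (at u)" for i j
    by (rule diff_at[OF flux_smooth assms(1)])
  have s: "smooth_on (\<lambda>u. flux i j u * partial_deriv j \<psi> u) U" for i j
    by (intro smooth_on_mult flux_smooth smooth_on_partial_deriv assms(2) openU)
  have "(\<Sum>i\<in>UNIV. partial_deriv i (\<lambda>u. \<Sum>j\<in>UNIV. flux i j u * partial_deriv j \<psi> u) u)
    = (\<Sum>i\<in>UNIV. \<Sum>j\<in>UNIV. flux i j u * partial_deriv i (partial_deriv j \<psi>) u + partial_deriv i (flux i j) u * partial_deriv j \<psi> u)"
    by (simp add: partial_deriv_sum[OF diff_at[OF s assms(1)]]
      partial_deriv_mult[OF df diff_partial[OF assms(2,1)]])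
  also have "\<dots> = vol u * second_order_op (\<lambda>i j. G i j u) b \<psi> u"
    unfolding second_order_op_def b_def flux_def using vnz by (simp add: sum_2 algebra_simps add_divide_distrib)
  also have "second_order_op (\<lambda>i j. G i j u) b \<psi> u = laplacian c \<Phi> \<psi> u"
  proof (rule laplacian_unique[OF assms(1) refl, symmetric])
    fix l
    let ?a = "\<lambda>i j l. ambient_form c (partial_deriv i (partial_deriv j \<Phi>) u) (partial_deriv l \<Phi> u)"
    have sym: "?a 2 1 l = ?a 1 2 l" for l
      using partial_deriv_commute[OF openU smooth assms(1), of 2 1] by simp
    have fd: "partial_deriv i (\<lambda>u. - (g k l u / vol u)) u = - partial_deriv i (\<lambda>u. g k l u / vol u) u" for i k l
      by (rule partial_deriv_linear[OF bounded_linear_minus[OF bounded_linear_ident]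
           diff_at[OF smooth_on_divide[OF openU metric_smooth vol_smooth] assms(1)]])
         (use metric_det in fastforce)
    have pf: "partial_deriv i (flux 1 1) u = partial_deriv i (\<lambda>u. g 2 2 u / vol u) u"
      "partial_deriv i (flux 1 2) u = - partial_deriv i (\<lambda>u. g 1 2 u / vol u) u"
      "partial_deriv i (flux 2 1) u = - partial_deriv i (\<lambda>u. g 1 2 u / vol u) u"
      "partial_deriv i (flux 2 2) u = partial_deriv i (\<lambda>u. g 1 1 u / vol u) u" for i
      unfolding fd[symmetric] by (rule partial_deriv_cong[OF openU assms(1)], erule flux_eq)+
    have q: "(p / w + - (r / w)) / w = (p - r) / a" "(- (r / w) + p / w) / w = (p - r) / a"
      if "w * w = a" for p r w a :: real
      using that by (auto simp: diff_divide_distrib divide_divide_eq_left)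
    have alg: "((x + x - e / (2 * a)) - (x + y - f / (2 * a))) / a = ((x - y) - (e - f) / (2 * a)) / a"
      "((x + x - e / (2 * a)) - (y + x - f / (2 * a))) / a = ((x - y) - (e - f) / (2 * a)) / a"
      for x y e f a :: real by (simp_all add: diff_divide_distrib add_divide_distrib)
    have b1: "b 1 = ((?a 1 2 2 - ?a 2 2 1) - (g 2 2 u * partial_deriv 1 vol2 u - g 1 2 u * partial_deriv 2 vol2 u) / (2 * vol2 u)) / vol2 u"
      unfolding b_def sum_2 pf flux_partial[OF assms(1)] metric_partial[OF assms(1)] sym q[OF vv]
      by (rule alg)
    have b2: "b 2 = ((?a 1 2 1 - ?a 1 1 2) - (g 1 1 u * partial_deriv 2 vol2 u - g 1 2 u * partial_deriv 1 vol2 u) / (2 * vol2 u)) / vol2 u"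
      unfolding b_def sum_2 pf flux_partial[OF assms(1)] metric_partial[OF assms(1)] sym q[OF vv]
      by (rule alg)
    have V1: "partial_deriv 1 vol2 u = 2 * ?a 1 1 1 * g 2 2 u + 2 * ?a 1 2 2 * g 1 1 u - 2 * g 1 2 u * (?a 1 1 2 + ?a 1 2 1)"
     and V2: "partial_deriv 2 vol2 u = 2 * ?a 1 2 1 * g 2 2 u + 2 * ?a 2 2 2 * g 1 1 u - 2 * g 1 2 u * (?a 1 2 2 + ?a 2 2 1)"
      unfolding vol2_partial[OF assms(1)] metric_partial[OF assms(1)] sym by (simp_all add: algebra_simps)
    note di = divergence_identity[OF refl less_imp_neq[OF V, symmetric] V1 V2 b1 b2]
    have "ambient_form c (second_order_op (\<lambda>i j. G i j u) b \<Phi> u) (partial_deriv l \<Phi> u)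
      = (g 2 2 u * ?a 1 1 l - 2 * g 1 2 u * ?a 1 2 l + g 1 1 u * ?a 2 2 l) / vol2 u + b 1 * g 1 l u + b 2 * g 2 l u"
      unfolding second_order_op_def
      by (simp add: sum_2 ambient_form_simps inverse_metric_eq[OF assms(1)] sym metric_nth[symmetric])
         (simp add: diff_divide_distrib add_divide_distrib)
    also have "\<dots> = 0"
      using di metric_commute[of u 2 1] exhaust_2[of l] by auto
    finally show "ambient_form c (second_order_op (\<lambda>i j. G i j u) b \<Phi> u) (partial_deriv l \<Phi> u) = 0" .
  qed
  finally show ?thesis .
qed

end

section \<open>Differentiation under the integral and Green's identity\<close>

text \<open>Along every null sequence the difference quotients are dominated by \<open>B\<close>, by the mean value
  theorem, so dominated convergence applies.\<close>

lemma integral_has_derivative_dominated: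
  fixes H H' :: "real \<Rightarrow> 'a \<Rightarrow> real"
  assumes e: "e > 0"
    and int: "\<And>s. \<bar>s\<bar> < e \<Longrightarrow> integrable M (H s)"
    and der: "\<And>s p. \<bar>s\<bar> < e \<Longrightarrow> p \<in> space M \<Longrightarrow> ((\<lambda>s. H s p) has_real_derivative H' s p) (at s)"
    and bnd: "\<And>s p. \<bar>s\<bar> < e \<Longrightarrow> p \<in> space M \<Longrightarrow> \<bar>H' s p\<bar> \<le> B p"
    and B: "integrable M B"
  shows "integrable M (H' 0)"
    and "((\<lambda>s. \<integral>p. H s p \<partial>M) has_real_derivative (\<integral>p. H' 0 p \<partial>M)) (at 0)"
proof -
  have quot: "integrable M (H' 0) \<and>
      (\<lambda>n. ((\<integral>p. H (S n) p \<partial>M) - (\<integral>p. H 0 p \<partial>M)) / S n) \<longlonglongrightarrow> (\<integral>p. H' 0 p \<partial>M)"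
    if S: "\<And>n. S n \<noteq> 0" "S \<longlonglongrightarrow> 0" for S :: "nat \<Rightarrow> real"
  proof -
    \<comment> \<open>The finitely many \<open>n\<close> with \<open>S n\<close> outside the interval are cut off, so that the bound
      holds for all \<open>n\<close>.\<close>
    define q where "q n p = (if \<bar>S n\<bar> < e then (H (S n) p - H 0 p) / S n else 0)" for n p
    have ev: "eventually (\<lambda>n. \<bar>S n\<bar> < e) sequentially"
      using tendstoD[OF S(2) e] by (simp add: dist_real_def)
    have qm: "q n \<in> borel_measurable M" for n
      unfolding q_def[abs_def] using int[of "S n"] int[of 0] e by (cases "\<bar>S n\<bar> < e") auto
    have lim: "(\<lambda>n. q n p) \<longlonglongrightarrow> H' 0 p" if p: "p \<in> space M" for p
    proof -
      have "((\<lambda>h. (H (0 + h) p - H 0 p) / h) \<longlongrightarrow> H' 0 p) (at 0)"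
        using der[of 0 p] e p unfolding DERIV_def by simp
      then have "(\<lambda>n. (H (S n) p - H 0 p) / S n) \<longlonglongrightarrow> H' 0 p"
        using S unfolding tendsto_at_iff_sequentially by (auto simp: comp_def)
      then show ?thesis
        by (rule Lim_transform_eventually) (use ev in \<open>auto simp: q_def elim: eventually_mono\<close>)
    qed
    have qb: "\<bar>q n p\<bar> \<le> B p" if p: "p \<in> space M" for n p
    proof (cases "\<bar>S n\<bar> < e")
      case True
      have "\<exists>z. \<bar>z\<bar> < e \<and> H (S n) p - H 0 p = S n * H' z p"
      proof (cases "S n > 0")
        case pos: True
        obtain z where "0 < z" "z < S n" "H (S n) p - H 0 p = (S n - 0) * H' z p"
          using MVT2[of 0 "S n" "\<lambda>s. H s p" "\<lambda>s. H' s p"] der[OF _ p] pos True by auto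
        then show ?thesis using True by (intro exI[of _ z]) auto
      next
        case False
        then have neg: "S n < 0" using S(1)[of n] by linarith
        obtain z where "S n < z" "z < 0" "H 0 p - H (S n) p = (0 - S n) * H' z p"
          using MVT2[of "S n" 0 "\<lambda>s. H s p" "\<lambda>s. H' s p"] der[OF _ p] neg True by auto
        then show ?thesis using True by (intro exI[of _ z]) auto
      qed
      then show ?thesis using bnd[OF _ p] S(1)[of n] True by (auto simp: q_def abs_mult)
    next
      case False
      have "0 \<le> B p" using order_trans[OF abs_ge_zero bnd[of 0 p]] e p by simp
      then show ?thesis using False by (simp add: q_def)
    qed
    have H'm: "H' 0 \<in> borel_measurable M"
      by (rule borel_measurable_LIMSEQ_real[OF lim qm])
    have i0: "integrable M (H' 0)"
      by (rule integrable_dominated_convergence[where s=q, OF H'm qm B]) (use lim qb in auto)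
    have i1: "(\<lambda>n. \<integral>p. q n p \<partial>M) \<longlonglongrightarrow> (\<integral>p. H' 0 p \<partial>M)"
      by (rule integral_dominated_convergence[where s=q, OF H'm qm B]) (use lim qb in auto)
    have i2: "eventually (\<lambda>n. (\<integral>p. q n p \<partial>M) = ((\<integral>p. H (S n) p \<partial>M) - (\<integral>p. H 0 p \<partial>M)) / S n) sequentially"
      using ev by eventually_elim (use int e in \<open>simp add: q_def\<close>)
    show ?thesis by (intro conjI i0 Lim_transform_eventually[OF i1 i2])
  qed
  have "(\<lambda>n. 1 / real (Suc n)) \<longlonglongrightarrow> 0" by (rule LIMSEQ_Suc[OF lim_1_over_n])
  from quot[OF _ this] show "integrable M (H' 0)" by auto
  have "((\<lambda>h. ((\<integral>p. H (0 + h) p \<partial>M) - (\<integral>p. H 0 p \<partial>M)) / h) \<longlongrightarrow> (\<integral>p. H' 0 p \<partial>M)) (at 0)"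
    unfolding tendsto_at_iff_sequentially using quot by (auto simp: comp_def)
  then show "((\<lambda>s. \<integral>p. H s p \<partial>M) has_real_derivative (\<integral>p. H' 0 p \<partial>M)) (at 0)"
    unfolding DERIV_def .
qed

text \<open>The integral of a translate of \<open>\<psi>\<close> does not depend on the translation; differentiate it under
  the integral along the \<open>i\<close>-th axis.\<close>

lemma integral_partial_deriv_zero:
  fixes \<psi> :: "real^2 \<Rightarrow> real"
  assumes \<psi>: "smooth_on \<psi> UNIV" and K: "compact K" and z: "\<And>u. u \<notin> K \<Longrightarrow> \<psi> u = 0"
  shows "integrable lborel (partial_deriv i \<psi>)" "integral\<^sup>L lborel (partial_deriv i \<psi>) = 0"
proof -
  define e :: "real^2" where "e = axis i 1"
  have ne: "norm e = 1" by (simp add: e_def)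
  \<comment> \<open>A compact set that contains the supports of all translates by at most one, on which
    they are dominated.\<close>
  define L where "L = {x + y |x y. x \<in> K \<and> y \<in> cball (0::real^2) 1}"
  have L: "compact L" unfolding L_def by (rule compact_sums[OF K compact_cball])
  have d: "\<psi> differentiable (at u)" for u by (rule smooth_on_differentiable[OF open_UNIV \<psi>]) simp
  have cpd: "continuous_on UNIV (partial_deriv i \<psi>)"
    by (rule smooth_on_continuous[OF smooth_on_partial_deriv[OF \<psi>]])
  have zpd: "partial_deriv i \<psi> u = 0" if "u \<notin> K" for u
    using partial_deriv_cong[of "- K" u \<psi> "\<lambda>_. 0" i] compact_imp_closed[OF K] that z
    by (simp add: open_Compl)
  have shift: "u \<in> L" if "u + s *\<^sub>R e \<in> K" "\<bar>s\<bar> < 1" for u s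
  proof -
    have "u = (u + s *\<^sub>R e) + (- s *\<^sub>R e)" by simp
    moreover have "- s *\<^sub>R e \<in> cball 0 1" using that(2) ne by simp
    ultimately show ?thesis unfolding L_def using that(1) by blast
  qed
  obtain m where m: "\<And>u. u \<in> K \<Longrightarrow> \<bar>partial_deriv i \<psi> u\<bar> \<le> m"
    using compact_imp_bounded[OF compact_continuous_image[OF continuous_on_subset[OF cpd] K]]
    unfolding bounded_iff by auto
  define B where "B u = \<bar>m\<bar> * indicator L u" for u :: "real^2"
  have B: "integrable lborel B"
    unfolding B_def[abs_def]
    by (intro integrable_mult_right integrable_real_indicator)
       (use L emeasure_compact_finite in \<open>auto simp: compact_imp_closed\<close>)
  have c\<psi>: "continuous_on UNIV \<psi>" by (rule smooth_on_continuous[OF \<psi>])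
  have i\<psi>: "integrable lborel \<psi>"
  proof -
    have "integrable lborel (\<lambda>u. indicator K u *\<^sub>R \<psi> u)"
      by (rule borel_integrable_compact[OF K continuous_on_subset[OF c\<psi>]]) simp
    moreover have "(\<lambda>u. indicator K u *\<^sub>R \<psi> u) = \<psi>" using z by (auto simp: indicator_def fun_eq_iff)
    ultimately show ?thesis by simp
  qed
  have tr: "integrable lborel (\<lambda>u. \<psi> (u + s *\<^sub>R e)) \<and> (\<integral>u. \<psi> (u + s *\<^sub>R e) \<partial>lborel) = (\<integral>u. \<psi> u \<partial>lborel)" for s
  proof -
    have *: "lborel = distr lborel borel (\<lambda>u. s *\<^sub>R e + u)" using lborel_distr_plus by metis
    have m: "(\<lambda>u. s *\<^sub>R e + u) \<in> measurable lborel borel" by simp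
    have \<psi>m: "\<psi> \<in> borel_measurable borel" using c\<psi> by (rule borel_measurable_continuous_onI)
    have "integrable (distr lborel borel (\<lambda>u. s *\<^sub>R e + u)) \<psi>" using i\<psi> * by simp
    moreover have "integral\<^sup>L (distr lborel borel (\<lambda>u. s *\<^sub>R e + u)) \<psi> = integral\<^sup>L lborel \<psi>" using * by simp
    ultimately show ?thesis
      using integrable_distr_eq[OF m \<psi>m] integral_distr[OF m \<psi>m] by (simp add: add.commute)
  qed
  have der: "((\<lambda>s. \<psi> (u + s *\<^sub>R e)) has_real_derivative partial_deriv i \<psi> (u + s *\<^sub>R e)) (at s)" for u s
  proof -
    have "((\<lambda>s. u + s *\<^sub>R e) has_derivative (\<lambda>r. r *\<^sub>R e)) (at s)" by (auto intro!: derivative_eq_intros)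
    from has_derivative_compose[OF this frechet_derivative_works[THEN iffD1, OF d]]
    have "((\<lambda>s. \<psi> (u + s *\<^sub>R e)) has_derivative (\<lambda>r. dir_deriv (r *\<^sub>R e) \<psi> (u + s *\<^sub>R e))) (at s)" .
    moreover have "dir_deriv (r *\<^sub>R e) \<psi> (u + s *\<^sub>R e) = partial_deriv i \<psi> (u + s *\<^sub>R e) * r" for r
      unfolding partial_deriv_def e_def
      using linear_cmul[OF has_derivative_linear[OF frechet_derivative_works[THEN iffD1, OF d]]] by simp
    ultimately show ?thesis by (simp add: has_field_derivative_def)
  qed
  have bnd: "\<bar>partial_deriv i \<psi> (u + s *\<^sub>R e)\<bar> \<le> B u" if "\<bar>s\<bar> < 1" for s u
  proof (cases "u + s *\<^sub>R e \<in> K")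
    case True
    then show ?thesis using m[OF True] shift[OF True that] by (auto simp: B_def intro: order_trans)
  next
    case False
    then show ?thesis by (simp add: zpd B_def)
  qed
  note D = integral_has_derivative_dominated[of 1 lborel "\<lambda>s u. \<psi> (u + s *\<^sub>R e)" "\<lambda>s u. partial_deriv i \<psi> (u + s *\<^sub>R e)" B]
  show "integrable lborel (partial_deriv i \<psi>)"
    using D(1) tr der bnd B by simp
  have "((\<lambda>s. \<integral>u. \<psi> (u + s *\<^sub>R e) \<partial>lborel) has_real_derivative (\<integral>u. partial_deriv i \<psi> u \<partial>lborel)) (at 0)"
    using D(2) tr der bnd B by simp
  moreover have "((\<lambda>s. \<integral>u. \<psi> (u + s *\<^sub>R e) \<partial>lborel) has_real_derivative 0) (at 0)"
    using tr by simp
  ultimately show "integral\<^sup>L lborel (partial_deriv i \<psi>) = 0" by (rule DERIV_unique)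
qed

lemma smooth_on_zero_extension:
  assumes "open U" "compact K" "K \<subseteq> U" "smooth_on f U" "\<And>u. u \<in> U - K \<Longrightarrow> f u = 0"
  shows "smooth_on (\<lambda>u. if u \<in> U then f u else 0) UNIV"
proof (rule smooth_on_local[OF open_UNIV])
  fix u
  have oK: "open (- K)" using assms(2) by (simp add: compact_imp_closed open_Compl)
  show "\<exists>T. open T \<and> u \<in> T \<and> smooth_on (\<lambda>u. if u \<in> U then f u else 0) T"
  proof (cases "u \<in> K")
    case True
    have "smooth_on (\<lambda>u. if u \<in> U then f u else 0) U"
      using smooth_on_cong[OF assms(1), of "\<lambda>u. if u \<in> U then f u else 0" f] assms(4) by simp
    then show ?thesis using True assms by blast
  next
    case False
    have "smooth_on (\<lambda>u. if u \<in> U then f u else 0) (- K)"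
      using smooth_on_cong[OF oK, of "\<lambda>u. if u \<in> U then f u else 0" "\<lambda>_. 0"] smooth_on_const[OF oK] assms(5) by simp
    then show ?thesis using False oK by blast
  qed
qed

text \<open>Green's identity in a chart: by the divergence form, the integrand is the divergence of
  \<open>\<psi> grad \<eta> - \<eta> grad \<psi>\<close>, which has compact support.\<close>

lemma (in immersed_chart) green_chart:
  fixes \<psi> \<eta> :: "real^2 \<Rightarrow> real"
  assumes "smooth_on \<psi> U" "smooth_on \<eta> U" "compact K" "K \<subseteq> U" "\<And>u. u \<in> U - K \<Longrightarrow> \<eta> u = 0"
  shows "(\<integral>u. indicator U u * (vol u * (\<psi> u * laplacian c \<Phi> \<eta> u - \<eta> u * laplacian c \<Phi> \<psi> u)) \<partial>lborel) = 0"
proof -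
  define F where "F f i u = (\<Sum>j\<in>UNIV. flux i j u * partial_deriv j f u)" for f :: "real^2 \<Rightarrow> real" and i u
  define w where "w i u = \<psi> u * F \<eta> i u - \<eta> u * F \<psi> i u" for i u
  define w0 where "w0 i u = (if u \<in> U then w i u else 0)" for i u
  have Fs: "smooth_on (F f i) U" if "smooth_on f U" for f i
    unfolding F_def[abs_def] by (intro smooth_on_sum smooth_on_mult flux_smooth smooth_on_partial_deriv that openU)
  have ws: "smooth_on (w i) U" for i
    unfolding w_def[abs_def] by (intro smooth_on_diff smooth_on_mult Fs assms openU)
  have oUK: "open (U - K)" using openU assms(3) by (simp add: compact_imp_closed open_Diff)
  have pz: "partial_deriv j \<eta> u = 0" if "u \<in> U - K" for j u
    using partial_deriv_cong[OF oUK that, of \<eta> "\<lambda>_. 0" j] assms(5) by simp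
  have wz: "w i u = 0" if "u \<in> U - K" for i u
    using pz[OF that] assms(5)[OF that] by (simp add: w_def F_def)
  have w0s: "smooth_on (w0 i) UNIV" for i
    unfolding w0_def[abs_def] by (rule smooth_on_zero_extension[OF openU assms(3,4) ws wz])
  have w0z: "w0 i u = 0" if "u \<notin> K" for i u using that wz by (auto simp: w0_def)
  note I = integral_partial_deriv_zero[OF w0s assms(3) w0z]
  have "(\<Sum>i\<in>UNIV. partial_deriv i (w0 i) u)
    = indicator U u * (vol u * (\<psi> u * laplacian c \<Phi> \<eta> u - \<eta> u * laplacian c \<Phi> \<psi> u))" for u
  proof (cases "u \<in> U")
    case True
    have "partial_deriv i (w0 i) u = partial_deriv i (w i) u" for i
      by (rule partial_deriv_cong[OF openU True]) (simp add: w0_def)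
    moreover have "partial_deriv i (w i) u
      = \<psi> u * partial_deriv i (F \<eta> i) u - \<eta> u * partial_deriv i (F \<psi> i) u
        + (partial_deriv i \<psi> u * F \<eta> i u - partial_deriv i \<eta> u * F \<psi> i u)" for i
    proof -
      have "(\<lambda>u. \<psi> u * F \<eta> i u) differentiable (at u)" "(\<lambda>u. \<eta> u * F \<psi> i u) differentiable (at u)"
        by (rule diff_at[OF smooth_on_mult[OF openU assms(1) Fs[OF assms(2)]] True],
            rule diff_at[OF smooth_on_mult[OF openU assms(2) Fs[OF assms(1)]] True])
      from partial_deriv_diff[OF this, of i] show ?thesis
        unfolding w_def[abs_def]
        using partial_deriv_mult[OF diff_at[OF assms(1) True] diff_at[OF Fs[OF assms(2)] True], of i i]
        partial_deriv_mult[OF diff_at[OF assms(2) True] diff_at[OF Fs[OF assms(1)] True], of i i]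
        by simp
    qed
    ultimately have "(\<Sum>i\<in>UNIV. partial_deriv i (w0 i) u)
      = \<psi> u * (\<Sum>i\<in>UNIV. partial_deriv i (F \<eta> i) u) - \<eta> u * (\<Sum>i\<in>UNIV. partial_deriv i (F \<psi> i) u)
       + (\<Sum>i\<in>UNIV. partial_deriv i \<psi> u * F \<eta> i u - partial_deriv i \<eta> u * F \<psi> i u)"
      by (simp add: sum_2 algebra_simps)
    also have "(\<Sum>i\<in>UNIV. partial_deriv i \<psi> u * F \<eta> i u - partial_deriv i \<eta> u * F \<psi> i u) = 0"
      using flux_commute[OF True, of 1 2] by (simp add: F_def sum_2 algebra_simps)
    also have "(\<Sum>i\<in>UNIV. partial_deriv i (F \<eta> i) u) = vol u * laplacian c \<Phi> \<eta> u"
      using laplacian_divergence[OF True assms(2)] by (simp add: F_def[abs_def])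
    also have "(\<Sum>i\<in>UNIV. partial_deriv i (F \<psi> i) u) = vol u * laplacian c \<Phi> \<psi> u"
      using laplacian_divergence[OF True assms(1)] by (simp add: F_def[abs_def])
    finally show ?thesis using True by (simp add: algebra_simps)
  next
    case False
    have "open (- K)" using assms(3) by (simp add: compact_imp_closed open_Compl)
    then have "partial_deriv i (w0 i) u = 0" for i
      using partial_deriv_cong[of "- K" u "w0 i" "\<lambda>_. 0" i] w0z False assms(4) by auto
    then show ?thesis using False by simp
  qed
  then have "(\<integral>u. indicator U u * (vol u * (\<psi> u * laplacian c \<Phi> \<eta> u - \<eta> u * laplacian c \<Phi> \<psi> u)) \<partial>lborel)
    = (\<integral>u. (\<Sum>i\<in>UNIV. partial_deriv i (w0 i) u) \<partial>lborel)" by simp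
  also have "\<dots> = (\<Sum>i\<in>UNIV. \<integral>u. partial_deriv i (w0 i) u \<partial>lborel)"
    by (rule Bochner_Integration.integral_sum) (use I(1) in auto)
  also have "\<dots> = 0" using I(2) by simp
  finally show ?thesis .
qed

section \<open>Smooth functions on the surface\<close>

lemma metric_cong:
  assumes "open S" "u \<in> S" "\<And>w. w \<in> S \<Longrightarrow> \<Phi> w = \<Phi>' w"
  shows "metric c \<Phi> u = metric c \<Phi>' u"
proof -
  have "partial_deriv i \<Phi> u = partial_deriv i \<Phi>' u" for i
    by (rule partial_deriv_cong) (use assms in auto)
  then show ?thesis unfolding metric_def by simp
qed

lemma partial_deriv2_cong:
  assumes "open S" "u \<in> S" "\<And>w. w \<in> S \<Longrightarrow> \<Phi> w = \<Phi>' w"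
  shows "partial_deriv i (partial_deriv j \<Phi>) u = partial_deriv i (partial_deriv j \<Phi>') u"
  by (rule partial_deriv_cong[OF assms(1,2)], rule partial_deriv_cong[OF assms(1)]) (use assms in auto)

lemma christoffel_cong:
  assumes "open S" "u \<in> S" "\<And>w. w \<in> S \<Longrightarrow> \<Phi> w = \<Phi>' w"
  shows "christoffel c \<Phi> k i j u = christoffel c \<Phi>' k i j u"
proof -
  have "partial_deriv a (\<lambda>w. metric c \<Phi> w $ b $ d) u = partial_deriv a (\<lambda>w. metric c \<Phi>' w $ b $ d) u" for a b d
  proof (rule partial_deriv_cong[OF assms(1,2)])
    fix w assume "w \<in> S"
    then have "metric c \<Phi> w = metric c \<Phi>' w" by (intro metric_cong) (use assms in auto)
    then show "metric c \<Phi> w $ b $ d = metric c \<Phi>' w $ b $ d" by simp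
  qed
  moreover have "metric c \<Phi> u = metric c \<Phi>' u" by (rule metric_cong) (use assms in auto)
  ultimately show ?thesis
    unfolding christoffel_def inverse_metric_def by simp
qed

lemma laplacian_cong:
  assumes "open S" "u \<in> S" "\<And>w. w \<in> S \<Longrightarrow> \<Phi> w = \<Phi>' w" "\<And>w. w \<in> S \<Longrightarrow> \<psi> w = \<psi>' w"
  shows "laplacian c \<Phi> \<psi> u = laplacian c \<Phi>' \<psi>' u"
proof -
  have "metric c \<Phi> u = metric c \<Phi>' u" by (rule metric_cong) (use assms in auto)
  moreover have "christoffel c \<Phi> k i j u = christoffel c \<Phi>' k i j u" for i j k
    by (rule christoffel_cong) (use assms in auto)
  moreover have "partial_deriv i (partial_deriv j \<psi>) u = partial_deriv i (partial_deriv j \<psi>') u" for i j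
    by (rule partial_deriv2_cong) (use assms in auto)
  moreover have "partial_deriv i \<psi> u = partial_deriv i \<psi>' u" for i
    by (rule partial_deriv_cong) (use assms in auto)
  ultimately show ?thesis unfolding laplacian_def inverse_metric_def by simp
qed

lemma tangent_proj_simps:
  "tangent_proj c y (v + w) = tangent_proj c y v + tangent_proj c y w"
  "tangent_proj c y (v - w) = tangent_proj c y v - tangent_proj c y w"
  "tangent_proj c y (a *\<^sub>R v) = a *\<^sub>R tangent_proj c y v"
  by (simp_all add: tangent_proj_def first_form_simps algebra_simps scaleR_left_distrib
      scaleR_diff_left)

lemma tangent_proj_id: "v \<in> tangent_space c y \<Longrightarrow> tangent_proj c y v = v"
  by (simp add: tangent_proj_def tangent_space_def zero_prod_def)

text \<open>The Christoffel terms of the tension field are combinations of tangent vectors, which the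
  projection fixes; so the projection can be applied after all summations.\<close>

lemma chart_tension_eq:
  assumes "open U" "smooth_on \<Psi> U" "\<And>u. u \<in> U \<Longrightarrow> \<Psi> u \<in> product_space c" "u \<in> U"
  shows "chart_tension c \<Phi> \<Psi> u = tangent_proj c (\<Psi> u) (laplacian c \<Phi> \<Psi> u)"
  unfolding chart_tension_def laplacian_def cov_deriv_along_def
  by (simp add: sum_2 tangent_proj_simps tangent_proj_id[OF partial_tangent[OF assms]])

text \<open>The normal component is \<open>c \<langle>v, y\<rangle> (y, 0)\<close>, and \<open>(y, 0)\<close> has square \<open>c\<close>.\<close>

lemma tangent_proj_square:
  assumes "c = 1 \<or> c = -1" "y \<in> product_space c"
  shows "ambient_form c (tangent_proj c y v) (tangent_proj c y v)
    = ambient_form c v v - c * (first_form c (fst v) (fst y))\<^sup>2"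
proof -
  have y: "first_form c (fst y) (fst y) = c"
    using assms(2) by (simp add: product_space_def space_form_def mem_Times_iff)
  have cc: "c * c = 1" using assms(1) by auto
  define k where "k = first_form c (fst v) (fst y)"
  have "first_form c (fst v - (c * k) *\<^sub>R fst y) (fst v - (c * k) *\<^sub>R fst y)
    = first_form c (fst v) (fst v) - 2 * c * k * k + (c * c) * (k * k) * c"
    using first_form_commute[of c "fst y" "fst v"] unfolding k_def[symmetric]
    by (simp add: first_form_simps y k_def[symmetric] algebra_simps)
  then show ?thesis
    unfolding cc by (simp add: tangent_proj_def ambient_form_def k_def[symmetric] power2_eq_square)
qed

definition smooth_map :: "'m chart set \<Rightarrow> ('m \<Rightarrow> 'b::real_normed_vector) \<Rightarrow> bool" where
  "smooth_map A \<psi> \<longleftrightarrow> (\<forall>(U, x) \<in> A. smooth_on (\<psi> \<circ> x) U)"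

text \<open>The chart is chosen as in the definition of \<open>tension_field\<close>, so that the two can be compared
  before it is known that the choice is irrelevant (\<open>lap_chart\<close>).\<close>

definition surface_laplacian ::
  "real \<Rightarrow> 'm chart set \<Rightarrow> ('m \<Rightarrow> (real^3) \<times> real) \<Rightarrow> ('m \<Rightarrow> 'b::real_normed_vector) \<Rightarrow> 'm \<Rightarrow> 'b" where
  "surface_laplacian c A \<phi> \<psi> p =
     (let (U, x) = (SOME (U, x). (U, x) \<in> A \<and> p \<in> x ` U)
      in laplacian c (\<phi> \<circ> x) (\<psi> \<circ> x) (inv_into U x p))"

locale surface =
  fixes c :: real and X :: "'m topology" and A :: "'m chart set" and \<phi> :: "'m \<Rightarrow> (real^3) \<times> real"
  assumes c: "c = 1 \<or> c = -1"
    and mfd: "connected_smooth_surface X A"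
    and imm: "smooth_immersion c X A \<phi>"
begin

abbreviation "lap \<equiv> surface_laplacian c A \<phi>"

lemma hausdorff: "Hausdorff_space X" and connected: "connected_space X" and nonempty: "topspace X \<noteq> {}"
  and countable2: "second_countable X" and atlas: "smooth_atlas X A"
  using mfd by (simp_all add: connected_smooth_surface_def)

lemma chart_open: "(U, x) \<in> A \<Longrightarrow> open U"
  and chart_image_open: "(U, x) \<in> A \<Longrightarrow> openin X (x ` U)"
  and chart_homeo: "(U, x) \<in> A \<Longrightarrow> homeomorphic_map (top_of_set U) (subtopology X (x ` U)) x"
  using atlas by (auto simp: smooth_atlas_def)

lemma chart_cover:
  assumes "p \<in> topspace X" obtains U x u where "(U, x) \<in> A" "u \<in> U" "p = x u"
  using atlas assms unfolding smooth_atlas_def by blast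

lemma chart_in: "(U, x) \<in> A \<Longrightarrow> u \<in> U \<Longrightarrow> x u \<in> topspace X"
  using chart_image_open openin_subset by blast

lemma chart_inj: "(U, x) \<in> A \<Longrightarrow> inj_on x U"
  using homeomorphic_imp_injective_map[OF chart_homeo] by simp

lemma chart_inv [simp]: "(U, x) \<in> A \<Longrightarrow> u \<in> U \<Longrightarrow> inv_into U x (x u) = u"
  using chart_inj inv_into_f_f by metis

lemma chart_inv_in: "p \<in> x ` U \<Longrightarrow> inv_into U x p \<in> U" "p \<in> x ` U \<Longrightarrow> x (inv_into U x p) = p"
  by (erule inv_into_into, erule f_inv_into_f)

lemma transition_smooth:
  "(U, x) \<in> A \<Longrightarrow> (V, y) \<in> A \<Longrightarrow> smooth_on (\<lambda>v. inv_into U x (y v)) {v \<in> V. y v \<in> x ` U}"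
  using atlas unfolding smooth_atlas_def by fast

lemma chart_preimage_open:
  assumes "(U, x) \<in> A" "openin X W" shows "open {u \<in> U. x u \<in> W}"
proof -
  have "continuous_map (top_of_set U) X x"
    using homeomorphic_imp_continuous_map[OF chart_homeo[OF assms(1)]] continuous_map_in_subtopology by blast
  from openin_continuous_map_preimage[OF this assms(2)]
  have "openin (top_of_set U) {u \<in> U. x u \<in> W}" by simp
  then show ?thesis using chart_open[OF assms(1)] by (simp add: openin_open_eq)
qed

lemma chart_image_openin:
  assumes "(U, x) \<in> A" "open S" "S \<subseteq> U" shows "openin X (x ` S)"
proof -
  have "open_map (top_of_set U) (subtopology X (x ` U)) x"
    using chart_homeo[OF assms(1)] homeomorphic_imp_open_map by blast
  then have "openin (subtopology X (x ` U)) (x ` S)"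
    using assms chart_open[OF assms(1)] unfolding open_map_def by (simp add: openin_open_eq)
  then show ?thesis using chart_image_open[OF assms(1)] openin_trans_full by blast
qed

lemma chart_image_compact:
  assumes "(U, x) \<in> A" "compact K" "K \<subseteq> U" shows "compactin X (x ` K)"
proof -
  have "continuous_map (top_of_set U) X x"
    using homeomorphic_imp_continuous_map[OF chart_homeo[OF assms(1)]] continuous_map_in_subtopology by blast
  moreover have "compactin (top_of_set U) K"
    using assms(2,3) by (simp add: compactin_subtopology)
  ultimately show ?thesis using image_compactin by blast
qed

text \<open>A parametrisation is made total by an arbitrary value outside its domain, in order to push
  measures forward along it.\<close>

lemma measurable_chart_extension:
  assumes Ux: "(U, x) \<in> A" and p0: "p0 \<in> topspace X"
    and S: "sets S = sigma_sets (topspace X) {W. openin X W}"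
  shows "(\<lambda>u. if u \<in> U then x u else p0) \<in> measurable borel S"
proof (rule measurable_sigma_sets[OF S])
  show "{W. openin X W} \<subseteq> Pow (topspace X)" using openin_subset by blast
  show "(\<lambda>u. if u \<in> U then x u else p0) \<in> space borel \<rightarrow> topspace X" using p0 chart_in[OF Ux] by auto
  fix W assume "W \<in> {W. openin X W}"
  then have "open {u \<in> U. x u \<in> W}" using chart_preimage_open[OF Ux] by blast
  moreover have "(\<lambda>u. if u \<in> U then x u else p0) -` W \<inter> space borel
      = {u \<in> U. x u \<in> W} \<union> (if p0 \<in> W then - U else {})"
    by (auto split: if_splits)
  ultimately show "(\<lambda>u. if u \<in> U then x u else p0) -` W \<inter> space borel \<in> sets borel"
    using chart_open[OF Ux] by (auto intro: sets.Un)
qed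

lemma compact_closed: "compactin X K \<Longrightarrow> closedin X K"
  using hausdorff compactin_imp_closedin by blast

lemma immersed_chart: assumes "(U, x) \<in> A" shows "immersed_chart c (\<phi> \<circ> x) U"
proof
  have "\<And>U x. (U, x) \<in> A \<Longrightarrow> smooth_on (\<phi> \<circ> x) U \<and> (\<forall>u\<in>U. inj (frechet_derivative (\<phi> \<circ> x) (at u)))"
    using imm unfolding smooth_immersion_def by fast
  then show "smooth_on (\<phi> \<circ> x) U" "\<And>u. u \<in> U \<Longrightarrow> inj (frechet_derivative (\<phi> \<circ> x) (at u))"
    using assms by auto
  show "(\<phi> \<circ> x) u \<in> product_space c" if "u \<in> U" for u
    using imm chart_in[OF assms that] unfolding smooth_immersion_def by auto
qed (use c chart_open[OF assms] in auto)

lemma smooth_mapD: "smooth_map A \<psi> \<Longrightarrow> (U, x) \<in> A \<Longrightarrow> smooth_on (\<lambda>u. \<psi> (x u)) U"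
  unfolding smooth_map_def comp_def by fast

lemma smooth_mapI: "(\<And>U x. (U, x) \<in> A \<Longrightarrow> smooth_on (\<lambda>u. \<psi> (x u)) U) \<Longrightarrow> smooth_map A \<psi>"
  unfolding smooth_map_def comp_def by fast

lemma \<phi>_smooth: "smooth_map A \<phi>"
  using imm unfolding smooth_immersion_def smooth_map_def by fast

lemma \<phi>_in: "p \<in> topspace X \<Longrightarrow> \<phi> p \<in> product_space c"
  using imm unfolding smooth_immersion_def by auto

lemma laplacian_transition:
  assumes "(U, x) \<in> A" "(V, y) \<in> A" "u \<in> U" "v \<in> V" "x u = y v" "smooth_map A \<psi>"
  shows "laplacian c (\<phi> \<circ> y) (\<psi> \<circ> y) v = laplacian c (\<phi> \<circ> x) (\<psi> \<circ> x) u"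
proof -
  define \<tau> where "\<tau> v = inv_into U x (y v)" for v
  define V' where "V' = {v \<in> V. y v \<in> x ` U}"
  have oV': "open V'" unfolding V'_def by (rule chart_preimage_open[OF assms(2) chart_image_open[OF assms(1)]])
  have vV': "v \<in> V'" using assms unfolding V'_def by (metis (mono_tags, lifting) imageI mem_Collect_eq)
  have \<tau>s: "smooth_on \<tau> V'" unfolding \<tau>_def V'_def by (rule transition_smooth[OF assms(1,2)])
  have \<tau>U: "\<tau> ` V' \<subseteq> U" and \<tau>y: "\<And>w. w \<in> V' \<Longrightarrow> x (\<tau> w) = y w"
    unfolding \<tau>_def V'_def by (auto intro!: inv_into_into f_inv_into_f)
  have \<tau>v: "\<tau> v = u" unfolding \<tau>_def assms(5)[symmetric] using assms(1,3) by simp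
  interpret x: immersed_chart c "\<phi> \<circ> x" U by (rule immersed_chart[OF assms(1)])
  interpret y: immersed_chart c "\<phi> \<circ> y" V by (rule immersed_chart[OF assms(2)])
  have eq: "(\<phi> \<circ> x) (\<tau> w) = (\<phi> \<circ> y) w" if "w \<in> V'" for w using \<tau>y[OF that] by simp
  have V'V: "V' \<subseteq> V" by (auto simp: V'_def)
  have "immersed_chart c (\<lambda>w. (\<phi> \<circ> x) (\<tau> w)) V'"
  proof
    show "smooth_on (\<lambda>w. (\<phi> \<circ> x) (\<tau> w)) V'"
      by (rule smooth_on_compose[OF oV' x.openU x.smooth \<tau>s \<tau>U])
    show "inj (frechet_derivative (\<lambda>w. (\<phi> \<circ> x) (\<tau> w)) (at w))" if "w \<in> V'" for w
    proof -
      have "frechet_derivative (\<lambda>w. (\<phi> \<circ> x) (\<tau> w)) (at w) = frechet_derivative (\<phi> \<circ> y) (at w)"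
        by (rule frechet_derivative_cong_open[OF oV' that]) (rule eq)
      then show ?thesis using y.inj[of w] that V'V by auto
    qed
    show "(\<phi> \<circ> x) (\<tau> w) \<in> product_space c" if "w \<in> V'" for w
      using x.img \<tau>U that by blast
  qed (use c oV' in auto)
  from laplacian_compose[OF x.immersed_chart_axioms this \<tau>s \<tau>U vV', of "\<psi> \<circ> x"]
  have "laplacian c (\<lambda>w. (\<phi> \<circ> x) (\<tau> w)) (\<lambda>w. (\<psi> \<circ> x) (\<tau> w)) v = laplacian c (\<phi> \<circ> x) (\<psi> \<circ> x) u"
    using smooth_mapD[OF assms(6,1)] \<tau>v by (simp add: comp_def)
  moreover have "laplacian c (\<lambda>w. (\<phi> \<circ> x) (\<tau> w)) (\<lambda>w. (\<psi> \<circ> x) (\<tau> w)) v = laplacian c (\<phi> \<circ> y) (\<psi> \<circ> y) v"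
    by (rule laplacian_cong[OF oV' vV']) (simp_all add: \<tau>y)
  ultimately show ?thesis by simp
qed

lemma some_chart:
  assumes "p \<in> topspace X"
  obtains U x where "(SOME (U, x). (U, x) \<in> A \<and> p \<in> x ` U) = (U, x)" "(U, x) \<in> A" "p \<in> x ` U"
proof -
  obtain U0 x0 u where *: "(U0, x0) \<in> A" "u \<in> U0" "p = x0 u" using chart_cover[OF assms] .
  let ?P = "\<lambda>(U, x). (U, x) \<in> A \<and> p \<in> x ` U"
  have "?P (U0, x0)" using * by auto
  then have "?P (Eps ?P)" by (rule someI)
  then show ?thesis using that[of "fst (Eps ?P)" "snd (Eps ?P)"] by (simp add: split_beta)
qed

lemma lap_chart:
  assumes "(U, x) \<in> A" "u \<in> U" "smooth_map A \<psi>"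
  shows "lap \<psi> (x u) = laplacian c (\<phi> \<circ> x) (\<psi> \<circ> x) u"
proof -
  obtain V y where Vy: "(SOME (V, y). (V, y) \<in> A \<and> x u \<in> y ` V) = (V, y)" "(V, y) \<in> A" "x u \<in> y ` V"
    using some_chart[OF chart_in[OF assms(1,2)]] .
  have "laplacian c (\<phi> \<circ> x) (\<psi> \<circ> x) u = laplacian c (\<phi> \<circ> y) (\<psi> \<circ> y) (inv_into V y (x u))"
    by (rule laplacian_transition[OF Vy(2) assms(1) chart_inv_in(1)[OF Vy(3)] assms(2) chart_inv_in(2)[OF Vy(3)] assms(3)])
  then show ?thesis unfolding surface_laplacian_def Vy(1) by simp
qed

lemma tension_lap:
  assumes "p \<in> topspace X" "smooth_map A \<psi>" "\<And>p. p \<in> topspace X \<Longrightarrow> \<psi> p \<in> product_space c"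
  shows "tension_field c A \<phi> \<psi> p = tangent_proj c (\<psi> p) (lap \<psi> p)"
proof -
  obtain U x where Ux: "(SOME (U, x). (U, x) \<in> A \<and> p \<in> x ` U) = (U, x)" "(U, x) \<in> A" "p \<in> x ` U"
    using some_chart[OF assms(1)] .
  have "chart_tension c (\<phi> \<circ> x) (\<psi> \<circ> x) (inv_into U x p)
    = tangent_proj c ((\<psi> \<circ> x) (inv_into U x p)) (laplacian c (\<phi> \<circ> x) (\<psi> \<circ> x) (inv_into U x p))"
    by (rule chart_tension_eq[OF chart_open[OF Ux(2)]])
      (use smooth_mapD[OF assms(2) Ux(2)] assms(3) chart_in[OF Ux(2)] chart_inv_in[OF Ux(3)] in \<open>auto simp: comp_def\<close>)
  then show ?thesis
    unfolding tension_field_def surface_laplacian_def Ux(1) using chart_inv_in[OF Ux(3)] by simp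
qed

lemma lap_smooth:
  assumes "smooth_map A \<psi>" shows "smooth_map A (lap \<psi>)"
proof (rule smooth_mapI)
  fix U x assume Ux: "(U, x) \<in> A"
  interpret immersed_chart c "\<phi> \<circ> x" U by (rule immersed_chart[OF Ux])
  have "smooth_on (laplacian c (\<phi> \<circ> x) (\<psi> \<circ> x)) U"
    by (rule laplacian_smooth) (use smooth_mapD[OF assms Ux] in \<open>simp add: comp_def\<close>)
  then show "smooth_on (\<lambda>u. lap \<psi> (x u)) U"
    using smooth_on_cong[OF openU, of "\<lambda>u. lap \<psi> (x u)"] lap_chart[OF Ux _ assms] by metis
qed

lemma smooth_map_continuous:
  fixes \<psi> :: "'m \<Rightarrow> 'b::real_normed_vector"
  assumes "smooth_map A \<psi>" shows "continuous_map X euclidean \<psi>"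
proof -
  have "openin X {p \<in> topspace X. \<psi> p \<in> W}" if "open W" for W
  proof -
    have "{p \<in> topspace X. \<psi> p \<in> W} = (\<Union>(U, x)\<in>A. x ` {u \<in> U. \<psi> (x u) \<in> W})"
    proof (intro equalityI subsetI)
      fix p assume p: "p \<in> {p \<in> topspace X. \<psi> p \<in> W}"
      then obtain U x u where "(U, x) \<in> A" "u \<in> U" "p = x u" using chart_cover by blast
      then show "p \<in> (\<Union>(U, x)\<in>A. x ` {u \<in> U. \<psi> (x u) \<in> W})" using p by blast
    next
      fix p assume "p \<in> (\<Union>(U, x)\<in>A. x ` {u \<in> U. \<psi> (x u) \<in> W})"
      then show "p \<in> {p \<in> topspace X. \<psi> p \<in> W}" using chart_in by auto
    qed
    moreover have "openin X (x ` {u \<in> U. \<psi> (x u) \<in> W})" if Ux: "(U, x) \<in> A" for U x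
    proof (rule chart_image_openin[OF Ux])
      have "open ((\<lambda>u. \<psi> (x u)) -` W \<inter> U)"
        using smooth_on_continuous[OF smooth_mapD[OF assms Ux]] chart_open[OF Ux] \<open>open W\<close>
          continuous_on_open_vimage by blast
      moreover have "(\<lambda>u. \<psi> (x u)) -` W \<inter> U = {u \<in> U. \<psi> (x u) \<in> W}" by auto
      ultimately show "open {u \<in> U. \<psi> (x u) \<in> W}" by simp
    qed auto
    then have "openin X (\<Union>(U, x)\<in>A. x ` {u \<in> U. \<psi> (x u) \<in> W})"
      by (intro openin_Union) auto
    ultimately show ?thesis by (simp only:)
  qed
  then show ?thesis by (auto simp: continuous_map_def)
qed

text \<open>The surface is Hausdorff, so the compact support is closed and the extension by zero is smooth
  also where the closure of the chart ends.\<close>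

lemma smooth_map_zero_extension:
  fixes f :: "real^2 \<Rightarrow> 'b::real_normed_vector"
  assumes "(U, x) \<in> A" "smooth_on f U" "compact K" "K \<subseteq> U" "\<And>u. u \<in> U - K \<Longrightarrow> f u = 0"
  shows "smooth_map A (\<lambda>p. if p \<in> x ` U then f (inv_into U x p) else 0)"
proof (rule smooth_mapI)
  fix V y assume Vy: "(V, y) \<in> A"
  let ?h = "\<lambda>v. if y v \<in> x ` U then f (inv_into U x (y v)) else 0"
  let ?T1 = "{v \<in> V. y v \<in> x ` U}" and ?T2 = "{v \<in> V. y v \<in> topspace X - x ` K}"
  have o1: "open ?T1" by (rule chart_preimage_open[OF Vy chart_image_open[OF assms(1)]])
  have "openin X (topspace X - x ` K)"
    using compact_closed[OF chart_image_compact[OF assms(1,3,4)]] by blast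
  then have o2: "open ?T2" by (rule chart_preimage_open[OF Vy])
  have "smooth_on (\<lambda>v. f (inv_into U x (y v))) ?T1"
    by (rule smooth_on_compose[OF o1 chart_open[OF assms(1)] assms(2) transition_smooth[OF assms(1) Vy]])
       (auto intro!: inv_into_into)
  then have s1: "smooth_on ?h ?T1"
    using smooth_on_cong[OF o1, of ?h "\<lambda>v. f (inv_into U x (y v))"] by simp
  have "?h v = 0" if "v \<in> ?T2" for v
  proof (cases "y v \<in> x ` U")
    case True
    have "inv_into U x (y v) \<notin> K"
    proof
      assume "inv_into U x (y v) \<in> K"
      then have "x (inv_into U x (y v)) \<in> x ` K" by (rule imageI)
      then show False using that chart_inv_in(2)[OF True] by simp
    qed
    then show ?thesis using assms(5) chart_inv_in(1)[OF True] by simp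
  qed simp
  then have s2: "smooth_on ?h ?T2"
    using smooth_on_cong[OF o2, of ?h "\<lambda>_. 0"] smooth_on_const[OF o2] by simp
  show "smooth_on ?h V"
  proof (rule smooth_on_local[OF chart_open[OF Vy]])
    fix v assume "v \<in> V"
    then have "v \<in> ?T1 \<or> v \<in> ?T2" using chart_in[OF Vy] assms(4) by auto
    then show "\<exists>T. open T \<and> v \<in> T \<and> smooth_on ?h T" using o1 o2 s1 s2 by blast
  qed
qed

text \<open>A cut-off function supported in a coordinate ball. These functions serve both for partitions
  of unity and for localising variations.\<close>

definition bump :: "(real^2) set \<Rightarrow> (real^2 \<Rightarrow> 'm) \<Rightarrow> real^2 \<Rightarrow> real \<Rightarrow> 'm \<Rightarrow> real" where
  "bump U x a r p = (if p \<in> x ` U then flat_fun 0 (r\<^sup>2 - (inv_into U x p - a) \<bullet> (inv_into U x p - a)) else 0)"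

lemma bump_smooth:
  assumes "(U, x) \<in> A" "cball a r \<subseteq> U" "r > 0"
  shows "smooth_map A (bump U x a r)"
  unfolding bump_def[abs_def]
proof (rule smooth_map_zero_extension[OF assms(1), where K="cball a r"
      and f="\<lambda>u. flat_fun 0 (r\<^sup>2 - (u - a) \<bullet> (u - a))"])
  have oU: "open U" by (rule chart_open[OF assms(1)])
  show "smooth_on (\<lambda>u. flat_fun 0 (r\<^sup>2 - (u - a) \<bullet> (u - a))) U"
    by (rule smooth_on_compose[where f="flat_fun 0" and T=UNIV])
       (auto simp: smooth_on_def[of "flat_fun 0"] Ck_on_flat_fun
         intro!: smooth_on_diff smooth_on_inner smooth_on_const smooth_on_id oU)
  show "flat_fun 0 (r\<^sup>2 - (u - a) \<bullet> (u - a)) = 0" if "u \<in> U - cball a r" for u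
  proof -
    have "r < norm (u - a)" using that by (simp add: dist_norm norm_minus_commute)
    then have "r\<^sup>2 < (norm (u - a))\<^sup>2" using assms(3) by (simp add: power_strict_mono)
    then show ?thesis by (simp add: flat_fun_def power2_norm_eq_inner)
  qed
qed (use assms in auto)

lemma bump_nonneg: "bump U x a r p \<ge> 0"
  by (simp add: bump_def flat_fun_def)

lemma bump_chart:
  assumes "(U, x) \<in> A" "u \<in> U" "r > 0"
  shows "bump U x a r (x u) > 0 \<longleftrightarrow> u \<in> ball a r"
proof -
  have "(u - a) \<bullet> (u - a) < r\<^sup>2 \<longleftrightarrow> norm (u - a) < r"
    unfolding power2_norm_eq_inner[symmetric] using assms(3)
    by (auto intro: power_strict_mono power2_less_imp_less)
  then show ?thesis using assms by (auto simp: bump_def flat_fun_def dist_norm norm_minus_commute)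
qed

lemma bump_support:
  assumes "(U, x) \<in> A" "r > 0" "p \<notin> x ` (U \<inter> cball a r)"
  shows "bump U x a r p = 0"
proof (rule ccontr)
  assume n: "bump U x a r p \<noteq> 0"
  then have "p \<in> x ` U" by (auto simp: bump_def split: if_splits)
  then obtain u where u: "u \<in> U" "p = x u" by auto
  have "bump U x a r p > 0" using n bump_nonneg[of U x a r p] by (simp add: less_le)
  then have "u \<in> ball a r" using bump_chart[OF assms(1) u(1) assms(2)] u(2) by blast
  then show False using u assms(3) by auto
qed

end

section \<open>Integration on the surface\<close>

context immersed_chart
begin

lemma partial_deriv2_add:
  assumes "smooth_on f U" "smooth_on h U" "u \<in> U"
  shows "partial_deriv i (partial_deriv j (\<lambda>u. f u + h u)) u
    = partial_deriv i (partial_deriv j f) u + partial_deriv i (partial_deriv j h) u"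
proof -
  have "partial_deriv i (partial_deriv j (\<lambda>u. f u + h u)) u = partial_deriv i (\<lambda>u. partial_deriv j f u + partial_deriv j h u) u"
    by (rule partial_deriv_cong[OF openU assms(3)])
       (rule partial_deriv_add[OF diff_at[OF assms(1)] diff_at[OF assms(2)]])
  then show ?thesis using partial_deriv_add[OF diff_partial[OF assms(1,3)] diff_partial[OF assms(2,3)]] by simp
qed

lemma partial_deriv2_linear:
  assumes "bounded_linear h" "smooth_on f U" "u \<in> U"
  shows "partial_deriv i (partial_deriv j (\<lambda>u. h (f u))) u = h (partial_deriv i (partial_deriv j f) u)"
proof -
  have "partial_deriv i (partial_deriv j (\<lambda>u. h (f u))) u = partial_deriv i (\<lambda>u. h (partial_deriv j f u)) u"
    by (rule partial_deriv_cong[OF openU assms(3)])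
       (rule partial_deriv_linear[OF assms(1) diff_at[OF assms(2)]])
  then show ?thesis using partial_deriv_linear[OF assms(1) diff_partial[OF assms(2,3)]] by simp
qed

lemma laplacian_add:
  assumes "smooth_on f U" "smooth_on h U" "u \<in> U"
  shows "laplacian c \<Phi> (\<lambda>u. f u + h u) u = laplacian c \<Phi> f u + laplacian c \<Phi> h u"
  unfolding laplacian_second_order_op second_order_op_def partial_deriv2_add[OF assms]
    partial_deriv_add[OF diff_at[OF assms(1,3)] diff_at[OF assms(2,3)]]
  by (simp add: sum_2 scaleR_add_right)

lemma laplacian_linear:
  assumes "bounded_linear h" "smooth_on f U" "u \<in> U"
  shows "laplacian c \<Phi> (\<lambda>u. h (f u)) u = h (laplacian c \<Phi> f u)"
  unfolding laplacian_second_order_op second_order_op_def partial_deriv2_linear[OF assms]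
    partial_deriv_linear[OF assms(1) diff_at[OF assms(2,3)]]
  using bounded_linear.linear[OF assms(1)] by (simp add: sum_2 linear_add linear_cmul)

lemma laplacian_const: "laplacian c \<Phi> (\<lambda>u. a) u = 0"
proof -
  have "partial_deriv j (\<lambda>u::real^2. a) = (\<lambda>u. 0)" for j by (rule ext) simp
  then show ?thesis unfolding laplacian_second_order_op second_order_op_def by simp
qed

end

context surface
begin

lemma smooth_map_add: "smooth_map A f \<Longrightarrow> smooth_map A g \<Longrightarrow> smooth_map A (\<lambda>p. f p + g p)"
  by (rule smooth_mapI) (intro smooth_on_add chart_open smooth_mapD; assumption)

lemma smooth_map_diff: "smooth_map A f \<Longrightarrow> smooth_map A g \<Longrightarrow> smooth_map A (\<lambda>p. f p - g p)"
  by (rule smooth_mapI) (intro smooth_on_diff chart_open smooth_mapD; assumption)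

lemma smooth_map_linear: "bounded_linear h \<Longrightarrow> smooth_map A f \<Longrightarrow> smooth_map A (\<lambda>p. h (f p))"
  by (rule smooth_mapI) (rule smooth_on_compose_linear[of h]; simp add: chart_open smooth_mapD)

lemma smooth_map_bilinear:
  "bounded_bilinear h \<Longrightarrow> smooth_map A f \<Longrightarrow> smooth_map A g \<Longrightarrow> smooth_map A (\<lambda>p. h (f p) (g p))"
  by (rule smooth_mapI) (rule smooth_on_bilinear[of h]; simp add: chart_open smooth_mapD)

lemma smooth_map_const: "smooth_map A (\<lambda>p. a)"
  by (rule smooth_mapI) (intro smooth_on_const chart_open; assumption)

lemma smooth_map_sum: "(\<And>i. i \<in> I \<Longrightarrow> smooth_map A (f i)) \<Longrightarrow> smooth_map A (\<lambda>p. \<Sum>i\<in>I. f i p)"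
  by (induction I rule: infinite_finite_induct) (auto intro: smooth_map_const smooth_map_add)

lemmas smooth_map_mult = smooth_map_bilinear[OF bounded_bilinear_mult]

lemma lap_add:
  assumes "p \<in> topspace X" "smooth_map A f" "smooth_map A g"
  shows "lap (\<lambda>p. f p + g p) p = lap f p + lap g p"
proof -
  obtain U x u where *: "(U, x) \<in> A" "u \<in> U" "p = x u" using chart_cover[OF assms(1)] .
  interpret immersed_chart c "\<phi> \<circ> x" U by (rule immersed_chart[OF *(1)])
  show ?thesis unfolding *(3) lap_chart[OF *(1,2) assms(2)] lap_chart[OF *(1,2) assms(3)]
    lap_chart[OF *(1,2) smooth_map_add[OF assms(2,3)]]
    using laplacian_add[OF smooth_mapD[OF assms(2) *(1)] smooth_mapD[OF assms(3) *(1)] *(2)]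
    by (simp add: comp_def)
qed

lemma lap_linear:
  assumes "p \<in> topspace X" "bounded_linear h" "smooth_map A f"
  shows "lap (\<lambda>p. h (f p)) p = h (lap f p)"
proof -
  obtain U x u where *: "(U, x) \<in> A" "u \<in> U" "p = x u" using chart_cover[OF assms(1)] .
  interpret immersed_chart c "\<phi> \<circ> x" U by (rule immersed_chart[OF *(1)])
  show ?thesis unfolding *(3) lap_chart[OF *(1,2) assms(3)]
    lap_chart[OF *(1,2) smooth_map_linear[OF assms(2,3)]]
    using laplacian_linear[OF assms(2) smooth_mapD[OF assms(3) *(1)] *(2)]
    by (simp add: comp_def)
qed

lemma lap_const:
  assumes "p \<in> topspace X" shows "lap (\<lambda>p. a) p = 0"
proof -
  obtain U x u where *: "(U, x) \<in> A" "u \<in> U" "p = x u" using chart_cover[OF assms(1)] .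
  interpret immersed_chart c "\<phi> \<circ> x" U by (rule immersed_chart[OF *(1)])
  show ?thesis unfolding *(3) lap_chart[OF *(1,2) smooth_map_const]
    using laplacian_const by (simp add: comp_def)
qed

lemma lap_sum:
  assumes "p \<in> topspace X" "\<And>i. i \<in> I \<Longrightarrow> smooth_map A (f i)"
  shows "lap (\<lambda>p. \<Sum>i\<in>I. f i p) p = (\<Sum>i\<in>I. lap (f i) p)"
  using assms(2)
proof (induction I rule: infinite_finite_induct)
  case (insert i I)
  then show ?case
    using lap_add[OF assms(1), of "f i" "\<lambda>p. \<Sum>i\<in>I. f i p"] smooth_map_sum[of I f] by simp
qed (simp_all add: lap_const[OF assms(1)])

lemma lap_local:
  assumes "openin X W" "p \<in> W" "smooth_map A f" "smooth_map A g" "\<And>q. q \<in> W \<Longrightarrow> f q = g q"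
  shows "lap f p = lap g p"
proof -
  have "p \<in> topspace X" using assms(1,2) openin_subset by blast
  then obtain U x u where *: "(U, x) \<in> A" "u \<in> U" "p = x u" using chart_cover by blast
  show ?thesis unfolding *(3) lap_chart[OF *(1,2) assms(3)] lap_chart[OF *(1,2) assms(4)]
    by (rule laplacian_cong[OF chart_preimage_open[OF *(1) assms(1)]]) (use * assms in auto)
qed

lemma lap_zero_outside:
  assumes "compactin X K" "smooth_map A v" "\<And>p. p \<in> topspace X - K \<Longrightarrow> v p = 0" "p \<in> topspace X - K"
  shows "lap v p = 0"
proof -
  have "openin X (topspace X - K)" using compact_closed[OF assms(1)] by blast
  then have "lap v p = lap (\<lambda>p. 0) p"
    by (rule lap_local[OF _ assms(4,2) smooth_map_const assms(3)])
  then show ?thesis using assms(4) by (simp add: lap_const)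
qed

lemma chart_ball:
  assumes "p \<in> topspace X"
  obtains U x a r where "(U, x) \<in> A" "r > 0" "cball a r \<subseteq> U" "p \<in> x ` ball a r" "openin X (x ` ball a r)"
proof -
  obtain U x u where *: "(U, x) \<in> A" "u \<in> U" "p = x u" using chart_cover[OF assms(1)] .
  obtain r where r: "r > 0" "cball u r \<subseteq> U" using chart_open[OF *(1)] *(2) open_contains_cball by blast
  show thesis
    using chart_image_openin[OF *(1) open_ball order_trans[OF ball_subset_cball r(2)]] *(2,3) r(1)
    by (intro that[OF *(1) r]) auto
qed

text \<open>The finite cover comes as a finite set of data \<open>(U, x, a, r)\<close>: a chart and a ball in it.\<close>

lemma compact_chart_balls:
  assumes "compactin X K"
  obtains I where "finite I" "K \<subseteq> (\<Union>(U, x, a, r)\<in>I. x ` ball a r)"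
    "\<And>U x a r. (U, x, a, r) \<in> I \<Longrightarrow> (U, x) \<in> A \<and> r > 0 \<and> cball a r \<subseteq> U"
proof -
  define J where "J = {(U, x, a, r). (U, x) \<in> A \<and> r > 0 \<and> cball a r \<subseteq> U}"
  let ?w = "\<lambda>(U, x, a, r). x ` ball a r"
  have o: "openin X W" if W: "W \<in> ?w ` J" for W
  proof -
    obtain U x a r where "(U, x) \<in> A" "cball a r \<subseteq> U" "W = x ` ball a r" using W unfolding J_def by auto
    then show ?thesis using chart_image_openin[OF _ open_ball order_trans[OF ball_subset_cball]] by blast
  qed
  have cov: "K \<subseteq> \<Union> (?w ` J)"
  proof
    fix p assume "p \<in> K"
    then have "p \<in> topspace X" using compactin_subset_topspace[OF assms] by blast
    then obtain U x a r where "(U, x) \<in> A" "r > 0" "cball a r \<subseteq> U" "p \<in> x ` ball a r"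
      using chart_ball by metis
    then show "p \<in> \<Union> (?w ` J)" unfolding J_def by blast
  qed
  have "\<exists>\<F>. finite \<F> \<and> \<F> \<subseteq> ?w ` J \<and> K \<subseteq> \<Union>\<F>"
    by (rule compactinD[OF assms]) (use o cov in auto)
  then obtain \<F> where F: "finite \<F>" "\<F> \<subseteq> ?w ` J" "K \<subseteq> \<Union>\<F>" by auto
  obtain I where I: "I \<subseteq> J" "finite I" "\<F> = ?w ` I" using finite_subset_image[OF F(1,2)] by blast
  show thesis
    by (rule that[of I]) (use I F(3) J_def in auto)
qed

end

locale measured_surface = surface c X A \<phi> for c and X :: "'m topology" and A \<phi> +
  fixes dv :: "'m measure"
  assumes dv: "is_area_measure c X A \<phi> dv"
begin

abbreviation "dens x u \<equiv> sqrt (det (metric c (\<phi> \<circ> x) u))"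

lemma sets_dv: "sets dv = sigma_sets (topspace X) {S. openin X S}"
  using dv by (simp add: is_area_measure_def)

lemma space_dv: "space dv = topspace X"
proof -
  have P: "{S. openin X S} \<subseteq> Pow (topspace X)" using openin_subset by blast
  have "space dv \<subseteq> topspace X" using sigma_sets_into_sp[OF P] sets_dv sets.top by metis
  moreover have "topspace X \<subseteq> space dv" using sigma_sets_top sets_dv sets.sets_into_space by metis
  ultimately show ?thesis by blast
qed

lemma open_in_sets: "openin X W \<Longrightarrow> W \<in> sets dv"
  unfolding sets_dv by auto

lemma closed_in_sets: "closedin X W \<Longrightarrow> W \<in> sets dv"
  using open_in_sets[of "topspace X - W"] sets.compl_sets[of "topspace X - W" dv] space_dv
  by (simp add: closedin_def Diff_Diff_Int Int_absorb1)

lemma emeasure_chart: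
  "(U, x) \<in> A \<Longrightarrow> E \<in> sets borel \<Longrightarrow> E \<subseteq> U \<Longrightarrow>
    emeasure dv (x ` E) = (\<integral>\<^sup>+u\<in>E. ennreal (dens x u) \<partial>lborel)"
  using dv unfolding is_area_measure_def by fast

lemma continuous_measurable:
  fixes h :: "'m \<Rightarrow> real"
  assumes "continuous_map X euclidean h" shows "h \<in> borel_measurable dv"
proof (rule borel_measurableI)
  fix S :: "real set" assume "open S"
  then have "openin X {p \<in> topspace X. h p \<in> S}"
    using openin_continuous_map_preimage[OF assms, of S] by simp
  moreover have "{p \<in> topspace X. h p \<in> S} = h -` S \<inter> space dv" by (auto simp: space_dv)
  ultimately show "h -` S \<inter> space dv \<in> sets dv" using open_in_sets by simp
qed

lemma dens_smooth: "(U, x) \<in> A \<Longrightarrow> smooth_on (dens x) U"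
  and dens_pos: "(U, x) \<in> A \<Longrightarrow> u \<in> U \<Longrightarrow> dens x u > 0"
proof -
  assume Ux: "(U, x) \<in> A"
  interpret immersed_chart c "\<phi> \<circ> x" U by (rule immersed_chart[OF Ux])
  show "smooth_on (dens x) U" unfolding det_metric by (rule vol_smooth)
  show "dens x u > 0" if "u \<in> U" using metric_det[OF that] unfolding det_metric by simp
qed

text \<open>The defining property of the area measure, extended from sets to functions by comparing two
  measures: the area measure restricted to the image of the chart, and the image of the density
  under the parametrisation.\<close>

lemma chart_integral:
  fixes h :: "'m \<Rightarrow> real"
  assumes Ux: "(U, x) \<in> A" and h: "h \<in> borel_measurable dv" and z: "\<And>p. p \<in> topspace X - x ` U \<Longrightarrow> h p = 0"
  shows "integral\<^sup>L dv h = (\<integral>u. indicator U u * (dens x u * h (x u)) \<partial>lborel)"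
proof -
  obtain p0 where p0: "p0 \<in> topspace X" using nonempty by blast
  define f where "f u = (if u \<in> U then x u else p0)" for u
  have oU: "open U" by (rule chart_open[OF Ux])
  have f: "f \<in> measurable borel dv"
    unfolding f_def[abs_def] by (rule measurable_chart_extension[OF Ux p0 sets_dv])
  define d where "d u = indicator U u * dens x u" for u
  have d: "d \<in> borel_measurable borel" "\<And>u. 0 \<le> d u"
  proof -
    have "(\<lambda>u. indicator U u *\<^sub>R dens x u) \<in> borel_measurable borel"
      by (rule borel_measurable_continuous_on_indicator)
         (use oU smooth_on_continuous[OF dens_smooth[OF Ux]] in auto)
    then show "d \<in> borel_measurable borel" by (simp add: d_def[abs_def])
    show "0 \<le> d u" for u using dens_pos[OF Ux, of u] by (cases "u \<in> U") (auto simp: d_def)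
  qed
  have xU: "x ` U \<in> sets dv" by (rule open_in_sets[OF chart_image_open[OF Ux]])
  have f': "f \<in> measurable (density lborel (\<lambda>u. ennreal (d u))) dv" using f by simp
  have eq: "density dv (\<lambda>p. ennreal (indicator (x ` U) p)) = distr (density lborel (\<lambda>u. ennreal (d u))) dv f"
  proof (rule measure_eqI)
    fix E assume "E \<in> sets (density dv (\<lambda>p. ennreal (indicator (x ` U) p)))"
    then have E: "E \<in> sets dv" by simp
    define E' where "E' = f -` E \<inter> U"
    have fE: "f -` E \<in> sets borel" using measurable_sets[OF f E] by simp
    then have E': "E' \<in> sets borel" unfolding E'_def using oU by auto
    have "emeasure (distr (density lborel (\<lambda>u. ennreal (d u))) dv f) E
      = emeasure (density lborel (\<lambda>u. ennreal (d u))) (f -` E)"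
      using emeasure_distr[OF f' E] by simp
    also have "\<dots> = (\<integral>\<^sup>+u. ennreal (d u) * indicator (f -` E) u \<partial>lborel)"
      by (rule emeasure_density) (use d fE in auto)
    also have "\<dots> = (\<integral>\<^sup>+u\<in>E'. ennreal (dens x u) \<partial>lborel)"
      by (rule nn_integral_cong) (auto simp: d_def E'_def indicator_def)
    also have "\<dots> = emeasure dv (x ` E')"
      by (rule emeasure_chart[OF Ux E', symmetric]) (simp add: E'_def)
    also have "x ` E' = x ` U \<inter> E" by (auto simp: E'_def f_def)
    also have "emeasure dv (x ` U \<inter> E) = (\<integral>\<^sup>+p. indicator (x ` U \<inter> E) p \<partial>dv)"
      using xU E by (simp add: sets.Int)
    also have "\<dots> = (\<integral>\<^sup>+p. ennreal (indicator (x ` U) p) * indicator E p \<partial>dv)"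
      by (rule nn_integral_cong) (auto simp: indicator_def)
    also have "\<dots> = emeasure (density dv (\<lambda>p. ennreal (indicator (x ` U) p))) E"
      by (rule emeasure_density[symmetric]) (use xU E in auto)
    finally show "emeasure (density dv (\<lambda>p. ennreal (indicator (x ` U) p))) E
      = emeasure (distr (density lborel (\<lambda>u. ennreal (d u))) dv f) E" by simp
  qed simp
  have "integral\<^sup>L dv h = (\<integral>p. indicator (x ` U) p *\<^sub>R h p \<partial>dv)"
    by (rule Bochner_Integration.integral_cong) (use z in \<open>auto simp: space_dv indicator_def\<close>)
  also have "\<dots> = integral\<^sup>L (density dv (\<lambda>p. ennreal (indicator (x ` U) p))) h"
    by (rule integral_density[symmetric]) (use h xU in auto)
  also have "\<dots> = integral\<^sup>L (density lborel (\<lambda>u. ennreal (d u))) (\<lambda>u. h (f u))"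
    unfolding eq by (rule integral_distr[OF f' h])
  also have "\<dots> = (\<integral>u. d u *\<^sub>R h (f u) \<partial>lborel)"
    by (rule integral_density) (use d measurable_compose[OF f h] in auto)
  also have "\<dots> = (\<integral>u. indicator U u * (dens x u * h (x u)) \<partial>lborel)"
    by (rule Bochner_Integration.integral_cong) (auto simp: d_def f_def indicator_def)
  finally show ?thesis .
qed

text \<open>A compact set is covered by finitely many coordinate balls, on whose closures the density is
  bounded.\<close>

lemma compact_finite_area:
  assumes "compactin X K" shows "emeasure dv K < \<infinity>"
proof -
  obtain I where I: "finite I" "K \<subseteq> (\<Union>(U, x, a, r)\<in>I. x ` ball a r)"
    "\<And>U x a r. (U, x, a, r) \<in> I \<Longrightarrow> (U, x) \<in> A \<and> r > 0 \<and> cball a r \<subseteq> U"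
    by (rule compact_chart_balls[OF assms]) (rule that)
  let ?w = "\<lambda>(U, x, a, r). x ` ball a r"
  have w: "?w i \<in> sets dv \<and> emeasure dv (?w i) < \<infinity>" if iI: "i \<in> I" for i
  proof -
    obtain U x a r where i: "i = (U, x, a, r)" by (cases i)
    have *: "(U, x) \<in> A" "r > 0" "cball a r \<subseteq> U" using I(3) iI i by auto
    have bU: "ball a r \<subseteq> U" using *(3) ball_subset_cball by blast
    have "bounded (dens x ` cball a r)"
      by (rule compact_imp_bounded[OF compact_continuous_image[OF continuous_on_subset[OF
          smooth_on_continuous[OF dens_smooth[OF *(1)]] *(3)] compact_cball]])
    then obtain B where B: "\<And>u. u \<in> cball a r \<Longrightarrow> \<bar>dens x u\<bar> \<le> B"
      unfolding bounded_iff by (metis imageI real_norm_def)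
    have "emeasure dv (x ` ball a r) = (\<integral>\<^sup>+u\<in>ball a r. ennreal (dens x u) \<partial>lborel)"
      by (rule emeasure_chart[OF *(1) _ bU]) simp
    also have "\<dots> \<le> (\<integral>\<^sup>+u. ennreal B * indicator (ball a r) u \<partial>lborel)"
    proof (rule nn_integral_mono)
      fix u
      show "ennreal (dens x u) * indicator (ball a r) u \<le> ennreal B * indicator (ball a r) u"
      proof (cases "u \<in> ball a r")
        case True
        then have "dens x u \<le> B" using B[of u] by (simp add: abs_le_iff)
        then show ?thesis by (intro mult_right_mono ennreal_leI) auto
      qed simp
    qed
    also have "\<dots> = ennreal B * emeasure lborel (ball a r)" by (rule nn_integral_cmult_indicator) simp
    also have "\<dots> < \<infinity>" using emeasure_bounded_finite[of "ball a r"] by (simp add: ennreal_mult_less_top)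
    finally show ?thesis using open_in_sets[OF chart_image_openin[OF *(1) open_ball bU]] i by simp
  qed
  have "emeasure dv K \<le> emeasure dv (\<Union>i\<in>I. ?w i)"
    by (rule emeasure_mono) (use I w in auto)
  also have "\<dots> \<le> (\<Sum>i\<in>I. emeasure dv (?w i))"
    by (rule emeasure_subadditive_finite) (use I w in auto)
  also have "\<dots> < \<infinity>" using w I(1) by (simp add: less_top)
  finally show ?thesis .
qed

lemma integrable_on_compact:
  fixes h :: "'m \<Rightarrow> real"
  assumes "continuous_map X euclidean h" "compactin X K"
  shows "integrable dv (\<lambda>p. indicator K p *\<^sub>R h p)"
proof -
  have "compact (h ` K)" using image_compactin[OF assms(2,1)] by simp
  then have "bounded (h ` K)" by (rule compact_imp_bounded)
  then obtain B where B: "\<And>p. p \<in> K \<Longrightarrow> \<bar>h p\<bar> \<le> B" unfolding bounded_iff by auto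
  have K: "K \<in> sets dv" by (rule closed_in_sets[OF compact_closed[OF assms(2)]])
  show ?thesis
    by (rule integrableI_bounded_set_indicator[OF K continuous_measurable[OF assms(1)] compact_finite_area[OF assms(2)], of B])
       (use B in auto)
qed

lemma integrable_compact_support:
  fixes h :: "'m \<Rightarrow> real"
  assumes "continuous_map X euclidean h" "compactin X K" "\<And>p. p \<in> topspace X - K \<Longrightarrow> h p = 0"
  shows "integrable dv h"
  using integrable_on_compact[OF assms(1,2)]
  by (rule Bochner_Integration.integrable_cong[THEN iffD1, OF refl, rotated])
     (use assms(3) in \<open>auto simp: space_dv indicator_def\<close>)

lemma green_integrand:
  assumes "smooth_map A \<psi>" "smooth_map A v" "compactin X K" "\<And>p. p \<in> topspace X - K \<Longrightarrow> v p = (0::real)"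
  shows "continuous_map X euclidean (\<lambda>p. \<psi> p * lap v p - v p * lap \<psi> p)"
    and "\<And>p. p \<in> topspace X - K \<Longrightarrow> \<psi> p * lap v p - v p * lap \<psi> p = 0"
proof -
  show "continuous_map X euclidean (\<lambda>p. \<psi> p * lap v p - v p * lap \<psi> p)"
    by (intro smooth_map_continuous smooth_map_diff smooth_map_mult lap_smooth assms)
  fix p assume p: "p \<in> topspace X - K"
  show "\<psi> p * lap v p - v p * lap \<psi> p = 0"
    using lap_zero_outside[OF assms(3,2,4) p] assms(4)[OF p] by simp
qed

lemma green_local:
  assumes "smooth_map A \<psi>" "smooth_map A v" "(U, x) \<in> A" "compact C" "C \<subseteq> U"
    "\<And>p. p \<in> topspace X - x ` C \<Longrightarrow> v p = (0::real)"
  shows "(\<integral>p. \<psi> p * lap v p - v p * lap \<psi> p \<partial>dv) = 0"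
proof -
  interpret immersed_chart c "\<phi> \<circ> x" U by (rule immersed_chart[OF assms(3)])
  note gi = green_integrand[OF assms(1,2) chart_image_compact[OF assms(3-5)] assms(6)]
  have "(\<integral>p. \<psi> p * lap v p - v p * lap \<psi> p \<partial>dv)
    = (\<integral>u. indicator U u * (dens x u * (\<psi> (x u) * lap v (x u) - v (x u) * lap \<psi> (x u))) \<partial>lborel)"
  proof (rule chart_integral[OF assms(3) continuous_measurable[OF gi(1)]])
    fix p assume "p \<in> topspace X - x ` U"
    then show "\<psi> p * lap v p - v p * lap \<psi> p = 0" by (intro gi(2)) (use assms(5) in auto)
  qed
  also have "\<dots> = (\<integral>u. indicator U u * (vol u * ((\<psi> \<circ> x) u * laplacian c (\<phi> \<circ> x) (v \<circ> x) u
      - (v \<circ> x) u * laplacian c (\<phi> \<circ> x) (\<psi> \<circ> x) u)) \<partial>lborel)"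
    by (rule Bochner_Integration.integral_cong)
      (auto simp: indicator_def det_metric lap_chart[OF assms(3) _ assms(1)] lap_chart[OF assms(3) _ assms(2)])
  also have "\<dots> = 0"
  proof (rule green_chart[OF _ _ assms(4,5)])
    show "smooth_on (\<psi> \<circ> x) U" "smooth_on (v \<circ> x) U"
      using smooth_mapD[OF assms(1,3)] smooth_mapD[OF assms(2,3)] by (simp_all add: comp_def)
    show "(v \<circ> x) u = 0" if "u \<in> U - C" for u
    proof -
      have "x u \<notin> x ` C" using that chart_inj[OF assms(3)] assms(5) by (auto dest: inj_onD)
      then show ?thesis using assms(6) chart_in[OF assms(3)] that by simp
    qed
  qed
  finally show ?thesis .
qed

text \<open>Reduction to the local case by a partition of unity made of bump functions.\<close>

lemma green:
  assumes "smooth_map A \<psi>" "smooth_map A v" "compactin X K" "\<And>p. p \<in> topspace X - K \<Longrightarrow> v p = (0::real)"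
  shows "(\<integral>p. \<psi> p * lap v p - v p * lap \<psi> p \<partial>dv) = 0"
proof -
  obtain I where I: "finite I" "K \<subseteq> (\<Union>(U, x, a, r)\<in>I. x ` ball a r)"
    "\<And>U x a r. (U, x, a, r) \<in> I \<Longrightarrow> (U, x) \<in> A \<and> r > 0 \<and> cball a r \<subseteq> U"
    by (rule compact_chart_balls[OF assms(3)]) (rule that)
  define b where "b = (\<lambda>(U, x, a, r). bump U x a r)"
  define \<beta> where "\<beta> p = (\<Sum>i\<in>I. b i p)" for p
  define W where "W = (\<Union>(U, x, a, r)\<in>I. x ` ball a r)"
  have bs: "smooth_map A (b i)" if "i \<in> I" for i
    using that I(3) bump_smooth by (cases i) (auto simp: b_def)
  have b0: "0 \<le> b i p" for i p by (cases i) (simp add: b_def bump_nonneg)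
  have oW: "openin X W"
    unfolding W_def
  proof (rule openin_Union)
    fix S assume "S \<in> (\<lambda>(U, x, a, r). x ` ball a r) ` I"
    then obtain U x a r where "(U, x, a, r) \<in> I" "S = x ` ball a r" by auto
    then show "openin X S"
      using chart_image_openin[OF _ open_ball order_trans[OF ball_subset_cball]] I(3) by blast
  qed
  have \<beta>pos: "\<beta> p > 0" if "p \<in> W" for p
  proof -
    obtain U x a r u where i: "(U, x, a, r) \<in> I" "u \<in> ball a r" "p = x u" using \<open>p \<in> W\<close> unfolding W_def by blast
    have "(U, x) \<in> A" "r > 0" "cball a r \<subseteq> U" using I(3)[OF i(1)] by auto
    moreover from this have "u \<in> U" using subsetD[OF ball_subset_cball i(2)] by blast
    ultimately have "b (U, x, a, r) p > 0" unfolding b_def i(3)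
      using bump_chart[of U x u r a] i(2) by simp
    then show ?thesis unfolding \<beta>_def by (intro sum_pos2[OF I(1) i(1)] b0)
  qed
  \<comment> \<open>The bumps add up to a positive function only near \<open>K\<close>; where the sum vanishes, so
    does \<open>v\<close>, and the quotient is zero by the convention for division by zero.\<close>
  define vi where "vi i p = b i p * v p / \<beta> p" for i p
  have vis: "smooth_map A (vi i)" if iI: "i \<in> I" for i
  proof (rule smooth_mapI)
    fix V y assume Vy: "(V, y) \<in> A"
    let ?T1 = "{w \<in> V. y w \<in> W}" and ?T2 = "{w \<in> V. y w \<in> topspace X - K}"
    have o1: "open ?T1" by (rule chart_preimage_open[OF Vy oW])
    have "openin X (topspace X - K)" using compact_closed[OF assms(3)] by blast
    then have o2: "open ?T2" by (rule chart_preimage_open[OF Vy])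
    have \<beta>s: "smooth_map A \<beta>" unfolding \<beta>_def[abs_def] by (rule smooth_map_sum[OF bs])
    have "smooth_on (\<lambda>w. b i (y w) * v (y w) / \<beta> (y w)) ?T1"
      using \<beta>pos by (intro smooth_on_divide smooth_on_mult o1
        smooth_on_subset[OF smooth_mapD[OF bs[OF iI] Vy]] smooth_on_subset[OF smooth_mapD[OF assms(2) Vy]]
        smooth_on_subset[OF smooth_mapD[OF \<beta>s Vy]]) fastforce+
    then have s1: "smooth_on (\<lambda>w. vi i (y w)) ?T1" by (simp add: vi_def)
    have "smooth_on (\<lambda>w. vi i (y w)) ?T2 \<longleftrightarrow> smooth_on (\<lambda>_. 0 :: real) ?T2"
      by (rule smooth_on_cong[OF o2]) (use assms(4) in \<open>simp add: vi_def\<close>)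
    then have s2: "smooth_on (\<lambda>w. vi i (y w)) ?T2" using smooth_on_const[OF o2] by simp
    show "smooth_on (\<lambda>w. vi i (y w)) V"
    proof (rule smooth_on_local[OF chart_open[OF Vy]])
      fix w assume "w \<in> V"
      then have "w \<in> ?T1 \<or> w \<in> ?T2" using I(2) chart_in[OF Vy] unfolding W_def by blast
      then show "\<exists>T. open T \<and> w \<in> T \<and> smooth_on (\<lambda>w. vi i (y w)) T" using o1 o2 s1 s2 by blast
    qed
  qed
  have vsum: "v p = (\<Sum>i\<in>I. vi i p)" if "p \<in> topspace X" for p
  proof (cases "p \<in> K")
    case True
    then have "\<beta> p \<noteq> 0" using \<beta>pos[of p] I(2) unfolding W_def by fastforce
    moreover have "(\<Sum>i\<in>I. vi i p) = \<beta> p * v p / \<beta> p"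
      unfolding vi_def \<beta>_def by (simp add: sum_distrib_right sum_divide_distrib)
    ultimately show ?thesis by simp
  next
    case False
    then show ?thesis using assms(4) that by (simp add: vi_def)
  qed
  have lapv: "lap v p = (\<Sum>i\<in>I. lap (vi i) p)" if "p \<in> topspace X" for p
    using lap_local[OF openin_topspace that assms(2) smooth_map_sum[OF vis] vsum] lap_sum[OF that vis] by simp
  have vi: "(\<integral>p. \<psi> p * lap (vi i) p - vi i p * lap \<psi> p \<partial>dv) = 0
      \<and> integrable dv (\<lambda>p. \<psi> p * lap (vi i) p - vi i p * lap \<psi> p)" if iI: "i \<in> I" for i
  proof -
    obtain U x a r where i: "i = (U, x, a, r)" by (cases i)
    have *: "(U, x) \<in> A" "r > 0" "cball a r \<subseteq> U" using I(3) iI i by auto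
    have z: "vi i p = 0" if "p \<in> topspace X - x ` cball a r" for p
      using bump_support[OF *(1,2), of p a] that by (auto simp: vi_def b_def i)
    note gi = green_integrand[OF assms(1) vis[OF iI] chart_image_compact[OF *(1) compact_cball *(3)] z]
    show ?thesis
      using green_local[OF assms(1) vis[OF iI] *(1) compact_cball *(3) z]
        integrable_compact_support[OF gi(1) chart_image_compact[OF *(1) compact_cball *(3)] gi(2)] by blast
  qed
  have "(\<integral>p. \<psi> p * lap v p - v p * lap \<psi> p \<partial>dv) = (\<integral>p. (\<Sum>i\<in>I. \<psi> p * lap (vi i) p - vi i p * lap \<psi> p) \<partial>dv)"
    by (rule Bochner_Integration.integral_cong)
       (simp_all add: space_dv lapv vsum sum_distrib_left sum_distrib_right sum_subtractf)
  also have "\<dots> = (\<Sum>i\<in>I. \<integral>p. \<psi> p * lap (vi i) p - vi i p * lap \<psi> p \<partial>dv)"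
    by (rule Bochner_Integration.integral_sum) (use vi in blast)
  also have "\<dots> = 0" using vi by simp
  finally show ?thesis .
qed

text \<open>Green's identity for vector valued functions, coordinate by coordinate. The Laplacian commutes
  with linear maps into the reals, and the coordinates are orthogonal for the ambient form.\<close>

lemma green_form:
  assumes "smooth_map A \<Psi>" "smooth_map A V" "compactin X K" "\<And>p. p \<in> topspace X - K \<Longrightarrow> V p = 0"
  shows "(\<integral>p. ambient_form c (\<Psi> p) (lap V p) - ambient_form c (lap \<Psi> p) (V p) \<partial>dv) = 0"
proof -
  have l: "bounded_linear (\<lambda>y::(real^3)\<times>real. fst y $ i)" for i
    by (rule bounded_linear_compose[OF bounded_linear_vec_nth bounded_linear_fst])
  have *: "(\<integral>p. h (\<Psi> p) * h (lap V p) - h (V p) * h (lap \<Psi> p) \<partial>dv) = 0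
     \<and> integrable dv (\<lambda>p. h (\<Psi> p) * h (lap V p) - h (V p) * h (lap \<Psi> p))"
    if h: "bounded_linear h" for h :: "(real^3)\<times>real \<Rightarrow> real"
  proof -
    have z: "h (V p) = 0" if "p \<in> topspace X - K" for p
      using assms(4)[OF that] linear_0[OF bounded_linear.linear[OF h]] by simp
    note sm = smooth_map_linear[OF h assms(1)] smooth_map_linear[OF h assms(2)]
    note gi = green_integrand[OF sm assms(3) z]
    have "integrable dv (\<lambda>p. h (\<Psi> p) * lap (\<lambda>p. h (V p)) p - h (V p) * lap (\<lambda>p. h (\<Psi> p)) p)"
      by (rule integrable_compact_support[OF gi(1) assms(3) gi(2)])
    then have "integrable dv (\<lambda>p. h (\<Psi> p) * h (lap V p) - h (V p) * h (lap \<Psi> p))"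
      by (rule Bochner_Integration.integrable_cong[THEN iffD1, OF refl, rotated])
         (simp add: space_dv lap_linear[OF _ h assms(1)] lap_linear[OF _ h assms(2)])
    moreover have "(\<integral>p. h (\<Psi> p) * h (lap V p) - h (V p) * h (lap \<Psi> p) \<partial>dv)
      = (\<integral>p. h (\<Psi> p) * lap (\<lambda>p. h (V p)) p - h (V p) * lap (\<lambda>p. h (\<Psi> p)) p \<partial>dv)"
      by (rule Bochner_Integration.integral_cong)
         (simp_all add: space_dv lap_linear[OF _ h assms(1)] lap_linear[OF _ h assms(2)])
    ultimately show ?thesis using green[OF sm assms(3) z] by simp
  qed
  let ?q = "\<lambda>h p. h (\<Psi> p) * h (lap V p) - h (V p) * h (lap \<Psi> p) :: real"
  note q1 = *[OF l[of 1]] and q2 = *[OF l[of 2]] and q3 = *[OF l[of 3]] and q4 = *[OF bounded_linear_snd]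
  have "(\<integral>p. ambient_form c (\<Psi> p) (lap V p) - ambient_form c (lap \<Psi> p) (V p) \<partial>dv)
    = (\<integral>p. ?q (\<lambda>y. fst y $ 1) p + ?q (\<lambda>y. fst y $ 2) p + c * ?q (\<lambda>y. fst y $ 3) p + ?q snd p \<partial>dv)"
    by (rule Bochner_Integration.integral_cong)
       (simp_all add: ambient_form_def first_form_def algebra_simps)
  also have "\<dots> = 0" using q1 q2 q3 q4 by simp
  finally show ?thesis .
qed

end

section \<open>First variation of the bienergy\<close>

lemma has_vector_derivative_first_arg:
  fixes H :: "real \<times> 'a::real_normed_vector \<Rightarrow> 'b::real_normed_vector"
  assumes "open D" "smooth_on H D" "(s, u) \<in> D"
  shows "((\<lambda>s. H (s, u)) has_vector_derivative dir_deriv (1, 0) H (s, u)) (at s)"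
proof -
  have "((\<lambda>s. (s, u)) has_derivative (\<lambda>r. (r, 0))) (at s)"
    by (auto intro!: derivative_eq_intros)
  from has_derivative_compose[OF this smooth_on_has_derivative[OF assms]]
  have d: "((\<lambda>s. H (s, u)) has_derivative (\<lambda>r. frechet_derivative H (at (s, u)) (r, 0))) (at s)" .
  have q: "frechet_derivative H (at (s, u)) (r, 0) = r *\<^sub>R dir_deriv (1, 0) H (s, u)" for r
  proof -
    have "linear (frechet_derivative H (at (s, u)))"
      by (rule has_derivative_linear[OF smooth_on_has_derivative[OF assms]])
    note l = linear_cmul[OF this, of r "(1, 0)"]
    have "(r, 0) = r *\<^sub>R (1, 0 :: 'a)" by (rule prod_eqI) (simp_all only: fst_conv snd_conv fst_scaleR snd_scaleR
         scaleR_zero_right real_scaleR_def mult_1_right)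
    then show ?thesis using l by (rule ssubst)
  qed
  show ?thesis unfolding has_vector_derivative_def
    by (rule has_derivative_eq_rhs[OF d ext[OF q]])
qed

lemma partial_deriv_second_arg:
  fixes H :: "real \<times> (real^2) \<Rightarrow> 'b::real_normed_vector"
  assumes "open D" "smooth_on H D" "(s, u) \<in> D"
  shows "partial_deriv i (\<lambda>u. H (s, u)) u = dir_deriv (0, axis i 1) H (s, u)"
proof -
  have "((\<lambda>u. (s, u)) has_derivative (\<lambda>r. (0, r))) (at u)"
    by (auto intro!: derivative_eq_intros)
  from partial_deriv_eqI[OF has_derivative_compose[OF this smooth_on_has_derivative[OF assms]]]
  show ?thesis .
qed

lemma partial_deriv2_second_arg:
  fixes H :: "real \<times> (real^2) \<Rightarrow> 'b::real_normed_vector"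
  assumes "open I" "open U" "smooth_on H (I \<times> U)" "s \<in> I" "u \<in> U"
  shows "partial_deriv i (partial_deriv j (\<lambda>u. H (s, u))) u
    = dir_deriv (0, axis i 1) (dir_deriv (0, axis j 1) H) (s, u)"
proof -
  have o: "open (I \<times> U)" using assms by (simp add: open_Times)
  have "partial_deriv i (partial_deriv j (\<lambda>u. H (s, u))) u = partial_deriv i (\<lambda>u. dir_deriv (0, axis j 1) H (s, u)) u"
    by (rule partial_deriv_cong[OF assms(2,5)]) (rule partial_deriv_second_arg[OF o assms(3)], use assms in auto)
  also have "\<dots> = dir_deriv (0, axis i 1) (dir_deriv (0, axis j 1) H) (s, u)"
    by (rule partial_deriv_second_arg[OF o smooth_on_dir_deriv[OF assms(3)]]) (use assms in auto)
  finally show ?thesis .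
qed

lemma smooth_on_slice:
  fixes H :: "real \<times> (real^2) \<Rightarrow> 'b::real_normed_vector"
  assumes "open I" "open U" "smooth_on H (I \<times> U)" "s \<in> I"
  shows "smooth_on (\<lambda>u. H (s, u)) U"
  by (rule smooth_on_compose[OF assms(2) _ assms(3)])
     (use assms in \<open>auto simp: open_Times intro!: smooth_on_Pair smooth_on_const smooth_on_id\<close>)

lemma smooth_on_snd_arg:
  fixes f :: "real^2 \<Rightarrow> 'b::real_normed_vector"
  assumes "open I" "open U" "smooth_on f U"
  shows "smooth_on (\<lambda>z. f (snd z)) (I \<times> U)"
  by (rule smooth_on_compose[OF _ assms(2,3)])
     (use assms in \<open>auto simp: open_Times intro!: smooth_on_snd smooth_on_id\<close>)

text \<open>As a function on the product of the parameter interval with the chart, the Laplacian of a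
  family has smooth coefficients, and the parameter derivative commutes with the derivatives
  along the surface.\<close>

lemma (in immersed_chart) laplacian_family:
  fixes H :: "real \<times> (real^2) \<Rightarrow> 'b::euclidean_space"
  assumes "open I" "smooth_on H (I \<times> U)"
  shows "smooth_on (\<lambda>(s, u). laplacian c \<Phi> (\<lambda>u. H (s, u)) u) (I \<times> U)"
    and "s \<in> I \<Longrightarrow> u \<in> U \<Longrightarrow>
      ((\<lambda>s. laplacian c \<Phi> (\<lambda>u. H (s, u)) u) has_vector_derivative
        laplacian c \<Phi> (\<lambda>u. dir_deriv (1, 0) H (s, u)) u) (at s)"
proof -
  have o: "open (I \<times> U)" using assms openU by (simp add: open_Times)
  let ?D = "\<lambda>i H. dir_deriv (0, axis i 1) H"
  define L where "L H z = (\<Sum>i\<in>UNIV. \<Sum>j\<in>UNIV. G i j (snd z) *\<^sub>R ?D i (?D j H) z)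
     + (\<Sum>k\<in>UNIV. drift c \<Phi> k (snd z) *\<^sub>R ?D k H z)" for H :: "real \<times> (real^2) \<Rightarrow> 'b" and z
  have eq: "laplacian c \<Phi> (\<lambda>u. H (s, u)) u = L H (s, u)" if "smooth_on H (I \<times> U)" "s \<in> I" "u \<in> U" for H s u
    unfolding laplacian_second_order_op second_order_op_def L_def
      partial_deriv2_second_arg[OF assms(1) openU that]
    using partial_deriv_second_arg[OF o that(1), of s u] that by simp
  have sL: "smooth_on (L H) (I \<times> U)"
    unfolding L_def[abs_def]
    by (intro smooth_on_add smooth_on_sum smooth_on_scaleR o smooth_on_dir_deriv assms(2)
      smooth_on_snd_arg[OF assms(1) openU] inverse_metric_smooth drift_smooth)
  show "smooth_on (\<lambda>(s, u). laplacian c \<Phi> (\<lambda>u. H (s, u)) u) (I \<times> U)"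
    using smooth_on_cong[OF o, of "\<lambda>(s, u). laplacian c \<Phi> (\<lambda>u. H (s, u)) u" "L H"] eq[OF assms(2)] sL by auto
  assume s: "s \<in> I" and u: "u \<in> U"
  let ?T = "dir_deriv (1, 0) H"
  have sT: "smooth_on ?T (I \<times> U)" by (rule smooth_on_dir_deriv[OF assms(2)])
  have c1: "dir_deriv (1, 0) (?D k H) z = ?D k ?T z" if "z \<in> I \<times> U" for k z
    by (rule dir_deriv_commute[OF o assms(2) that])
  have c2: "dir_deriv (1, 0) (?D i (?D j H)) z = ?D i (?D j ?T) z" if "z \<in> I \<times> U" for i j z
  proof -
    have "dir_deriv (1, 0) (?D i (?D j H)) z = ?D i (dir_deriv (1, 0) (?D j H)) z"
      by (rule dir_deriv_commute[OF o smooth_on_dir_deriv[OF assms(2)] that])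
    also have "\<dots> = ?D i (?D j ?T) z"
      by (rule arg_cong[where f="\<lambda>h. h _"], rule frechet_derivative_cong_open[OF o that c1])
    finally show ?thesis .
  qed
  have su: "(s, u) \<in> I \<times> U" using s u by simp
  have "((\<lambda>s. L H (s, u)) has_vector_derivative L ?T (s, u)) (at s)"
    unfolding L_def snd_conv c1[OF su, symmetric] c2[OF su, symmetric]
    by (intro has_vector_derivative_add has_vector_derivative_sum
        bounded_linear.has_vector_derivative[OF bounded_linear_scaleR_right]
        has_vector_derivative_first_arg[OF o _ su] smooth_on_dir_deriv assms(2))
  then have "((\<lambda>s. laplacian c \<Phi> (\<lambda>u. H (s, u)) u) has_vector_derivative L ?T (s, u)) (at s)"
    by (rule has_vector_derivative_transform_within_open[OF _ assms(1) s]) (use eq[OF assms(2) _ u] in simp)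
  then show "((\<lambda>s. laplacian c \<Phi> (\<lambda>u. H (s, u)) u) has_vector_derivative laplacian c \<Phi> (\<lambda>u. ?T (s, u)) u) (at s)"
    unfolding eq[OF sT s u] .
qed

context surface
begin

text \<open>In a coordinate ball the values are taken on a compact set: the product of the closed ball
  with the closed half of the parameter interval.\<close>

lemma compact_bound:
  assumes "compactin X K" "(e::real) > 0"
    and "\<And>U x. (U, x) \<in> A \<Longrightarrow> continuous_on ({-e<..<e} \<times> U) (\<lambda>(s, u). h s (x u))"
  obtains B where "\<And>s p. \<bar>s\<bar> < e / 2 \<Longrightarrow> p \<in> K \<Longrightarrow> \<bar>h s p\<bar> \<le> (B :: real)"
proof -
  obtain I where I: "finite I" "K \<subseteq> (\<Union>(U, x, a, r)\<in>I. x ` ball a r)"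
    "\<And>U x a r. (U, x, a, r) \<in> I \<Longrightarrow> (U, x) \<in> A \<and> r > 0 \<and> cball a r \<subseteq> U"
    by (rule compact_chart_balls[OF assms(1)]) (rule that)
  let ?w = "\<lambda>(U, x, a, r). x ` ball a r"
  have "\<exists>B. \<forall>s p. \<bar>s\<bar> < e / 2 \<longrightarrow> p \<in> ?w i \<longrightarrow> \<bar>h s p\<bar> \<le> B" if iI: "i \<in> I" for i
  proof -
    obtain U x a r where i: "i = (U, x, a, r)" by (cases i)
    have *: "(U, x) \<in> A" "r > 0" "cball a r \<subseteq> U" using I(3) iI i by auto
    have sub: "{-e/2..e/2} \<times> cball a r \<subseteq> {-e<..<e} \<times> U" using *(3) assms(2) by auto
    have "bounded ((\<lambda>(s, u). h s (x u)) ` ({-e/2..e/2} \<times> cball a r))"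
      by (intro compact_imp_bounded compact_continuous_image continuous_on_subset[OF assms(3)[OF *(1)] sub]
          compact_Times compact_Icc compact_cball)
    then obtain B where B: "\<And>z. z \<in> {-e/2..e/2} \<times> cball a r \<Longrightarrow> \<bar>case z of (s, u) \<Rightarrow> h s (x u)\<bar> \<le> B"
      unfolding bounded_iff by (metis imageI real_norm_def)
    have "\<bar>h s p\<bar> \<le> B" if s: "\<bar>s\<bar> < e / 2" and p: "p \<in> ?w i" for s p
    proof -
      obtain u where u: "u \<in> ball a r" "p = x u" using p i by auto
      have "(s, u) \<in> {-e/2..e/2} \<times> cball a r"
        using s subsetD[OF ball_subset_cball u(1)] by (simp add: abs_less_iff) linarith
      then show ?thesis using B[of "(s, u)"] u(2) by simp
    qed
    then show ?thesis by blast
  qed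
  then obtain B where B: "\<And>i s p. i \<in> I \<Longrightarrow> \<bar>s\<bar> < e / 2 \<Longrightarrow> p \<in> ?w i \<Longrightarrow> \<bar>h s p\<bar> \<le> B i" by metis
  show thesis
  proof (rule that[of "\<Sum>i\<in>I. \<bar>B i\<bar>"])
    fix s p assume s: "\<bar>s\<bar> < e / 2" and "p \<in> K"
    then obtain i where i: "i \<in> I" "p \<in> ?w i" using I(2) by blast
    have "\<bar>h s p\<bar> \<le> \<bar>B i\<bar>" using B[OF i(1) s i(2)] by linarith
    also have "\<dots> \<le> (\<Sum>i\<in>I. \<bar>B i\<bar>)" using i(1) I(1) by (intro member_le_sum) auto
    finally show "\<bar>h s p\<bar> \<le> (\<Sum>i\<in>I. \<bar>B i\<bar>)" .
  qed
qed

end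

text \<open>The hypotheses of dominated convergence hold because the parameter derivative is bounded on
  the compact set.\<close>

lemma (in measured_surface) integral_over_compact_has_derivative:
  fixes H :: "real \<Rightarrow> 'm \<Rightarrow> real"
  assumes "compactin X K" "e > 0"
    and sm: "\<And>U x. (U, x) \<in> A \<Longrightarrow> smooth_on (\<lambda>(s, u). H s (x u)) ({-e<..<e} \<times> U)"
    and der: "\<And>p. p \<in> topspace X \<Longrightarrow> ((\<lambda>s. H s p) has_real_derivative H' p) (at 0)"
  shows "((\<lambda>s. LINT p:K|dv. H s p) has_real_derivative (LINT p:K|dv. H' p)) (at 0)"
proof -
  have oI: "open {-e<..<e}" by auto
  define D where "D s p = vector_derivative (\<lambda>s. H s p) (at s)" for s p
  have chart: "((\<lambda>s. H s (x u)) has_vector_derivative dir_deriv (1, 0) (\<lambda>(s, u). H s (x u)) (s, u)) (at s)"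
    "D s (x u) = dir_deriv (1, 0) (\<lambda>(s, u). H s (x u)) (s, u)"
    if "(U, x) \<in> A" "u \<in> U" "s \<in> {-e<..<e}" for U x u s
  proof -
    have o: "open ({-e<..<e} \<times> U)" using chart_open[OF that(1)] by (simp add: open_Times)
    show *: "((\<lambda>s. H s (x u)) has_vector_derivative dir_deriv (1, 0) (\<lambda>(s, u). H s (x u)) (s, u)) (at s)"
      using has_vector_derivative_first_arg[OF o sm[OF that(1)], of s u] that by simp
    show "D s (x u) = dir_deriv (1, 0) (\<lambda>(s, u). H s (x u)) (s, u)"
      unfolding D_def by (rule vector_derivative_at[OF *])
  qed
  have derD: "((\<lambda>s. H s p) has_real_derivative D s p) (at s)" if p: "p \<in> topspace X" and se: "\<bar>s\<bar> < e" for p s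
  proof -
    obtain U x u where *: "(U, x) \<in> A" "u \<in> U" "p = x u" using chart_cover[OF p] .
    have s: "s \<in> {-e<..<e}" using se by auto
    show ?thesis using chart[OF *(1,2) s] unfolding *(3) by (simp add: has_real_derivative_iff_has_vector_derivative)
  qed
  have D0: "D 0 p = H' p" if "p \<in> topspace X" for p
    using DERIV_unique[OF derD[OF that, of 0] der[OF that]] assms(2) by simp
  have "continuous_on ({-e<..<e} \<times> U) (\<lambda>(s, u). D s (x u))" if Ux: "(U, x) \<in> A" for U x
    using smooth_on_continuous[OF smooth_on_dir_deriv[OF sm[OF Ux]], of "(1, 0)"] chart(2)[OF Ux]
    by (subst continuous_on_cong[OF refl, where g="dir_deriv (1, 0) (\<lambda>(s, u). H s (x u))"]) auto
  then obtain B where B: "\<And>s p. \<bar>s\<bar> < e / 2 \<Longrightarrow> p \<in> K \<Longrightarrow> \<bar>D s p\<bar> \<le> B"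
    using compact_bound[OF assms(1,2), of D] by blast
  have K: "K \<in> sets dv" "K \<subseteq> topspace X"
    using closed_in_sets[OF compact_closed[OF assms(1)]] compactin_subset_topspace[OF assms(1)] by auto
  have "smooth_map A (H s)" if "\<bar>s\<bar> < e" for s
  proof (rule smooth_mapI)
    fix U x assume Ux: "(U, x) \<in> A"
    show "smooth_on (\<lambda>u. H s (x u)) U"
      using smooth_on_slice[OF oI chart_open[OF Ux] sm[OF Ux], of s] that by (auto simp: abs_less_iff)
  qed
  then have int: "integrable dv (\<lambda>p. indicator K p *\<^sub>R H s p)" if "\<bar>s\<bar> < e" for s
    using integrable_on_compact[OF smooth_map_continuous assms(1)] that by blast
  have "((\<lambda>s. \<integral>p. indicator K p *\<^sub>R H s p \<partial>dv) has_real_derivative (\<integral>p. indicator K p *\<^sub>R D 0 p \<partial>dv)) (at 0)"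
  proof (rule integral_has_derivative_dominated(2)[of "e / 2" dv "\<lambda>s p. indicator K p *\<^sub>R H s p"
        "\<lambda>s p. indicator K p *\<^sub>R D s p" "\<lambda>p. indicator K p *\<^sub>R \<bar>B\<bar>"])
    show "e / 2 > 0" using assms(2) by simp
    show "integrable dv (\<lambda>p. indicator K p *\<^sub>R H s p)" if "\<bar>s\<bar> < e / 2" for s
      by (rule int) (use that assms(2) in linarith)
    show "((\<lambda>s. indicator K p *\<^sub>R H s p) has_real_derivative indicator K p *\<^sub>R D s p) (at s)"
      if "\<bar>s\<bar> < e / 2" "p \<in> space dv" for s p
      unfolding real_scaleR_def by (rule DERIV_cmult[OF derD]) (use that assms(2) space_dv in auto)
    show "\<bar>indicator K p *\<^sub>R D s p\<bar> \<le> indicator K p *\<^sub>R \<bar>B\<bar>" if "\<bar>s\<bar> < e / 2" "p \<in> space dv" for s p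
      using B[OF that(1), of p] by (auto simp: indicator_def intro: order_trans)
    show "integrable dv (\<lambda>p. indicator K p *\<^sub>R \<bar>B\<bar>)"
      by (rule integrable_on_compact[OF _ assms(1)]) simp
  qed
  moreover have "(\<integral>p. indicator K p *\<^sub>R D 0 p \<partial>dv) = (\<integral>p. indicator K p *\<^sub>R H' p \<partial>dv)"
    by (rule Bochner_Integration.integral_cong) (auto simp: space_dv D0)
  ultimately show ?thesis unfolding set_lebesgue_integral_def by simp
qed

context surface
begin

lemma variation_chart:
  assumes "smooth_variation c X A \<phi> K e F" "e > 0" "(U, x) \<in> A" "u \<in> U"
    and "((\<lambda>s. F s (x u)) has_vector_derivative V) (at 0)"
  shows "V = dir_deriv (1, 0) (\<lambda>(s, u). F s (x u)) (0, u)"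
proof -
  have o: "open ({-e<..<e} \<times> U)" using chart_open[OF assms(3)] by (simp add: open_Times)
  have "smooth_on (\<lambda>(s, u). F s (x u)) ({-e<..<e} \<times> U)"
    using assms(1,3) unfolding smooth_variation_def by fast
  from has_vector_derivative_first_arg[OF o this, of 0 u] assms(2,4)
  have "((\<lambda>s. F s (x u)) has_vector_derivative dir_deriv (1, 0) (\<lambda>(s, u). F s (x u)) (0, u)) (at 0)" by simp
  then show ?thesis using assms(5) vector_derivative_unique_at by blast
qed

lemma variation_field:
  assumes "smooth_variation c X A \<phi> K e F" "e > 0"
    and V: "\<And>p. p \<in> topspace X \<Longrightarrow> ((\<lambda>s. F s p) has_vector_derivative V p) (at 0)"
  shows "smooth_map A V" "\<And>p. p \<in> topspace X - K \<Longrightarrow> V p = 0"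
proof -
  show "smooth_map A V"
  proof (rule smooth_mapI)
    fix U x assume Ux: "(U, x) \<in> A"
    have oI: "open {-e<..<e}" by auto
    have "smooth_on (\<lambda>(s, u). F s (x u)) ({-e<..<e} \<times> U)"
      using assms(1) Ux unfolding smooth_variation_def by fast
    from smooth_on_slice[OF oI chart_open[OF Ux] smooth_on_dir_deriv[OF this], of 0 "(1, 0)"]
    have "smooth_on (\<lambda>u. dir_deriv (1, 0) (\<lambda>(s, u). F s (x u)) (0, u)) U" using assms(2) by simp
    moreover have "V (x u) = dir_deriv (1, 0) (\<lambda>(s, u). F s (x u)) (0, u)" if "u \<in> U" for u
      by (rule variation_chart[OF assms(1,2) Ux that V[OF chart_in[OF Ux that]]])
    ultimately show "smooth_on (\<lambda>u. V (x u)) U"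
      using smooth_on_cong[OF chart_open[OF Ux], of "\<lambda>u. V (x u)"] by simp
  qed
  fix p assume p: "p \<in> topspace X - K"
  have "((\<lambda>s. \<phi> p) has_vector_derivative 0) (at 0)" by simp
  then have "((\<lambda>s. F s p) has_vector_derivative 0) (at 0)"
    by (rule has_vector_derivative_transform_within_open[where S="{-e<..<e}"])
       (use assms(1,2) p in \<open>auto simp: smooth_variation_def\<close>)
  then show "V p = 0" using V[of p] p vector_derivative_unique_at by blast
qed

end

text \<open>The integrand of the first variation: half the derivative of \<open>|\<Delta>F|\<^sup>2 - c \<langle>\<Delta>F\<^sub>1, F\<^sub>1\<rangle>\<^sup>2\<close> at a
  point, where \<open>y\<close> and \<open>l\<close> are the values of the immersion and of its Laplacian, and \<open>v\<close> and \<open>w\<close>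
  those of the variation field and of its Laplacian.\<close>

definition bienergy_derivative ::
  "real \<Rightarrow> (real^3) \<times> real \<Rightarrow> (real^3) \<times> real \<Rightarrow> (real^3) \<times> real \<Rightarrow> (real^3) \<times> real \<Rightarrow> real" where
  "bienergy_derivative c y l v w = ambient_form c l w - c * first_form c (fst l) (fst y) *
     (first_form c (fst w) (fst y) + first_form c (fst l) (fst v))"

text \<open>The square of the tension field is a polynomial in \<open>\<Delta>F\<close> and \<open>F\<close>, and the Laplacian acts on the
  variation field since the metric does not vary. The integral extends over the whole surface
  because the variation field vanishes outside \<open>K\<close>.\<close>

lemma (in measured_surface) first_variation:
  assumes K: "compactin X K" and e: "e > 0" and F: "smooth_variation c X A \<phi> K e F"
    and V: "\<And>p. p \<in> topspace X \<Longrightarrow> ((\<lambda>s. F s p) has_vector_derivative V p) (at 0)"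
  shows "((\<lambda>s. bienergy c A \<phi> dv K (F s)) has_real_derivative
      (\<integral>p. bienergy_derivative c (\<phi> p) (lap \<phi> p) (V p) (lap V p) \<partial>dv)) (at 0)"
proof -
  let ?I = "{-e<..<e}"
  have oI: "open ?I" by auto
  have Vs: "smooth_map A V" "\<And>p. p \<in> topspace X - K \<Longrightarrow> V p = 0"
    using variation_field[OF F e, of V] V by auto
  have FX: "F s p \<in> product_space c" if "s \<in> ?I" "p \<in> topspace X" for s p
    using F that unfolding smooth_variation_def by blast
  have F0: "F 0 p = \<phi> p" if "p \<in> topspace X" for p
    using F that unfolding smooth_variation_def by blast
  have Fs: "smooth_on (\<lambda>(s, u). F s (x u)) (?I \<times> U)" if "(U, x) \<in> A" for U x
    using F that unfolding smooth_variation_def by fast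
  have Fsm: "smooth_map A (F s)" if "s \<in> ?I" for s
  proof (rule smooth_mapI)
    fix U x assume Ux: "(U, x) \<in> A"
    show "smooth_on (\<lambda>u. F s (x u)) U"
      using smooth_on_slice[OF oI chart_open[OF Ux] Fs[OF Ux] that] by simp
  qed
  define T where "T s p = ambient_form c (lap (F s) p) (lap (F s) p)
    - c * (first_form c (fst (lap (F s) p)) (fst (F s p)))\<^sup>2" for s p
  have tens: "ambient_form c (tension_field c A \<phi> (F s) p) (tension_field c A \<phi> (F s) p) = T s p"
    if "s \<in> ?I" "p \<in> topspace X" for s p
  proof -
    have "tension_field c A \<phi> (F s) p = tangent_proj c (F s p) (lap (F s) p)"
      by (rule tension_lap[OF that(2) Fsm[OF that(1)]]) (rule FX[OF that(1)])
    then show ?thesis unfolding T_def using tangent_proj_square[OF c FX[OF that]] by simp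
  qed
  have lapF: "lap (F s) (x u) = laplacian c (\<phi> \<circ> x) (\<lambda>u. (\<lambda>(s, u). F s (x u)) (s, u)) u"
    if "(U, x) \<in> A" "u \<in> U" "s \<in> ?I" for U x u s
    using lap_chart[OF that(1,2) Fsm[OF that(3)]] by (simp add: comp_def)
  have Ts: "smooth_on (\<lambda>(s, u). T s (x u)) (?I \<times> U)" if Ux: "(U, x) \<in> A" for U x
  proof -
    interpret immersed_chart c "\<phi> \<circ> x" U by (rule immersed_chart[OF Ux])
    have o: "open (?I \<times> U)" using openU by (simp add: open_Times)
    have l: "smooth_on (\<lambda>(s, u). lap (F s) (x u)) (?I \<times> U)"
      using laplacian_family(1)[OF oI Fs[OF Ux]] lapF[OF Ux]
        smooth_on_cong[OF o, of "\<lambda>(s, u). lap (F s) (x u)"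
          "\<lambda>(s, u). laplacian c (\<phi> \<circ> x) (\<lambda>u. (\<lambda>(s, u). F s (x u)) (s, u)) u"] by auto
    have "smooth_on (\<lambda>z. ambient_form c ((\<lambda>(s, u). lap (F s) (x u)) z) ((\<lambda>(s, u). lap (F s) (x u)) z)
      - c * (first_form c (fst ((\<lambda>(s, u). lap (F s) (x u)) z)) (fst ((\<lambda>(s, u). F s (x u)) z))
        * first_form c (fst ((\<lambda>(s, u). lap (F s) (x u)) z)) (fst ((\<lambda>(s, u). F s (x u)) z)))) (?I \<times> U)"
      by (intro smooth_on_diff smooth_on_mult smooth_on_const o l Fs[OF Ux] smooth_on_fst
          smooth_on_bilinear[OF bounded_bilinear_ambient_form] smooth_on_bilinear[OF bounded_bilinear_first_form])
    then show ?thesis by (simp add: T_def case_prod_unfold power2_eq_square)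
  qed
  have Td: "((\<lambda>s. T s p) has_real_derivative 2 * bienergy_derivative c (\<phi> p) (lap \<phi> p) (V p) (lap V p)) (at 0)"
    if p: "p \<in> topspace X" for p
  proof -
    obtain U x u where *: "(U, x) \<in> A" "u \<in> U" "p = x u" using chart_cover[OF p] .
    interpret immersed_chart c "\<phi> \<circ> x" U by (rule immersed_chart[OF *(1)])
    have 0: "0 \<in> ?I" using e by simp
    have Veq: "V (x w) = dir_deriv (1, 0) (\<lambda>(s, u). F s (x u)) (0, w)" if "w \<in> U" for w
      by (rule variation_chart[OF F e *(1) that V[OF chart_in[OF *(1) that]]])
    have "laplacian c (\<phi> \<circ> x) (\<lambda>u. dir_deriv (1, 0) (\<lambda>(s, u). F s (x u)) (0, u)) u = lap V p"
      unfolding *(3) lap_chart[OF *(1,2) Vs(1)]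
      by (rule laplacian_cong[OF openU *(2)]) (use Veq in auto)
    with laplacian_family(2)[OF oI Fs[OF *(1)] 0 *(2)]
    have "((\<lambda>s. laplacian c (\<phi> \<circ> x) (\<lambda>u. (\<lambda>(s, u). F s (x u)) (s, u)) u) has_vector_derivative lap V p) (at 0)"
      by simp
    then have dl: "((\<lambda>s. lap (F s) p) has_vector_derivative lap V p) (at 0)"
      by (rule has_vector_derivative_transform_within_open[OF _ oI 0]) (use lapF[OF *(1,2)] *(3) in simp)
    have l0: "lap (F 0) p = lap \<phi> p"
      by (rule lap_local[OF openin_topspace p Fsm[OF 0] \<phi>_smooth F0])
    have dlf: "((\<lambda>s. fst (lap (F s) p)) has_vector_derivative fst (lap V p)) (at 0)"
      by (rule bounded_linear.has_vector_derivative[OF bounded_linear_fst dl])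
    have dff: "((\<lambda>s. fst (F s p)) has_vector_derivative fst (V p)) (at 0)"
      by (rule bounded_linear.has_vector_derivative[OF bounded_linear_fst V[OF p]])
    have a: "((\<lambda>s. ambient_form c (lap (F s) p) (lap (F s) p)) has_vector_derivative
        (ambient_form c (lap (F 0) p) (lap V p) + ambient_form c (lap V p) (lap (F 0) p))) (at 0)"
      by (rule bounded_bilinear.has_vector_derivative[OF bounded_bilinear_ambient_form dl dl])
    have b: "((\<lambda>s. first_form c (fst (lap (F s) p)) (fst (F s p))) has_vector_derivative
        (first_form c (fst (lap (F 0) p)) (fst (V p)) + first_form c (fst (lap V p)) (fst (F 0 p)))) (at 0)"
      by (rule bounded_bilinear.has_vector_derivative[OF bounded_bilinear_first_form dlf dff])
    let ?k = "first_form c (fst (lap \<phi> p)) (fst (\<phi> p))"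
    have "((\<lambda>s. T s p) has_real_derivative
       (ambient_form c (lap (F 0) p) (lap V p) + ambient_form c (lap V p) (lap (F 0) p)
        - c * (2 * ?k * (first_form c (fst (lap (F 0) p)) (fst (V p)) + first_form c (fst (lap V p)) (fst (F 0 p)))))) (at 0)"
      unfolding T_def[abs_def] power2_eq_square
      by (rule DERIV_cong[OF DERIV_diff[OF a[unfolded has_real_derivative_iff_has_vector_derivative[symmetric]]
          DERIV_cmult[OF DERIV_mult[OF b[unfolded has_real_derivative_iff_has_vector_derivative[symmetric]]
            b[unfolded has_real_derivative_iff_has_vector_derivative[symmetric]]]]]])
         (simp add: l0 F0[OF p] algebra_simps)
    then show ?thesis
      unfolding bienergy_derivative_def l0 F0[OF p] ambient_form_commute[of c "lap V p"]
      by (simp add: algebra_simps)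
  qed
  have D: "((\<lambda>s. (LINT p:K|dv. T s p) / 2) has_real_derivative
    (LINT p:K|dv. 2 * bienergy_derivative c (\<phi> p) (lap \<phi> p) (V p) (lap V p)) / 2) (at 0)"
    by (rule DERIV_cdivide[OF integral_over_compact_has_derivative[OF K e Ts Td]])
  have KX: "K \<subseteq> topspace X" by (rule compactin_subset_topspace[OF K])
  have bi: "bienergy c A \<phi> dv K (F s) = (LINT p:K|dv. T s p) / 2" if "s \<in> ?I" for s
  proof -
    have "(LINT p:K|dv. ambient_form c (tension_field c A \<phi> (F s) p) (tension_field c A \<phi> (F s) p)) = (LINT p:K|dv. T s p)"
      unfolding set_lebesgue_integral_def
      by (rule Bochner_Integration.integral_cong) (use tens[OF that] space_dv in auto)
    then show ?thesis unfolding bienergy_def by simp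
  qed
  have "(LINT p:K|dv. 2 * bienergy_derivative c (\<phi> p) (lap \<phi> p) (V p) (lap V p)) / 2
    = (\<integral>p. bienergy_derivative c (\<phi> p) (lap \<phi> p) (V p) (lap V p) \<partial>dv)"
  proof -
    have "bienergy_derivative c (\<phi> p) (lap \<phi> p) (V p) (lap V p) = 0" if "p \<in> topspace X - K" for p
      using lap_zero_outside[OF K Vs that] Vs(2)[OF that]
      by (simp add: bienergy_derivative_def ambient_form_simps first_form_simps)
    then have "(LINT p:K|dv. 2 * bienergy_derivative c (\<phi> p) (lap \<phi> p) (V p) (lap V p))
      = (\<integral>p. 2 * bienergy_derivative c (\<phi> p) (lap \<phi> p) (V p) (lap V p) \<partial>dv)"
      unfolding set_lebesgue_integral_def
      by (intro Bochner_Integration.integral_cong) (auto simp: space_dv indicator_def)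
    then show ?thesis by simp
  qed
  with D have D': "((\<lambda>s. (LINT p:K|dv. T s p) / 2) has_real_derivative
    (\<integral>p. bienergy_derivative c (\<phi> p) (lap \<phi> p) (V p) (lap V p) \<partial>dv)) (at 0)" by simp
  show ?thesis
    by (rule has_field_derivative_transform_within_open[OF D' oI]) (use e bi in auto)
qed

section \<open>Existence of the area measure\<close>

text \<open>Change of variables for sets. The density is integrable exactly if the image has finite
  measure, so both sides are infinite at the same time.\<close>

lemma emeasure_diffeomorphic_image:
  fixes \<tau> :: "real^2 \<Rightarrow> real^2"
  assumes E: "E \<in> sets borel" and im: "\<tau> ` E \<in> sets borel" and inj: "inj_on \<tau> E"
    and der: "\<And>v. v \<in> E \<Longrightarrow> (\<tau> has_derivative \<tau>' v) (at v)"
    and meas: "(\<lambda>v. indicator E v *\<^sub>R \<bar>det (matrix (\<tau>' v))\<bar>) \<in> borel_measurable borel"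
  shows "emeasure lborel (\<tau> ` E) = (\<integral>\<^sup>+v\<in>E. ennreal \<bar>det (matrix (\<tau>' v))\<bar> \<partial>lborel)"
proof -
  let ?d = "\<lambda>v. \<bar>det (matrix (\<tau>' v))\<bar>"
  have El: "E \<in> sets lebesgue" using E by auto
  have der': "(\<tau> has_derivative \<tau>' v) (at v within E)" if "v \<in> E" for v
    using der[OF that] by (rule has_derivative_at_withinI)
  have eml: "emeasure lebesgue (\<tau> ` E) = emeasure lborel (\<tau> ` E)" using im by simp
  note H = has_measure_differentiable_image[OF El der' inj]
  show ?thesis
  proof (cases "?d integrable_on E")
    case True
    then obtain r where r: "(?d has_integral r) E" by (auto simp: integrable_on_def)
    then have lm: "\<tau> ` E \<in> lmeasurable" "measure lebesgue (\<tau> ` E) = r" using H[of r] by auto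
    have "emeasure lborel (\<tau> ` E) = ennreal r"
      using emeasure_eq_measure2[OF lm(1)] lm(2) eml by simp
    also have "\<dots> = (\<integral>\<^sup>+v\<in>E. ennreal (?d v) \<partial>lborel)"
      by (rule nn_integral_has_integral_lebesgue'[OF _ r, symmetric]) simp
    finally show ?thesis .
  next
    case False
    have "emeasure lborel (\<tau> ` E) = \<infinity>"
    proof (rule ccontr)
      assume "emeasure lborel (\<tau> ` E) \<noteq> \<infinity>"
      then have "\<tau> ` E \<in> lmeasurable"
        using im eml by (intro fmeasurableI) (auto simp: less_top)
      then show False using H[of "measure lebesgue (\<tau> ` E)"] False by (auto simp: integrable_on_def)
    qed
    moreover have "(\<integral>\<^sup>+v\<in>E. ennreal (?d v) \<partial>lborel) = \<infinity>"
    proof (rule ccontr)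
      assume n: "(\<integral>\<^sup>+v\<in>E. ennreal (?d v) \<partial>lborel) \<noteq> \<infinity>"
      have e: "(\<integral>\<^sup>+v. ennreal (indicator E v *\<^sub>R ?d v) \<partial>lborel) = (\<integral>\<^sup>+v\<in>E. ennreal (?d v) \<partial>lborel)"
        by (rule nn_integral_cong) (auto simp: indicator_def)
      define r where "r = enn2real (\<integral>\<^sup>+v\<in>E. ennreal (?d v) \<partial>lborel)"
      have "((\<lambda>v. indicator E v *\<^sub>R ?d v) has_integral r) UNIV"
        by (rule nn_integral_has_integral) (use meas n e in \<open>auto simp: r_def less_top\<close>)
      moreover have "(\<lambda>v. indicator E v *\<^sub>R ?d v) = (\<lambda>v. if v \<in> E then ?d v else 0)" by auto
      ultimately have "(?d has_integral r) E" by (simp add: has_integral_restrict_UNIV)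
      then show False using False by (auto simp: integrable_on_def)
    qed
    ultimately show ?thesis by simp
  qed
qed

text \<open>Change of variables for nonnegative functions: an equality of two measures that is checked on
  sets.\<close>

lemma nn_integral_diffeomorphic_image:
  fixes \<tau> :: "real^2 \<Rightarrow> real^2" and \<rho> :: "real^2 \<Rightarrow> ennreal"
  assumes V: "open V" and T: "\<tau> ` V \<in> sets borel" and inj: "inj_on \<tau> V" and sm: "smooth_on \<tau> V"
    and E: "E \<in> sets borel" "E \<subseteq> V" "\<tau> ` E \<in> sets borel" and \<rho>: "(\<lambda>u. \<rho> u * indicator (\<tau> ` V) u) \<in> borel_measurable borel"
  shows "(\<integral>\<^sup>+u\<in>\<tau> ` E. \<rho> u \<partial>lborel)
    = (\<integral>\<^sup>+v\<in>E. ennreal \<bar>det (matrix (frechet_derivative \<tau> (at v)))\<bar> * \<rho> (\<tau> v) \<partial>lborel)"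
proof -
  let ?d = "\<lambda>v. \<bar>det (matrix (frechet_derivative \<tau> (at v)))\<bar>"
  have der: "(\<tau> has_derivative frechet_derivative \<tau> (at v)) (at v)" if "v \<in> V" for v
    by (rule smooth_on_has_derivative[OF V sm that])
  have cd: "continuous_on V ?d"
  proof -
    have "matrix (frechet_derivative \<tau> (at v)) $ i $ j = partial_deriv j \<tau> v $ i" for v i j
      by (simp add: matrix_def partial_deriv_def)
    then have "?d = (\<lambda>v. \<bar>partial_deriv 1 \<tau> v $ 1 * partial_deriv 2 \<tau> v $ 2 - partial_deriv 2 \<tau> v $ 1 * partial_deriv 1 \<tau> v $ 2\<bar>)"
      by (simp add: det_2)
    then show ?thesis
      by (simp only:) (intro continuous_intros smooth_on_continuous[OF smooth_on_nth[OF V smooth_on_partial_deriv[OF sm]]])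
  qed
  define t where "t v = indicator V v *\<^sub>R \<tau> v" for v
  have t: "t \<in> borel_measurable borel"
    unfolding t_def[abs_def]
    by (rule borel_measurable_continuous_on_indicator) (use V smooth_on_continuous[OF sm] in auto)
  define d where "d v = indicator V v *\<^sub>R ?d v" for v
  have d: "d \<in> borel_measurable borel"
    unfolding d_def[abs_def] by (rule borel_measurable_continuous_on_indicator) (use V cd in auto)
  have eq: "distr (density lborel (\<lambda>v. ennreal (d v))) borel t = density lborel (indicator (\<tau> ` V))"
  proof (rule measure_eqI)
    fix B assume "B \<in> sets (distr (density lborel (\<lambda>v. ennreal (d v))) borel t)"
    then have B: "B \<in> sets borel" by simp
    define C where "C = t -` B \<inter> V"
    have tB: "t -` B \<in> sets borel" using measurable_sets[OF t B] by simp
    have C: "C \<in> sets borel" unfolding C_def using tB V by auto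
    have im: "\<tau> ` C = B \<inter> \<tau> ` V" by (auto simp: C_def t_def)
    have "emeasure (distr (density lborel (\<lambda>v. ennreal (d v))) borel t) B = emeasure (density lborel (\<lambda>v. ennreal (d v))) (t -` B)"
      using emeasure_distr[of t "density lborel (\<lambda>v. ennreal (d v))" borel B] t B by simp
    also have "\<dots> = (\<integral>\<^sup>+v. ennreal (d v) * indicator (t -` B) v \<partial>lborel)"
      by (rule emeasure_density) (use d tB in auto)
    also have "\<dots> = (\<integral>\<^sup>+v\<in>C. ennreal (?d v) \<partial>lborel)"
      by (rule nn_integral_cong) (auto simp: d_def C_def indicator_def)
    also have "\<dots> = emeasure lborel (\<tau> ` C)"
    proof (rule emeasure_diffeomorphic_image[symmetric, OF C])
      show "\<tau> ` C \<in> sets borel" unfolding im using B T by auto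
      show "inj_on \<tau> C" by (rule inj_on_subset[OF inj]) (auto simp: C_def)
      show "(\<tau> has_derivative frechet_derivative \<tau> (at v)) (at v)" if "v \<in> C" for v
        by (rule der) (use that in \<open>auto simp: C_def\<close>)
      have "(\<lambda>v. indicator C v *\<^sub>R d v) \<in> borel_measurable borel"
        using C d by simp
      moreover have "(\<lambda>v. indicator C v *\<^sub>R d v) = (\<lambda>v. indicator C v *\<^sub>R ?d v)"
        by (auto simp: d_def C_def indicator_def)
      ultimately show "(\<lambda>v. indicator C v *\<^sub>R ?d v) \<in> borel_measurable borel" by simp
    qed
    also have "\<dots> = (\<integral>\<^sup>+u. indicator (B \<inter> \<tau> ` V) u \<partial>lborel)"
      unfolding im using B T by simp
    also have "\<dots> = (\<integral>\<^sup>+u. indicator (\<tau> ` V) u * indicator B u \<partial>lborel)"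
      by (rule nn_integral_cong) (auto simp: indicator_def)
    also have "\<dots> = emeasure (density lborel (indicator (\<tau> ` V))) B"
      by (rule emeasure_density[symmetric]) (use B T in auto)
    finally show "emeasure (distr (density lborel (\<lambda>v. ennreal (d v))) borel t) B
      = emeasure (density lborel (indicator (\<tau> ` V))) B" .
  qed simp
  define f where "f u = \<rho> u * indicator (\<tau> ` V) u * indicator (\<tau> ` E) u" for u
  have f: "f \<in> borel_measurable borel" unfolding f_def[abs_def] using \<rho> E(3) by simp
  have "(\<integral>\<^sup>+u\<in>\<tau> ` E. \<rho> u \<partial>lborel) = (\<integral>\<^sup>+u. indicator (\<tau> ` V) u * f u \<partial>lborel)"
    by (rule nn_integral_cong) (use E(2) in \<open>auto simp: f_def indicator_def\<close>)
  also have "\<dots> = integral\<^sup>N (density lborel (indicator (\<tau> ` V))) f"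
    by (rule nn_integral_density[symmetric]) (use f T in auto)
  also have "\<dots> = integral\<^sup>N (density lborel (\<lambda>v. ennreal (d v))) (\<lambda>v. f (t v))"
    unfolding eq[symmetric] by (rule nn_integral_distr) (use t f in auto)
  also have "\<dots> = (\<integral>\<^sup>+v. ennreal (d v) * f (t v) \<partial>lborel)"
    by (rule nn_integral_density) (use d measurable_compose[OF t f] in auto)
  also have "\<dots> = (\<integral>\<^sup>+v\<in>E. ennreal (?d v) * \<rho> (\<tau> v) \<partial>lborel)"
  proof (rule nn_integral_cong)
    fix v
    have "v \<in> E" if "v \<in> V" "\<tau> v \<in> \<tau> ` E" using that inj E(2) by (meson inj_on_image_mem_iff)
    then show "ennreal (d v) * f (t v) = ennreal (?d v) * \<rho> (\<tau> v) * indicator E v"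
      using E(2) by (cases "v \<in> V"; cases "v \<in> E") (auto simp: d_def t_def f_def indicator_def)
  qed
  finally show ?thesis .
qed

text \<open>The metric transforms by the Jacobian matrix on both sides, so the root of its determinant
  transforms by the absolute value of the Jacobian determinant.\<close>

lemma area_density_transition:
  assumes "immersed_chart c \<Phi> U" "open V" "smooth_on \<tau> V" "\<tau> ` V \<subseteq> U" "v \<in> V"
  shows "sqrt (det (metric c (\<lambda>v. \<Phi> (\<tau> v)) v))
    = \<bar>det (matrix (frechet_derivative \<tau> (at v)))\<bar> * sqrt (det (metric c \<Phi> (\<tau> v)))"
proof -
  have "matrix (frechet_derivative \<tau> (at v)) = (\<chi> i a. partial_deriv a \<tau> v $ i)"
    by (simp add: matrix_def partial_deriv_def)
  then show ?thesis
    unfolding metric_compose[OF assms] det_mul det_transpose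
    by (simp add: real_sqrt_mult real_sqrt_mult_self mult.commute mult.assoc)
qed

context surface
begin

text \<open>A second countable space is Lindelof, so countably many of the charts cover the surface.\<close>

lemma countable_atlas:
  obtains U :: "nat \<Rightarrow> (real^2) set" and x :: "nat \<Rightarrow> real^2 \<Rightarrow> 'm"
  where "\<And>n. (U n, x n) \<in> A" "(\<Union>n. x n ` U n) = topspace X"
proof -
  have "Lindelof_space X" using countable2 second_countable_imp_Lindelof_space by blast
  moreover have "\<Union> ((\<lambda>(U, x). x ` U) ` A) = topspace X" using atlas by (auto simp: smooth_atlas_def)
  moreover have "\<forall>W\<in>(\<lambda>(U, x). x ` U) ` A. openin X W" using chart_image_open by auto
  ultimately obtain \<V> where V: "countable \<V>" "\<V> \<subseteq> (\<lambda>(U, x). x ` U) ` A" "\<Union>\<V> = topspace X"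
    unfolding Lindelof_space_def by metis
  have ne: "\<V> \<noteq> {}"
  proof
    assume "\<V> = {}"
    with V(3) have "topspace X = {}" by blast
    with nonempty show False by (rule notE)
  qed
  have "\<exists>U x. (U, x) \<in> A \<and> x ` U = from_nat_into \<V> n" for n
  proof -
    have "from_nat_into \<V> n \<in> (\<lambda>(U, x). x ` U) ` A" using from_nat_into[OF ne, of n] V(2) by blast
    then obtain U x where "(U, x) \<in> A" "from_nat_into \<V> n = x ` U" by auto
    then show ?thesis by metis
  qed
  then obtain U x where Ux: "\<And>n. (U n, x n) \<in> A \<and> x n ` U n = from_nat_into \<V> n" by metis
  have "(\<Union>n. x n ` U n) = topspace X"
    using Ux range_from_nat_into[OF ne V(1)] V(3) by auto
  then show thesis using that Ux by blast
qed

text \<open>Cut the surface into countably many disjoint Borel pieces, each inside one chart, and add up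
  the images of the densities on these pieces. In another chart the change of variables gives
  the same value on each piece.\<close>

lemma area_measure_exists: "\<exists>dv. is_area_measure c X A \<phi> dv"
proof -
  obtain U x where Ux: "\<And>n::nat. (U n, x n) \<in> A" and cov: "(\<Union>n. x n ` U n) = topspace X"
    using countable_atlas by blast
  define S where "S = sigma (topspace X) {W. openin X W}"
  have P: "{W. openin X W} \<subseteq> Pow (topspace X)" using openin_subset by blast
  have sS: "sets S = sigma_sets (topspace X) {W. openin X W}" and spS: "space S = topspace X"
    unfolding S_def using P by simp_all
  have oS: "W \<in> sets S" if "openin X W" for W unfolding sS using that by auto
  note chart_meas = measurable_chart_extension[OF _ _ sS]
  have pre_meas: "{u \<in> V. y u \<in> E} \<in> sets borel" if Vy: "(V, y) \<in> A" and E: "E \<in> sets S" for V y E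
  proof -
    obtain p0 where p0: "p0 \<in> topspace X" using nonempty by blast
    have "(\<lambda>u. if u \<in> V then y u else p0) -` E \<inter> space borel \<in> sets borel"
      by (rule measurable_sets[OF chart_meas[OF Vy p0] E])
    then have "((\<lambda>u. if u \<in> V then y u else p0) -` E) \<inter> V \<in> sets borel"
      using chart_open[OF Vy] by auto
    moreover have "((\<lambda>u. if u \<in> V then y u else p0) -` E) \<inter> V = {u \<in> V. y u \<in> E}" by auto
    ultimately show ?thesis by simp
  qed
  have im_meas: "y ` E \<in> sets S" if Vy: "(V, y) \<in> A" and E: "E \<in> sets borel" "E \<subseteq> V" for V y E
  proof -
    define k where "k p = (if p \<in> y ` V then inv_into V y p else 0)" for p
    have "k \<in> measurable S borel"
    proof (rule borel_measurableI)
      fix O' :: "(real^2) set" assume "open O'"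
      then have "openin X (y ` (V \<inter> O'))"
        using chart_image_openin[OF Vy, of "V \<inter> O'"] chart_open[OF Vy] by auto
      moreover have "k -` O' \<inter> space S = y ` (V \<inter> O') \<union> (if 0 \<in> O' then topspace X - y ` V else {})"
        using chart_in[OF Vy] by (auto simp: k_def spS chart_inv[OF Vy] split: if_splits)
      moreover have "topspace X - y ` V \<in> sets S"
        using sets.compl_sets[OF oS[OF chart_image_open[OF Vy]]] spS by simp
      ultimately show "k -` O' \<inter> space S \<in> sets S" using oS by auto
    qed
    from measurable_sets[OF this E(1)] have "(k -` E \<inter> space S) \<inter> y ` V \<in> sets S"
      using oS[OF chart_image_open[OF Vy]] by auto
    moreover have "(k -` E \<inter> space S) \<inter> y ` V = y ` E"
      using E(2) chart_in[OF Vy] by (auto simp: k_def spS chart_inv[OF Vy] split: if_splits)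
    ultimately show ?thesis by simp
  qed
  obtain p0 where p0: "p0 \<in> topspace X" using nonempty by blast
  define B where "B = disjointed (\<lambda>n. x n ` U n)"
  have BS: "B n \<in> sets S" for n
    using sets.range_disjointed_sets[of "\<lambda>n. x n ` U n" S] oS[OF chart_image_open[OF Ux]] unfolding B_def by auto
  have Bsub: "B n \<subseteq> x n ` U n" for n unfolding B_def by (rule disjointed_subset)
  have Bcov: "(\<Union>n. B n) = topspace X" unfolding B_def UN_disjointed_eq cov ..
  have Bdis: "disjoint_family B" unfolding B_def by (rule disjoint_family_disjointed)
  let ?dens = "\<lambda>y u. sqrt (det (metric c (\<phi> \<circ> y) u))"
  have dens_meas: "(\<lambda>u. indicator V u *\<^sub>R ?dens y u) \<in> borel_measurable borel" if Vy: "(V, y) \<in> A" for V y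
  proof (rule borel_measurable_continuous_on_indicator)
    interpret immersed_chart c "\<phi> \<circ> y" V by (rule immersed_chart[OF Vy])
    show "V \<in> sets borel" using openU by simp
    show "continuous_on V (?dens y)" unfolding det_metric by (rule smooth_on_continuous[OF vol_smooth])
  qed
  define C where "C n = {u \<in> U n. x n u \<in> B n}" for n
  have Cb: "C n \<in> sets borel" for n unfolding C_def by (rule pre_meas[OF Ux BS])
  define w where "w = (\<lambda>(n, u). ennreal (indicator (U n) u *\<^sub>R ?dens (x n) u) * indicator (C n) u)"
  define f where "f = (\<lambda>(n, u). if u \<in> U n then x n u else p0)"
  \<comment> \<open>The countable sum of measures is realised as the image of a single measure on the
    disjoint union of the chart domains, the product of the natural numbers and the
    plane.\<close>
  define Q where "Q = count_space (UNIV :: nat set) \<Otimes>\<^sub>M (lborel :: (real^2) measure)"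
  have wQ: "w \<in> borel_measurable Q"
    unfolding Q_def
  proof (rule measurable_pair_measure_countable1)
    fix n
    show "(\<lambda>u. w (n, u)) \<in> borel_measurable lborel"
      unfolding w_def using dens_meas[OF Ux[of n]] Cb[of n] by simp
  qed simp
  have fQ: "f \<in> measurable Q S"
    unfolding Q_def
  proof (rule measurable_pair_measure_countable1)
    fix n
    show "(\<lambda>u. f (n, u)) \<in> measurable lborel S"
      unfolding f_def using chart_meas[OF Ux[of n] p0] by simp
  qed simp
  define dv where "dv = distr (density Q w) S f"
  have em: "emeasure dv E = (\<Sum>n. \<integral>\<^sup>+u\<in>{u \<in> C n. x n u \<in> E}. ennreal (?dens (x n) u) \<partial>lborel)"
    if E: "E \<in> sets S" for E
  proof -
    have fE: "f -` E \<inter> space Q \<in> sets Q" by (rule measurable_sets[OF fQ E])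
    have sp: "space Q = UNIV" unfolding Q_def by (simp add: space_pair_measure)
    have "emeasure dv E = emeasure (density Q w) (f -` E)"
      unfolding dv_def using emeasure_distr[of f "density Q w" S E] fQ E sp by simp
    also have "\<dots> = (\<integral>\<^sup>+z. w z * indicator (f -` E) z \<partial>Q)"
      by (rule emeasure_density) (use wQ fE sp in auto)
    also have "\<dots> = (\<integral>\<^sup>+n. \<integral>\<^sup>+u. w (n, u) * indicator (f -` E) (n, u) \<partial>lborel \<partial>count_space UNIV)"
      unfolding Q_def
      by (rule lborel.nn_integral_fst[symmetric]) (use wQ fE sp in \<open>auto simp: Q_def\<close>)
    also have "\<dots> = (\<Sum>n. \<integral>\<^sup>+u. w (n, u) * indicator (f -` E) (n, u) \<partial>lborel)"
      by (rule nn_integral_count_space_nat)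
    also have "\<dots> = (\<Sum>n. \<integral>\<^sup>+u\<in>{u \<in> C n. x n u \<in> E}. ennreal (?dens (x n) u) \<partial>lborel)"
      by (intro suminf_cong nn_integral_cong) (auto simp: w_def f_def C_def indicator_def)
    finally show ?thesis .
  qed
  have "emeasure dv (y ` E) = (\<integral>\<^sup>+v\<in>E. ennreal (?dens y v) \<partial>lborel)"
    if Vy: "(V, y) \<in> A" and E: "E \<in> sets borel" "E \<subseteq> V" for V y E
  proof -
    interpret y: immersed_chart c "\<phi> \<circ> y" V by (rule immersed_chart[OF Vy])
    define En where "En n = {v \<in> V. y v \<in> B n} \<inter> E" for n
    have Enb: "En n \<in> sets borel" for n unfolding En_def using pre_meas[OF Vy BS] E(1) by auto
    have piece: "(\<integral>\<^sup>+u\<in>{u \<in> C n. x n u \<in> y ` E}. ennreal (?dens (x n) u) \<partial>lborel)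
        = (\<integral>\<^sup>+v\<in>En n. ennreal (?dens y v) \<partial>lborel)" for n
    proof -
      interpret x: immersed_chart c "\<phi> \<circ> x n" "U n" by (rule immersed_chart[OF Ux])
      define V' where "V' = {v \<in> V. y v \<in> x n ` U n}"
      define \<tau> where "\<tau> v = inv_into (U n) (x n) (y v)" for v
      have oV': "open V'" unfolding V'_def by (rule chart_preimage_open[OF Vy chart_image_open[OF Ux]])
      have \<tau>s: "smooth_on \<tau> V'" unfolding \<tau>_def V'_def by (rule transition_smooth[OF Ux Vy])
      have \<tau>y: "x n (\<tau> v) = y v" "\<tau> v \<in> U n" if "v \<in> V'" for v
        using that chart_inv_in[of "y v" "x n" "U n"] unfolding V'_def \<tau>_def by auto
      have inj\<tau>: "inj_on \<tau> V'"
      proof (rule inj_onI)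
        fix v w assume vw: "v \<in> V'" "w \<in> V'" "\<tau> v = \<tau> w"
        then have "y v = y w" using \<tau>y by metis
        then show "v = w" using vw chart_inj[OF Vy] unfolding V'_def by (auto dest: inj_onD)
      qed
      have imV: "\<tau> ` V' = {u \<in> U n. x n u \<in> y ` V}"
      proof (intro equalityI subsetI)
        fix u assume "u \<in> \<tau> ` V'"
        then show "u \<in> {u \<in> U n. x n u \<in> y ` V}" using \<tau>y by (auto simp: V'_def)
      next
        fix u assume "u \<in> {u \<in> U n. x n u \<in> y ` V}"
        then obtain v where v: "u \<in> U n" "v \<in> V" "x n u = y v" by auto
        then have "v \<in> V'" unfolding V'_def by (metis (mono_tags, lifting) imageI mem_Collect_eq)
        moreover have "\<tau> v = u" unfolding \<tau>_def v(3)[symmetric] using chart_inv[OF Ux v(1)] .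
        ultimately show "u \<in> \<tau> ` V'" by blast
      qed
      have oT: "open (\<tau> ` V')" unfolding imV by (rule chart_preimage_open[OF Ux chart_image_open[OF Vy]])
      have EnV: "En n \<subseteq> V'" using Bsub[of n] unfolding En_def V'_def by blast
      have imE: "{u \<in> C n. x n u \<in> y ` E} = \<tau> ` En n"
      proof (intro equalityI subsetI)
        fix u assume "u \<in> {u \<in> C n. x n u \<in> y ` E}"
        then obtain v where v: "u \<in> U n" "x n u \<in> B n" "v \<in> E" "x n u = y v" by (auto simp: C_def)
        then have "v \<in> En n" using E(2) unfolding En_def by auto
        moreover have "\<tau> v = u" unfolding \<tau>_def v(4)[symmetric] using chart_inv[OF Ux v(1)] .
        ultimately show "u \<in> \<tau> ` En n" by blast
      next
        fix u assume "u \<in> \<tau> ` En n"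
        then obtain v where v: "v \<in> En n" "u = \<tau> v" by auto
        then have "x n u = y v" "u \<in> U n" using \<tau>y EnV by auto
        then show "u \<in> {u \<in> C n. x n u \<in> y ` E}" using v(1) unfolding C_def En_def by auto
      qed
      have Tb: "\<tau> ` En n \<in> sets borel"
        unfolding imE[symmetric] C_def
        using sets.Int[OF Cb[of n] pre_meas[OF Ux[of n] im_meas[OF Vy E]]]
        by (rule back_subst) (auto simp: C_def)
      have "(\<integral>\<^sup>+u\<in>\<tau> ` En n. ennreal (?dens (x n) u) \<partial>lborel)
        = (\<integral>\<^sup>+v\<in>En n. ennreal \<bar>det (matrix (frechet_derivative \<tau> (at v)))\<bar> * ennreal (?dens (x n) (\<tau> v)) \<partial>lborel)"
      proof (rule nn_integral_diffeomorphic_image[OF oV' _ inj\<tau> \<tau>s Enb EnV Tb])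
        show "\<tau> ` V' \<in> sets borel" using oT by simp
        have "(\<lambda>u. ennreal (indicator (U n) u *\<^sub>R ?dens (x n) u) * indicator (\<tau> ` V') u) \<in> borel_measurable borel"
          using dens_meas[OF Ux[of n]] oT by simp
        moreover have "(\<lambda>u. ennreal (indicator (U n) u *\<^sub>R ?dens (x n) u) * indicator (\<tau> ` V') u)
            = (\<lambda>u. ennreal (?dens (x n) u) * indicator (\<tau> ` V') u)"
          using imV by (auto simp: indicator_def fun_eq_iff)
        ultimately show "(\<lambda>u. ennreal (?dens (x n) u) * indicator (\<tau> ` V') u) \<in> borel_measurable borel" by simp
      qed
      also have "\<dots> = (\<integral>\<^sup>+v\<in>En n. ennreal (?dens y v) \<partial>lborel)"
      proof (rule nn_integral_cong)
        fix v
        show "ennreal \<bar>det (matrix (frechet_derivative \<tau> (at v)))\<bar> * ennreal (?dens (x n) (\<tau> v)) * indicator (En n) v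
          = ennreal (?dens y v) * indicator (En n) v"
        proof (cases "v \<in> En n")
          case True
          then have v: "v \<in> V'" using EnV by blast
          have "metric c (\<lambda>v. (\<phi> \<circ> x n) (\<tau> v)) v = metric c (\<phi> \<circ> y) v"
            by (rule metric_cong[OF oV' v]) (simp add: \<tau>y)
          moreover have "\<tau> ` V' \<subseteq> U n" using \<tau>y by auto
          ultimately have "?dens y v = \<bar>det (matrix (frechet_derivative \<tau> (at v)))\<bar> * ?dens (x n) (\<tau> v)"
            using area_density_transition[OF x.immersed_chart_axioms oV' \<tau>s _ v] by simp
          moreover have "?dens (x n) (\<tau> v) \<ge> 0"
            using x.metric_det[OF \<tau>y(2)[OF v]] unfolding x.det_metric by simp
          ultimately show ?thesis by (simp add: ennreal_mult)
        qed simp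
      qed
      finally show ?thesis unfolding imE .
    qed
    define \<mu> where "\<mu> = density lborel (\<lambda>v. ennreal (indicator V v *\<^sub>R ?dens y v))"
    have \<mu>: "emeasure \<mu> D = (\<integral>\<^sup>+v\<in>D. ennreal (?dens y v) \<partial>lborel)" if "D \<in> sets borel" "D \<subseteq> V" for D
      unfolding \<mu>_def
      by (subst emeasure_density) (use dens_meas[OF Vy] that in \<open>auto intro!: nn_integral_cong simp: indicator_def\<close>)
    have "emeasure \<mu> (En n) = (\<integral>\<^sup>+v\<in>En n. ennreal (?dens y v) \<partial>lborel)" for n
      by (rule \<mu>[OF Enb]) (auto simp: En_def)
    then have "emeasure dv (y ` E) = (\<Sum>n. emeasure \<mu> (En n))"
      unfolding em[OF im_meas[OF Vy E]] piece by simp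
    also have "\<dots> = emeasure \<mu> (\<Union>n. En n)"
    proof (rule suminf_emeasure)
      show "range En \<subseteq> sets \<mu>" using Enb unfolding \<mu>_def by auto
      show "disjoint_family En" using Bdis unfolding disjoint_family_on_def En_def by blast
    qed
    also have "(\<Union>n. En n) = E" using Bcov chart_in[OF Vy] E(2) unfolding En_def by blast
    also have "emeasure \<mu> E = (\<integral>\<^sup>+v\<in>E. ennreal (?dens y v) \<partial>lborel)" by (rule \<mu>[OF E])
    finally show ?thesis .
  qed
  moreover have "sets dv = sigma_sets (topspace X) {S. openin X S}" unfolding dv_def using sS by simp
  ultimately have "is_area_measure c X A \<phi> dv" unfolding is_area_measure_def by auto
  then show ?thesis by blast
qed

end

section \<open>The Euler-Lagrange equation, tested along Killing fields\<close>

text \<open>Cosine and sine of the geometry of curvature \<open>c\<close>, for a uniform treatment of rotations and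
  boosts.\<close>

definition gen_cos :: "real \<Rightarrow> real \<Rightarrow> real" where "gen_cos c t = (if c = 1 then cos t else cosh t)"
definition gen_sin :: "real \<Rightarrow> real \<Rightarrow> real" where "gen_sin c t = (if c = 1 then sin t else sinh t)"

lemma gen_cos_sin:
  assumes "c = 1 \<or> c = -1"
  shows "(gen_cos c t)\<^sup>2 + c * (gen_sin c t)\<^sup>2 = 1" "gen_cos c 0 = 1" "gen_sin c 0 = 0"
    "(gen_cos c has_real_derivative - c * gen_sin c t) (at t)" "(gen_sin c has_real_derivative gen_cos c t) (at t)"
    "smooth_on (gen_cos c) UNIV" "smooth_on (gen_sin c) UNIV"
proof -
  have e: "smooth_on (exp :: real \<Rightarrow> real) UNIV" "smooth_on (\<lambda>t::real. exp (- t)) UNIV"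
    using Ck_on_exp smooth_on_compose[of UNIV UNIV exp "\<lambda>t::real. - t"] smooth_on_uminus[OF open_UNIV smooth_on_id[OF open_UNIV]]
    by (auto simp: smooth_on_def)
  have h: "smooth_on (\<lambda>t::real. (1/2) *\<^sub>R (exp t + exp (- t))) UNIV" "smooth_on (\<lambda>t::real. (1/2) *\<^sub>R (exp t - exp (- t))) UNIV"
    by (intro smooth_on_scaleR smooth_on_const smooth_on_add smooth_on_diff e open_UNIV)+
  have ch: "smooth_on (cosh :: real \<Rightarrow> real) UNIV" "smooth_on (sinh :: real \<Rightarrow> real) UNIV"
    using h by (simp_all add: cosh_def[abs_def] sinh_def[abs_def])
  have tr: "smooth_on (cos :: real \<Rightarrow> real) UNIV" "smooth_on (sin :: real \<Rightarrow> real) UNIV"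
    using Ck_on_sin_cos by (simp_all add: smooth_on_def)
  have f: "gen_cos c = (if c = 1 then cos else cosh)" "gen_sin c = (if c = 1 then sin else sinh)"
    by (auto simp: gen_cos_def[abs_def] gen_sin_def[abs_def])
  show "(gen_cos c t)\<^sup>2 + c * (gen_sin c t)\<^sup>2 = 1" "gen_cos c 0 = 1" "gen_sin c 0 = 0"
    using assms hyperbolic_pythagoras[of t] by (auto simp: f)
  show "(gen_cos c has_real_derivative - c * gen_sin c t) (at t)" "(gen_sin c has_real_derivative gen_cos c t) (at t)"
    using assms by (auto simp: f intro!: derivative_eq_intros)
  show "smooth_on (gen_cos c) UNIV" "smooth_on (gen_sin c) UNIV"
    using ch tr by (auto simp: f)
qed

text \<open>The rotation in the plane of the axes \<open>i\<close> and 3; for \<open>c = -1\<close> it is a boost.\<close>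

definition mixed_rotation :: "real \<Rightarrow> 3 \<Rightarrow> real \<Rightarrow> (real^3) \<times> real \<Rightarrow> (real^3) \<times> real" where
  "mixed_rotation c i t y = ((\<chi> k. if k = i then gen_cos c t * fst y $ i + gen_sin c t * fst y $ 3
     else if k = 3 then gen_cos c t * fst y $ 3 - c * gen_sin c t * fst y $ i else fst y $ k), snd y)"

definition mixed_generator :: "real \<Rightarrow> 3 \<Rightarrow> (real^3) \<times> real \<Rightarrow> (real^3) \<times> real" where
  "mixed_generator c i y = ((\<chi> k. if k = i then fst y $ 3 else if k = 3 then - c * fst y $ i else 0), 0)"

definition axial_rotation :: "real \<Rightarrow> (real^3) \<times> real \<Rightarrow> (real^3) \<times> real" where
  "axial_rotation t y = ((\<chi> k. if k = 1 then cos t * fst y $ 1 - sin t * fst y $ 2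
     else if k = 2 then sin t * fst y $ 1 + cos t * fst y $ 2 else fst y $ 3), snd y)"

definition axial_generator :: "(real^3) \<times> real \<Rightarrow> (real^3) \<times> real" where
  "axial_generator y = ((\<chi> k. if k = 1 then - fst y $ 2 else if k = 2 then fst y $ 1 else 0), 0)"

text \<open>A smooth family of maps of the product space into itself that starts at the identity with
  velocity \<open>b\<close>. Composed with an immersion, it yields variations that stay in the product space.\<close>

definition flow_on :: "real \<Rightarrow> (real \<Rightarrow> (real^3) \<times> real \<Rightarrow> (real^3) \<times> real) \<Rightarrow> ((real^3) \<times> real \<Rightarrow> (real^3) \<times> real) \<Rightarrow> bool" where
  "flow_on c R b \<longleftrightarrow> smooth_on (\<lambda>z. R (fst z) (snd z)) UNIV \<and> (\<forall>y. R 0 y = y) \<and>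
     (\<forall>t. \<forall>y\<in>product_space c. R t y \<in> product_space c) \<and>
     (\<forall>y. ((\<lambda>t. R t y) has_vector_derivative b y) (at 0)) \<and> smooth_on b UNIV"

lemma has_vector_derivative_vec:
  fixes f :: "real \<Rightarrow> real^'n"
  assumes "\<And>i. ((\<lambda>t. f t $ i) has_real_derivative d $ i) (at t)"
  shows "(f has_vector_derivative d) (at t)"
proof -
  have "((\<lambda>t. \<Sum>i\<in>UNIV. f t $ i *\<^sub>R (axis i 1 :: real^'n)) has_vector_derivative (\<Sum>i\<in>UNIV. d $ i *\<^sub>R axis i 1)) (at t)"
    using assms
    by (intro has_vector_derivative_sum bounded_linear.has_vector_derivative[OF bounded_linear_scaleR_left])
       (simp add: has_real_derivative_iff_has_vector_derivative)
  moreover have "(\<Sum>i\<in>UNIV. v $ i *\<^sub>R (axis i 1 :: real^'n)) = v" for v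
    using basis_expansion[of v] by (simp add: scalar_mult_eq_scaleR)
  ultimately show ?thesis by simp
qed

lemma flow_on_vertical: "flow_on c (\<lambda>t y. (fst y, snd y + t)) (\<lambda>y. (0, 1))"
  unfolding flow_on_def
  by (auto simp: product_space_def intro!: smooth_on_Pair smooth_on_fst smooth_on_snd smooth_on_add
      smooth_on_const smooth_on_id derivative_eq_intros)

lemma flow_on_axial: "flow_on c axial_rotation axial_generator"
  unfolding flow_on_def
proof (intro conjI allI ballI)
  have c: "smooth_on (\<lambda>z :: real \<times> (real^3) \<times> real. cos (fst z)) UNIV" "smooth_on (\<lambda>z :: real \<times> (real^3) \<times> real. sin (fst z)) UNIV"
    by (rule smooth_on_compose[of UNIV UNIV cos] smooth_on_compose[of UNIV UNIV sin],
        auto simp: smooth_on_def[of cos] smooth_on_def[of sin] Ck_on_sin_cos intro!: smooth_on_fst smooth_on_id)+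
  have n: "smooth_on (\<lambda>z :: real \<times> (real^3) \<times> real. fst (snd z) $ i) UNIV" for i
    by (intro smooth_on_nth smooth_on_fst smooth_on_snd smooth_on_id open_UNIV)
  have "smooth_on (\<lambda>z. fst (axial_rotation (fst z) (snd z)) $ k) UNIV" for k
    unfolding axial_rotation_def
    by (cases "k = 1"; cases "k = 2")
       (auto intro!: smooth_on_add smooth_on_diff smooth_on_mult c n)
  then have "smooth_on (\<lambda>z. fst (axial_rotation (fst z) (snd z))) UNIV" by (intro smooth_on_vec) auto
  then have "smooth_on (\<lambda>z. (fst (axial_rotation (fst z) (snd z)), snd (snd z))) UNIV"
    by (intro smooth_on_Pair smooth_on_snd smooth_on_id) auto
  then show "smooth_on (\<lambda>z. axial_rotation (fst z) (snd z)) UNIV" by (simp add: axial_rotation_def)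
  show "axial_rotation 0 y = y" for y
    by (cases y) (simp add: axial_rotation_def vec_eq_iff forall_3)
  show "axial_rotation t y \<in> product_space c" if "y \<in> product_space c" for t y
  proof -
    have alg: "(C * a - S * b) * (C * a - S * b) + (S * a + C * b) * (S * a + C * b)
      = (a * a + b * b) * (S\<^sup>2 + C\<^sup>2)" for C S a b :: real
      by (simp add: power2_eq_square algebra_simps)
    have "(cos t * a - sin t * b) * (cos t * a - sin t * b) + (sin t * a + cos t * b) * (sin t * a + cos t * b)
      = a * a + b * b" for a b :: real
      unfolding alg by simp
    then show ?thesis using that
      by (auto simp: axial_rotation_def product_space_def space_form_def first_form_def)
  qed
  show "((\<lambda>t. axial_rotation t y) has_vector_derivative axial_generator y) (at 0)" for y
    unfolding axial_rotation_def axial_generator_def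
    by (intro has_vector_derivative_Pair has_vector_derivative_vec has_vector_derivative_const)
       (auto intro!: derivative_eq_intros)
  have "smooth_on (\<lambda>y. fst (axial_generator y) $ k) UNIV" for k
    unfolding axial_generator_def
    by (cases "k = 1"; cases "k = 2")
       (auto intro!: smooth_on_uminus smooth_on_nth smooth_on_fst smooth_on_id smooth_on_const)
  then have "smooth_on (\<lambda>y. fst (axial_generator y)) UNIV" by (intro smooth_on_vec) auto
  then have "smooth_on (\<lambda>y. (fst (axial_generator y), 0 :: real)) UNIV"
    by (intro smooth_on_Pair smooth_on_const) auto
  then show "smooth_on axial_generator UNIV" by (simp add: axial_generator_def[abs_def])
qed

lemma flow_on_mixed:
  assumes c: "c = 1 \<or> c = -1" and i: "i = 1 \<or> i = (2::3)"
  shows "flow_on c (mixed_rotation c i) (mixed_generator c i)"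
  unfolding flow_on_def
proof (intro conjI allI ballI)
  note cs = gen_cos_sin[OF c]
  have i3: "i \<noteq> 3" using i by auto
  have C: "smooth_on (\<lambda>z :: real \<times> (real^3) \<times> real. gen_cos c (fst z)) UNIV" "smooth_on (\<lambda>z :: real \<times> (real^3) \<times> real. gen_sin c (fst z)) UNIV"
    by (rule smooth_on_compose[OF open_UNIV open_UNIV cs(6)] smooth_on_compose[OF open_UNIV open_UNIV cs(7)],
        auto intro!: smooth_on_fst smooth_on_id)+
  have n: "smooth_on (\<lambda>z :: real \<times> (real^3) \<times> real. fst (snd z) $ i) UNIV" for i
    by (intro smooth_on_nth smooth_on_fst smooth_on_snd smooth_on_id open_UNIV)
  have "smooth_on (\<lambda>z. fst (mixed_rotation c i (fst z) (snd z)) $ k) UNIV" for k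
    unfolding mixed_rotation_def
    by (cases "k = i"; cases "k = 3")
       (auto intro!: smooth_on_add smooth_on_diff smooth_on_mult smooth_on_const C n)
  then have "smooth_on (\<lambda>z. fst (mixed_rotation c i (fst z) (snd z))) UNIV" by (intro smooth_on_vec) auto
  then have "smooth_on (\<lambda>z. (fst (mixed_rotation c i (fst z) (snd z)), snd (snd z))) UNIV"
    by (intro smooth_on_Pair smooth_on_snd smooth_on_id) auto
  then show "smooth_on (\<lambda>z. mixed_rotation c i (fst z) (snd z)) UNIV" by (simp add: mixed_rotation_def)
  show "mixed_rotation c i 0 y = y" for y
    using i3 by (cases y) (auto simp: mixed_rotation_def vec_eq_iff cs)
  show "mixed_rotation c i t y \<in> product_space c" if y: "y \<in> product_space c" for t y
  proof -
    define C S where "C = gen_cos c t" and "S = gen_sin c t"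
    have CS: "C\<^sup>2 + c * S\<^sup>2 = 1" using cs(1)[of t] by (simp add: C_def S_def)
    have cc: "c * c = 1" using c by auto
    have q: "(C * a + S * b) * (C * a + S * b) + c * ((C * b - c * S * a) * (C * b - c * S * a)) = a * a + c * (b * b)" for a b
    proof -
      have "(C * a + S * b) * (C * a + S * b) + c * ((C * b - c * S * a) * (C * b - c * S * a))
        = a * a * (C\<^sup>2 + (c * c) * c * S\<^sup>2) + c * (b * b) * C\<^sup>2 + b * b * S\<^sup>2 + 2 * C * S * a * b * (1 - c * c)"
        by (simp add: power2_eq_square algebra_simps)
      also have "b * b * S\<^sup>2 = c * (b * b) * (c * S\<^sup>2)" using cc by (simp add: algebra_simps)
      finally show ?thesis using CS cc by (simp add: distrib_left[symmetric])
    qed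
    have f: "first_form c (fst y) (fst y) = c" "c < 0 \<longrightarrow> fst y $ 3 > 0"
      using y by (auto simp: product_space_def space_form_def)
    have "first_form c (fst (mixed_rotation c i t y)) (fst (mixed_rotation c i t y)) = first_form c (fst y) (fst y)"
      using i q[of "fst y $ i" "fst y $ 3"]
      by (auto simp: first_form_def mixed_rotation_def C_def[symmetric] S_def[symmetric])
    moreover have "fst (mixed_rotation c i t y) $ 3 > 0" if "c < 0"
    proof -
      have c1: "c = -1" using c that by auto
      have C0: "C > 0" unfolding C_def gen_cos_def c1 using cosh_real_pos[of t] by simp
      have "\<bar>S\<bar>\<^sup>2 \<le> C\<^sup>2" using CS c1 by simp
      then have SC: "\<bar>S\<bar> \<le> C" by (rule power2_le_imp_le) (use C0 in simp)
      define a b where "a = fst y $ i" and "b = fst y $ 3"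
      have b0: "b > 0" using f(2) that by (simp add: b_def)
      have "b\<^sup>2 = 1 + (fst y $ 1)\<^sup>2 + (fst y $ 2)\<^sup>2"
        using f(1) c1 by (simp add: first_form_def b_def power2_eq_square)
      then have "a\<^sup>2 < b\<^sup>2" using i by (auto simp: a_def add_strict_increasing2 add_pos_nonneg)
      then have "\<bar>a\<bar>\<^sup>2 < b\<^sup>2" by simp
      then have ab: "\<bar>a\<bar> < b" by (rule power2_less_imp_less) (use b0 in simp)
      have "\<bar>S * a\<bar> \<le> C * \<bar>a\<bar>" unfolding abs_mult using SC by (rule mult_right_mono) simp
      also have "\<dots> < C * b" using C0 ab by simp
      finally have "C * b + S * a > 0" by linarith
      then show ?thesis using i3 by (simp add: mixed_rotation_def c1 C_def S_def a_def b_def)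
    qed
    ultimately show ?thesis using f
      by (auto simp: product_space_def space_form_def mem_Times_iff)
  qed
  show "((\<lambda>t. mixed_rotation c i t y) has_vector_derivative mixed_generator c i y) (at 0)" for y
    unfolding mixed_rotation_def mixed_generator_def
  proof (intro has_vector_derivative_Pair has_vector_derivative_vec has_vector_derivative_const)
    fix k
    have d: "(gen_cos c has_real_derivative 0) (at 0)" "(gen_sin c has_real_derivative 1) (at 0)"
      using cs(4)[of 0] cs(5)[of 0] by (simp_all add: cs(2,3))
    show "((\<lambda>t. (\<chi> k. if k = i then gen_cos c t * fst y $ i + gen_sin c t * fst y $ 3
        else if k = 3 then gen_cos c t * fst y $ 3 - c * gen_sin c t * fst y $ i else fst y $ k) $ k) has_real_derivative
        (\<chi> k. if k = i then fst y $ 3 else if k = 3 then - c * fst y $ i else 0) $ k) (at 0)"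
      using i3 by (auto intro!: derivative_eq_intros d)
  qed
  have "smooth_on (\<lambda>y. fst (mixed_generator c i y) $ k) UNIV" for k
    unfolding mixed_generator_def
    by (cases "k = i"; cases "k = 3")
       (auto intro!: smooth_on_uminus smooth_on_mult smooth_on_nth smooth_on_fst smooth_on_id smooth_on_const)
  then have "smooth_on (\<lambda>y. fst (mixed_generator c i y)) UNIV" by (intro smooth_on_vec) auto
  then have "smooth_on (\<lambda>y. (fst (mixed_generator c i y), 0 :: real)) UNIV"
    by (intro smooth_on_Pair smooth_on_const) auto
  then show "smooth_on (mixed_generator c i) UNIV" by (simp add: mixed_generator_def[abs_def])
qed

text \<open>The rotation fields at \<open>y\<close> span the tangent space of the space form. The proof multiplies the
  claim by \<open>\<langle>y, y\<rangle> = c\<close> and uses Lagrange's identity for \<open>\<langle>y, y\<rangle> \<langle>W, v\<rangle> - \<langle>W, y\<rangle> \<langle>y, v\<rangle>\<close>.\<close>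

lemma first_form_parallel:
  assumes c: "c = 1 \<or> c = -1" and y: "first_form c (fst y) (fst y) = c"
    and "first_form c W (fst (axial_generator y)) = 0"
    and "first_form c W (fst (mixed_generator c 1 y)) = 0" "first_form c W (fst (mixed_generator c 2 y)) = 0"
    and v: "first_form c v (fst y) = 0"
  shows "first_form c W v = 0"
proof -
  have cc: "c * c = 1" using c by auto
  define f1 f2 f3 where "f1 = fst y $ 1" and "f2 = fst y $ 2" and "f3 = fst y $ 3"
  define w1 w2 w3 where "w1 = W $ 1" and "w2 = W $ 2" and "w3 = W $ 3"
  define v1 v2 v3 where "v1 = v $ 1" and "v2 = v $ 2" and "v3 = v $ 3"
  note d = f1_def[symmetric] f2_def[symmetric] f3_def[symmetric] w1_def[symmetric] w2_def[symmetric] w3_def[symmetric]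
    v1_def[symmetric] v2_def[symmetric] v3_def[symmetric]
  have c3: "c * (z * (c * x)) = z * x" for z x using cc by (metis mult.assoc mult.left_commute mult_1)
  have e12: "w2 * f1 = w1 * f2" using assms(3) by (simp add: first_form_def axial_generator_def d)
  have e13: "w3 * f1 = w1 * f3" using assms(4) c3[of w3 f1] by (simp add: first_form_def mixed_generator_def d)
  have e23: "w3 * f2 = w2 * f3" using assms(5) c3[of w3 f2] by (simp add: first_form_def mixed_generator_def d)
  have n: "f1 * f1 + f2 * f2 + c * (f3 * f3) = c" using y by (simp add: first_form_def d)
  have o: "v1 * f1 + v2 * f2 + c * (v3 * f3) = 0" using v by (simp add: first_form_def d)
  have "c * (w1 * v1 + w2 * v2 + c * (w3 * v3)) = (f1 * f1 + f2 * f2 + c * (f3 * f3)) * (w1 * v1 + w2 * v2 + c * (w3 * v3))"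
    by (simp add: n)
  also have "\<dots> = (w1 * f1 + w2 * f2 + c * (w3 * f3)) * (v1 * f1 + v2 * f2 + c * (v3 * f3))
     + (w2 * f1 - w1 * f2) * (f1 * v2 - f2 * v1) + c * (w3 * f1 - w1 * f3) * (f1 * v3 - f3 * v1)
     + c * (w3 * f2 - w2 * f3) * (f2 * v3 - f3 * v2)"
    by (simp add: algebra_simps)
  also have "\<dots> = 0" using o e12 e13 e23 by simp
  finally have "w1 * v1 + w2 * v2 + c * (w3 * v3) = 0" using c by auto
  then show ?thesis by (simp add: first_form_def d)
qed

context measured_surface
begin

text \<open>The fundamental lemma of the calculus of variations, one inequality at a time: if \<open>q\<close> were
  positive at a point, a bump concentrated near it would have positive integral against \<open>q\<close>.\<close>

lemma vanishing_from_bumps: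
  fixes q :: "'m \<Rightarrow> real"
  assumes q: "continuous_map X euclidean q" and Ux: "(U, x) \<in> A" and u0: "u0 \<in> U"
    and z: "\<And>r. r > 0 \<Longrightarrow> cball u0 r \<subseteq> U \<Longrightarrow> (\<integral>p. bump U x u0 r p * q p \<partial>dv) = 0"
  shows "q (x u0) \<le> 0"
proof (rule ccontr)
  assume "\<not> ?thesis"
  then have pos: "q (x u0) > 0" by simp
  have oU: "open U" by (rule chart_open[OF Ux])
  have "openin X {p \<in> topspace X. q p \<in> {0<..}}"
    using openin_continuous_map_preimage[OF q, of "{0<..}"] by simp
  then have "open {u \<in> U. x u \<in> {p \<in> topspace X. q p \<in> {0<..}}}" by (rule chart_preimage_open[OF Ux])
  moreover have "u0 \<in> {u \<in> U. x u \<in> {p \<in> topspace X. q p \<in> {0<..}}}" using u0 pos chart_in[OF Ux] by auto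
  ultimately obtain r where r: "r > 0" "cball u0 r \<subseteq> {u \<in> U. x u \<in> {p \<in> topspace X. q p \<in> {0<..}}}"
    using open_contains_cball by blast
  have rU: "cball u0 r \<subseteq> U" and qpos: "\<And>u. u \<in> cball u0 r \<Longrightarrow> q (x u) > 0" using r(2) by auto
  let ?b = "bump U x u0 r"
  have bs: "continuous_map X euclidean ?b" by (rule smooth_map_continuous[OF bump_smooth[OF Ux rU r(1)]])
  have chart_cont: "continuous_on U (\<lambda>u. h (x u))" if "continuous_map X euclidean h" for h :: "'m \<Rightarrow> real"
  proof -
    have "continuous_map (top_of_set U) X x"
      using homeomorphic_imp_continuous_map[OF chart_homeo[OF Ux]] continuous_map_in_subtopology by blast
    from continuous_map_compose[OF this that] show ?thesis by (simp add: comp_def)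
  qed
  define k where "k u = dens x u * (?b (x u) * q (x u))" for u
  have kc: "continuous_on U k"
    unfolding k_def[abs_def]
    by (rule continuous_on_mult[OF smooth_on_continuous[OF dens_smooth[OF Ux]]
         continuous_on_mult[OF chart_cont[OF bs] chart_cont[OF q]]])
  have bz: "?b (x u) = 0" if "u \<in> U - cball u0 r" for u
  proof (rule bump_support[OF Ux r(1)])
    show "x u \<notin> x ` (U \<inter> cball u0 r)"
    proof
      assume "x u \<in> x ` (U \<inter> cball u0 r)"
      then obtain w where w: "w \<in> U" "w \<in> cball u0 r" "x u = x w" by blast
      then have "u = w" using inj_onD[OF chart_inj[OF Ux] w(3)] that by blast
      then show False using w(2) that by blast
    qed
  qed
  have "(\<integral>p. ?b p * q p \<partial>dv) = (\<integral>u. indicator U u * (dens x u * (?b (x u) * q (x u))) \<partial>lborel)"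
  proof (rule chart_integral[OF Ux])
    show "(\<lambda>p. ?b p * q p) \<in> borel_measurable dv"
      using continuous_measurable[OF bs] continuous_measurable[OF q] by simp
  qed (simp add: bump_def)
  also have "\<dots> = (\<integral>u. indicator (cball u0 r) u *\<^sub>R k u \<partial>lborel)"
    by (rule Bochner_Integration.integral_cong) (use rU bz in \<open>auto simp: k_def indicator_def\<close>)
  finally have I0: "(\<integral>u. indicator (cball u0 r) u *\<^sub>R k u \<partial>lborel) = 0" using z[OF r(1) rU] by simp
  have int: "integrable lborel (\<lambda>u. indicator (cball u0 r) u *\<^sub>R k u)"
    by (rule borel_integrable_compact[OF compact_cball continuous_on_subset[OF kc rU]])
  have nn: "0 \<le> indicator (cball u0 r) u *\<^sub>R k u" for u
    using dens_pos[OF Ux, of u] qpos[of u] rU bump_nonneg[of U x u0 r "x u"] by (auto simp: k_def indicator_def less_imp_le)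
  have "AE u in lborel. indicator (cball u0 r) u *\<^sub>R k u = 0"
    using integral_nonneg_eq_0_iff_AE[OF int] nn I0 by simp
  then have ae: "AE u in lebesgue. u \<in> ball u0 r \<longrightarrow> u \<in> {}"
  proof (rule AE_mp[OF AE_completion], intro AE_I2 impI)
    fix u assume 0: "indicator (cball u0 r) u *\<^sub>R k u = 0" and u: "u \<in> ball u0 r"
    then have uc: "u \<in> cball u0 r" by auto
    then have "u \<in> U" using rU by auto
    then have "k u > 0" unfolding k_def
      using dens_pos[OF Ux] qpos[OF uc] bump_chart[OF Ux _ r(1), of u u0] u by simp
    then show "u \<in> {}" using 0 uc by simp
  qed
  have "u0 \<in> {}" by (rule mem_closed_if_AE_lebesgue_open[OF open_ball closed_empty ae]) (use r(1) in simp)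
  then show False by simp
qed

text \<open>Moving \<open>\<phi>\<close> by the flow for the time \<open>s \<eta>(p)\<close>, with a bump \<open>\<eta>\<close>, gives an admissible variation
  with field \<open>\<eta> b(\<phi>)\<close>. As \<open>\<langle>\<Delta>f, f\<rangle> = - m\<close> is constant, the integrand of the first variation
  differs from that of Green's identity for \<open>\<Delta>\<phi> + c m (f, 0)\<close> only by \<open>\<eta>\<close> times the expression
  in the conclusion.\<close>

lemma euler_lagrange_along_flow:
  assumes crit: "\<And>K \<epsilon> F. compactin X K \<Longrightarrow> \<epsilon> > 0 \<Longrightarrow> smooth_variation c X A \<phi> K \<epsilon> F \<Longrightarrow>
           ((\<lambda>s. bienergy c A \<phi> dv K (F s)) has_real_derivative 0) (at 0)"
    and m: "\<And>p. p \<in> topspace X \<Longrightarrow> first_form c (fst (lap \<phi> p)) (fst (\<phi> p)) = - m"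
    and R: "flow_on c R b" and p: "p \<in> topspace X"
  shows "ambient_form c (lap (lap \<phi>) p) (b (\<phi> p)) + 2 * c * m * first_form c (fst (lap \<phi> p)) (fst (b (\<phi> p))) = 0"
proof -
  define q where "q p = ambient_form c (lap (lap \<phi>) p) (b (\<phi> p)) + 2 * c * m * first_form c (fst (lap \<phi> p)) (fst (b (\<phi> p)))" for p
  have Rs: "smooth_on (\<lambda>z. R (fst z) (snd z)) UNIV" "\<And>y. R 0 y = y"
    "\<And>t y. y \<in> product_space c \<Longrightarrow> R t y \<in> product_space c"
    "\<And>y. ((\<lambda>t. R t y) has_vector_derivative b y) (at 0)" "smooth_on b UNIV"
    using R unfolding flow_on_def by auto
  have lp: "smooth_map A (lap \<phi>)" "smooth_map A (lap (lap \<phi>))"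
    by (intro lap_smooth \<phi>_smooth)+
  have bp: "smooth_map A (\<lambda>p. b (\<phi> p))"
  proof (rule smooth_mapI)
    fix U x assume Ux: "(U, x) \<in> A"
    show "smooth_on (\<lambda>u. b (\<phi> (x u))) U"
      by (rule smooth_on_compose[OF chart_open[OF Ux] open_UNIV Rs(5) smooth_mapD[OF \<phi>_smooth Ux]]) simp
  qed
  have qs: "smooth_map A q"
    unfolding q_def[abs_def]
    by (intro smooth_map_add smooth_map_mult smooth_map_const smooth_map_bilinear[OF bounded_bilinear_ambient_form]
        smooth_map_bilinear[OF bounded_bilinear_first_form] smooth_map_linear[OF bounded_linear_fst] lp bp)
  have qc: "continuous_map X euclidean q" by (rule smooth_map_continuous[OF qs])
  have key: "(\<integral>p. bump U x u0 r p * q p \<partial>dv) = 0" if Ux: "(U, x) \<in> A" and r: "r > 0" "cball u0 r \<subseteq> U" for U x u0 r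
  proof -
    let ?\<eta> = "bump U x u0 r"
    have \<eta>s: "smooth_map A ?\<eta>" by (rule bump_smooth[OF Ux r(2,1)])
    define K where "K = x ` cball u0 r"
    have K: "compactin X K" unfolding K_def by (rule chart_image_compact[OF Ux compact_cball r(2)])
    have \<eta>0: "?\<eta> p = 0" if "p \<in> topspace X - K" for p
      using bump_support[OF Ux r(1), of p u0] that by (auto simp: K_def)
    define F where "F s p = R (s * ?\<eta> p) (\<phi> p)" for s p
    have var: "smooth_variation c X A \<phi> K 1 F"
      unfolding smooth_variation_def
    proof (intro conjI ballI)
      show "F s p \<in> product_space c" if "s \<in> {-1<..<1}" "p \<in> topspace X" for s p
        unfolding F_def by (rule Rs(3)[OF \<phi>_in[OF that(2)]])
      show "F 0 p = \<phi> p" for p by (simp add: F_def Rs(2))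
      show "F s p = \<phi> p" if "p \<in> topspace X - K" for s p using \<eta>0[OF that] by (simp add: F_def Rs(2))
      show "case z of (V, y) \<Rightarrow> smooth_on (\<lambda>(s, v). F s (y v)) ({-1<..<1} \<times> V)" if zA: "z \<in> A" for z
      proof -
        obtain V y where z: "z = (V, y)" by (cases z)
        have Vy: "(V, y) \<in> A" using zA z by simp
        have oI: "open {-1<..<1::real}" by auto
        have o: "open ({-1<..<1::real} \<times> V)" using chart_open[OF Vy] by (simp add: open_Times)
        have "smooth_on (\<lambda>w. (fst w * ?\<eta> (y (snd w)), \<phi> (y (snd w)))) ({-1<..<1::real} \<times> V)"
          by (intro smooth_on_Pair smooth_on_mult smooth_on_fst smooth_on_id o
            smooth_on_snd_arg[OF oI chart_open[OF Vy] smooth_mapD[OF \<eta>s Vy]]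
            smooth_on_snd_arg[OF oI chart_open[OF Vy] smooth_mapD[OF \<phi>_smooth Vy]])
        from smooth_on_compose[OF o open_UNIV Rs(1) this]
        show ?thesis unfolding z F_def by (simp add: case_prod_unfold)
      qed
    qed
    define V where "V p = ?\<eta> p *\<^sub>R b (\<phi> p)" for p
    have dV: "((\<lambda>s. F s p) has_vector_derivative V p) (at 0)" for p
    proof -
      have "((\<lambda>s. s * ?\<eta> p) has_vector_derivative ?\<eta> p) (at 0)"
        by (auto intro!: derivative_eq_intros)
      moreover have "((\<lambda>t. R t (\<phi> p)) has_vector_derivative b (\<phi> p)) (at (0 * ?\<eta> p))" using Rs(4) by simp
      ultimately show ?thesis
        unfolding F_def V_def using vector_diff_chain_at[of "\<lambda>s. s * ?\<eta> p" "?\<eta> p" 0 "\<lambda>t. R t (\<phi> p)" "b (\<phi> p)"]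
        by (simp add: comp_def)
    qed
    have Vs: "smooth_map A V" unfolding V_def[abs_def]
      by (rule smooth_map_bilinear[OF bounded_bilinear_scaleR \<eta>s bp])
    have V0: "V p = 0" if "p \<in> topspace X - K" for p using \<eta>0[OF that] by (simp add: V_def)
    have bd0: "(\<integral>p. bienergy_derivative c (\<phi> p) (lap \<phi> p) (V p) (lap V p) \<partial>dv) = 0"
      by (rule DERIV_unique[OF first_variation[OF K _ var dV] crit[OF K _ var]]) auto
    define \<Psi> where "\<Psi> p = lap \<phi> p + (c * m) *\<^sub>R (fst (\<phi> p), 0)" for p
    have l: "bounded_linear (\<lambda>y::(real^3) \<times> real. (c * m) *\<^sub>R (fst y, 0 :: real))"
      by (intro bounded_linear_const_scaleR bounded_linear_Pair bounded_linear_fst bounded_linear_zero)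
    have \<Psi>s: "smooth_map A \<Psi>" unfolding \<Psi>_def[abs_def]
      by (intro smooth_map_add lp smooth_map_linear[OF l \<phi>_smooth])
    have lap\<Psi>: "lap \<Psi> p = lap (lap \<phi>) p + (c * m) *\<^sub>R (fst (lap \<phi> p), 0)" if "p \<in> topspace X" for p
      unfolding \<Psi>_def[abs_def] lap_add[OF that lp(1) smooth_map_linear[OF l \<phi>_smooth]] lap_linear[OF that l \<phi>_smooth] ..
    let ?g = "\<lambda>p. ambient_form c (\<Psi> p) (lap V p) - ambient_form c (lap \<Psi> p) (V p)"
    have split: "bienergy_derivative c (\<phi> p) (lap \<phi> p) (V p) (lap V p) = ?g p + ?\<eta> p * q p" if "p \<in> topspace X" for p
      unfolding bienergy_derivative_def m[OF that] lap\<Psi>[OF that] \<Psi>_def V_def q_def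
      by (simp add: ambient_form_simps first_form_simps ambient_form_def first_form_commute[of c "fst (lap _ p)" "fst (\<phi> p)"] algebra_simps)
    have gs: "continuous_map X euclidean ?g"
      by (intro smooth_map_continuous smooth_map_diff smooth_map_bilinear[OF bounded_bilinear_ambient_form] lap_smooth \<Psi>s Vs)
    have g0: "?g p = 0" if "p \<in> topspace X - K" for p
      using lap_zero_outside[OF K Vs V0 that] V0[OF that] by (simp add: ambient_form_simps)
    have ig: "integrable dv ?g" by (rule integrable_compact_support[OF gs K g0])
    have i\<eta>: "integrable dv (\<lambda>p. ?\<eta> p * q p)"
      by (rule integrable_compact_support[OF smooth_map_continuous[OF smooth_map_mult[OF \<eta>s qs]] K]) (simp add: \<eta>0)
    have "(\<integral>p. bienergy_derivative c (\<phi> p) (lap \<phi> p) (V p) (lap V p) \<partial>dv) = (\<integral>p. ?g p + ?\<eta> p * q p \<partial>dv)"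
      by (rule Bochner_Integration.integral_cong) (use split space_dv in auto)
    also have "\<dots> = (\<integral>p. ?g p \<partial>dv) + (\<integral>p. ?\<eta> p * q p \<partial>dv)"
      by (rule Bochner_Integration.integral_add[OF ig i\<eta>])
    finally show ?thesis using green_form[OF \<Psi>s Vs K V0] bd0 by simp
  qed
  obtain U x u0 where Ux: "(U, x) \<in> A" "u0 \<in> U" "p = x u0" using chart_cover[OF p] .
  have "q p \<le> 0" unfolding Ux(3)
    by (rule vanishing_from_bumps[OF qc Ux(1,2)]) (rule key[OF Ux(1)])
  moreover have "- q p \<le> 0" unfolding Ux(3)
  proof (rule vanishing_from_bumps[OF _ Ux(1,2)])
    show "continuous_map X euclidean (\<lambda>p. - q p)"
      by (rule smooth_map_continuous[OF smooth_map_linear[OF bounded_linear_minus[OF bounded_linear_ident] qs]])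
    show "(\<integral>p. bump U x u0 r p * - q p \<partial>dv) = 0" if "r > 0" "cball u0 r \<subseteq> U" for r
      using key[OF Ux(1) that] by simp
  qed
  ultimately show ?thesis unfolding q_def by linarith
qed

text \<open>The vertical translations give the first equation. The rotations give the second one, since
  their velocities span the tangent space of the first factor.\<close>

lemma euler_lagrange:
  assumes crit: "\<And>K \<epsilon> F. compactin X K \<Longrightarrow> \<epsilon> > 0 \<Longrightarrow> smooth_variation c X A \<phi> K \<epsilon> F \<Longrightarrow>
           ((\<lambda>s. bienergy c A \<phi> dv K (F s)) has_real_derivative 0) (at 0)"
    and m: "\<And>p. p \<in> topspace X \<Longrightarrow> first_form c (fst (lap \<phi> p)) (fst (\<phi> p)) = - m"
    and p: "p \<in> topspace X"
  shows "snd (lap (lap \<phi>) p) = 0"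
    and "first_form c v (fst (\<phi> p)) = 0 \<Longrightarrow>
      first_form c (fst (lap (lap \<phi>) p) + (2 * c * m) *\<^sub>R fst (lap \<phi> p)) v = 0"
proof -
  have E: "ambient_form c (lap (lap \<phi>) p) (b (\<phi> p)) + 2 * c * m * first_form c (fst (lap \<phi> p)) (fst (b (\<phi> p))) = 0"
    if "flow_on c R b" for R b
    by (rule euler_lagrange_along_flow[OF _ _ that p]) (rule crit m; assumption)+
  show "snd (lap (lap \<phi>) p) = 0"
    using E[OF flow_on_vertical] by (simp add: ambient_form_def first_form_simps)
  let ?W = "fst (lap (lap \<phi>) p) + (2 * c * m) *\<^sub>R fst (lap \<phi> p)"
  have W: "first_form c ?W (fst (b (\<phi> p))) = 0" if "flow_on c R b" "\<And>y. snd (b y) = 0" for R b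
    using E[OF that(1)] that(2) by (simp add: ambient_form_def first_form_simps)
  have y: "first_form c (fst (\<phi> p)) (fst (\<phi> p)) = c"
    using \<phi>_in[OF p] by (simp add: product_space_def space_form_def mem_Times_iff)
  assume v: "first_form c v (fst (\<phi> p)) = 0"
  show "first_form c ?W v = 0"
    by (rule first_form_parallel[OF c y W[OF flow_on_axial] W[OF flow_on_mixed[OF c]] W[OF flow_on_mixed[OF c]] v])
       (simp_all add: axial_generator_def mixed_generator_def)
qed

end

section \<open>Adapted frames along a constant angle surface\<close>

text \<open>The cross product of the bilinear form: orthogonal to both factors with respect to
  \<open>first_form c\<close>.\<close>

definition form_cross :: "real \<Rightarrow> real^3 \<Rightarrow> real^3 \<Rightarrow> real^3" where
  "form_cross c a b = (\<chi> i. if i = 1 then a $ 2 * b $ 3 - a $ 3 * b $ 2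
     else if i = 2 then a $ 3 * b $ 1 - a $ 1 * b $ 3 else c * (a $ 1 * b $ 2 - a $ 2 * b $ 1))"

lemma form_cross_ortho:
  assumes "c * c = 1"
  shows "first_form c (form_cross c a b) a = 0" "first_form c (form_cross c a b) b = 0"
    "first_form c (form_cross c a b) (form_cross c a b)
      = c * (first_form c a a * first_form c b b - (first_form c a b)\<^sup>2)"
proof -
  have c3: "c * (c * x) = x" for x using assms by (metis mult.assoc mult_1)
  show "first_form c (form_cross c a b) a = 0" "first_form c (form_cross c a b) b = 0"
    unfolding first_form_def form_cross_def by (simp_all add: c3 algebra_simps)
  show "first_form c (form_cross c a b) (form_cross c a b)
      = c * (first_form c a a * first_form c b b - (first_form c a b)\<^sup>2)"
    unfolding first_form_def form_cross_def by (simp add: c3 power2_eq_square algebra_simps)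
qed

text \<open>The difference \<open>d\<close> of the two sides is orthogonal to three independent vectors; Cramer's rule
  turns this linear system for \<open>d\<close> into \<open>d = 0\<close>. The determinant is the square of the third
  frame vector, which is 1.\<close>

lemma frame_expansion:
  assumes cc: "c * c = 1" and n: "first_form c n n = 1" "first_form c n f = 0" "first_form c f f = c"
  shows "a = first_form c a n *\<^sub>R n + first_form c a (form_cross c n f) *\<^sub>R form_cross c n f
      + (c * first_form c a f) *\<^sub>R f"
proof -
  define b where "b = form_cross c n f"
  have b: "first_form c b n = 0" "first_form c b f = 0" "first_form c b b = 1"
    unfolding b_def using form_cross_ortho[OF cc] n cc by simp_all
  define d where "d = a - (first_form c a n *\<^sub>R n + first_form c a b *\<^sub>R b + (c * first_form c a f) *\<^sub>R f)"
  have nf: "first_form c f n = 0" "first_form c n b = 0" "first_form c f b = 0"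
    using n b first_form_commute[of c] by metis+
  have ccx: "c * x * c = x" for x using cc by (metis mult.assoc mult.commute mult_1)
  have d0: "first_form c d n = 0" "first_form c d f = 0" "first_form c d b = 0"
    unfolding d_def by (simp_all add: first_form_simps n b nf ccx)
  define D3 where "D3 = c * d $ 3"
  have D: "n $ 1 * d $ 1 + n $ 2 * d $ 2 + n $ 3 * D3 = 0" "f $ 1 * d $ 1 + f $ 2 * d $ 2 + f $ 3 * D3 = 0"
    "b $ 1 * d $ 1 + b $ 2 * d $ 2 + b $ 3 * D3 = 0"
    using d0 unfolding first_form_def D3_def by (simp_all add: algebra_simps)
  have b3: "b $ 1 = n $ 2 * f $ 3 - n $ 3 * f $ 2" "b $ 2 = n $ 3 * f $ 1 - n $ 1 * f $ 3"
     "c * b $ 3 = n $ 1 * f $ 2 - n $ 2 * f $ 1"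
    using cc by (simp_all add: b_def form_cross_def mult.assoc[symmetric])
  have det: "(n $ 2 * f $ 3 - n $ 3 * f $ 2) * b $ 1 + (n $ 3 * f $ 1 - n $ 1 * f $ 3) * b $ 2
      + (n $ 1 * f $ 2 - n $ 2 * f $ 1) * b $ 3 = 1"
    unfolding b3[symmetric] using b(3) by (simp add: first_form_def mult.assoc)
  have "d $ 1 * ((n $ 2 * f $ 3 - n $ 3 * f $ 2) * b $ 1 + (n $ 3 * f $ 1 - n $ 1 * f $ 3) * b $ 2
      + (n $ 1 * f $ 2 - n $ 2 * f $ 1) * b $ 3)
    = (f $ 2 * b $ 3 - f $ 3 * b $ 2) * (n $ 1 * d $ 1 + n $ 2 * d $ 2 + n $ 3 * D3)
    + (n $ 3 * b $ 2 - n $ 2 * b $ 3) * (f $ 1 * d $ 1 + f $ 2 * d $ 2 + f $ 3 * D3)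
    + (n $ 2 * f $ 3 - n $ 3 * f $ 2) * (b $ 1 * d $ 1 + b $ 2 * d $ 2 + b $ 3 * D3)"
    by (simp add: algebra_simps)
  then have 1: "d $ 1 = 0" unfolding det D by simp
  have "d $ 2 * ((n $ 2 * f $ 3 - n $ 3 * f $ 2) * b $ 1 + (n $ 3 * f $ 1 - n $ 1 * f $ 3) * b $ 2
      + (n $ 1 * f $ 2 - n $ 2 * f $ 1) * b $ 3)
    = (f $ 3 * b $ 1 - f $ 1 * b $ 3) * (n $ 1 * d $ 1 + n $ 2 * d $ 2 + n $ 3 * D3)
    + (n $ 1 * b $ 3 - n $ 3 * b $ 1) * (f $ 1 * d $ 1 + f $ 2 * d $ 2 + f $ 3 * D3)
    + (n $ 3 * f $ 1 - n $ 1 * f $ 3) * (b $ 1 * d $ 1 + b $ 2 * d $ 2 + b $ 3 * D3)"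
    by (simp add: algebra_simps)
  then have 2: "d $ 2 = 0" unfolding det D by simp
  have "D3 * ((n $ 2 * f $ 3 - n $ 3 * f $ 2) * b $ 1 + (n $ 3 * f $ 1 - n $ 1 * f $ 3) * b $ 2
      + (n $ 1 * f $ 2 - n $ 2 * f $ 1) * b $ 3)
    = (f $ 1 * b $ 2 - f $ 2 * b $ 1) * (n $ 1 * d $ 1 + n $ 2 * d $ 2 + n $ 3 * D3)
    + (n $ 2 * b $ 1 - n $ 1 * b $ 2) * (f $ 1 * d $ 1 + f $ 2 * d $ 2 + f $ 3 * D3)
    + (n $ 1 * f $ 2 - n $ 2 * f $ 1) * (b $ 1 * d $ 1 + b $ 2 * d $ 2 + b $ 3 * D3)"
    by (simp add: algebra_simps)
  then have "D3 = 0" unfolding det D by simp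
  then have "d $ 3 = 0" using cc by (auto simp: D3_def)
  with 1 2 have "d = 0" by (simp add: vec_eq_iff forall_3)
  then show ?thesis unfolding d_def b_def by simp
qed

locale normal_chart = immersed_chart +
  fixes \<Xi> :: "real^2 \<Rightarrow> (real^3) \<times> real"
  assumes \<Xi>_smooth: "smooth_on \<Xi> U"
    and \<Xi>_tangent: "u \<in> U \<Longrightarrow> first_form c (fst (\<Xi> u)) (fst (\<Phi> u)) = 0"
    and \<Xi>_unit: "u \<in> U \<Longrightarrow> ambient_form c (\<Xi> u) (\<Xi> u) = 1"
    and \<Xi>_normal: "u \<in> U \<Longrightarrow> ambient_form c (\<Xi> u) (partial_deriv i \<Phi> u) = 0"
begin

text \<open>Projection and Christoffel terms disappear in the product with the normal.\<close>

lemma mean_curvature_eq: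
  assumes u: "u \<in> U"
  shows "chart_mean_curvature c \<Phi> \<Xi> u = ambient_form c (laplacian c \<Phi> \<Phi> u) (\<Xi> u) / 2"
proof -
  have "ambient_form c (cov_deriv_along c \<Phi> i j u) (\<Xi> u)
      = ambient_form c (partial_deriv i (partial_deriv j \<Phi>) u) (\<Xi> u)" for i j
    using \<Xi>_tangent[OF u] unfolding cov_deriv_along_def tangent_proj_def
    by (simp add: ambient_form_simps) (simp add: ambient_form_def first_form_simps first_form_commute)
  then show ?thesis
    unfolding chart_mean_curvature_def laplacian_second_order_op second_order_op_def
    using \<Xi>_normal[OF u] by (simp add: sum_2 ambient_form_simps ambient_form_commute[of c _ "\<Xi> u"])
qed

end

locale constant_angle_chart = normal_chart +
  fixes \<theta> :: real
  assumes angle: "u \<in> U \<Longrightarrow> snd (\<Xi> u) = \<theta>"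
begin

lemma first_form_\<Xi>: "u \<in> U \<Longrightarrow> first_form c (fst (\<Xi> u)) (fst (\<Xi> u)) = 1 - \<theta>\<^sup>2"
  using \<Xi>_unit[of u] angle[of u] by (simp add: ambient_form_def power2_eq_square)

text \<open>The first component of the normal has square \<open>1 - \<theta>\<^sup>2 \<le> 0\<close>, so it vanishes by positivity and
  the height is locally constant; the Laplacian of the immersion then has no vertical component,
  and the normal has only this one.\<close>

lemma horizontal_minimal:
  assumes "\<theta>\<^sup>2 \<ge> 1" "u \<in> U"
  shows "chart_mean_curvature c \<Phi> \<Xi> u = 0"
proof -
  have z: "fst (\<Xi> u) = 0" if "u \<in> U" for u
  proof (rule ccontr)
    assume "fst (\<Xi> u) \<noteq> 0"
    then have "first_form c (fst (\<Xi> u)) (fst (\<Xi> u)) > 0"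
      using first_form_pos[OF c _ \<Xi>_tangent[OF that]] img[OF that] by (simp add: product_space_def mem_Times_iff)
    then show False using first_form_\<Xi>[OF that] assms(1) by simp
  qed
  have h0: "partial_deriv i (\<lambda>u. snd (\<Phi> u)) u = 0" if "u \<in> U" for i u
  proof -
    have "\<theta> * snd (partial_deriv i \<Phi> u) = 0"
      using \<Xi>_normal[OF that, of i] z[OF that] angle[OF that] by (simp add: ambient_form_def first_form_simps)
    then show ?thesis using assms(1) partial_snd[OF that] by auto
  qed
  have "partial_deriv i (partial_deriv j (\<lambda>u. snd (\<Phi> u))) u = 0" for i j
  proof -
    have "partial_deriv i (partial_deriv j (\<lambda>u. snd (\<Phi> u))) u = partial_deriv i (\<lambda>_. 0) u"
      by (rule partial_deriv_cong[OF openU assms(2)]) (rule h0)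
    then show ?thesis by simp
  qed
  then have "laplacian c \<Phi> (\<lambda>u. snd (\<Phi> u)) u = 0"
    unfolding laplacian_second_order_op second_order_op_def using h0[OF assms(2)] by simp
  then have "snd (laplacian c \<Phi> \<Phi> u) = 0"
    using laplacian_linear[OF bounded_linear_snd smooth assms(2)] by simp
  then show ?thesis
    unfolding mean_curvature_eq[OF assms(2)] ambient_form_def using z[OF assms(2)] by (simp add: first_form_simps)
qed

end

text \<open>The frame along the surface. With \<open>\<Phi> = (f, h)\<close> and unit normal \<open>(s \<nu>, \<theta>)\<close>, the vectors \<open>\<nu>\<close>,
  \<open>\<beta>\<close>, \<open>f\<close> are an orthogonal basis of \<open>\<real>\<^sup>3\<close>. The coframe \<open>\<omega>1 = dh / s\<close>, \<open>\<omega>2 = \<langle>df, \<beta>\<rangle>\<close> is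
  orthonormal with dual frame \<open>e1\<close>, \<open>e2\<close>, and \<open>d1\<close>, \<open>d2\<close> are the derivatives in these
  directions: \<open>e1\<close> is the normalised tangential part of \<open>\<partial>\<^sub>t\<close>, with image \<open>(- \<theta> \<nu>, s)\<close>, and \<open>e2\<close>
  has image \<open>(\<beta>, 0)\<close> and is tangent to the level curves of \<open>h\<close>. The function \<open>\<kappa>\<close> is the geodesic
  curvature of these curves in the space form, and \<open>D\<close> is the determinant of the coframe in
  coordinates.\<close>

locale slanted_chart = constant_angle_chart +
  assumes angle_lt: "\<theta>\<^sup>2 < 1"
begin

definition "s = sqrt (1 - \<theta>\<^sup>2)"
abbreviation "f u \<equiv> fst (\<Phi> u)"
abbreviation "h u \<equiv> snd (\<Phi> u)"
definition "\<nu> u = (1 / s) *\<^sub>R fst (\<Xi> u)"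
definition "\<beta> u = form_cross c (\<nu> u) (f u)"
definition "\<omega>1 i u = partial_deriv i h u / s"
definition "\<omega>2 i u = first_form c (partial_deriv i f u) (\<beta> u)"
definition "D u = \<omega>1 1 u * \<omega>2 2 u - \<omega>1 2 u * \<omega>2 1 u"
definition "e1 i u = (if i = (1::2) then \<omega>2 2 u else - \<omega>2 1 u) / D u"
definition "e2 i u = (if i = (1::2) then - \<omega>1 2 u else \<omega>1 1 u) / D u"
definition "\<kappa> u = - (\<Sum>i\<in>UNIV. e2 i u * first_form c (partial_deriv i \<nu> u) (\<beta> u))"
definition d1 :: "(real^2 \<Rightarrow> 'z::real_normed_vector) \<Rightarrow> real^2 \<Rightarrow> 'z" where
  "d1 \<psi> u = (\<Sum>i\<in>UNIV. e1 i u *\<^sub>R partial_deriv i \<psi> u)"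
definition d2 :: "(real^2 \<Rightarrow> 'z::real_normed_vector) \<Rightarrow> real^2 \<Rightarrow> 'z" where
  "d2 \<psi> u = (\<Sum>i\<in>UNIV. e2 i u *\<^sub>R partial_deriv i \<psi> u)"

lemma s: "s > 0" "s * s = 1 - \<theta> * \<theta>" "s \<noteq> 0"
  using angle_lt by (auto simp: s_def power2_eq_square)

lemma f_smooth: "smooth_on f U" and h_smooth: "smooth_on h U"
  by (rule smooth_on_fst[OF openU smooth], rule smooth_on_snd[OF openU smooth])

lemma \<nu>_smooth: "smooth_on \<nu> U"
  unfolding \<nu>_def[abs_def] by (intro smooth_on_scaleR smooth_on_const smooth_on_fst \<Xi>_smooth openU)

lemma \<beta>_smooth: "smooth_on \<beta> U"
proof (rule smooth_on_vec[OF openU])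
  fix i :: 3
  have n: "smooth_on (\<lambda>u. \<nu> u $ j) U" "smooth_on (\<lambda>u. f u $ j) U" for j
    by (intro smooth_on_nth openU \<nu>_smooth f_smooth)+
  show "smooth_on (\<lambda>u. \<beta> u $ i) U"
    unfolding \<beta>_def form_cross_def
    by (cases "i = 1"; cases "i = 2") (auto intro!: smooth_on_mult smooth_on_diff smooth_on_const openU n)
qed

lemma frame:
  assumes "u \<in> U"
  shows "first_form c (\<nu> u) (\<nu> u) = 1" "first_form c (\<nu> u) (f u) = 0" "first_form c (f u) (f u) = c"
    "first_form c (\<beta> u) (\<nu> u) = 0" "first_form c (\<beta> u) (f u) = 0" "first_form c (\<beta> u) (\<beta> u) = 1"
    "first_form c (f u) (\<nu> u) = 0" "first_form c (\<nu> u) (\<beta> u) = 0" "first_form c (f u) (\<beta> u) = 0"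
proof -
  have ss: "s * s = 1 - \<theta>\<^sup>2" using s(2) by (simp add: power2_eq_square)
  show 1: "first_form c (\<nu> u) (\<nu> u) = 1"
  proof -
    have "first_form c (fst (\<Xi> u)) (fst (\<Xi> u)) = s * s" using first_form_\<Xi>[OF assms] ss by simp
    then show ?thesis unfolding \<nu>_def using s(3) by (simp add: first_form_simps)
  qed
  show 2: "first_form c (\<nu> u) (f u) = 0" unfolding \<nu>_def using \<Xi>_tangent[OF assms] by (simp add: first_form_simps)
  show 3: "first_form c (f u) (f u) = c" by (rule first_const[OF assms])
  show 4: "first_form c (\<beta> u) (\<nu> u) = 0" "first_form c (\<beta> u) (f u) = 0" "first_form c (\<beta> u) (\<beta> u) = 1"
    unfolding \<beta>_def using form_cross_ortho[OF cc] 1 2 3 by simp_all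
  show "first_form c (f u) (\<nu> u) = 0" "first_form c (\<nu> u) (\<beta> u) = 0" "first_form c (f u) (\<beta> u) = 0"
    using 2 4 first_form_commute[of c] by metis+
qed

lemma expansion:
  "u \<in> U \<Longrightarrow> a = first_form c a (\<nu> u) *\<^sub>R \<nu> u + first_form c a (\<beta> u) *\<^sub>R \<beta> u + (c * first_form c a (f u)) *\<^sub>R f u"
  unfolding \<beta>_def by (rule frame_expansion[OF cc frame(1-3)])

text \<open>Constant products in the frame can be differentiated; this determines all derivatives of the
  frame up to \<open>\<langle>d\<nu>, \<beta>\<rangle>\<close>.\<close>

lemma form_partial:
  assumes "smooth_on a U" "smooth_on b U" "u \<in> U" "\<And>w. w \<in> U \<Longrightarrow> first_form c (a w) (b w) = k"
  shows "first_form c (partial_deriv i a u) (b u) = - first_form c (a u) (partial_deriv i b u)"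
proof -
  have "partial_deriv i (\<lambda>w. first_form c (a w) (b w)) u = 0"
    using partial_deriv_cong[OF openU assms(3), of "\<lambda>w. first_form c (a w) (b w)" "\<lambda>_. k"] assms(4) by simp
  then show ?thesis
    using partial_deriv_bilinear[OF bounded_bilinear_first_form diff_at[OF assms(1,3)] diff_at[OF assms(2,3)], of i c]
    by simp
qed

lemma form_partial_self:
  assumes "smooth_on a U" "u \<in> U" "\<And>w. w \<in> U \<Longrightarrow> first_form c (a w) (a w) = k"
  shows "first_form c (partial_deriv i a u) (a u) = 0"
  using form_partial[OF assms(1,1,2), of k i] assms(3) first_form_commute[of c "a u"] by simp

lemma partial_h: "partial_deriv i h u = s * \<omega>1 i u"
  using s by (simp add: \<omega>1_def)

lemma partial_f:
  assumes "u \<in> U"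
  shows "partial_deriv i f u = (- \<theta> * \<omega>1 i u) *\<^sub>R \<nu> u + \<omega>2 i u *\<^sub>R \<beta> u"
proof -
  have "first_form c (fst (\<Xi> u)) (partial_deriv i f u) + \<theta> * partial_deriv i h u = 0"
    using \<Xi>_normal[OF assms, of i] partial_fst[OF assms, of i] partial_snd[OF assms, of i] angle[OF assms]
    by (simp add: ambient_form_def)
  then have "first_form c (partial_deriv i f u) (fst (\<Xi> u)) = - \<theta> * (s * \<omega>1 i u)"
    unfolding partial_h first_form_commute[of c "partial_deriv i f u"] by simp
  then have "first_form c (partial_deriv i f u) (\<nu> u) = - \<theta> * \<omega>1 i u"
    unfolding \<nu>_def using s by (simp add: first_form_simps)
  moreover have "first_form c (partial_deriv i f u) (f u) = 0"
    by (rule form_partial_self[OF f_smooth assms frame(3)])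
  ultimately show ?thesis using expansion[OF assms, of "partial_deriv i f u"] by (simp add: \<omega>2_def)
qed

lemma metric_coframe:
  assumes "u \<in> U"
  shows "g i j u = \<omega>1 i u * \<omega>1 j u + \<omega>2 i u * \<omega>2 j u"
proof -
  have "g i j u = first_form c (partial_deriv i f u) (partial_deriv j f u) + partial_deriv i h u * partial_deriv j h u"
    unfolding metric_nth ambient_form_def partial_fst[OF assms] partial_snd[OF assms] ..
  also have "\<dots> = (\<theta> * \<theta> + s * s) * (\<omega>1 i u * \<omega>1 j u) + \<omega>2 i u * \<omega>2 j u"
    unfolding partial_f[OF assms] partial_h
    by (simp add: first_form_simps frame[OF assms] algebra_simps)
  finally show ?thesis using s(2) by simp
qed

lemma D_nonzero:
  assumes "u \<in> U" shows "D u \<noteq> 0" "vol2 u = D u * D u"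
proof -
  show "vol2 u = D u * D u" unfolding metric_coframe[OF assms] D_def by (simp add: algebra_simps)
  then show "D u \<noteq> 0" using metric_det[OF assms] by auto
qed

lemma dual_frame:
  assumes "u \<in> U"
  shows "(\<Sum>i\<in>UNIV. e1 i u * \<omega>1 i u) = 1" "(\<Sum>i\<in>UNIV. e1 i u * \<omega>2 i u) = 0"
    "(\<Sum>i\<in>UNIV. e2 i u * \<omega>1 i u) = 0" "(\<Sum>i\<in>UNIV. e2 i u * \<omega>2 i u) = 1"
proof -
  have "(\<omega>2 2 u * \<omega>1 1 u - \<omega>2 1 u * \<omega>1 2 u) / D u = 1" "(\<omega>1 1 u * \<omega>2 2 u - \<omega>1 2 u * \<omega>2 1 u) / D u = 1"
    using D_nonzero[OF assms] by (simp_all add: D_def mult.commute)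
  then show "(\<Sum>i\<in>UNIV. e1 i u * \<omega>1 i u) = 1" "(\<Sum>i\<in>UNIV. e1 i u * \<omega>2 i u) = 0"
    "(\<Sum>i\<in>UNIV. e2 i u * \<omega>1 i u) = 0" "(\<Sum>i\<in>UNIV. e2 i u * \<omega>2 i u) = 1"
    by (simp_all add: sum_2 e1_def e2_def diff_divide_distrib)
qed

lemma coframe_smooth: "smooth_on (\<omega>1 i) U" "smooth_on (\<omega>2 i) U"
proof -
  show "smooth_on (\<omega>1 i) U" unfolding \<omega>1_def[abs_def]
    by (intro smooth_on_divide smooth_on_partial_deriv h_smooth smooth_on_const openU s)
  show "smooth_on (\<omega>2 i) U" unfolding \<omega>2_def[abs_def]
    by (intro smooth_on_bilinear[OF bounded_bilinear_first_form] smooth_on_partial_deriv f_smooth \<beta>_smooth openU)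
qed

lemma D_smooth: "smooth_on D U"
  unfolding D_def[abs_def] by (intro smooth_on_diff smooth_on_mult coframe_smooth openU)

lemma e_smooth: "smooth_on (e1 i) U" "smooth_on (e2 i) U"
  unfolding e1_def[abs_def] e2_def[abs_def]
  using exhaust_2[of i] D_nonzero(1)
  by (auto intro!: smooth_on_divide smooth_on_uminus coframe_smooth D_smooth openU)

lemma \<kappa>_smooth: "smooth_on \<kappa> U"
  unfolding \<kappa>_def[abs_def]
  by (intro smooth_on_uminus smooth_on_sum smooth_on_mult e_smooth smooth_on_bilinear[OF bounded_bilinear_first_form]
     smooth_on_partial_deriv \<nu>_smooth \<beta>_smooth openU)

lemma d_smooth: "smooth_on \<psi> U \<Longrightarrow> smooth_on (d1 \<psi>) U" "smooth_on \<psi> U \<Longrightarrow> smooth_on (d2 \<psi>) U"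
  unfolding d1_def[abs_def] d2_def[abs_def]
  by (intro smooth_on_sum smooth_on_scaleR e_smooth smooth_on_partial_deriv openU; assumption)+

text \<open>The shape operator is symmetric, and \<open>\<langle>d\<xi>, d\<Phi>\<rangle> = s \<langle>d\<nu>, \<beta>\<rangle> \<omega>2\<close>; so \<open>\<langle>d\<nu>, \<beta>\<rangle>\<close> is a multiple of
  \<open>\<omega>2\<close>, which leaves the single function \<open>\<kappa>\<close>.\<close>

lemma partial_\<nu>_\<beta>:
  assumes "u \<in> U"
  shows "first_form c (partial_deriv i \<nu> u) (\<beta> u) = - \<kappa> u * \<omega>2 i u"
proof -
  let ?a = "\<lambda>i. first_form c (partial_deriv i \<nu> u) (\<beta> u)"
  have "ambient_form c (partial_deriv i \<Xi> u) (partial_deriv j \<Phi> u) = - ambient_form c (\<Xi> u) (partial_deriv i (partial_deriv j \<Phi>) u)" for i j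
  proof -
    have "partial_deriv i (\<lambda>w. ambient_form c (\<Xi> w) (partial_deriv j \<Phi> w)) u = 0"
      using partial_deriv_cong[OF openU assms, of "\<lambda>w. ambient_form c (\<Xi> w) (partial_deriv j \<Phi> w)" "\<lambda>_. 0"] \<Xi>_normal by simp
    then show ?thesis
      using partial_deriv_bilinear[OF bounded_bilinear_ambient_form diff_at[OF \<Xi>_smooth assms]
          diff_at[OF smooth_on_partial_deriv[OF smooth] assms], of i c j] by simp
  qed
  moreover have "ambient_form c (partial_deriv i \<Xi> u) (partial_deriv j \<Phi> u) = s * (?a i * \<omega>2 j u)" for i j
  proof -
    have "snd (partial_deriv i \<Xi> u) = partial_deriv i (\<lambda>u. snd (\<Xi> u)) u"
      using partial_deriv_linear[OF bounded_linear_snd diff_at[OF \<Xi>_smooth assms]] by simp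
    also have "\<dots> = 0" using partial_deriv_cong[OF openU assms, of "\<lambda>u. snd (\<Xi> u)" "\<lambda>_. \<theta>"] angle by simp
    finally have 1: "snd (partial_deriv i \<Xi> u) = 0" .
    have l: "bounded_linear (\<lambda>y::(real^3) \<times> real. (1 / s) *\<^sub>R fst y)"
      by (intro bounded_linear_const_scaleR bounded_linear_fst)
    have "partial_deriv i \<nu> u = (1 / s) *\<^sub>R fst (partial_deriv i \<Xi> u)"
      unfolding \<nu>_def[abs_def] by (rule partial_deriv_linear[OF l diff_at[OF \<Xi>_smooth assms]])
    then have 2: "fst (partial_deriv i \<Xi> u) = s *\<^sub>R partial_deriv i \<nu> u" using s by simp
    have "first_form c (partial_deriv i \<nu> u) (\<nu> u) = 0" by (rule form_partial_self[OF \<nu>_smooth assms frame(1)])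
    then show ?thesis
      unfolding ambient_form_def 1 2 partial_fst[OF assms, symmetric] partial_f[OF assms]
      by (simp add: first_form_simps)
  qed
  ultimately have sym: "s * (?a i * \<omega>2 j u) = s * (?a j * \<omega>2 i u)" for i j
    using partial_deriv_commute[OF openU smooth assms, of i j] by metis
  have "?a i = ?a i * (\<Sum>j\<in>UNIV. e2 j u * \<omega>2 j u)" using dual_frame(4)[OF assms] by simp
  also have "\<dots> = (\<Sum>j\<in>UNIV. e2 j u * (?a i * \<omega>2 j u))" by (simp add: sum_2 algebra_simps)
  also have "\<dots> = (\<Sum>j\<in>UNIV. e2 j u * (?a j * \<omega>2 i u))" using sym s by simp
  also have "\<dots> = - \<kappa> u * \<omega>2 i u" by (simp add: \<kappa>_def sum_2 algebra_simps)
  finally show ?thesis .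
qed

lemma partial_\<nu>:
  assumes "u \<in> U"
  shows "partial_deriv i \<nu> u = (c * \<theta> * \<omega>1 i u) *\<^sub>R f u - (\<kappa> u * \<omega>2 i u) *\<^sub>R \<beta> u"
proof -
  have "first_form c (partial_deriv i \<nu> u) (\<nu> u) = 0" by (rule form_partial_self[OF \<nu>_smooth assms frame(1)])
  moreover have "first_form c (partial_deriv i \<nu> u) (f u) = \<theta> * \<omega>1 i u"
    using form_partial[OF \<nu>_smooth f_smooth assms frame(2), of i]
    by (simp add: partial_f[OF assms] first_form_simps frame[OF assms])
  ultimately show ?thesis
    using expansion[OF assms, of "partial_deriv i \<nu> u"] partial_\<nu>_\<beta>[OF assms, of i] by (simp add: mult.assoc)
qed

lemma partial_\<beta>:
  assumes "u \<in> U"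
  shows "partial_deriv i \<beta> u = (\<kappa> u * \<omega>2 i u) *\<^sub>R \<nu> u - (c * \<omega>2 i u) *\<^sub>R f u"
proof -
  have "first_form c (partial_deriv i \<beta> u) (\<beta> u) = 0" by (rule form_partial_self[OF \<beta>_smooth assms frame(6)])
  moreover have "first_form c (partial_deriv i \<beta> u) (f u) = - \<omega>2 i u"
    using form_partial[OF \<beta>_smooth f_smooth assms frame(5), of i]
    by (simp add: partial_f[OF assms] first_form_simps frame[OF assms])
  moreover have "first_form c (partial_deriv i \<beta> u) (\<nu> u) = \<kappa> u * \<omega>2 i u"
    using form_partial[OF \<beta>_smooth \<nu>_smooth assms frame(4), of i]
    by (simp add: partial_\<nu>[OF assms] first_form_simps frame[OF assms])
  ultimately show ?thesis
    using expansion[OF assms, of "partial_deriv i \<beta> u"] by simp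
qed

text \<open>The structure equations, evaluated on the dual frame.\<close>

lemma d_frame:
  assumes "u \<in> U"
  shows "d1 f u = - \<theta> *\<^sub>R \<nu> u" "d2 f u = \<beta> u" "d1 h u = s" "d2 h u = 0"
    "d1 \<nu> u = (c * \<theta>) *\<^sub>R f u" "d2 \<nu> u = - \<kappa> u *\<^sub>R \<beta> u" "d1 \<beta> u = 0" "d2 \<beta> u = \<kappa> u *\<^sub>R \<nu> u - c *\<^sub>R f u"
proof -
  have S1: "(\<Sum>i\<in>UNIV. e1 i u *\<^sub>R ((a * \<omega>1 i u) *\<^sub>R x + (b * \<omega>2 i u) *\<^sub>R y)) = a *\<^sub>R x" for a b and x y :: "'z::real_vector"
  proof -
    have "(\<Sum>i\<in>UNIV. e1 i u *\<^sub>R ((a * \<omega>1 i u) *\<^sub>R x + (b * \<omega>2 i u) *\<^sub>R y))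
      = (a * (\<Sum>i\<in>UNIV. e1 i u * \<omega>1 i u)) *\<^sub>R x + (b * (\<Sum>i\<in>UNIV. e1 i u * \<omega>2 i u)) *\<^sub>R y"
      by (simp add: sum_2 algebra_simps)
    then show ?thesis unfolding dual_frame[OF assms] by simp
  qed
  have S2: "(\<Sum>i\<in>UNIV. e2 i u *\<^sub>R ((a * \<omega>1 i u) *\<^sub>R x + (b * \<omega>2 i u) *\<^sub>R y)) = b *\<^sub>R y" for a b and x y :: "'z::real_vector"
  proof -
    have "(\<Sum>i\<in>UNIV. e2 i u *\<^sub>R ((a * \<omega>1 i u) *\<^sub>R x + (b * \<omega>2 i u) *\<^sub>R y))
      = (a * (\<Sum>i\<in>UNIV. e2 i u * \<omega>1 i u)) *\<^sub>R x + (b * (\<Sum>i\<in>UNIV. e2 i u * \<omega>2 i u)) *\<^sub>R y"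
      by (simp add: sum_2 algebra_simps)
    then show ?thesis unfolding dual_frame[OF assms] by simp
  qed
  have pf: "partial_deriv i f u = (- \<theta> * \<omega>1 i u) *\<^sub>R \<nu> u + (1 * \<omega>2 i u) *\<^sub>R \<beta> u" for i
    using partial_f[OF assms] by simp
  have ph: "partial_deriv i h u = (s * \<omega>1 i u) *\<^sub>R 1 + (0 * \<omega>2 i u) *\<^sub>R 1" for i
    using partial_h by simp
  have p\<nu>: "partial_deriv i \<nu> u = (c * \<theta> * \<omega>1 i u) *\<^sub>R f u + (- \<kappa> u * \<omega>2 i u) *\<^sub>R \<beta> u" for i
    using partial_\<nu>[OF assms] by simp
  have p\<beta>: "partial_deriv i \<beta> u = (0 * \<omega>1 i u) *\<^sub>R f u + (1 * \<omega>2 i u) *\<^sub>R (\<kappa> u *\<^sub>R \<nu> u - c *\<^sub>R f u)" for i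
    using partial_\<beta>[OF assms] by (simp add: scaleR_diff_right mult.commute)
  show "d1 f u = - \<theta> *\<^sub>R \<nu> u" unfolding d1_def pf S1 ..
  show "d2 f u = \<beta> u" unfolding d2_def pf S2 by simp
  show "d1 h u = s" unfolding d1_def ph S1 by simp
  show "d2 h u = 0" unfolding d2_def ph S2 by simp
  show "d1 \<nu> u = (c * \<theta>) *\<^sub>R f u" unfolding d1_def p\<nu> S1 ..
  show "d2 \<nu> u = - \<kappa> u *\<^sub>R \<beta> u" unfolding d2_def p\<nu> S2 ..
  show "d1 \<beta> u = 0" unfolding d1_def p\<beta> S1 by simp
  show "d2 \<beta> u = \<kappa> u *\<^sub>R \<nu> u - c *\<^sub>R f u" unfolding d2_def p\<beta> S2 by simp
qed

text \<open>The integrability condition, read off from the symmetry of the second derivatives of \<open>f\<close>, \<open>h\<close>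
  and \<open>\<nu>\<close>.\<close>

lemma codazzi:
  assumes "u \<in> U"
  shows "d1 \<kappa> u = - \<theta> * (c + (\<kappa> u)\<^sup>2)"
proof -
  let ?p = "\<lambda>i j \<psi>. partial_deriv i (\<lambda>u. \<psi> j u) u :: real"
  have pd: "partial_deriv i (\<lambda>u. a u *\<^sub>R b u) u = a u *\<^sub>R partial_deriv i b u + partial_deriv i a u *\<^sub>R b u"
    if "smooth_on a U" "smooth_on b U" for i and a and b :: "real^2 \<Rightarrow> real^3"
    by (rule partial_deriv_scaleR[OF diff_at[OF that(1) assms] diff_at[OF that(2) assms]])
  have padd: "partial_deriv i (\<lambda>u. a u + b u) u = partial_deriv i a u + partial_deriv i b u"
    if "smooth_on a U" "smooth_on b U" for i and a b :: "real^2 \<Rightarrow> real^3"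
    by (rule partial_deriv_add[OF diff_at[OF that(1) assms] diff_at[OF that(2) assms]])
  have w1: "partial_deriv 1 (\<omega>1 2) u = partial_deriv 2 (\<omega>1 1) u"
  proof -
    have l: "bounded_linear (\<lambda>x::real. x / s)" by (rule bounded_linear_divide)
    have "partial_deriv i (\<omega>1 j) u = partial_deriv i (partial_deriv j h) u / s" for i j
      unfolding \<omega>1_def[abs_def] by (rule partial_deriv_linear[OF l diff_partial[OF h_smooth assms]])
    then show ?thesis using partial_deriv_commute[OF openU h_smooth assms, of 1 2] by simp
  qed
  define A where "A i j = partial_deriv i (\<omega>2 j) u" for i j
  have ff: "first_form c (partial_deriv i (partial_deriv j f) u) (\<beta> u)
     = \<theta> * \<kappa> u * \<omega>1 j u * \<omega>2 i u + A i j" for i j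
  proof -
    have s1: "smooth_on (\<lambda>u. - \<theta> * \<omega>1 j u) U" by (intro smooth_on_mult smooth_on_const coframe_smooth openU)
    have "partial_deriv i (partial_deriv j f) u = partial_deriv i (\<lambda>u. (- \<theta> * \<omega>1 j u) *\<^sub>R \<nu> u + \<omega>2 j u *\<^sub>R \<beta> u) u"
      by (rule partial_deriv_cong[OF openU assms partial_f])
    also have "\<dots> = ((- \<theta> * \<omega>1 j u) *\<^sub>R partial_deriv i \<nu> u + partial_deriv i (\<lambda>u. - \<theta> * \<omega>1 j u) u *\<^sub>R \<nu> u)
       + (\<omega>2 j u *\<^sub>R partial_deriv i \<beta> u + A i j *\<^sub>R \<beta> u)"
      unfolding padd[OF smooth_on_scaleR[OF openU s1 \<nu>_smooth] smooth_on_scaleR[OF openU coframe_smooth(2) \<beta>_smooth]]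
        pd[OF s1 \<nu>_smooth] pd[OF coframe_smooth(2) \<beta>_smooth] A_def ..
    finally show ?thesis
      by (simp add: first_form_simps frame[OF assms] partial_\<nu>[OF assms] partial_\<beta>[OF assms])
  qed
  have nn: "first_form c (partial_deriv i (partial_deriv j \<nu>) u) (\<beta> u)
     = c * \<theta> * \<omega>1 j u * \<omega>2 i u - partial_deriv i \<kappa> u * \<omega>2 j u - \<kappa> u * A i j" for i j
  proof -
    have s1: "smooth_on (\<lambda>u. c * \<theta> * \<omega>1 j u) U" by (intro smooth_on_mult smooth_on_const coframe_smooth openU)
    have s2: "smooth_on (\<lambda>u. \<kappa> u * \<omega>2 j u) U" by (intro smooth_on_mult \<kappa>_smooth coframe_smooth openU)
    have "partial_deriv i (partial_deriv j \<nu>) u = partial_deriv i (\<lambda>u. (c * \<theta> * \<omega>1 j u) *\<^sub>R f u - (\<kappa> u * \<omega>2 j u) *\<^sub>R \<beta> u) u"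
      by (rule partial_deriv_cong[OF openU assms partial_\<nu>])
    also have "\<dots> = partial_deriv i (\<lambda>u. (c * \<theta> * \<omega>1 j u) *\<^sub>R f u) u - partial_deriv i (\<lambda>u. (\<kappa> u * \<omega>2 j u) *\<^sub>R \<beta> u) u"
      by (rule partial_deriv_diff[OF diff_at[OF smooth_on_scaleR[OF openU s1 f_smooth] assms] diff_at[OF smooth_on_scaleR[OF openU s2 \<beta>_smooth] assms]])
    also have "\<dots> = ((c * \<theta> * \<omega>1 j u) *\<^sub>R partial_deriv i f u + partial_deriv i (\<lambda>u. c * \<theta> * \<omega>1 j u) u *\<^sub>R f u)
      - ((\<kappa> u * \<omega>2 j u) *\<^sub>R partial_deriv i \<beta> u + (\<kappa> u * A i j + partial_deriv i \<kappa> u * \<omega>2 j u) *\<^sub>R \<beta> u)"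
      unfolding pd[OF s1 f_smooth] pd[OF s2 \<beta>_smooth] A_def
        partial_deriv_mult[OF diff_at[OF \<kappa>_smooth assms] diff_at[OF coframe_smooth(2) assms]] ..
    finally show ?thesis
      by (simp only:) (simp add: first_form_simps frame[OF assms] partial_f[OF assms] partial_\<beta>[OF assms] algebra_simps)
  qed
  have A12: "\<theta> * \<kappa> u * \<omega>1 2 u * \<omega>2 1 u + A 1 2 = \<theta> * \<kappa> u * \<omega>1 1 u * \<omega>2 2 u + A 2 1"
    using ff[of 1 2] ff[of 2 1] partial_deriv_commute[OF openU f_smooth assms, of 1 2] by simp
  have "c * \<theta> * \<omega>1 2 u * \<omega>2 1 u - partial_deriv 1 \<kappa> u * \<omega>2 2 u - \<kappa> u * A 1 2
      = c * \<theta> * \<omega>1 1 u * \<omega>2 2 u - partial_deriv 2 \<kappa> u * \<omega>2 1 u - \<kappa> u * A 2 1"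
    using nn[of 1 2] nn[of 2 1] partial_deriv_commute[OF openU \<nu>_smooth assms, of 1 2] by simp
  moreover have "A 1 2 - A 2 1 = \<theta> * \<kappa> u * D u" using A12 by (simp add: D_def algebra_simps)
  then have "\<kappa> u * A 1 2 - \<kappa> u * A 2 1 = \<kappa> u * (\<theta> * \<kappa> u * D u)" by (simp add: right_diff_distrib[symmetric])
  ultimately have "partial_deriv 1 \<kappa> u * \<omega>2 2 u - partial_deriv 2 \<kappa> u * \<omega>2 1 u
     = - (c * \<theta> * D u) - \<kappa> u * (\<theta> * \<kappa> u * D u)"
    by (simp add: D_def algebra_simps)
  also have "\<dots> = - \<theta> * (c + (\<kappa> u)\<^sup>2) * D u" by (simp add: power2_eq_square algebra_simps)
  finally have "(partial_deriv 1 \<kappa> u * \<omega>2 2 u - partial_deriv 2 \<kappa> u * \<omega>2 1 u) / D u = - \<theta> * (c + (\<kappa> u)\<^sup>2)"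
    using D_nonzero(1)[OF assms] by (simp add: field_simps)
  then show ?thesis by (simp add: d1_def e1_def sum_2 diff_divide_distrib mult.commute)
qed

end

section \<open>The Euler-Lagrange equation in the adapted frame\<close>

lemma (in immersed_chart) second_order_op_linear:
  assumes "bounded_linear l" "smooth_on \<psi> U" "u \<in> U"
  shows "second_order_op a b (\<lambda>u. l (\<psi> u)) u = l (second_order_op a b \<psi> u)"
  unfolding second_order_op_def partial_deriv2_linear[OF assms] partial_deriv_linear[OF assms(1) diff_at[OF assms(2,3)]]
  using bounded_linear.linear[OF assms(1)] by (simp add: sum_2 linear_add linear_cmul)

context slanted_chart
begin

lemma d_cong:
  assumes "u \<in> U" "\<And>w. w \<in> U \<Longrightarrow> \<psi> w = \<psi>' w"
  shows "d1 \<psi> u = d1 \<psi>' u" "d2 \<psi> u = d2 \<psi>' u"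
proof -
  have "partial_deriv i \<psi> u = partial_deriv i \<psi>' u" for i
    by (rule partial_deriv_cong[OF openU assms(1)]) (rule assms(2))
  then show "d1 \<psi> u = d1 \<psi>' u" "d2 \<psi> u = d2 \<psi>' u" unfolding d1_def d2_def by simp_all
qed

lemma d_scaleR:
  assumes "u \<in> U" "smooth_on a U" "smooth_on b U"
  shows "d1 (\<lambda>u. a u *\<^sub>R b u) u = a u *\<^sub>R d1 b u + d1 a u *\<^sub>R b u"
    "d2 (\<lambda>u. a u *\<^sub>R b u) u = a u *\<^sub>R d2 b u + d2 a u *\<^sub>R b u"
  unfolding d1_def d2_def partial_deriv_scaleR[OF diff_at[OF assms(2,1)] diff_at[OF assms(3,1)]]
  by (simp_all add: sum_2 algebra_simps)

lemma d_add:
  assumes "u \<in> U" "smooth_on a U" "smooth_on b U"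
  shows "d1 (\<lambda>u. a u + b u) u = d1 a u + d1 b u" "d2 (\<lambda>u. a u + b u) u = d2 a u + d2 b u"
  unfolding d1_def d2_def partial_deriv_add[OF diff_at[OF assms(2,1)] diff_at[OF assms(3,1)]]
  by (simp_all add: sum_2 algebra_simps)

lemma d_const [simp]: "d1 (\<lambda>u. k) u = 0" "d2 (\<lambda>u. k) u = 0"
  unfolding d1_def d2_def by simp_all

text \<open>Differentiating twice along a vector field \<open>e\<close> is a second order operator, whose first order
  part comes from the derivatives of \<open>e\<close>.\<close>

lemma iterated_derivative:
  fixes \<psi> :: "real^2 \<Rightarrow> 'b::real_normed_vector"
  assumes "u \<in> U" "smooth_on \<psi> U" "\<And>j. smooth_on (e j) U"
  shows "(\<Sum>i\<in>UNIV. e i u *\<^sub>R partial_deriv i (\<lambda>u. \<Sum>j\<in>UNIV. e j u *\<^sub>R partial_deriv j \<psi> u) u)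
    = second_order_op (\<lambda>i j. e i u * e j u) (\<lambda>k. \<Sum>i\<in>UNIV. e i u * partial_deriv i (e k) u) \<psi> u"
proof -
  have "partial_deriv i (\<lambda>u. \<Sum>j\<in>UNIV. e j u *\<^sub>R partial_deriv j \<psi> u) u
    = (\<Sum>j\<in>UNIV. e j u *\<^sub>R partial_deriv i (partial_deriv j \<psi>) u + partial_deriv i (e j) u *\<^sub>R partial_deriv j \<psi> u)" for i
    by (simp add: partial_deriv_sum[OF diff_at[OF smooth_on_scaleR[OF openU assms(3) smooth_on_partial_deriv[OF assms(2)]] assms(1)]]
        partial_deriv_scaleR[OF diff_at[OF assms(3,1)] diff_partial[OF assms(2,1)]])
  then show ?thesis
    unfolding second_order_op_def by (simp add: sum_2 algebra_simps)
qed

text \<open>The first order coefficients that make the operator of \<open>frame_operator\<close> map \<open>\<Phi>\<close> to a normal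
  vector: the term with \<open>\<kappa>\<close> is minus the covariant derivative of \<open>e2\<close> along itself, and \<open>e1\<close> is
  geodesic.\<close>

definition "frame_drift u k = (\<Sum>i\<in>UNIV. e1 i u * partial_deriv i (e1 k) u) + (\<Sum>i\<in>UNIV. e2 i u * partial_deriv i (e2 k) u)
    + \<theta> * \<kappa> u * e1 k u"

lemma frame_operator:
  fixes \<psi> :: "real^2 \<Rightarrow> 'b::real_normed_vector"
  assumes "u \<in> U" "smooth_on \<psi> U"
  shows "second_order_op (\<lambda>i j. e1 i u * e1 j u + e2 i u * e2 j u) (frame_drift u) \<psi> u
    = d1 (d1 \<psi>) u + d2 (d2 \<psi>) u + (\<theta> * \<kappa> u) *\<^sub>R d1 \<psi> u"
proof -
  have "d1 (d1 \<psi>) u = second_order_op (\<lambda>i j. e1 i u * e1 j u) (\<lambda>k. \<Sum>i\<in>UNIV. e1 i u * partial_deriv i (e1 k) u) \<psi> u"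
    using iterated_derivative[OF assms e_smooth(1)] by (simp add: d1_def[abs_def])
  moreover have "d2 (d2 \<psi>) u = second_order_op (\<lambda>i j. e2 i u * e2 j u) (\<lambda>k. \<Sum>i\<in>UNIV. e2 i u * partial_deriv i (e2 k) u) \<psi> u"
    using iterated_derivative[OF assms e_smooth(2)] by (simp add: d2_def[abs_def])
  ultimately show ?thesis
    unfolding second_order_op_def frame_drift_def d1_def[of \<psi>] by (simp add: sum_2 algebra_simps)
qed

lemma second_frame_derivatives:
  assumes u: "u \<in> U"
  shows "d1 (d1 f) u = (- \<theta> * c * \<theta>) *\<^sub>R f u" "d2 (d2 f) u = \<kappa> u *\<^sub>R \<nu> u - c *\<^sub>R f u"
    "d1 (d1 h) u = 0" "d2 (d2 h) u = 0"
proof -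
  have "d1 (d1 f) u = d1 (\<lambda>u. - \<theta> *\<^sub>R \<nu> u) u" by (rule d_cong[OF u]) (rule d_frame)
  also have "\<dots> = (- \<theta> * c * \<theta>) *\<^sub>R f u"
    using d_scaleR(1)[OF u smooth_on_const[OF openU, of "- \<theta>"] \<nu>_smooth] d_frame(5)[OF u] by simp
  finally show "d1 (d1 f) u = (- \<theta> * c * \<theta>) *\<^sub>R f u" .
  have "d2 (d2 f) u = d2 \<beta> u" by (rule d_cong[OF u]) (rule d_frame)
  then show "d2 (d2 f) u = \<kappa> u *\<^sub>R \<nu> u - c *\<^sub>R f u" using d_frame(8)[OF u] by simp
  have "d1 (d1 h) u = d1 (\<lambda>u. s) u" by (rule d_cong[OF u]) (rule d_frame)
  then show "d1 (d1 h) u = 0" by simp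
  have "d2 (d2 h) u = d2 (\<lambda>u. 0) u" by (rule d_cong[OF u]) (rule d_frame)
  then show "d2 (d2 h) u = 0" by simp
qed

text \<open>The value is normal to the surface, which identifies this operator with the Laplacian.\<close>

lemma frame_operator_\<Phi>:
  assumes u: "u \<in> U"
  shows "second_order_op (\<lambda>i j. e1 i u * e1 j u + e2 i u * e2 j u) (frame_drift u) \<Phi> u
    = ((s * s * \<kappa> u) *\<^sub>R \<nu> u - (c * (1 + \<theta> * \<theta>)) *\<^sub>R f u, \<theta> * \<kappa> u * s)"
proof (rule prod_eqI)
  let ?L = "\<lambda>\<psi>. second_order_op (\<lambda>i j. e1 i u * e1 j u + e2 i u * e2 j u) (frame_drift u) \<psi> u"
  have "fst (?L \<Phi>) = ?L f" by (rule second_order_op_linear[OF bounded_linear_fst smooth u, symmetric])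
  also have "\<dots> = (\<kappa> u - \<theta> * \<theta> * \<kappa> u) *\<^sub>R \<nu> u - (c * (1 + \<theta> * \<theta>)) *\<^sub>R f u"
    unfolding frame_operator[OF u f_smooth] second_frame_derivatives[OF u] d_frame[OF u]
    by (simp add: algebra_simps)
  also have "\<kappa> u - \<theta> * \<theta> * \<kappa> u = s * s * \<kappa> u" unfolding s(2) by (simp add: algebra_simps)
  finally show "fst (?L \<Phi>) = fst ((s * s * \<kappa> u) *\<^sub>R \<nu> u - (c * (1 + \<theta> * \<theta>)) *\<^sub>R f u, \<theta> * \<kappa> u * s)" by simp
  have "snd (?L \<Phi>) = ?L h" by (rule second_order_op_linear[OF bounded_linear_snd smooth u, symmetric])
  also have "\<dots> = \<theta> * \<kappa> u * s"
    unfolding frame_operator[OF u h_smooth] second_frame_derivatives[OF u] d_frame[OF u] by simp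
  finally show "snd (?L \<Phi>) = snd ((s * s * \<kappa> u) *\<^sub>R \<nu> u - (c * (1 + \<theta> * \<theta>)) *\<^sub>R f u, \<theta> * \<kappa> u * s)" by simp
qed

lemma laplacian_frame:
  fixes \<psi> :: "real^2 \<Rightarrow> 'b::real_normed_vector"
  assumes u: "u \<in> U" and \<psi>: "smooth_on \<psi> U"
  shows "laplacian c \<Phi> \<psi> u = d1 (d1 \<psi>) u + d2 (d2 \<psi>) u + (\<theta> * \<kappa> u) *\<^sub>R d1 \<psi> u"
  unfolding frame_operator[OF assms, symmetric]
proof (rule laplacian_unique[OF u])
  fix i j :: 2
  have "G 1 1 u = e1 1 u * e1 1 u + e2 1 u * e2 1 u" "G 1 2 u = e1 1 u * e1 2 u + e2 1 u * e2 2 u"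
    "G 2 1 u = e1 2 u * e1 1 u + e2 2 u * e2 1 u" "G 2 2 u = e1 2 u * e1 2 u + e2 2 u * e2 2 u"
    unfolding inverse_metric_eq[OF u] D_nonzero(2)[OF u]
    by (simp_all add: metric_coframe[OF u] e1_def e2_def add_divide_distrib diff_divide_distrib algebra_simps)
  then show "e1 i u * e1 j u + e2 i u * e2 j u = G i j u"
    using exhaust_2[of i] exhaust_2[of j] by auto
  fix l
  have "ambient_form c (second_order_op (\<lambda>i j. e1 i u * e1 j u + e2 i u * e2 j u) (frame_drift u) \<Phi> u) (partial_deriv l \<Phi> u)
    = first_form c ((s * s * \<kappa> u) *\<^sub>R \<nu> u - (c * (1 + \<theta> * \<theta>)) *\<^sub>R f u) (partial_deriv l f u) + \<theta> * \<kappa> u * s * partial_deriv l h u"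
    unfolding frame_operator_\<Phi>[OF u] ambient_form_def partial_fst[OF u] partial_snd[OF u] by simp
  also have "\<dots> = 0"
    unfolding partial_f[OF u] partial_h by (simp add: first_form_simps frame[OF u])
  finally show "ambient_form c (second_order_op (\<lambda>i j. e1 i u * e1 j u + e2 i u * e2 j u) (frame_drift u) \<Phi> u) (partial_deriv l \<Phi> u) = 0" .
qed

lemma laplacian_\<Phi>:
  "u \<in> U \<Longrightarrow> laplacian c \<Phi> \<Phi> u = ((s * s * \<kappa> u) *\<^sub>R \<nu> u - (c * (1 + \<theta> * \<theta>)) *\<^sub>R f u, \<theta> * \<kappa> u * s)"
  using laplacian_frame[OF _ smooth] frame_operator[OF _ smooth] frame_operator_\<Phi> by simp

lemma laplacian_\<Phi>_\<Xi>: assumes "u \<in> U" shows "ambient_form c (laplacian c \<Phi> \<Phi> u) (\<Xi> u) = s * \<kappa> u"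
proof -
  have "fst (\<Xi> u) = s *\<^sub>R \<nu> u" unfolding \<nu>_def using s by simp
  then have "ambient_form c (laplacian c \<Phi> \<Phi> u) (\<Xi> u) = (s * s + \<theta> * \<theta>) * (s * \<kappa> u)"
    unfolding laplacian_\<Phi>[OF assms] ambient_form_def angle[OF assms]
    by (simp add: first_form_simps frame[OF assms] algebra_simps)
  then show ?thesis using s(2) by simp
qed

text \<open>This product is constant on a surface of constant angle, as \<open>euler_lagrange\<close> demands.\<close>

lemma laplacian_\<Phi>_f:
  assumes "u \<in> U" shows "first_form c (fst (laplacian c \<Phi> \<Phi> u)) (f u) = - (1 + \<theta> * \<theta>)"
proof -
  have "first_form c (fst (laplacian c \<Phi> \<Phi> u)) (f u) = - ((c * c) * (1 + \<theta> * \<theta>))"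
    unfolding laplacian_\<Phi>[OF assms] by (simp add: first_form_simps frame[OF assms] mult.commute del: cc)
  then show ?thesis by simp
qed

text \<open>In the frame the biharmonic equation is a system for the single function \<open>\<kappa>\<close> (\<open>eqA\<close>, \<open>eqB\<close>,
  \<open>eqC\<close> in the proof); together with the Codazzi equation it leaves only the vertical cylinder
  of curvature \<open>\<kappa> = \<plusminus>1\<close> in the sphere.\<close>

lemma biharmonic_curvature:
  assumes E1: "\<And>u. u \<in> U \<Longrightarrow> snd (laplacian c \<Phi> (laplacian c \<Phi> \<Phi>) u) = 0"
    and E2: "\<And>u v. u \<in> U \<Longrightarrow> first_form c v (f u) = 0 \<Longrightarrow>
      first_form c (fst (laplacian c \<Phi> (laplacian c \<Phi> \<Phi>) u) + (2 * c * (1 + \<theta> * \<theta>)) *\<^sub>R fst (laplacian c \<Phi> \<Phi> u)) v = 0"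
    and u0: "u0 \<in> U" "\<kappa> u0 \<noteq> 0"
  shows "\<theta> = 0" "c = 1" "(\<kappa> u0)\<^sup>2 = 1"
proof -
  define m where "m = 1 + \<theta> * \<theta>"
  let ?L = "laplacian c \<Phi>"
  have sL: "smooth_on (?L \<Phi>) U" by (rule laplacian_smooth[OF smooth])
  have s\<kappa>\<nu>: "smooth_on (\<lambda>u. \<kappa> u *\<^sub>R \<nu> u) U" by (intro smooth_on_scaleR \<kappa>_smooth \<nu>_smooth openU)
  \<comment> \<open>The vertical component of \<open>\<Delta>\<Phi>\<close> is \<open>\<theta> s \<kappa>\<close>.\<close>
  have eqA: "\<theta> * ?L \<kappa> u = 0" if u: "u \<in> U" for u
  proof -
    have l: "bounded_linear (\<lambda>x::real. \<theta> * s * x)" by (rule bounded_linear_mult_right)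
    have "snd (?L (?L \<Phi>) u) = ?L (\<lambda>u. snd (?L \<Phi> u)) u"
      using laplacian_linear[OF bounded_linear_snd sL u] by simp
    also have "\<dots> = ?L (\<lambda>u. \<theta> * s * \<kappa> u) u"
      by (rule laplacian_cong[OF openU u refl]) (simp add: laplacian_\<Phi>)
    also have "\<dots> = \<theta> * s * ?L \<kappa> u" by (rule laplacian_linear[OF l \<kappa>_smooth u])
    finally show ?thesis using E1[OF u] s(3) by simp
  qed
  \<comment> \<open>Since \<open>\<Delta>f = s\<^sup>2 \<kappa> \<nu> - c m f\<close>, the equation for the first component is one for
    \<open>\<Delta>(\<kappa> \<nu>)\<close>, modulo \<open>f\<close>.\<close>
  have E2': "s * s * first_form c (?L (\<lambda>u. \<kappa> u *\<^sub>R \<nu> u) u + (c * m * \<kappa> u) *\<^sub>R \<nu> u) v = 0"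
    if u: "u \<in> U" and v: "first_form c v (f u) = 0" for u v
  proof -
    have l: "bounded_linear (\<lambda>x::real^3. (s * s) *\<^sub>R x)" "bounded_linear (\<lambda>x::real^3. (- (c * m)) *\<^sub>R x)"
      by (rule bounded_linear_scaleR_right)+
    have "fst (?L (?L \<Phi>) u) = ?L (\<lambda>u. fst (?L \<Phi> u)) u"
      using laplacian_linear[OF bounded_linear_fst sL u] by simp
    also have "\<dots> = ?L (\<lambda>u. (s * s) *\<^sub>R (\<kappa> u *\<^sub>R \<nu> u) + (- (c * m)) *\<^sub>R f u) u"
      by (rule laplacian_cong[OF openU u refl]) (simp add: laplacian_\<Phi> m_def)
    also have "\<dots> = (s * s) *\<^sub>R ?L (\<lambda>u. \<kappa> u *\<^sub>R \<nu> u) u + (- (c * m)) *\<^sub>R ?L f u"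
      unfolding laplacian_add[OF smooth_on_compose_linear[OF l(1) openU s\<kappa>\<nu>] smooth_on_compose_linear[OF l(2) openU f_smooth] u]
        laplacian_linear[OF l(1) s\<kappa>\<nu> u] laplacian_linear[OF l(2) f_smooth u] ..
    also have "?L f u = fst (?L \<Phi> u)" by (rule laplacian_linear[OF bounded_linear_fst smooth u])
    finally have 1: "fst (?L (?L \<Phi>) u) = (s * s) *\<^sub>R ?L (\<lambda>u. \<kappa> u *\<^sub>R \<nu> u) u + (- (c * m)) *\<^sub>R fst (?L \<Phi> u)" .
    have fv: "first_form c (f u) v = 0" using v first_form_commute by metis
    show ?thesis
      using E2[OF u v] unfolding 1 m_def[symmetric] unfolding laplacian_\<Phi>[OF u] fst_conv m_def[symmetric]
      by (simp add: first_form_simps fv algebra_simps)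
  qed
  have dd: "?L (\<lambda>u. \<kappa> u *\<^sub>R \<nu> u) u = (?L \<kappa> u - c * \<theta> * \<theta> * \<kappa> u - (\<kappa> u)^3) *\<^sub>R \<nu> u - (3 * \<kappa> u * d2 \<kappa> u) *\<^sub>R \<beta> u
      + (2 * c * \<theta> * d1 \<kappa> u + c * (\<kappa> u)^2 + \<theta> * \<kappa> u * (c * \<theta> * \<kappa> u)) *\<^sub>R f u" if u: "u \<in> U" for u
  proof -
    note ss = d_scaleR[OF _ \<kappa>_smooth \<nu>_smooth]
    have s2: "smooth_on (\<lambda>u. \<kappa> u * (c * \<theta>)) U" "smooth_on (\<lambda>u. - (\<kappa> u * \<kappa> u)) U"
      by (intro smooth_on_mult smooth_on_uminus \<kappa>_smooth smooth_on_const openU)+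
    have D1: "d1 (\<lambda>u. \<kappa> u *\<^sub>R \<nu> u) w = (\<kappa> w * (c * \<theta>)) *\<^sub>R f w + d1 \<kappa> w *\<^sub>R \<nu> w" if "w \<in> U" for w
      unfolding ss[OF that] d_frame[OF that] by simp
    have D2: "d2 (\<lambda>u. \<kappa> u *\<^sub>R \<nu> u) w = (- (\<kappa> w * \<kappa> w)) *\<^sub>R \<beta> w + d2 \<kappa> w *\<^sub>R \<nu> w" if "w \<in> U" for w
      unfolding ss[OF that] d_frame[OF that] by simp
    have k1: "d1 (\<lambda>u. \<kappa> u * (c * \<theta>)) u = (c * \<theta>) * d1 \<kappa> u"
      using d_scaleR(1)[OF u \<kappa>_smooth smooth_on_const[OF openU, of "c * \<theta>"]] by simp
    have k2: "d2 (\<lambda>u. - (\<kappa> u * \<kappa> u)) u = - (2 * \<kappa> u * d2 \<kappa> u)"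
    proof -
      have "smooth_on (\<lambda>u. - \<kappa> u) U" by (intro smooth_on_uminus \<kappa>_smooth openU)
      from d_scaleR(2)[OF u this \<kappa>_smooth]
      have "d2 (\<lambda>u. - (\<kappa> u * \<kappa> u)) u = - \<kappa> u * d2 \<kappa> u + d2 (\<lambda>u. - \<kappa> u) u * \<kappa> u" by simp
      moreover have "d2 (\<lambda>u. - \<kappa> u) u = - d2 \<kappa> u"
        using d_scaleR(2)[OF u smooth_on_const[OF openU, of "-1"] \<kappa>_smooth] by simp
      ultimately show ?thesis by simp
    qed
    have "d1 (d1 (\<lambda>u. \<kappa> u *\<^sub>R \<nu> u)) u = d1 (\<lambda>w. (\<kappa> w * (c * \<theta>)) *\<^sub>R f w + d1 \<kappa> w *\<^sub>R \<nu> w) u"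
      by (rule d_cong(1)[OF u D1])
    also have "\<dots> = ((\<kappa> u * (c * \<theta>)) *\<^sub>R (- \<theta> *\<^sub>R \<nu> u) + ((c * \<theta>) * d1 \<kappa> u) *\<^sub>R f u) + (d1 \<kappa> u *\<^sub>R ((c * \<theta>) *\<^sub>R f u) + d1 (d1 \<kappa>) u *\<^sub>R \<nu> u)"
      unfolding d_add(1)[OF u smooth_on_scaleR[OF openU s2(1) f_smooth] smooth_on_scaleR[OF openU d_smooth(1)[OF \<kappa>_smooth] \<nu>_smooth]]
        d_scaleR(1)[OF u s2(1) f_smooth] d_scaleR(1)[OF u d_smooth(1)[OF \<kappa>_smooth] \<nu>_smooth] k1 d_frame[OF u] ..
    finally have 1: "d1 (d1 (\<lambda>u. \<kappa> u *\<^sub>R \<nu> u)) u = \<dots>" .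
    have "d2 (d2 (\<lambda>u. \<kappa> u *\<^sub>R \<nu> u)) u = d2 (\<lambda>w. (- (\<kappa> w * \<kappa> w)) *\<^sub>R \<beta> w + d2 \<kappa> w *\<^sub>R \<nu> w) u"
      by (rule d_cong(2)[OF u D2])
    also have "\<dots> = ((- (\<kappa> u * \<kappa> u)) *\<^sub>R (\<kappa> u *\<^sub>R \<nu> u - c *\<^sub>R f u) + (- (2 * \<kappa> u * d2 \<kappa> u)) *\<^sub>R \<beta> u) + (d2 \<kappa> u *\<^sub>R (- \<kappa> u *\<^sub>R \<beta> u) + d2 (d2 \<kappa>) u *\<^sub>R \<nu> u)"
      unfolding d_add(2)[OF u smooth_on_scaleR[OF openU s2(2) \<beta>_smooth] smooth_on_scaleR[OF openU d_smooth(2)[OF \<kappa>_smooth] \<nu>_smooth]]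
        d_scaleR(2)[OF u s2(2) \<beta>_smooth] d_scaleR(2)[OF u d_smooth(2)[OF \<kappa>_smooth] \<nu>_smooth] k2 d_frame[OF u] ..
    finally have 2: "d2 (d2 (\<lambda>u. \<kappa> u *\<^sub>R \<nu> u)) u = \<dots>" .
    show ?thesis
      unfolding laplacian_frame[OF u s\<kappa>\<nu>] laplacian_frame[OF u \<kappa>_smooth] 1 2 D1[OF u]
      by (simp add: vec_eq_iff power2_eq_square power3_eq_cube algebra_simps)
  qed
  \<comment> \<open>The components along \<open>\<beta>\<close> and along \<open>\<nu>\<close>.\<close>
  have eqB: "\<kappa> u * d2 \<kappa> u = 0" and eqC: "?L \<kappa> u - (\<kappa> u)^3 + c * \<kappa> u = 0" if u: "u \<in> U" for u
  proof -
    have "s * s \<noteq> 0" using s(3) by simp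
    then have E3: "first_form c (?L (\<lambda>u. \<kappa> u *\<^sub>R \<nu> u) u + (c * m * \<kappa> u) *\<^sub>R \<nu> u) v = 0"
      if "first_form c v (f u) = 0" for v
      using E2'[OF u that] by (metis mult_eq_0_iff)
    show "\<kappa> u * d2 \<kappa> u = 0"
      using E3[OF frame(5)[OF u]] unfolding dd[OF u] by (simp add: first_form_simps frame[OF u])
    show "?L \<kappa> u - (\<kappa> u)^3 + c * \<kappa> u = 0"
      using E3[OF frame(2)[OF u]] unfolding dd[OF u] m_def by (simp add: first_form_simps frame[OF u] algebra_simps)
  qed
  \<comment> \<open>All three equations simplify on the open set where \<open>\<kappa>\<close> does not vanish.\<close>
  define W where "W = {u \<in> U. \<kappa> u \<noteq> 0}"
  have "open (\<kappa> -` (- {0}) \<inter> U)"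
    by (rule continuous_on_open_vimage[OF openU, THEN iffD1, rule_format]) (auto intro: smooth_on_continuous[OF \<kappa>_smooth])
  moreover have "\<kappa> -` (- {0}) \<inter> U = W" by (auto simp: W_def)
  ultimately have oW: "open W" by simp
  have u0W: "u0 \<in> W" using u0 by (simp add: W_def)
  have WU: "w \<in> U" "\<kappa> w \<noteq> 0" if "w \<in> W" for w using that by (auto simp: W_def)
  have const: "d1 \<psi> w = 0" if \<psi>: "\<And>w. w \<in> W \<Longrightarrow> \<psi> w = k" and w: "w \<in> W" for \<psi> :: "real^2 \<Rightarrow> real" and k w
  proof -
    have "partial_deriv i \<psi> w = partial_deriv i (\<lambda>_. k) w" for i
      by (rule partial_deriv_cong[OF oW w]) (rule \<psi>)
    then show ?thesis unfolding d1_def by simp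
  qed
  show \<theta>0: "\<theta> = 0"
  proof (rule ccontr)
    assume n: "\<theta> \<noteq> 0"
    have k2: "(\<kappa> w)\<^sup>2 = c" if "w \<in> W" for w
    proof -
      have "?L \<kappa> w = 0" using eqA[OF WU(1)[OF that]] n by simp
      then have "\<kappa> w * ((\<kappa> w)\<^sup>2 - c) = 0"
        using eqC[OF WU(1)[OF that]] by (auto simp: power2_eq_square power3_eq_cube algebra_simps)
      then show ?thesis using WU(2)[OF that] by simp
    qed
    have "d1 (\<lambda>u. (\<kappa> u)\<^sup>2) u0 = 0" by (rule const[OF k2 u0W])
    moreover have "d1 (\<lambda>u. (\<kappa> u)\<^sup>2) u0 = 2 * \<kappa> u0 * d1 \<kappa> u0"
      using d_scaleR(1)[OF u0(1) \<kappa>_smooth \<kappa>_smooth] by (simp add: power2_eq_square)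
    ultimately have "d1 \<kappa> u0 = 0" using u0(2) by simp
    then have "\<theta> * (c + c) = 0" using codazzi[OF u0(1)] k2[OF u0W] by simp
    then show False using n c by auto
  qed
  have p0: "partial_deriv i \<kappa> w = 0" if w: "w \<in> W" for i w
  proof -
    have 1: "d1 \<kappa> w = 0" using codazzi[OF WU(1)[OF w]] \<theta>0 by simp
    have 2: "d2 \<kappa> w = 0" using eqB[OF WU(1)[OF w]] WU(2)[OF w] by simp
    have Dw: "D w \<noteq> 0" by (rule D_nonzero(1)[OF WU(1)[OF w]])
    let ?p = "\<lambda>i. partial_deriv i \<kappa> w"
    have a: "\<omega>2 2 w * ?p 1 - \<omega>2 1 w * ?p 2 = 0" "\<omega>1 1 w * ?p 2 - \<omega>1 2 w * ?p 1 = 0"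
      using 1 2 Dw unfolding d1_def d2_def sum_2 e1_def e2_def
      by (auto simp: field_simps)
    have "D w * ?p 1 = \<omega>1 1 w * (\<omega>2 2 w * ?p 1 - \<omega>2 1 w * ?p 2) + \<omega>2 1 w * (\<omega>1 1 w * ?p 2 - \<omega>1 2 w * ?p 1)"
      unfolding D_def by (simp add: algebra_simps)
    then have "?p 1 = 0" using a Dw by simp
    moreover have "D w * ?p 2 = \<omega>1 2 w * (\<omega>2 2 w * ?p 1 - \<omega>2 1 w * ?p 2) + \<omega>2 2 w * (\<omega>1 1 w * ?p 2 - \<omega>1 2 w * ?p 1)"
      unfolding D_def by (simp add: algebra_simps)
    then have "?p 2 = 0" using a Dw by simp
    ultimately show ?thesis using exhaust_2[of i] by auto
  qed
  have "partial_deriv i (partial_deriv j \<kappa>) u0 = 0" for i j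
  proof -
    have "partial_deriv i (partial_deriv j \<kappa>) u0 = partial_deriv i (\<lambda>_. 0) u0"
      by (rule partial_deriv_cong[OF oW u0W]) (rule p0)
    then show ?thesis by simp
  qed
  then have "?L \<kappa> u0 = 0"
    unfolding laplacian_second_order_op second_order_op_def using p0[OF u0W] by simp
  then have "\<kappa> u0 * ((\<kappa> u0)\<^sup>2 - c) = 0"
    using eqC[OF u0(1)] by (auto simp: power2_eq_square power3_eq_cube algebra_simps)
  then have k: "(\<kappa> u0)\<^sup>2 = c" using u0(2) by simp
  then show "c = 1" using c zero_le_power2[of "\<kappa> u0"] by auto
  then show "(\<kappa> u0)\<^sup>2 = 1" using k by simp
qed

end

section \<open>Constant angle biharmonic surfaces are cylinders\<close>

lemma first_form_inner: "first_form 1 a b = a \<bullet> b"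
  by (simp add: first_form_def inner_vec_def sum_3)

lemma dist_circle_radius_iff: "dist a q = 1 / sqrt 2 \<longleftrightarrow> (a - q) \<bullet> (a - q) = 1/2"
  for a q :: "real^3"
  unfolding dist_norm norm_eq_sqrt_inner by (metis real_sqrt_divide real_sqrt_eq_iff real_sqrt_one)

context surface
begin

lemma locally_constant_imp_constant:
  assumes "\<And>p. p \<in> topspace X \<Longrightarrow> \<exists>W. openin X W \<and> p \<in> W \<and> (\<forall>q\<in>W. z q = z p)"
  shows "\<exists>k. \<forall>p\<in>topspace X. z p = k"
proof -
  obtain p0 where p0: "p0 \<in> topspace X" using nonempty by blast
  let ?S = "{p \<in> topspace X. z p = z p0}" and ?T = "{p \<in> topspace X. z p \<noteq> z p0}"
  have op: "openin X {p \<in> topspace X. P (z p)}" for P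
  proof (subst openin_subopen, intro ballI)
    fix p assume p: "p \<in> {p \<in> topspace X. P (z p)}"
    then obtain W where W: "openin X W" "p \<in> W" "\<forall>q\<in>W. z q = z p" using assms by blast
    have "W \<subseteq> {p \<in> topspace X. P (z p)}" using W p openin_subset by fastforce
    then show "\<exists>T. openin X T \<and> p \<in> T \<and> T \<subseteq> {p \<in> topspace X. P (z p)}" using W by blast
  qed
  have "closedin X ?S"
    unfolding closedin_def
  proof
    have "topspace X - ?S = ?T" by blast
    then show "openin X (topspace X - ?S)" using op[of "\<lambda>y. y \<noteq> z p0"] by simp
  qed blast
  then have "?S = {} \<or> ?S = topspace X"
    using connected op[of "\<lambda>y. y = z p0"] unfolding connected_space_clopen_in by blast
  then show ?thesis using p0 by blast
qed

text \<open>Locally by the mean value theorem, globally by connectedness.\<close>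

lemma constant_from_derivative:
  fixes z :: "'m \<Rightarrow> 'b::real_normed_vector"
  assumes z: "smooth_map A z"
    and d: "\<And>U x u i. (U, x) \<in> A \<Longrightarrow> u \<in> U \<Longrightarrow> partial_deriv i (\<lambda>u. z (x u)) u = 0"
  shows "\<exists>k. \<forall>p\<in>topspace X. z p = k"
proof (rule locally_constant_imp_constant)
  fix p assume "p \<in> topspace X"
  then obtain U x a r where B: "(U, x) \<in> A" "r > 0" "cball a r \<subseteq> U" "p \<in> x ` ball a r" "openin X (x ` ball a r)"
    using chart_ball by metis
  have bU: "ball a r \<subseteq> U" using B(3) ball_subset_cball by blast
  have "((\<lambda>u. z (x u)) has_derivative (\<lambda>h. 0)) (at u within ball a r)" if "u \<in> ball a r" for u
  proof -
    have u: "u \<in> U" using that bU by blast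
    have "((\<lambda>u. z (x u)) has_derivative frechet_derivative (\<lambda>u. z (x u)) (at u)) (at u)"
      by (rule smooth_on_has_derivative[OF chart_open[OF B(1)] smooth_mapD[OF z B(1)] u])
    moreover have "frechet_derivative (\<lambda>u. z (x u)) (at u) = (\<lambda>h. 0)"
    proof
      fix v
      show "frechet_derivative (\<lambda>u. z (x u)) (at u) v = 0"
        using dir_deriv_partial[OF smooth_on_differentiable[OF chart_open[OF B(1)] smooth_mapD[OF z B(1)] u], of v]
          d[OF B(1) u] by simp
    qed
    ultimately show ?thesis using has_derivative_at_withinI by simp
  qed
  from has_derivative_zero_constant[OF convex_ball this] obtain k where k: "\<And>u. u \<in> ball a r \<Longrightarrow> z (x u) = k" by blast
  then have "\<forall>q\<in>x ` ball a r. z q = z p" using B(4) by auto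
  then show "\<exists>W. openin X W \<and> p \<in> W \<and> (\<forall>q\<in>W. z q = z p)" using B by blast
qed

text \<open>Projecting the cylinder along the radius at a point is injective on the half of it that faces
  this point, and the composition with the immersion has an invertible derivative there, hence
  maps neighbourhoods to neighbourhoods in the plane.\<close>

lemma image_open_in_cylinder:
  assumes n: "norm n = 1" and r: "r > 0"
    and im: "\<And>p. p \<in> topspace X \<Longrightarrow> dist (fst (\<phi> p)) q = r \<and> (fst (\<phi> p) - q) \<bullet> n = 0"
  shows "openin (top_of_set ({a. dist a q = r \<and> (a - q) \<bullet> n = 0} \<times> (UNIV :: real set))) (\<phi> ` topspace X)"
    (is "openin (top_of_set ?C) _")
proof (subst openin_subopen, intro ballI)
  fix y assume "y \<in> \<phi> ` topspace X"
  then obtain U x u0 where Ux: "(U, x) \<in> A" "u0 \<in> U" "y = \<phi> (x u0)" using chart_cover by (metis imageE)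
  interpret immersed_chart c "\<phi> \<circ> x" U by (rule immersed_chart[OF Ux(1)])
  let ?\<Phi> = "\<lambda>u. \<phi> (x u)"
  have sm: "smooth_on ?\<Phi> U" using smooth by (simp add: comp_def)
  have im': "dist (fst (?\<Phi> u)) q = r" "(fst (?\<Phi> u) - q) \<bullet> n = 0" if "u \<in> U" for u
    using im[OF chart_in[OF Ux(1) that]] by auto
  define w where "w = (1 / r) *\<^sub>R (fst y - q)"
  define b where "b = form_cross 1 w n"
  have ww: "w \<bullet> w = 1"
  proof -
    have "(fst y - q) \<bullet> (fst y - q) = r * r"
      using im'(1)[OF Ux(2)] unfolding Ux(3) by (simp add: dist_norm power2_norm_eq_inner[symmetric] power2_eq_square)
    then show ?thesis unfolding w_def using r by simp
  qed
  have wn: "w \<bullet> n = 0" unfolding w_def using im'(2)[OF Ux(2)] Ux(3) by simp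
  have nn: "n \<bullet> n = 1" using n by (simp add: norm_eq_1)
  have ex: "a = (a \<bullet> w) *\<^sub>R w + (a \<bullet> b) *\<^sub>R b + (a \<bullet> n) *\<^sub>R n" for a
    using frame_expansion[of 1 w n a] ww wn nn unfolding first_form_inner b_def by simp
  have bw: "b \<bullet> w = 0" "b \<bullet> n = 0" "b \<bullet> b = 1"
    using form_cross_ortho[of 1 w n] ww wn nn unfolding first_form_inner b_def by simp_all
  \<comment> \<open>The coordinates along the tangent line of the circle and along the axis.\<close>
  define \<pi> where "\<pi> y = ((\<chi> i. if i = 1 then fst y \<bullet> b else snd y) :: real^2)" for y :: "(real^3) \<times> real"
  have \<pi>: "bounded_linear \<pi>"
    unfolding linear_conv_bounded_linear[symmetric] \<pi>_def
    by (rule linearI) (auto simp: vec_eq_iff inner_add_left)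
  define T where "T = frechet_derivative ?\<Phi> (at u0)"
  have T: "(?\<Phi> has_derivative T) (at u0)" unfolding T_def by (rule smooth_on_has_derivative[OF openU sm Ux(2)])
  have Tinj: "inj T" unfolding T_def using inj[OF Ux(2)] by (simp add: comp_def)
  have Tn: "fst (T v) \<bullet> n = 0" for v
  proof -
    have "bounded_linear (\<lambda>y::(real^3) \<times> real. fst y \<bullet> n)"
      by (rule bounded_linear_compose[OF bounded_linear_inner_left bounded_linear_fst])
    from bounded_linear.has_derivative[OF this T]
    have "((\<lambda>u. fst (?\<Phi> u) \<bullet> n) has_derivative (\<lambda>v. fst (T v) \<bullet> n)) (at u0)" .
    moreover have "((\<lambda>u. fst (?\<Phi> u) \<bullet> n) has_derivative (\<lambda>v. 0)) (at u0)"
      by (rule has_derivative_transform_within_open[OF has_derivative_const[of "q \<bullet> n"] openU Ux(2)])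
         (use im'(2) in \<open>simp add: inner_diff_left\<close>)
    ultimately show ?thesis using has_derivative_unique by metis
  qed
  have Tw: "fst (T v) \<bullet> w = 0" for v
  proof -
    have "((\<lambda>u. fst (?\<Phi> u) - q) has_derivative (\<lambda>v. fst (T v))) (at u0)"
      by (rule has_derivative_eq_rhs[OF has_derivative_diff[OF
            bounded_linear.has_derivative[OF bounded_linear_fst T] has_derivative_const]]) simp
    from has_derivative_inner[OF this this]
    have d1: "((\<lambda>u. (fst (?\<Phi> u) - q) \<bullet> (fst (?\<Phi> u) - q)) has_derivative
      (\<lambda>v. (fst (?\<Phi> u0) - q) \<bullet> fst (T v) + fst (T v) \<bullet> (fst (?\<Phi> u0) - q))) (at u0)" .
    have "r * r = (fst (?\<Phi> u) - q) \<bullet> (fst (?\<Phi> u) - q)" if "u \<in> U" for u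
      using power2_norm_eq_inner[of "fst (?\<Phi> u) - q"] im'(1)[OF that] by (simp add: dist_norm power2_eq_square)
    then have d2: "((\<lambda>u. (fst (?\<Phi> u) - q) \<bullet> (fst (?\<Phi> u) - q)) has_derivative (\<lambda>v. 0)) (at u0)"
      by (rule has_derivative_transform_within_open[OF has_derivative_const[of "r * r"] openU Ux(2)])
    have "(fst (?\<Phi> u0) - q) \<bullet> fst (T v) + fst (T v) \<bullet> (fst (?\<Phi> u0) - q) = 0"
      by (rule fun_cong[OF has_derivative_unique[OF d1 d2]])
    then show ?thesis unfolding w_def Ux(3) by (simp add: inner_commute)
  qed
  have lT: "linear T" by (rule has_derivative_linear[OF T])
  have l\<pi>T: "linear (\<lambda>v. \<pi> (T v))"
    using linear_compose[OF lT bounded_linear.linear[OF \<pi>]] unfolding comp_def .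
  have "inj (\<lambda>v. \<pi> (T v))"
    unfolding linear_injective_0[OF l\<pi>T]
  proof (intro allI impI)
    fix v assume "\<pi> (T v) = 0"
    then have "\<pi> (T v) $ 1 = 0" "\<pi> (T v) $ 2 = 0" by simp_all
    then have "fst (T v) \<bullet> b = 0" "snd (T v) = 0" unfolding \<pi>_def by simp_all
    moreover from this have "fst (T v) = 0" using ex[of "fst (T v)"] Tn Tw by simp
    ultimately have "T v = 0" by (simp add: prod_eq_iff)
    then show "v = 0" using Tinj linear_injective_0[OF lT] by blast
  qed
  then obtain g' where g': "linear g'" "\<And>x. \<pi> (T (g' x)) = x"
    using linear_injective_isomorphism[OF l\<pi>T] by blast
  define W where "W = {u \<in> U. (fst (?\<Phi> u) - q) \<bullet> w > 0}"
  have cW: "continuous_on U (\<lambda>u. (fst (?\<Phi> u) - q) \<bullet> w)"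
    by (intro continuous_intros smooth_on_continuous[OF sm])
  have "open ((\<lambda>u. (fst (?\<Phi> u) - q) \<bullet> w) -` {0<..} \<inter> U)"
    by (rule continuous_on_open_vimage[OF openU, THEN iffD1, rule_format, OF cW]) simp
  moreover have "(\<lambda>u. (fst (?\<Phi> u) - q) \<bullet> w) -` {0<..} \<inter> U = W" by (auto simp: W_def)
  ultimately have oW: "open W" by simp
  have yq: "fst y - q = r *\<^sub>R w" unfolding w_def using r by simp
  have u0W: "u0 \<in> W" using Ux(2) yq ww r unfolding W_def Ux(3) by simp
  have WU: "W \<subseteq> U" by (auto simp: W_def)
  have "\<pi> (?\<Phi> u0) \<in> interior ((\<lambda>u. \<pi> (?\<Phi> u)) ` W)"
  proof (rule sussmann_open_mapping[OF oW])
    show "continuous_on W (\<lambda>u. \<pi> (?\<Phi> u))"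
      using bounded_linear.continuous_on[OF \<pi> continuous_on_subset[OF smooth_on_continuous[OF sm] WU]] .
    show "((\<lambda>u. \<pi> (?\<Phi> u)) has_derivative (\<lambda>v. \<pi> (T v))) (at u0)"
      by (rule bounded_linear.has_derivative[OF \<pi> T])
    show "bounded_linear g'" using g'(1) linear_conv_bounded_linear by blast
    show "(\<lambda>v. \<pi> (T v)) \<circ> g' = id" using g'(2) by (simp add: fun_eq_iff)
    show "u0 \<in> interior W" using u0W interior_open[OF oW] by simp
  qed (use u0W in auto)
  define O' where "O' = \<pi> -` interior ((\<lambda>u. \<pi> (?\<Phi> u)) ` W) \<inter> {z. (fst z - q) \<bullet> w > 0}"
  have "continuous_on UNIV \<pi>" using linear_continuous_on[OF \<pi>] .
  then have "open (\<pi> -` interior ((\<lambda>u. \<pi> (?\<Phi> u)) ` W))" using open_vimage[OF open_interior] by blast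
  moreover have "open {z :: (real^3) \<times> real. (fst z - q) \<bullet> w > 0}"
    by (intro open_Collect_less continuous_intros)
  ultimately have oO: "open O'" unfolding O'_def by (rule open_Int)
  have yC: "y \<in> ?C" using im' Ux(2,3) by (auto simp: mem_Times_iff)
  have "?C \<inter> O' \<subseteq> \<phi> ` topspace X"
  proof
    fix z assume z: "z \<in> ?C \<inter> O'"
    then have "\<pi> z \<in> (\<lambda>u. \<pi> (?\<Phi> u)) ` W" unfolding O'_def using interior_subset by blast
    then obtain u where u: "u \<in> W" "\<pi> z = \<pi> (?\<Phi> u)" by blast
    have "\<pi> z $ 1 = \<pi> (?\<Phi> u) $ 1" "\<pi> z $ 2 = \<pi> (?\<Phi> u) $ 2" using u(2) by simp_all
    then have e: "fst z \<bullet> b = fst (?\<Phi> u) \<bullet> b" "snd z = snd (?\<Phi> u)" unfolding \<pi>_def by simp_all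
    define \<alpha> \<beta> where "\<alpha> = fst z - q" and "\<beta> = fst (?\<Phi> u) - q"
    have pos: "\<alpha> \<bullet> w > 0" "\<beta> \<bullet> w > 0" using z u(1) unfolding O'_def W_def \<alpha>_def \<beta>_def by auto
    have perp: "\<alpha> \<bullet> n = 0" "\<beta> \<bullet> n = 0" using z im'(2) u(1) WU unfolding \<alpha>_def \<beta>_def by (auto simp: mem_Times_iff)
    have eb: "\<alpha> \<bullet> b = \<beta> \<bullet> b" using e(1) unfolding \<alpha>_def \<beta>_def by (simp add: inner_diff_left)
    have len: "\<alpha> \<bullet> \<alpha> = r * r" "\<beta> \<bullet> \<beta> = r * r"
      using z im'(1) u(1) WU unfolding \<alpha>_def \<beta>_def
      by (auto simp: mem_Times_iff dist_norm power2_norm_eq_inner[symmetric] power2_eq_square)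
    have sq: "a \<bullet> a = (a \<bullet> w)\<^sup>2 + (a \<bullet> b)\<^sup>2" if "a \<bullet> n = 0" for a
    proof -
      have "a \<bullet> a = ((a \<bullet> w) *\<^sub>R w + (a \<bullet> b) *\<^sub>R b) \<bullet> a" using ex[of a] that by simp
      also have "\<dots> = (a \<bullet> w) * (w \<bullet> a) + (a \<bullet> b) * (b \<bullet> a)"
        by (simp only: inner_add_left inner_scaleR_left)
      finally show ?thesis by (simp add: power2_eq_square inner_commute[of w a] inner_commute[of b a])
    qed
    have "(\<alpha> \<bullet> w)\<^sup>2 = (\<beta> \<bullet> w)\<^sup>2" using sq[OF perp(1)] sq[OF perp(2)] len eb by simp
    then have "\<alpha> \<bullet> w = \<beta> \<bullet> w" using pos by (simp add: power2_eq_iff_nonneg)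
    then have "\<alpha> = \<beta>" using ex[of \<alpha>] ex[of \<beta>] perp eb by simp
    then have "z = ?\<Phi> u" using e(2) unfolding \<alpha>_def \<beta>_def by (simp add: prod_eq_iff)
    then show "z \<in> \<phi> ` topspace X" using chart_in[OF Ux(1)] u(1) WU by blast
  qed
  moreover have "openin (top_of_set ?C) (?C \<inter> O')" using oO by (rule openin_open_Int)
  moreover have "y \<in> ?C \<inter> O'"
    using yC \<open>\<pi> (?\<Phi> u0) \<in> interior _\<close> u0W unfolding O'_def W_def Ux(3) by simp
  ultimately show "\<exists>T. openin (top_of_set ?C) T \<and> y \<in> T \<and> T \<subseteq> \<phi> ` topspace X" by blast
qed

lemma normal_chart:
  assumes "unit_normal_field c X A \<phi> \<xi>" "(U, x) \<in> A"
  shows "normal_chart c (\<phi> \<circ> x) U (\<xi> \<circ> x)"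
proof -
  interpret immersed_chart c "\<phi> \<circ> x" U by (rule immersed_chart[OF assms(2)])
  have n: "\<xi> p \<in> tangent_space c (\<phi> p)" "ambient_form c (\<xi> p) (\<xi> p) = 1" if "p \<in> topspace X" for p
    using assms(1) that unfolding unit_normal_field_def by auto
  have ch: "smooth_on (\<xi> \<circ> x) U \<and>
        (\<forall>u \<in> U. \<forall>v. ambient_form c (\<xi> (x u)) (frechet_derivative (\<phi> \<circ> x) (at u) v) = 0)"
    using assms unfolding unit_normal_field_def by fast
  show ?thesis
    by unfold_locales
      (use ch n chart_in[OF assms(2)] in \<open>auto simp: tangent_space_def partial_deriv_def\<close>)
qed

end

text \<open>The pointwise result \<open>biharmonic_curvature\<close> becomes global by continuity: twice the mean
  curvature takes values in \<open>{-1, 0, 1}\<close>, so it is constant on the connected surface. Then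
  \<open>d(f + \<kappa> \<nu>) = (1 - \<kappa>\<^sup>2) \<omega>2 \<beta> = 0\<close>, and half of this constant vector is the centre of the
  circle.\<close>

lemma (in measured_surface) constant_angle_biharmonic_cylinder:
  assumes crit: "\<And>K \<epsilon> F. compactin X K \<Longrightarrow> \<epsilon> > 0 \<Longrightarrow> smooth_variation c X A \<phi> K \<epsilon> F \<Longrightarrow>
           ((\<lambda>s. bienergy c A \<phi> dv K (F s)) has_real_derivative 0) (at 0)"
    and \<xi>: "unit_normal_field c X A \<phi> \<xi>" and angle: "constant_angle c X \<xi>"
    and nonmin: "\<not> minimal_surface c A \<phi> \<xi>"
  shows "c = 1 \<and> (\<exists>C. is_circle (1 / sqrt 2) C \<and> C \<subseteq> space_form 1 \<and>
         openin (top_of_set (C \<times> (UNIV :: real set))) (\<phi> ` topspace X))"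
proof -
  obtain \<theta> where \<theta>: "\<And>p. p \<in> topspace X \<Longrightarrow> snd (\<xi> p) = \<theta>"
    using angle unfolding constant_angle_def by (auto simp: ambient_form_def vertical_field_def first_form_simps)
  have cac: "constant_angle_chart c (\<phi> \<circ> x) U (\<xi> \<circ> x) \<theta>" if Ux: "(U, x) \<in> A" for U x
  proof -
    interpret normal_chart c "\<phi> \<circ> x" U "\<xi> \<circ> x" by (rule normal_chart[OF \<xi> Ux])
    show ?thesis by unfold_locales (use \<theta> chart_in[OF Ux] in simp)
  qed
  obtain U0 x0 u0 where U0: "(U0, x0) \<in> A" "u0 \<in> U0" "chart_mean_curvature c (\<phi> \<circ> x0) (\<xi> \<circ> x0) u0 \<noteq> 0"
    using nonmin unfolding minimal_surface_def by auto
  have lt: "\<theta>\<^sup>2 < 1"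
    using constant_angle_chart.horizontal_minimal[OF cac[OF U0(1)] _ U0(2)] U0(3) by force
  have sc: "slanted_chart c (\<phi> \<circ> x) U (\<xi> \<circ> x) \<theta>" if Ux: "(U, x) \<in> A" for U x
    using cac[OF Ux] lt by (simp add: slanted_chart_def slanted_chart_axioms_def)
  define m where "m = 1 + \<theta> * \<theta>"
  have lapc: "lap \<phi> (x u) = laplacian c (\<phi> \<circ> x) (\<phi> \<circ> x) u" if "(U, x) \<in> A" "u \<in> U" for U x u
    by (rule lap_chart[OF that \<phi>_smooth])
  have lapm: "first_form c (fst (lap \<phi> p)) (fst (\<phi> p)) = - m" if p: "p \<in> topspace X" for p
  proof -
    obtain U x u where Ux: "(U, x) \<in> A" "u \<in> U" "p = x u" using chart_cover[OF p] .
    show ?thesis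
      using slanted_chart.laplacian_\<Phi>_f[OF sc[OF Ux(1)] Ux(2)] unfolding Ux(3) lapc[OF Ux(1,2)] m_def by simp
  qed
  have EL1: "snd (lap (lap \<phi>) p) = 0" if p: "p \<in> topspace X" for p
    by (rule euler_lagrange(1)[OF _ _ p]) (rule crit lapm; assumption)+
  have EL2: "first_form c v (fst (\<phi> p)) = 0 \<Longrightarrow> first_form c (fst (lap (lap \<phi>) p) + (2 * c * m) *\<^sub>R fst (lap \<phi> p)) v = 0"
    if p: "p \<in> topspace X" for p v
    by (rule euler_lagrange(2)[OF _ _ p]) (rule crit lapm; assumption)+
  have lap2: "lap (lap \<phi>) (x u) = laplacian c (\<phi> \<circ> x) (laplacian c (\<phi> \<circ> x) (\<phi> \<circ> x)) u" if Ux: "(U, x) \<in> A" "u \<in> U" for U x u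
    unfolding lap_chart[OF Ux lap_smooth[OF \<phi>_smooth]]
    by (rule laplacian_cong[OF chart_open[OF Ux(1)] Ux(2)]) (simp_all add: lapc[OF Ux(1)])
  have key: "\<theta> = 0 \<and> c = 1 \<and> (slanted_chart.\<kappa> c (\<phi> \<circ> x) (\<xi> \<circ> x) \<theta> u)\<^sup>2 = 1"
    if Ux: "(U, x) \<in> A" "u \<in> U" and k: "slanted_chart.\<kappa> c (\<phi> \<circ> x) (\<xi> \<circ> x) \<theta> u \<noteq> 0" for U x u
  proof -
    interpret slanted_chart c "\<phi> \<circ> x" U "\<xi> \<circ> x" \<theta> by (rule sc[OF Ux(1)])
    have E1: "snd (laplacian c (\<phi> \<circ> x) (laplacian c (\<phi> \<circ> x) (\<phi> \<circ> x)) w) = 0" if "w \<in> U" for w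
      using EL1[OF chart_in[OF Ux(1) that]] lap2[OF Ux(1) that] by simp
    have E2: "first_form c (fst (laplacian c (\<phi> \<circ> x) (laplacian c (\<phi> \<circ> x) (\<phi> \<circ> x)) w)
        + (2 * c * (1 + \<theta> * \<theta>)) *\<^sub>R fst (laplacian c (\<phi> \<circ> x) (\<phi> \<circ> x) w)) v = 0"
      if "w \<in> U" "first_form c v (fst ((\<phi> \<circ> x) w)) = 0" for w v
      using EL2[OF chart_in[OF Ux(1) that(1)], of v] that(2) unfolding lap2[OF Ux(1) that(1)] lapc[OF Ux(1) that(1)] m_def by simp
    show ?thesis using biharmonic_curvature[OF E1 E2 Ux(2) k] by blast
  qed
  \<comment> \<open>Twice the mean curvature, which is defined without a chart; in a chart it is \<open>s \<kappa>\<close>.\<close>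
  define Q where "Q p = ambient_form c (lap \<phi> p) (\<xi> p)" for p
  have \<xi>s: "smooth_map A \<xi>" using \<xi> unfolding unit_normal_field_def smooth_map_def by fast
  have Qs: "smooth_map A Q" unfolding Q_def[abs_def]
    by (intro smooth_map_bilinear[OF bounded_bilinear_ambient_form] lap_smooth \<phi>_smooth \<xi>s)
  have Qk: "Q (x u) = slanted_chart.s \<theta> * slanted_chart.\<kappa> c (\<phi> \<circ> x) (\<xi> \<circ> x) \<theta> u" if Ux: "(U, x) \<in> A" "u \<in> U" for U x u
    using slanted_chart.laplacian_\<Phi>_\<Xi>[OF sc[OF Ux(1)] Ux(2)] lapc[OF Ux] unfolding Q_def by simp
  have "slanted_chart.\<kappa> c (\<phi> \<circ> x0) (\<xi> \<circ> x0) \<theta> u0 \<noteq> 0"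
  proof -
    interpret slanted_chart c "\<phi> \<circ> x0" U0 "\<xi> \<circ> x0" \<theta> by (rule sc[OF U0(1)])
    show ?thesis using U0(3) unfolding mean_curvature_eq[OF U0(2)] laplacian_\<Phi>_\<Xi>[OF U0(2)] by auto
  qed
  from key[OF U0(1,2) this] have \<theta>0: "\<theta> = 0" and c1: "c = 1" by auto
  have s1: "slanted_chart.s \<theta> = 1" using slanted_chart.s_def[OF sc[OF U0(1)]] \<theta>0 by simp
  have Qk1: "Q (x u) = slanted_chart.\<kappa> c (\<phi> \<circ> x) (\<xi> \<circ> x) \<theta> u" if Ux: "(U, x) \<in> A" "u \<in> U" for U x u
    using Qk[OF Ux] s1 by simp
  have Qval: "Q p \<in> {-1, 0, 1}" if p: "p \<in> topspace X" for p
  proof -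
    obtain U x u where Ux: "(U, x) \<in> A" "u \<in> U" "p = x u" using chart_cover[OF p] .
    show ?thesis using key[OF Ux(1,2)] Qk1[OF Ux(1,2)] Ux(3) by (auto simp: power2_eq_1_iff)
  qed
  have "connectedin X (topspace X)" using connected by (simp add: connectedin_topspace)
  from connectedin_continuous_map_image[OF smooth_map_continuous[OF Qs] this]
  have cQ: "connected (Q ` topspace X)" by simp
  have "finite (Q ` topspace X)" by (rule finite_subset[of _ "{-1, 0, 1}"]) (use Qval in auto)
  then have "\<exists>\<sigma>. Q ` topspace X = {\<sigma>}" using connected_finite_iff_sing[OF cQ] nonempty by auto
  then obtain \<sigma> where \<sigma>: "\<And>p. p \<in> topspace X \<Longrightarrow> Q p = \<sigma>" by blast
  have kap: "slanted_chart.\<kappa> c (\<phi> \<circ> x) (\<xi> \<circ> x) \<theta> u = \<sigma>" if Ux: "(U, x) \<in> A" "u \<in> U" for U x u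
    using Qk1[OF Ux] \<sigma>[OF chart_in[OF Ux]] by simp
  have \<sigma>2: "\<sigma> * \<sigma> = 1"
    using key[OF U0(1,2)] \<open>slanted_chart.\<kappa> c (\<phi> \<circ> x0) (\<xi> \<circ> x0) \<theta> u0 \<noteq> 0\<close> kap[OF U0(1,2)] by (simp add: power2_eq_square)
  define z where "z p = fst (\<phi> p) + \<sigma> *\<^sub>R fst (\<xi> p)" for p
  have zs: "smooth_map A z"
    unfolding z_def[abs_def]
    by (intro smooth_map_add smooth_map_bilinear[OF bounded_bilinear_scaleR] smooth_map_const
        smooth_map_linear[OF bounded_linear_fst] \<phi>_smooth \<xi>s)
  have z0: "partial_deriv i (\<lambda>u. z (x u)) u = 0" if Ux: "(U, x) \<in> A" "u \<in> U" for U x u i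
  proof -
    interpret slanted_chart c "\<phi> \<circ> x" U "\<xi> \<circ> x" \<theta> by (rule sc[OF Ux(1)])
    have "(\<lambda>u. z (x u)) = (\<lambda>u. fst ((\<phi> \<circ> x) u) + \<sigma> *\<^sub>R \<nu> u)"
      unfolding z_def \<nu>_def using s1 by simp
    moreover have l: "bounded_linear (\<lambda>v::real^3. \<sigma> *\<^sub>R v)" by (rule bounded_linear_scaleR_right)
    ultimately have "partial_deriv i (\<lambda>u. z (x u)) u = partial_deriv i (\<lambda>u. fst ((\<phi> \<circ> x) u)) u + \<sigma> *\<^sub>R partial_deriv i \<nu> u"
      using partial_deriv_add[OF diff_at[OF f_smooth Ux(2)] diff_at[OF smooth_on_compose_linear[OF l openU \<nu>_smooth] Ux(2)], of i]
        partial_deriv_linear[OF l diff_at[OF \<nu>_smooth Ux(2)], of i] by simp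
    also have "\<dots> = (1 - \<sigma> * \<sigma>) *\<^sub>R (\<omega>2 i u *\<^sub>R \<beta> u)"
      unfolding partial_f[OF Ux(2)] partial_\<nu>[OF Ux(2)] kap[OF Ux] unfolding \<theta>0 by (simp add: algebra_simps)
    finally show ?thesis using \<sigma>2 by simp
  qed
  have "\<exists>k. \<forall>p\<in>topspace X. z p = k" by (rule constant_from_derivative[OF zs]) (rule z0)
  then obtain k where k: "\<And>p. p \<in> topspace X \<Longrightarrow> z p = k" by blast
  define q where "q = (1/2) *\<^sub>R k"
  have pt: "fst (\<phi> p) \<bullet> fst (\<phi> p) = 1" "fst (\<xi> p) \<bullet> fst (\<xi> p) = 1" "fst (\<phi> p) \<bullet> fst (\<xi> p) = 0"
    if p: "p \<in> topspace X" for p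
  proof -
    show "fst (\<phi> p) \<bullet> fst (\<phi> p) = 1"
      using \<phi>_in[OF p] c1 by (simp add: product_space_def space_form_def mem_Times_iff first_form_inner)
    have "\<xi> p \<in> tangent_space c (\<phi> p)" "ambient_form c (\<xi> p) (\<xi> p) = 1"
      using \<xi> p unfolding unit_normal_field_def by auto
    then show "fst (\<xi> p) \<bullet> fst (\<xi> p) = 1" "fst (\<phi> p) \<bullet> fst (\<xi> p) = 0"
      using \<theta>[OF p] \<theta>0 c1 by (simp_all add: tangent_space_def ambient_form_def first_form_inner inner_commute)
  qed
  have fq: "fst (\<phi> p) - q = (1/2) *\<^sub>R (fst (\<phi> p) - \<sigma> *\<^sub>R fst (\<xi> p))" "q = (1/2) *\<^sub>R (fst (\<phi> p) + \<sigma> *\<^sub>R fst (\<xi> p))"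
    if p: "p \<in> topspace X" for p
  proof -
    show qq: "q = (1/2) *\<^sub>R (fst (\<phi> p) + \<sigma> *\<^sub>R fst (\<xi> p))" using k[OF p] unfolding q_def z_def by simp
    show "fst (\<phi> p) - q = (1/2) *\<^sub>R (fst (\<phi> p) - \<sigma> *\<^sub>R fst (\<xi> p))"
      unfolding qq by (simp add: vec_eq_iff algebra_simps)
  qed
  have ip: "q \<bullet> q = 1/2" "(fst (\<phi> p) - q) \<bullet> (fst (\<phi> p) - q) = 1/2" "(fst (\<phi> p) - q) \<bullet> q = 0" if p: "p \<in> topspace X" for p
  proof -
    have e: "\<sigma> * (\<sigma> * x) = x" for x using \<sigma>2 by (simp add: mult.assoc[symmetric])
    show "q \<bullet> q = 1/2" unfolding fq(2)[OF p]
      using pt[OF p] by (simp add: inner_add_left inner_add_right inner_commute[of "fst (\<xi> p)" "fst (\<phi> p)"] e \<sigma>2)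
    show "(fst (\<phi> p) - q) \<bullet> (fst (\<phi> p) - q) = 1/2" unfolding fq(1)[OF p]
      using pt[OF p] by (simp add: inner_diff_left inner_diff_right inner_commute[of "fst (\<xi> p)" "fst (\<phi> p)"] e \<sigma>2)
    show "(fst (\<phi> p) - q) \<bullet> q = 0" unfolding fq(1)[OF p] unfolding fq(2)[OF p]
      using pt[OF p] by (simp add: inner_diff_left inner_add_right inner_commute[of "fst (\<xi> p)" "fst (\<phi> p)"] e \<sigma>2)
  qed
  obtain p0 where p0: "p0 \<in> topspace X" using nonempty by blast
  \<comment> \<open>The centre has norm \<open>1 / sqrt 2\<close>, and the plane of the circle is orthogonal to it.\<close>
  define n where "n = sqrt 2 *\<^sub>R q"
  have n1: "norm n = 1" unfolding n_def norm_eq_1 using ip(1)[OF p0] by (simp add: mult.assoc[symmetric])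
  let ?C = "{a. dist a q = 1 / sqrt 2 \<and> (a - q) \<bullet> n = 0}"
  note distq = dist_circle_radius_iff
  have "is_circle (1 / sqrt 2) ?C" unfolding is_circle_def using n1 by auto
  moreover have "?C \<subseteq> space_form 1"
  proof
    fix a assume a: "a \<in> ?C"
    then have "(a - q) \<bullet> (a - q) = 1/2" "(a - q) \<bullet> q = 0" using distq by (auto simp: n_def)
    moreover have "a \<bullet> a = (a - q) \<bullet> (a - q) + 2 * ((a - q) \<bullet> q) + q \<bullet> q"
      by (simp add: inner_diff_left inner_diff_right inner_commute)
    ultimately show "a \<in> space_form 1" using ip(1)[OF p0] by (simp add: space_form_def first_form_inner)
  qed
  moreover have "openin (top_of_set (?C \<times> (UNIV :: real set))) (\<phi> ` topspace X)"
    by (rule image_open_in_cylinder[OF n1]) (use ip distq in \<open>auto simp: n_def\<close>)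
  ultimately show ?thesis using c1 by blast
qed

section \<open>The cylinder over the circle of radius \<open>1 / sqrt 2\<close>\<close>

text \<open>Opposite points of a circle on the unit sphere have the same norm, so its centre \<open>q\<close> is
  orthogonal to its plane; then \<open>|q|\<^sup>2 + 1/2 = 1\<close>.\<close>

lemma circle_in_sphere:
  assumes "norm n = 1" and sub: "{a. dist a q = 1 / sqrt 2 \<and> (a - q) \<bullet> n = 0} \<subseteq> space_form 1"
  shows "v \<bullet> n = 0 \<Longrightarrow> q \<bullet> v = 0" "q \<bullet> q = 1/2"
proof -
  have key: "q \<bullet> v = 0 \<and> q \<bullet> q = 1/2" if v: "v \<bullet> n = 0" "norm v = 1" for v
  proof -
    have e: "q \<bullet> q + 2 * (t * (q \<bullet> v)) + 1/2 = 1" if t: "t * t = 1/2" for t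
    proof -
      have "norm (t *\<^sub>R v) = 1 / sqrt 2"
        using v(2) t by (metis abs_of_nonneg mult.right_neutral norm_scaleR real_sqrt_abs2 real_sqrt_divide real_sqrt_one)
      then have "q + t *\<^sub>R v \<in> space_form 1"
        using sub v(1) by (intro subsetD[OF sub]) (simp add: dist_norm)
      then have "(q + t *\<^sub>R v) \<bullet> (q + t *\<^sub>R v) = 1" by (simp add: space_form_def first_form_inner)
      moreover have "v \<bullet> v = 1" using v(2) by (simp add: norm_eq_1)
      ultimately show ?thesis using t by (simp add: inner_add_left inner_add_right inner_commute[of v q] algebra_simps)
    qed
    have t: "(1 / sqrt 2) * (1 / sqrt 2) = (1/2::real)" "(- 1 / sqrt 2) * (- 1 / sqrt 2) = (1/2::real)" by simp_all
    define z where "z = (1 / sqrt 2) * (q \<bullet> v)"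
    have "q \<bullet> q + 2 * z + 1/2 = 1" "q \<bullet> q + 2 * (- z) + 1/2 = 1"
      using e[OF t(1)] e[OF t(2)] unfolding z_def by simp_all
    then have "z = 0" "q \<bullet> q = 1/2" by linarith+
    then show ?thesis by (simp add: z_def)
  qed
  show "q \<bullet> v = 0" if "v \<bullet> n = 0"
  proof (cases "v = 0")
    case False
    have "q \<bullet> ((1 / norm v) *\<^sub>R v) = 0" using key[of "(1 / norm v) *\<^sub>R v"] that False by simp
    then show ?thesis using False by simp
  qed simp
  obtain v :: "real^3" where "v \<noteq> 0" "orthogonal n v" using orthogonal_to_vector_exists[of n] by auto
  then show "q \<bullet> q = 1/2"
    using key[of "(1 / norm v) *\<^sub>R v"] by (simp add: orthogonal_def inner_commute)
qed

text \<open>The tangent plane of the cylinder is spanned by the tangent \<open>b\<close> of the circle and the vertical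
  direction, so the normal is horizontal. The Laplacian \<open>Z\<close> of \<open>f\<close> is orthogonal to \<open>q\<close> and \<open>n\<close>,
  since \<open>\<langle>f, q\<rangle>\<close> and \<open>\<langle>f, n\<rangle>\<close> are constant, and to \<open>b\<close>, since it is a combination of the normal
  and the position vector. So it points along the radius, and its length is determined by
  \<open>\<langle>Z, f\<rangle> = -1\<close>.\<close>

lemma (in normal_chart) cylinder_geometry:
  assumes c1: "c = 1" and n: "norm n = 1"
    and sub: "{a. dist a q = 1 / sqrt 2 \<and> (a - q) \<bullet> n = 0} \<subseteq> space_form 1"
    and im: "\<And>u. u \<in> U \<Longrightarrow> dist (fst (\<Phi> u)) q = 1 / sqrt 2 \<and> (fst (\<Phi> u) - q) \<bullet> n = 0"
    and u: "u \<in> U"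
  shows "snd (\<Xi> u) = 0" and "laplacian c \<Phi> \<Phi> u = (- 2 *\<^sub>R (fst (\<Phi> u) - q), 0)"
    and "chart_mean_curvature c \<Phi> \<Xi> u \<noteq> 0"
proof -
  note qv = circle_in_sphere[OF n sub]
  have nn: "n \<bullet> n = 1" using n by (simp add: norm_eq_1)
  let ?f = "\<lambda>u. fst (\<Phi> u)"
  have fs: "smooth_on ?f U" by (rule smooth_on_fst[OF openU smooth])
  define w where "w u = sqrt 2 *\<^sub>R (?f u - q)" for u
  define b where "b u = form_cross 1 (w u) n" for u
  have wf: "(?f u - q) \<bullet> (?f u - q) = 1/2" "(?f u - q) \<bullet> n = 0" if "u \<in> U" for u
    using im[OF that] unfolding dist_circle_radius_iff by auto
  have ww: "w u \<bullet> w u = 1" "w u \<bullet> n = 0" if "u \<in> U" for u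
    using wf[OF that] by (simp_all add: w_def mult.assoc[symmetric])
  have ex: "a = (a \<bullet> w u) *\<^sub>R w u + (a \<bullet> b u) *\<^sub>R b u + (a \<bullet> n) *\<^sub>R n" if "u \<in> U" for a u
    using frame_expansion[of 1 "w u" n a] ww[OF that] nn unfolding first_form_inner b_def by simp
  have bo: "b u \<bullet> w u = 0" "b u \<bullet> n = 0" "b u \<bullet> b u = 1" if "u \<in> U" for u
    using form_cross_ortho[of 1 "w u" n] ww[OF that] nn unfolding first_form_inner b_def by simp_all
  have bf: "?f u \<bullet> b u = 0" if "u \<in> U" for u
    using qv(1)[OF bo(2)[OF that]] bo(1)[OF that] by (simp add: w_def inner_diff_right inner_commute)
  have pn: "partial_deriv i ?f u \<bullet> n = 0" if "u \<in> U" for i u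
  proof -
    have "partial_deriv i (\<lambda>u. ?f u \<bullet> n) u = partial_deriv i (\<lambda>_. q \<bullet> n) u"
      by (rule partial_deriv_cong[OF openU that]) (use wf(2) in \<open>simp add: inner_diff_left\<close>)
    then show ?thesis using partial_deriv_linear[OF bounded_linear_inner_left diff_at[OF fs that], of i n] by simp
  qed
  have pw: "partial_deriv i ?f u \<bullet> w u = 0" if "u \<in> U" for i u
  proof -
    have s: "smooth_on (\<lambda>u. ?f u - q) U" by (intro smooth_on_diff fs smooth_on_const openU)
    have "partial_deriv i (\<lambda>u. ?f u - q) u = partial_deriv i ?f u - 0"
      using partial_deriv_diff[OF diff_at[OF fs that] diff_at[OF smooth_on_const[OF openU] that], of i q] by simp
    moreover have "partial_deriv i (\<lambda>u. (?f u - q) \<bullet> (?f u - q)) u = partial_deriv i (\<lambda>_. 1/2) u"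
      by (rule partial_deriv_cong[OF openU that]) (use wf(1) in simp)
    ultimately show ?thesis
      using partial_deriv_bilinear[OF bounded_bilinear_inner diff_at[OF s that] diff_at[OF s that], of i]
      by (simp add: w_def inner_commute)
  qed
  define \<omega> where "\<omega> i u = partial_deriv i ?f u \<bullet> b u" for i u
  define \<eta> where "\<eta> i u = partial_deriv i (\<lambda>u. snd (\<Phi> u)) u" for i u
  have pf: "partial_deriv i ?f u = \<omega> i u *\<^sub>R b u" if "u \<in> U" for i u
    using ex[OF that, of "partial_deriv i ?f u"] pn[OF that] pw[OF that] by (simp add: \<omega>_def)
  have normal: "snd (\<Xi> u) = 0 \<and> fst (\<Xi> u) \<bullet> b u = 0" if "u \<in> U" for u
  proof -
    have "g i j u = \<omega> i u * \<omega> j u + \<eta> i u * \<eta> j u" for i j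
      unfolding metric_nth ambient_form_def partial_fst[OF that, symmetric] partial_snd[OF that, symmetric] \<eta>_def[symmetric]
      using pf[OF that] bo(3)[OF that] unfolding c1 first_form_inner by simp
    then have "vol2 u = (\<eta> 1 u * \<omega> 2 u - \<eta> 2 u * \<omega> 1 u) * (\<eta> 1 u * \<omega> 2 u - \<eta> 2 u * \<omega> 1 u)"
      by (simp add: algebra_simps)
    then have D: "\<eta> 1 u * \<omega> 2 u - \<eta> 2 u * \<omega> 1 u \<noteq> 0" using metric_det[OF that] by auto
    define a where "a = fst (\<Xi> u) \<bullet> b u"
    define t where "t = snd (\<Xi> u)"
    have E: "a * \<omega> i u + t * \<eta> i u = 0" for i
    proof -
      have "fst (\<Xi> u) \<bullet> partial_deriv i ?f u + t * \<eta> i u = 0"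
        using \<Xi>_normal[OF that, of i] unfolding ambient_form_def partial_fst[OF that, symmetric] partial_snd[OF that, symmetric] \<eta>_def t_def c1 first_form_inner .
      then show ?thesis using pf[OF that, of i] by (simp add: a_def mult.commute)
    qed
    have "a * (\<eta> 1 u * \<omega> 2 u - \<eta> 2 u * \<omega> 1 u) = \<eta> 1 u * (a * \<omega> 2 u + t * \<eta> 2 u) - \<eta> 2 u * (a * \<omega> 1 u + t * \<eta> 1 u)"
      "t * (\<eta> 1 u * \<omega> 2 u - \<eta> 2 u * \<omega> 1 u) = \<omega> 2 u * (a * \<omega> 1 u + t * \<eta> 1 u) - \<omega> 1 u * (a * \<omega> 2 u + t * \<eta> 2 u)"
      by (simp_all add: algebra_simps)
    then have "a * (\<eta> 1 u * \<omega> 2 u - \<eta> 2 u * \<omega> 1 u) = 0" "t * (\<eta> 1 u * \<omega> 2 u - \<eta> 2 u * \<omega> 1 u) = 0"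
      unfolding E by simp_all
    then have "a = 0" "t = 0" using D by (simp_all only: mult_eq_0_iff simp_thms)
    then show ?thesis unfolding a_def t_def by simp
  qed
  then show "snd (\<Xi> u) = 0" using u by blast
  interpret slanted_chart c \<Phi> U \<Xi> 0
    by unfold_locales (use normal in auto)
  have L: "fst (laplacian c \<Phi> \<Phi> u) = laplacian c \<Phi> ?f u"
    using laplacian_linear[OF bounded_linear_fst smooth u] by simp
  define Z where "Z = laplacian c \<Phi> ?f u"
  have Zc: "Z \<bullet> y = 0" if "\<And>u. u \<in> U \<Longrightarrow> ?f u \<bullet> y = k" for y k
  proof -
    have "Z \<bullet> y = laplacian c \<Phi> (\<lambda>u. ?f u \<bullet> y) u"
      unfolding Z_def by (rule laplacian_linear[OF bounded_linear_inner_left fs u, symmetric])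
    also have "\<dots> = laplacian c \<Phi> (\<lambda>_. k) u" by (rule laplacian_cong[OF openU u refl]) (rule that)
    finally show ?thesis using laplacian_const by simp
  qed
  have Zn: "Z \<bullet> n = 0" by (rule Zc[of n "q \<bullet> n"]) (use wf(2) in \<open>simp add: inner_diff_left\<close>)
  have Zq: "Z \<bullet> q = 0"
  proof (rule Zc[of q "1/2"])
    fix u assume "u \<in> U"
    then show "?f u \<bullet> q = 1/2" using qv(1)[OF wf(2)] qv(2) by (simp add: inner_diff_right inner_commute)
  qed
  have Zf: "Z \<bullet> ?f u = -1"
    using laplacian_\<Phi>_f[OF u] unfolding L Z_def by (simp add: c1 first_form_inner)
  have Z\<nu>: "Z = (s * s * \<kappa> u) *\<^sub>R \<nu> u - ?f u"
    using laplacian_\<Phi>[OF u] L c1 unfolding Z_def by simp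
  have "\<nu> u \<bullet> b u = 0" using normal[OF u] by (simp add: \<nu>_def)
  then have Zb: "Z \<bullet> b u = 0" unfolding Z\<nu> using bf[OF u] by (simp add: inner_diff_left)
  have "Z \<bullet> w u = - sqrt 2" using Zf Zq by (simp add: w_def inner_diff_right)
  then have Zw: "Z = - 2 *\<^sub>R (?f u - q)"
    using ex[OF u, of Z] Zn Zb by (simp add: w_def)
  then show "laplacian c \<Phi> \<Phi> u = (- 2 *\<^sub>R (?f u - q), 0)"
    using L laplacian_\<Phi>[OF u] unfolding Z_def by (simp add: prod_eq_iff)
  show "chart_mean_curvature c \<Phi> \<Xi> u \<noteq> 0"
  proof
    assume "chart_mean_curvature c \<Phi> \<Xi> u = 0"
    then have "s * \<kappa> u = 0" unfolding mean_curvature_eq[OF u] laplacian_\<Phi>_\<Xi>[OF u] by simp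
    then have "Z = - ?f u" unfolding Z\<nu> using s(3) by simp
    then have "?f u \<bullet> q = 0" using Zq by simp
    moreover have "?f u \<bullet> q = 1/2" using qv(1)[OF wf(2)[OF u]] qv(2) by (simp add: inner_diff_right inner_commute)
    ultimately show False by simp
  qed
qed

text \<open>Since \<open>\<langle>\<Delta>f, f\<rangle> = -1\<close>, the first variation has the integrand \<open>\<langle>\<Delta>\<phi> + (f, 0), \<Delta>V\<rangle> + \<langle>\<Delta>f, V\<^sub>1\<rangle>\<close>.
  Here \<open>\<Delta>\<phi> + (f, 0) = (2 q - f, 0)\<close>, whose Laplacian is \<open>(- \<Delta>f, 0)\<close>, so this is the integrand of
  Green's identity.\<close>

lemma (in surface) cylinder_proper_biharmonic:
  assumes c1: "c = 1" and \<xi>: "unit_normal_field c X A \<phi> \<xi>"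
    and C: "is_circle (1 / sqrt 2) C" "C \<subseteq> space_form 1" and im: "\<phi> ` topspace X \<subseteq> C \<times> UNIV"
  shows "constant_angle c X \<xi>" "proper_biharmonic c X A \<phi> \<xi>"
proof -
  obtain q n where n: "norm n = 1" and Ceq: "C = {a. dist a q = 1 / sqrt 2 \<and> (a - q) \<bullet> n = 0}"
    using C(1) unfolding is_circle_def by blast
  have sub: "{a. dist a q = 1 / sqrt 2 \<and> (a - q) \<bullet> n = 0} \<subseteq> space_form 1" using C(2) Ceq by simp
  have imp: "dist (fst (\<phi> p)) q = 1 / sqrt 2 \<and> (fst (\<phi> p) - q) \<bullet> n = 0" if "p \<in> topspace X" for p
    using im that Ceq by (auto simp: image_subset_iff mem_Times_iff)
  have geo: "snd (\<xi> (x u)) = 0" "lap \<phi> (x u) = (- 2 *\<^sub>R (fst (\<phi> (x u)) - q), 0)"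
    "chart_mean_curvature c (\<phi> \<circ> x) (\<xi> \<circ> x) u \<noteq> 0" if Ux: "(U, x) \<in> A" "u \<in> U" for U x u
  proof -
    interpret normal_chart c "\<phi> \<circ> x" U "\<xi> \<circ> x" by (rule normal_chart[OF \<xi> Ux(1)])
    note cg = cylinder_geometry[OF c1 n sub _ Ux(2)]
    have i: "dist (fst ((\<phi> \<circ> x) u)) q = 1 / sqrt 2 \<and> (fst ((\<phi> \<circ> x) u) - q) \<bullet> n = 0" if "u \<in> U" for u
      using imp[OF chart_in[OF Ux(1) that]] by simp
    show "snd (\<xi> (x u)) = 0" using cg(1)[OF i] by simp
    show "lap \<phi> (x u) = (- 2 *\<^sub>R (fst (\<phi> (x u)) - q), 0)"
      unfolding lap_chart[OF Ux \<phi>_smooth] using cg(2)[OF i] by simp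
    show "chart_mean_curvature c (\<phi> \<circ> x) (\<xi> \<circ> x) u \<noteq> 0" by (rule cg(3)[OF i])
  qed
  have lap\<phi>: "lap \<phi> p = (- 2 *\<^sub>R (fst (\<phi> p) - q), 0)" if p: "p \<in> topspace X" for p
    using chart_cover[OF p] geo(2) by metis
  have "snd (\<xi> p) = 0" if "p \<in> topspace X" for p using chart_cover[OF that] geo(1) by metis
  then show "constant_angle c X \<xi>"
    unfolding constant_angle_def by (auto simp: ambient_form_def vertical_field_def first_form_simps)
  have "\<not> minimal_surface c A \<phi> \<xi>"
  proof -
    obtain p where "p \<in> topspace X" using nonempty by blast
    then obtain U x u where "(U, x) \<in> A" "u \<in> U" using chart_cover by metis
    then show ?thesis using geo(3) unfolding minimal_surface_def by fast
  qed
  moreover have "biharmonic c X A \<phi>"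
  proof -
    obtain dv where dv: "is_area_measure c X A \<phi> dv" using area_measure_exists by blast
    interpret measured_surface c X A \<phi> dv by unfold_locales (rule dv)
    have "((\<lambda>s. bienergy c A \<phi> dv K (F s)) has_real_derivative 0) (at 0)"
      if K: "compactin X K" and e: "\<epsilon> > 0" and F: "smooth_variation c X A \<phi> K \<epsilon> F" for K \<epsilon> F
    proof -
      define V where "V p = vector_derivative (\<lambda>s. F s p) (at 0)" for p
      have dV: "((\<lambda>s. F s p) has_vector_derivative V p) (at 0)" if p: "p \<in> topspace X" for p
      proof -
        obtain U x u where Ux: "(U, x) \<in> A" "u \<in> U" "p = x u" using chart_cover[OF p] .
        have o: "open ({-\<epsilon><..<\<epsilon>} \<times> U)" using chart_open[OF Ux(1)] by (simp add: open_Times)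
        have "smooth_on (\<lambda>(s, u). F s (x u)) ({-\<epsilon><..<\<epsilon>} \<times> U)" using F Ux(1) unfolding smooth_variation_def by fast
        from has_vector_derivative_first_arg[OF o this, of 0 u] e Ux(2)
        have *: "((\<lambda>s. F s p) has_vector_derivative dir_deriv (1, 0) (\<lambda>(s, u). F s (x u)) (0, u)) (at 0)"
          unfolding Ux(3) by simp
        show ?thesis unfolding V_def vector_derivative_at[OF *] by (rule *)
      qed
      have Vs: "smooth_map A V" "\<And>p. p \<in> topspace X - K \<Longrightarrow> V p = 0"
        using variation_field[OF F e, of V] dV by auto
      have l: "bounded_linear (\<lambda>y::(real^3) \<times> real. (- fst y, 0 :: real))"
        by (intro bounded_linear_Pair bounded_linear_minus bounded_linear_fst bounded_linear_zero)
      define \<Psi> where "\<Psi> p = (- fst (\<phi> p), 0) + (2 *\<^sub>R q, 0 :: real)" for p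
      have \<Psi>s: "smooth_map A \<Psi>" unfolding \<Psi>_def[abs_def]
        by (intro smooth_map_add smooth_map_linear[OF l \<phi>_smooth] smooth_map_const)
      have lap\<Psi>: "lap \<Psi> p = (2 *\<^sub>R (fst (\<phi> p) - q), 0)" if p: "p \<in> topspace X" for p
        unfolding \<Psi>_def[abs_def] lap_add[OF p smooth_map_linear[OF l \<phi>_smooth] smooth_map_const]
          lap_linear[OF p l \<phi>_smooth] lap_const[OF p] lap\<phi>[OF p] by simp
      have ff: "first_form c (- 2 *\<^sub>R (fst (\<phi> p) - q)) (fst (\<phi> p)) = -1" if p: "p \<in> topspace X" for p
      proof -
        have "(fst (\<phi> p) - q) \<bullet> n = 0" "(fst (\<phi> p) - q) \<bullet> (fst (\<phi> p) - q) = 1/2"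
          using imp[OF p] unfolding dist_circle_radius_iff by auto
        moreover from this have "q \<bullet> (fst (\<phi> p) - q) = 0" using circle_in_sphere(1)[OF n sub] by blast
        ultimately have "(fst (\<phi> p) - q) \<bullet> fst (\<phi> p) = 1/2"
          by (simp add: inner_diff_left inner_diff_right inner_commute)
        then show ?thesis unfolding c1 first_form_inner by simp
      qed
      have "(\<integral>p. bienergy_derivative c (\<phi> p) (lap \<phi> p) (V p) (lap V p) \<partial>dv)
        = (\<integral>p. ambient_form c (\<Psi> p) (lap V p) - ambient_form c (lap \<Psi> p) (V p) \<partial>dv)"
      proof (rule Bochner_Integration.integral_cong[OF refl])
        fix p assume "p \<in> space dv"
        then have p: "p \<in> topspace X" by (simp add: space_dv)
        show "bienergy_derivative c (\<phi> p) (lap \<phi> p) (V p) (lap V p)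
          = ambient_form c (\<Psi> p) (lap V p) - ambient_form c (lap \<Psi> p) (V p)"
          unfolding bienergy_derivative_def lap\<Psi>[OF p] lap\<phi>[OF p] fst_conv ff[OF p]
          unfolding \<Psi>_def ambient_form_def c1 first_form_inner
          by (simp add: inner_diff_left inner_add_left inner_commute algebra_simps)
      qed
      also have "\<dots> = 0" by (rule green_form[OF \<Psi>s Vs(1) K Vs(2)])
      finally show ?thesis using first_variation[OF K e F dV] by simp
    qed
    then show ?thesis unfolding biharmonic_def using dv by blast
  qed
  ultimately show "proper_biharmonic c X A \<phi> \<xi>" unfolding proper_biharmonic_def by blast
qed

theorem theorem3p2:
  fixes c :: real
    and X :: "'m topology"
    and A :: "'m chart set"
    and \<phi> \<xi> :: "'m \<Rightarrow> (real^3) \<times> real"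
  assumes "c = 1 \<or> c = -1"
    and "immersed_surface c X A \<phi> \<xi>"
  shows "constant_angle c X \<xi> \<and> proper_biharmonic c X A \<phi> \<xi> \<longleftrightarrow>
    c = 1 \<and>
    (\<exists>C. is_circle (1 / sqrt 2) C \<and> C \<subseteq> space_form 1 \<and>
         openin (top_of_set (C \<times> (UNIV :: real set))) (\<phi> ` topspace X))"
proof -
  have S: "surface c X A \<phi>" and \<xi>: "unit_normal_field c X A \<phi> \<xi>"
    using assms unfolding immersed_surface_def surface_def by auto
  show ?thesis
  proof
    assume L: "constant_angle c X \<xi> \<and> proper_biharmonic c X A \<phi> \<xi>"
    then obtain dv where dv: "is_area_measure c X A \<phi> dv"
      and crit: "\<And>K \<epsilon> F. compactin X K \<Longrightarrow> \<epsilon> > 0 \<Longrightarrow> smooth_variation c X A \<phi> K \<epsilon> F \<Longrightarrow>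
           ((\<lambda>s. bienergy c A \<phi> dv K (F s)) has_real_derivative 0) (at 0)"
      unfolding proper_biharmonic_def biharmonic_def by blast
    have "measured_surface c X A \<phi> dv"
      using S dv by (simp add: measured_surface_def measured_surface_axioms_def)
    then show "c = 1 \<and> (\<exists>C. is_circle (1 / sqrt 2) C \<and> C \<subseteq> space_form 1 \<and>
         openin (top_of_set (C \<times> (UNIV :: real set))) (\<phi> ` topspace X))"
    proof (rule measured_surface.constant_angle_biharmonic_cylinder[OF _ _ \<xi>])
      show "((\<lambda>s. bienergy c A \<phi> dv K (F s)) has_real_derivative 0) (at 0)"
        if "compactin X K" "\<epsilon> > 0" "smooth_variation c X A \<phi> K \<epsilon> F" for K \<epsilon> F
        by (rule crit[OF that])
    qed (use L in \<open>auto simp: proper_biharmonic_def\<close>)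
  next
    assume "c = 1 \<and> (\<exists>C. is_circle (1 / sqrt 2) C \<and> C \<subseteq> space_form 1 \<and>
         openin (top_of_set (C \<times> (UNIV :: real set))) (\<phi> ` topspace X))"
    then obtain C where c1: "c = 1" and C: "is_circle (1 / sqrt 2) C" "C \<subseteq> space_form 1"
      and o: "openin (top_of_set (C \<times> (UNIV :: real set))) (\<phi> ` topspace X)" by blast
    have "\<phi> ` topspace X \<subseteq> C \<times> UNIV" using openin_imp_subset[OF o] .
    then show "constant_angle c X \<xi> \<and> proper_biharmonic c X A \<phi> \<xi>"
      using surface.cylinder_proper_biharmonic[OF S c1 \<xi> C] by blast
  qed
qed

end
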